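(* Let $k$ be a number field with ring of integers $R$, and let $G$ be a finite group having a non-cyclic abelian subgroup. Then for every positive integer $s$ and every $k$-regular $G$-extensions $E_1/k(T),\dots,E_s/k(T)$, there is no finite set $\mathcal{S}_{\rm exc}$ of nonzero prime ideals of $R$ with the following property: every Grunwald problem $(G,(L^{(\mathfrak{p})}/k_{\mathfrak{p}})_{\mathfrak{p}\in\mathcal{S}})$ with $\mathcal{S}$ finite and disjoint from $\mathcal{S}_{\rm exc}$ has a solution among the specializations $(E_j)_{t_0}/k$, $1\le j\le s$, $t_0\in\mathbb{P}^1(k)$.
   Context: $T$ is an indeterminate, $\widetilde k$ an algebraic closure of $k$. A $k$-regular $G$-extension is a finite Galois extension $E/k(T)$ with group $G$ and $E\cap\widetilde k=k$; for $t_0\in\mathbb{P}^1(k)$ its specialization $E_{t_0}/k$ is the residue extension of $E/k(T)$ at the prime $(T-t_0)$ (or $1/T$ if $t_0=\infty$). A $G$-extension of $k$ is a finite Galois extension with group $G$. For a nonzero prime $\mathfrak{p}$ of $R$, $k_{\mathfrak{p}}$ is the completion and the completion of a Galois extension $L/k$ at $\mathfrak{p}$ is $L_{\mathfrak{p}}=L\cdot k_{\mathfrak{p}}$ (well defined up to $k_{\mathfrak{p}}$-isomorphism). A Grunwald problem $(G,(L^{(\mathfrak{p})}/k_{\mathfrak{p}})_{\mathfrak{p}\in\mathcal{S}})$ consists of a finite set $\mathcal{S}$ of nonzero primes of $R$ and finite Galois extensions $L^{(\mathfrak{p})}/k_{\mathfrak{p}}$ whose Galois groups embed into $G$; a solution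 is a $G$-extension $L/k$ whose completion $L_{\mathfrak{p}}$ is $k_{\mathfrak{p}}$-isomorphic to $L^{(\mathfrak{p})}$ for every $\mathfrak{p}\in\mathcal{S}$. *)

theory Defs
  imports
    "HOL-Algebra.Algebra"
    "HOL-Algebra.Algebraic_Closure_Type"
    "HOL-Computational_Algebra.Computational_Algebra"
begin

text \<open>
  The ground field \<open>k\<close> is a type \<open>'k\<close> of characteristic \<open>0\<close>, so that \<open>k(T)\<close> is the type
  \<^typ>\<open>'k::field_char_0 poly fract\<close>. All field extensions are HOL-Algebra records together with an
  explicit embedding of the base field; \<^const>\<open>ring_of_type_algebra\<close> turns a type into such a record.
\<close>

section \<open>Galois extensions\<close>

definition field_ext :: "'a ring \<Rightarrow> 'b ring \<Rightarrow> ('a \<Rightarrow> 'b) \<Rightarrow> bool" where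
  "field_ext K L h \<longleftrightarrow> field K \<and> field L \<and> h \<in> ring_hom K L"

text \<open>Automorphisms are extensional functions on the carrier, as required by \<^const>\<open>BijGroup\<close>.\<close>

definition galois_group :: "'a ring \<Rightarrow> 'b ring \<Rightarrow> ('a \<Rightarrow> 'b) \<Rightarrow> ('b \<Rightarrow> 'b) monoid" where
  "galois_group K L h = BijGroup (carrier L)
     \<lparr>carrier := {\<sigma> \<in> Bij (carrier L) \<inter> ring_iso L L. \<forall>a\<in>carrier K. \<sigma> (h a) = h a}\<rparr>"

definition finite_galois :: "'a ring \<Rightarrow> 'b ring \<Rightarrow> ('a \<Rightarrow> 'b) \<Rightarrow> bool" where
  "finite_galois K L h \<longleftrightarrow> field_ext K L h
     \<and> ring.finite_dimension L (h ` carrier K) (carrier L)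
     \<and> {x \<in> carrier L. \<forall>\<sigma>\<in>carrier (galois_group K L h). \<sigma> x = x} = h ` carrier K"

definition galois_ext_with_group ::
  "'g monoid \<Rightarrow> 'a ring \<Rightarrow> 'b ring \<Rightarrow> ('a \<Rightarrow> 'b) \<Rightarrow> bool" where
  "galois_ext_with_group G K L h \<longleftrightarrow> finite_galois K L h \<and> galois_group K L h \<cong> G"

definition base_isomorphic ::
  "'a ring \<Rightarrow> 'b ring \<Rightarrow> ('a \<Rightarrow> 'b) \<Rightarrow> 'c ring \<Rightarrow> ('a \<Rightarrow> 'c) \<Rightarrow> bool" where
  "base_isomorphic K L h M g \<longleftrightarrow> (\<exists>\<phi>\<in>ring_iso L M. \<forall>a\<in>carrier K. \<phi> (h a) = g a)"

section \<open>Number fields and their completions\<close>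

definition number_field :: "'k::field_char_0 itself \<Rightarrow> bool" where
  "number_field _ \<longleftrightarrow>
     (\<exists>B. finite_dimensional_vector_space (\<lambda>(q::rat) (x::'k). of_rat q * x) B)"

definition integer_ring :: "'k::field_char_0 ring" where
  "integer_ring = ring_of_type_algebra\<lparr>carrier := {x. algebraic_int x}\<rparr>"

definition nonzero_primes :: "'k::field_char_0 set set" where
  "nonzero_primes = {P. primeideal P (integer_ring :: 'k ring) \<and> P \<noteq> {0}}"

definition prime_power :: "'k::field_char_0 set \<Rightarrow> nat \<Rightarrow> 'k set" where
  "prime_power P n = ((ideal_prod integer_ring P) ^^ n) (carrier integer_ring)"

text \<open>The elements of \<open>k\<close> of \<open>P\<close>-adic valuation at least \<open>n\<close>, i.e. \<open>P\<^sup>n R\<^sub>P\<close>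
  with \<open>R\<^sub>P\<close> the localization of the ring of integers at \<open>P\<close>.\<close>

definition adic_nbhd :: "'k::field_char_0 set \<Rightarrow> nat \<Rightarrow> 'k set" where
  "adic_nbhd P n = {x. \<exists>b\<in>carrier integer_ring - P. b * x \<in> prime_power P n}"

definition adic_Cauchy :: "'k::field_char_0 set \<Rightarrow> (nat \<Rightarrow> 'k) set" where
  "adic_Cauchy P = {x. \<forall>n. \<exists>N. \<forall>i\<ge>N. \<forall>j\<ge>N. x i - x j \<in> adic_nbhd P n}"

definition adic_null :: "'k::field_char_0 set \<Rightarrow> (nat \<Rightarrow> 'k) set" where
  "adic_null P = {x. \<forall>n. \<exists>N. \<forall>i\<ge>N. x i \<in> adic_nbhd P n}"

definition Cauchy_ring :: "'k::field_char_0 set \<Rightarrow> (nat \<Rightarrow> 'k) ring" where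
  "Cauchy_ring P = \<lparr>carrier = adic_Cauchy P,
     monoid.mult = (\<lambda>x y i. x i * y i), one = (\<lambda>_. 1),
     ring.zero = (\<lambda>_. 0), add = (\<lambda>x y i. x i + y i)\<rparr>"

type_synonym 'k completion = "(nat \<Rightarrow> 'k) set"

definition completion :: "'k::field_char_0 set \<Rightarrow> 'k completion ring" where
  "completion P = Cauchy_ring P Quot adic_null P"

definition to_completion :: "'k::field_char_0 set \<Rightarrow> 'k \<Rightarrow> 'k completion" where
  "to_completion P a = adic_null P +>\<^bsub>Cauchy_ring P\<^esub> (\<lambda>_. a)"

text \<open>\<open>M\<close> (with \<open>\<mu>\<close> embedding the completion of \<open>k\<close> at \<open>P\<close>) is a compositum \<open>L \<cdot> k\<^sub>P\<close>.
  For a finite Galois extension \<open>L/k\<close> this determines \<open>M\<close> up to \<open>k\<^sub>P\<close>-isomorphism.\<close>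

definition is_completion_of_ext ::
  "'k::field_char_0 set \<Rightarrow> 'l ring \<Rightarrow> ('k \<Rightarrow> 'l) \<Rightarrow> 'm ring \<Rightarrow> ('k completion \<Rightarrow> 'm) \<Rightarrow> bool" where
  "is_completion_of_ext P L h M \<mu> \<longleftrightarrow> field_ext (completion P) M \<mu>
     \<and> (\<exists>l\<in>ring_hom L M. (\<forall>a. l (h a) = \<mu> (to_completion P a))
          \<and> generate_field M (\<mu> ` carrier (completion P) \<union> l ` carrier L) = carrier M)"

section \<open>Regular extensions and specializations\<close>

definition const_fract :: "'k::field_char_0 \<Rightarrow> 'k poly fract" where
  "const_fract a = Fract [:a:] 1"

definition regular_extension ::
  "'g monoid \<Rightarrow> 'e ring \<Rightarrow> ('k::field_char_0 poly fract \<Rightarrow> 'e) \<Rightarrow> bool" where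
  "regular_extension G E \<iota> \<longleftrightarrow> galois_ext_with_group G ring_of_type_algebra E \<iota>
     \<and> {x \<in> carrier E. \<not> ring.transcendental E (range (\<lambda>a. \<iota> (const_fract a))) x}
         = range (\<lambda>a. \<iota> (const_fract a))"

datatype 'k proj_line = Finite_point 'k | Infinite_point

fun local_parameter :: "'k::field_char_0 proj_line \<Rightarrow> 'k poly fract" where
  "local_parameter (Finite_point t) = Fract [:- t, 1:] 1"
| "local_parameter Infinite_point = Fract 1 [:0, 1:]"

text \<open>With \<open>u = T - t\<^sub>0\<close>, resp. \<open>u = 1/T\<close>, this is the localization of \<open>k[u]\<close> at the prime \<open>(u)\<close>.\<close>

definition local_ring :: "'k::field_char_0 proj_line \<Rightarrow> 'k poly fract set" where
  "local_ring t = {poly (map_poly const_fract f) (local_parameter t)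
                     / poly (map_poly const_fract g) (local_parameter t) | f g. poly g 0 \<noteq> 0}"

text \<open>Polynomials over a subring of a HOL-Algebra ring are lists with leading coefficient first.\<close>

definition integral_closure :: "'e ring \<Rightarrow> 'e set \<Rightarrow> 'e set" where
  "integral_closure E A = {x \<in> carrier E.
     \<exists>p\<in>carrier (univ_poly E A). p \<noteq> [] \<and> hd p = \<one>\<^bsub>E\<^esub> \<and> ring.eval E p x = \<zero>\<^bsub>E\<^esub>}"

definition closure_ring ::
  "'e ring \<Rightarrow> ('k::field_char_0 poly fract \<Rightarrow> 'e) \<Rightarrow> 'k proj_line \<Rightarrow> 'e ring" where
  "closure_ring E \<iota> t = E\<lparr>carrier := integral_closure E (\<iota> ` local_ring t)\<rparr>"

definition primes_above ::
  "'e ring \<Rightarrow> ('k::field_char_0 poly fract \<Rightarrow> 'e) \<Rightarrow> 'k proj_line \<Rightarrow> 'e set set" where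
  "primes_above E \<iota> t = {Q. primeideal Q (closure_ring E \<iota> t) \<and> \<iota> (local_parameter t) \<in> Q}"

text \<open>The residue extensions, each paired with its embedding of \<open>k\<close>. For \<open>E/k(T)\<close> Galois, different
  choices of \<open>Q\<close> above the same point give \<open>k\<close>-isomorphic extensions.\<close>

definition specializations ::
  "'e ring \<Rightarrow> ('k::field_char_0 poly fract \<Rightarrow> 'e) \<Rightarrow> ('e set ring \<times> ('k \<Rightarrow> 'e set)) set" where
  "specializations E \<iota> =
     {(closure_ring E \<iota> t Quot Q, \<lambda>a. Q +>\<^bsub>closure_ring E \<iota> t\<^esub> \<iota> (const_fract a)) | t Q.
        Q \<in> primes_above E \<iota> t}"

section \<open>Grunwald problems\<close>

definition grunwald_problem ::
  "'g monoid \<Rightarrow> 'k::field_char_0 set set \<Rightarrow> ('k set \<Rightarrow> 'm ring) \<Rightarrow>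
     ('k set \<Rightarrow> 'k completion \<Rightarrow> 'm) \<Rightarrow> bool" where
  "grunwald_problem G S Lp \<nu> \<longleftrightarrow> finite S \<and> S \<subseteq> nonzero_primes
     \<and> (\<forall>P\<in>S. finite_galois (completion P) (Lp P) (\<nu> P)
          \<and> (\<exists>\<phi>\<in>hom (galois_group (completion P) (Lp P) (\<nu> P)) G.
               inj_on \<phi> (carrier (galois_group (completion P) (Lp P) (\<nu> P)))))"

text \<open>A compositum isomorphic to \<open>Lp P\<close> can be transported to the element type of \<open>Lp P\<close>,
  so taking \<open>M\<close> over that type loses nothing.\<close>

definition grunwald_solution ::
  "'g monoid \<Rightarrow> 'k::field_char_0 set set \<Rightarrow> ('k set \<Rightarrow> 'm ring) \<Rightarrow>
     ('k set \<Rightarrow> 'k completion \<Rightarrow> 'm) \<Rightarrow> 'l ring \<Rightarrow> ('k \<Rightarrow> 'l) \<Rightarrow> bool" where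
  "grunwald_solution G S Lp \<nu> L h \<longleftrightarrow> galois_ext_with_group G ring_of_type_algebra L h
     \<and> (\<forall>P\<in>S. \<exists>(M :: 'm ring) \<mu>. is_completion_of_ext P L h M \<mu>
          \<and> base_isomorphic (completion P) M \<mu> (Lp P) (\<nu> P))"

text \<open>
  HOL cannot quantify over types inside a formula, so the fields \<open>L\<^sup>(\<^sup>P\<^sup>)\<close> of a Grunwald problem need
  a fixed element type. A finite extension of degree \<open>n\<close> of \<open>k\<^sub>P\<close> is, by coordinates with respect
  to a basis, isomorphic to one whose elements are lists of length \<open>n\<close> over \<open>k\<^sub>P\<close>.
\<close>

type_synonym 'k local_ext_elem = "'k completion list"

end

(*
Let l be a prime with (Z/l)^2 inside G. For infinitely many primes P of k the completion k_P has a
Kummer extension Lp with group (Z/l)^2, generated by an l-th root of a unit and one of p. If a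
specialization E_t0 completed to Lp, then each nontrivial automorphism of Lp would permute without fixed points
the roots in Lp of the defining polynomial of E/k(T), specialized at t0. Some nontrivial automorphism
must fail to do so: when t0 is not P-adically close to a branch point, the tame inertia moves every
integral element only by a nonunit while the discriminant is a unit; when t0 is close to a branch
point t, a Puiseux expansion in a root of T - t lies in a fixed field of a nontrivial automorphism,
and Krasner-type estimates give a root moved less than the discriminant allows. The finitely many
points t0 where the defining polynomial is inseparable are excluded by letting P split completely in
their residue extensions. Both charts T and 1/T are used, so that the coordinate of t0 is P-integral.
Valuation rings of the algebraic closure of k replace the usual theory of primes above P.
*)
theory Submission
 imports Defs "HOL-Number_Theory.Number_Theory"
begin

section \<open>Valuation rings dominating a proper ideal, and the preorder they induce\<close>

section \<open>Valuation rings\<close>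

text \<open>The contradiction compares two sizes of one product. A nontrivial automorphism of
  \<open>Lp\<close> acts on the conjugates of an integral element y through a nontrivial element of
  the Galois group of E/k(T), hence without fixed points; the difference between a conjugate and its
  image is therefore one factor of D(x0), where D is a common multiple of the norms of all such
  differences, and the remaining factors are integral. The estimates give a difference below a
  radius r smaller than D(x0). The obstacle is uniformity: one place must serve all t0. So whatever
  depends on E alone (coefficients, branch points, Puiseux truncations, roots of residue
  polynomials) is gathered in a finite set, and the place is chosen afterwards such that this set
  and its inverses are integral. Completions get no valuation of their own: elements of
  \<open>Lp\<close> are Cauchy sequences in the algebraic closure, and every estimate is made at one
  late index. Puiseux expansions need N-th roots for a multiple N of l, so estimates live in a
  Kummer field of level N, and the automorphism found there must stay nontrivial on the subfield of
  level l that completes to \<open>Lp\<close>.\<close>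

definition subring_set :: "'a::field set => bool" where
 "subring_set A \<longleftrightarrow> 1 : A & (ALL x:A. ALL y:A. x - y : A & x * y : A)"

context
 fixes A :: "'a::field set"
 assumes A: "subring_set A"
begin

lemma subring_set_1: "1 : A"
 and subring_set_diff: "x : A ==> y : A ==> x - y : A"
 and subring_set_mult: "x : A ==> y : A ==> x * y : A"
 using A by (auto simp: subring_set_def)

lemma subring_set_0: "0 : A"
 using subring_set_diff[OF subring_set_1 subring_set_1] by simp

lemma subring_set_uminus: "x : A ==> - x : A"
 using subring_set_diff[OF subring_set_0, of x] by simp

lemma subring_set_add: "x : A ==> y : A ==> x + y : A"
 using subring_set_diff[of x "- y"] subring_set_uminus[of y] by simp

lemma subring_set_power: "x : A ==> x ^ n : A"
 by (induction n) (auto intro: subring_set_1 subring_set_mult)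

lemma subring_set_sum: "(!!i. i : I ==> f i : A) ==> sum f I : A"
 by (induction I rule: infinite_finite_induct) (auto intro: subring_set_0 subring_set_add)

lemma subring_set_prod: "(!!i. i : I ==> f i : A) ==> prod f I : A"
 by (induction I rule: infinite_finite_induct) (auto intro: subring_set_1 subring_set_mult)

lemma subring_set_of_nat: "of_nat n : A"
 by (induction n) (auto intro: subring_set_0 subring_set_1 subring_set_add)

lemma subring_set_of_int: "of_int n : A"
 by (cases n) (auto intro: subring_set_of_nat subring_set_uminus simp flip: of_nat_Suc)

lemma subring_set_poly: "(!!i. coeff p i : A) ==> x : A ==> poly p x : A"
 unfolding poly_altdef by (intro subring_set_sum subring_set_mult subring_set_power)

end

definition span_ideal :: "'a::field set => 'a set => 'a set" where
 "span_ideal A I = {\<Sum>x\<in>S. a x * x | S a. finite S & S <= I & a ` S <= A}"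

lemma span_ideal_superset:
 assumes "subring_set A" shows "I <= span_ideal A I"
proof
 fix x assume "x : I"
 thus "x : span_ideal A I" unfolding span_ideal_def
  by (intro CollectI exI[of _ "{x}"] exI[of _ "%_. 1"]) (auto intro: subring_set_1 assms)
qed

lemma span_ideal_mult:
 assumes "subring_set A" "c : A" "x : span_ideal A I" shows "c * x : span_ideal A I"
proof -
 obtain S a where "finite S" "S <= I" "a ` S <= A" "x = (\<Sum>x\<in>S. a x * x)"
  using assms(3) by (auto simp: span_ideal_def)
 thus ?thesis unfolding span_ideal_def
  by (intro CollectI exI[of _ S] exI[of _ "%x. c * a x"])
    (auto simp: sum_distrib_left mult.assoc intro!: subring_set_mult[OF assms(1)] assms(2))
qed

lemma span_ideal_add:
 assumes A: "subring_set A" and "x : span_ideal A I" "y : span_ideal A I"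
 shows "x + y : span_ideal A I"
proof -
 obtain S a where 1: "finite S" "S <= I" "a ` S <= A" "x = (\<Sum>x\<in>S. a x * x)"
  using assms(2) by (auto simp: span_ideal_def)
 obtain T b where 2: "finite T" "T <= I" "b ` T <= A" "y = (\<Sum>x\<in>T. b x * x)"
  using assms(3) by (auto simp: span_ideal_def)
 define a' where "a' = (%x. if x : S then a x else 0)"
 define b' where "b' = (%x. if x : T then b x else 0)"
 have x: "x = (\<Sum>x\<in>S \<union> T. a' x * x)"
  unfolding 1 using 1 2 by (intro sum.mono_neutral_cong_left) (auto simp: a'_def)
 have y: "y = (\<Sum>x\<in>S \<union> T. b' x * x)"
  unfolding 2 using 1 2 by (intro sum.mono_neutral_cong_left) (auto simp: b'_def)
 have in_A: "a' x : A" "b' x : A" for x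
  using 1 2 subring_set_0[OF A] by (auto simp: a'_def b'_def)
 show ?thesis unfolding span_ideal_def
  by (intro CollectI exI[of _ "S \<union> T"] exI[of _ "%x. a' x + b' x"])
    (use 1 2 in_A in \<open>auto simp: x y distrib_right sum.distrib intro!: subring_set_add[OF A]\<close>)
qed

lemma span_ideal_sum:
 assumes A: "subring_set A" and "!!i. i : T ==> f i : span_ideal A I"
 shows "sum f T : span_ideal A I"
proof -
 have 0: "0 : span_ideal A I"
  unfolding span_ideal_def by (intro CollectI exI[of _ "{}"]) auto
 show ?thesis using assms(2)
  by (induction T rule: infinite_finite_induct) (auto intro: 0 span_ideal_add[OF A])
qed

lemma span_ideal_diff:
 assumes A: "subring_set A" and "x : span_ideal A I" "y : span_ideal A I"
 shows "x - y : span_ideal A I"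
 using span_ideal_add[OF A assms(2) span_ideal_mult[OF A _ assms(3), of "- 1"]]
  subring_set_uminus[OF A subring_set_1[OF A]] by simp

lemma span_ideal_subset:
 assumes A: "subring_set A" and "I <= A" shows "span_ideal A I <= A"
 using assms by (auto simp: span_ideal_def intro!: subring_set_sum subring_set_mult)

definition adjoin :: "'a::field set => 'a => 'a set" where
 "adjoin A x = {poly p x | p. ALL i. coeff p i : A}"

lemma adjoin_subring:
 assumes A: "subring_set A" shows "subring_set (adjoin A x)"
 unfolding subring_set_def
proof (intro conjI ballI)
 show "1 : adjoin A x" unfolding adjoin_def
  by (intro CollectI exI[of _ 1]) (auto simp: coeff_1 subring_set_0[OF A] subring_set_1[OF A])
next
 fix a b assume "a : adjoin A x" "b : adjoin A x"
 then obtain p q where pq: "a = poly p x" "b = poly q x" "ALL i. coeff p i : A" "ALL i. coeff q i : A"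
  by (auto simp: adjoin_def)
 show "a - b : adjoin A x" unfolding adjoin_def
  by (intro CollectI exI[of _ "p - q"]) (use pq in \<open>auto intro: subring_set_diff[OF A]\<close>)
 show "a * b : adjoin A x" unfolding adjoin_def
  by (intro CollectI exI[of _ "p * q"])
    (use pq in \<open>auto simp: coeff_mult intro!: subring_set_sum[OF A] subring_set_mult[OF A]\<close>)
qed

lemma adjoin_superset:
 assumes A: "subring_set A" shows "A <= adjoin A x"
proof
 fix a assume "a : A"
 thus "a : adjoin A x" unfolding adjoin_def
  by (intro CollectI exI[of _ "[:a:]"]) (auto simp: coeff_pCons subring_set_0[OF A] split: nat.split)
qed

lemma adjoin_gen:
 assumes A: "subring_set A" shows "x : adjoin A x"
 unfolding adjoin_def
 by (intro CollectI exI[of _ "[:0, 1:]"])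
   (auto simp: coeff_pCons subring_set_0[OF A] subring_set_1[OF A] split: nat.split)

text \<open>Collecting powers of \<open>x\<close> moves the ideal into the coefficients. This turns
  \<open>1 : span_ideal (adjoin A x) I\<close> into a polynomial relation for \<open>x\<close> over
  the ideal of \<open>A\<close>, the raw material of the maximality argument.\<close>

lemma span_ideal_adjoin:
 assumes A: "subring_set A" and "z : span_ideal (adjoin A x) I"
 obtains p where "z = poly p x" "ALL i. coeff p i : span_ideal A I"
proof -
 obtain S a where S: "finite S" "S <= I" "a ` S <= adjoin A x" "z = (\<Sum>y\<in>S. a y * y)"
  using assms(2) by (auto simp: span_ideal_def)
 have "ALL y:S. EX p. a y = poly p x & (ALL i. coeff p i : A)"
  using S(3) by (auto simp: adjoin_def)
 then obtain q where q: "!!y. y : S ==> a y = poly (q y) x"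
   "!!y i. y : S ==> coeff (q y) i : A" by metis
 show thesis
 proof (rule that[of "\<Sum>y\<in>S. smult y (q y)"])
  show "z = poly (\<Sum>y\<in>S. smult y (q y)) x"
   unfolding S(4) poly_sum using q by (intro sum.cong) auto
  show "ALL i. coeff (\<Sum>y\<in>S. smult y (q y)) i : span_ideal A I"
  proof
   fix i
   have "y * coeff (q y) i : span_ideal A I" if "y : S" for y
    using span_ideal_mult[OF A q(2)[OF that, of i], of y I] span_ideal_superset[OF A, of I] S(2) that
    by (auto simp: mult.commute)
   thus "coeff (\<Sum>y\<in>S. smult y (q y)) i : span_ideal A I"
    by (auto simp: coeff_sum intro!: span_ideal_sum[OF A])
  qed
 qed
qed

definition valuation_ring :: "'a::field set => bool" where
 "valuation_ring A \<longleftrightarrow> subring_set A & (ALL x. x : A | inverse x : A)"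

definition nonunits :: "'a::field set => 'a set" where
 "nonunits A = {x : A. x = 0 | inverse x ~: A}"

text \<open>If neither \<open>x\<close> nor \<open>inverse x\<close> lies in \<open>A\<close>,
  maximality makes the ideal improper after adjoining either of them. This gives relations writing 1
  as a polynomial in \<open>x\<close>, and as one in \<open>inverse x\<close>, with coefficients in
  the ideal; taken of minimal degree, the shorter one shortens the longer one.\<close>

lemma maximal_imp_valuation_ring:
 assumes A: "subring_set A" and IA: "I <= A" and proper: "1 ~: span_ideal A I"
  and max: "!!B. subring_set B ==> A <= B ==> 1 ~: span_ideal B I ==> B = A"
 shows "valuation_ring A"
proof -
 define J where "J = span_ideal A I"
 have JA: "J <= A" unfolding J_def by (rule span_ideal_subset[OF A IA])
 have J_mult: "c * x : J" if "c : A" "x : J" for c x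
  using span_ideal_mult[OF A] that by (auto simp: J_def)
 have J_add: "x + y : J" if "x : J" "y : J" for x y
  using span_ideal_add[OF A] that by (auto simp: J_def)
 have J_diff: "x - y : J" if "x : J" "y : J" for x y
  using span_ideal_diff[OF A] that by (auto simp: J_def)
 have J_sum: "(!!i. i : S ==> f i : J) ==> sum f S : J" for f :: "nat => 'a" and S
  using span_ideal_sum[OF A] by (auto simp: J_def)
 have J1: "1 ~: J" using proper by (simp add: J_def)
 define rel where "rel = (%x n. EX j. (ALL i. j i : J) & (\<Sum>i\<le>n. j i * x ^ i) = 1)"
 have ex_rel: "EX n. rel x n" if "x ~: A" for x
 proof -
  have "1 : span_ideal (adjoin A x) I"
   using max[OF adjoin_subring[OF A, of x] adjoin_superset[OF A]] adjoin_gen[OF A, of x] that by blast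
  then obtain p where p: "1 = poly p x" "ALL i. coeff p i : J"
   using span_ideal_adjoin[OF A] unfolding J_def by metis
  show ?thesis unfolding rel_def
   by (intro exI[of _ "degree p"] exI[of _ "coeff p"]) (use p in \<open>auto simp: poly_altdef\<close>)
 qed
 \<comment> \<open>Elements of \<open>1 + J\<close> are units: otherwise maximality applied to
   \<open>inverse c\<close> puts a power of \<open>c\<close> into \<open>J\<close>, although
   \<open>c\<close> is congruent to 1 modulo \<open>J\<close>.\<close>
 have unit: "inverse (1 - k) : A" if k: "k : J" for k
 proof (rule ccontr)
  assume n: "inverse (1 - k) ~: A"
  define c where "c = 1 - k"
  have c: "c : A" "c ~= 0" using k JA J1 subring_set_diff[OF A subring_set_1[OF A]] by (auto simp: c_def)
  obtain m j where j: "ALL i. j i : J" "(\<Sum>i\<le>m. j i * inverse c ^ i) = 1"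
   using ex_rel[OF n] by (auto simp: rel_def c_def)
  have "c ^ m = (\<Sum>i\<le>m. c ^ (m - i) * j i)"
  proof -
   have "c ^ m = c ^ m * (\<Sum>i\<le>m. j i * inverse c ^ i)" using j by simp
   also have "... = (\<Sum>i\<le>m. c ^ (m - i) * j i)"
    unfolding sum_distrib_left
   proof (intro sum.cong refl)
    fix i assume "i : {..m}"
    hence "c ^ m = c ^ (m - i) * c ^ i" by (simp flip: power_add)
    thus "c ^ m * (j i * inverse c ^ i) = c ^ (m - i) * j i"
     using c by (simp add: field_simps)
   qed
   finally show ?thesis .
  qed
  also have "... : J" using j c by (intro J_sum J_mult subring_set_power[OF A]) auto
  finally have 1: "c ^ m : J" .
  have "1 - c ^ i : J" for i
  proof (induction i)
   case (Suc i)
   have "1 - c ^ Suc i = (1 - c ^ i) + c ^ i * k" by (simp add: c_def algebra_simps)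
   thus ?case by (simp only: J_add[OF Suc J_mult[OF subring_set_power[OF A c(1)] k]])
  qed (use J_sum[of "{}"] in auto)
  from this[of m] 1 have "(1 - c ^ m) + c ^ m : J" by (rule J_add)
  thus False using J1 by simp
 qed
 \<comment> \<open>Solved for 1 with its constant term moved to the other side, the shorter relation
   rewrites \<open>x ^ n\<close> through lower powers; \<open>m <= n\<close> keeps all exponents
   nonnegative.\<close>
 have contra: False if x: "x ~= 0" and r: "rel x n" "!!n'. rel x n' ==> n <= n'"
   and s: "rel (inverse x) m" and mn: "m <= n" for x n m
 proof -
  obtain j where j: "ALL i. j i : J" "(\<Sum>i\<le>n. j i * x ^ i) = 1" using r by (auto simp: rel_def)
  obtain k where k: "ALL i. k i : J" "(\<Sum>i\<le>m. k i * inverse x ^ i) = 1" using s by (auto simp: rel_def)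
  have n0: "n > 0"
  proof (rule ccontr)
   assume "~ n > 0"
   hence "j 0 = 1" using j by simp
   thus False using j(1) J1 by metis
  qed
  have split0: "(\<Sum>i\<le>m. k i * inverse x ^ i) = k 0 + (\<Sum>i<m. k (Suc i) * inverse x ^ Suc i)"
   by (subst sum.atMost_shift) simp
  define d where "d = inverse (1 - k 0)"
  have d: "d : A" using unit[of "k 0"] k by (auto simp: d_def)
  have k0: "1 - k 0 ~= 0" using k(1) J1 by (metis eq_iff_diff_eq_0)
  have one: "1 = d * (\<Sum>i<m. k (Suc i) * inverse x ^ Suc i)"
  proof -
   have "(\<Sum>i<m. k (Suc i) * inverse x ^ Suc i) = 1 - k 0" using split0 k(2) by (simp add: algebra_simps)
   thus ?thesis using k0 by (simp add: d_def)
  qed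
  obtain n' where n': "n = Suc n'" using n0 by (cases n) auto
  have xn: "x ^ n * inverse x ^ Suc i = x ^ (n' - i)" if "i < m" for i
  proof -
   have "x ^ n = x ^ (n' - i) * x ^ Suc i" using that mn n' by (simp flip: power_add)
   thus ?thesis using x by (simp add: field_simps)
  qed
  \<comment> \<open>Coefficients of \<open>j n * x ^ n\<close> after this substitution, indexed by
    the exponent \<open>l = n' - i\<close>, where \<open>n' = n - 1\<close> is the new
    degree.\<close>
  define k' where "k' = (%l. if n' - l < m & l <= n' then j n * (d * k (Suc (n' - l))) else 0)"
  have 1: "j n * x ^ n = (\<Sum>i<m. j n * (d * k (Suc i)) * x ^ (n' - i))"
  proof -
   have "j n * x ^ n = j n * x ^ n * (d * (\<Sum>i<m. k (Suc i) * inverse x ^ Suc i))" by (subst one[symmetric]) simp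
   also have "... = (\<Sum>i<m. j n * (d * k (Suc i)) * (x ^ n * inverse x ^ Suc i))"
    by (simp add: sum_distrib_left mult_ac)
   finally show ?thesis using xn by (auto simp: mult_ac intro!: sum.cong)
  qed
  also have "... = (\<Sum>l\<le>n'. k' l * x ^ l)"
  proof -
   have "(\<Sum>l\<le>n'. k' l * x ^ l) = (\<Sum>l\<in>{l. l <= n' & n' - l < m}. k' l * x ^ l)"
    by (intro sum.mono_neutral_right) (auto simp: k'_def)
   also have "... = (\<Sum>i<m. j n * (d * k (Suc i)) * x ^ (n' - i))"
    by (rule sum.reindex_bij_witness[of _ "%i. n' - i" "%l. n' - l"])
      (use mn n' in \<open>auto simp: k'_def\<close>)
   finally show ?thesis by simp
  qed
  finally have "(\<Sum>l\<le>n'. (j l + k' l) * x ^ l) = (\<Sum>i\<le>n. j i * x ^ i)"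
   by (simp add: n' distrib_right sum.distrib)
  hence "(\<Sum>l\<le>n'. (j l + k' l) * x ^ l) = 1" using j by simp
  moreover have "j l + k' l : J" for l
   using j k d JA J_sum[of "{}"] by (auto simp: k'_def intro!: J_add J_mult)
  ultimately have "rel x n'" unfolding rel_def by (intro exI[of _ "%l. j l + k' l"]) auto
  thus False using r(2)[of n'] n' by simp
 qed
 show ?thesis
 proof (rule ccontr)
  assume "~ valuation_ring A"
  then obtain x where x: "x ~: A" "inverse x ~: A" using A by (auto simp: valuation_ring_def)
  have x0: "x ~= 0" using x subring_set_0[OF A] by auto
  obtain n where n: "rel x n" "!!n'. rel x n' ==> n <= n'"
   using ex_rel[OF x(1)] by (metis LeastI_ex Least_le)
  obtain m where m: "rel (inverse x) m" "!!n'. rel (inverse x) n' ==> m <= n'"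
   using ex_rel[OF x(2)] by (metis LeastI_ex Least_le)
  show False
  proof (cases "m <= n")
   case True thus False using contra[OF x0 n m(1)] by simp
  next
   case False thus False using contra[of "inverse x" m n] x0 m n by simp
  qed
 qed
qed

text \<open>Chevalley's theorem. Zorn's lemma is applied to the subrings over which \<open>I\<close>
  still spans a proper ideal: an equation writing 1 in the span has finitely many coefficients,
  which already lie in one member of a chain.\<close>

theorem exists_dominating_valuation_ring:
 assumes R: "subring_set R" and IR: "I <= R" and proper: "1 ~: span_ideal R I"
 obtains A where "valuation_ring A" "R <= A" "I <= nonunits A"
proof -
 define FF where "FF = {A. subring_set A & R <= A & 1 ~: span_ideal A I}"
 have "EX M:FF. ALL B:FF. M <= B --> B = M"
 proof (rule subset_Zorn_nonempty)
  show "FF ~= {}" using assms by (auto simp: FF_def)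
 next
  fix Ch assume ne: "Ch ~= {}" and ch: "subset.chain FF Ch"
  have sub: "A : Ch ==> subring_set A" for A using ch by (auto simp: subset.chain_def FF_def)
  have dir: "EX B:Ch. A1 <= B & A2 <= B" if "A1 : Ch" "A2 : Ch" for A1 A2
   using ch that by (metis subset_chain_def order_refl)
  have "subring_set (\<Union>Ch)" unfolding subring_set_def
  proof (intro conjI ballI)
   show "1 : \<Union>Ch" using ne sub subring_set_1 by blast
  next
   fix x y assume "x : \<Union>Ch" "y : \<Union>Ch"
   then obtain B where "B : Ch" "x : B" "y : B" using dir by blast
   thus "x - y : \<Union>Ch" "x * y : \<Union>Ch" using sub subring_set_diff subring_set_mult by blast+
  qed
  moreover have "R <= \<Union>Ch" using ne ch unfolding subset.chain_def FF_def by blast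
  moreover have "1 ~: span_ideal (\<Union>Ch) I"
  proof
   assume "1 : span_ideal (\<Union>Ch) I"
   then obtain S a where S: "finite S" "S <= I" "a ` S <= \<Union>Ch" "1 = (\<Sum>x\<in>S. a x * x)"
    unfolding span_ideal_def by blast
   have "EX B:Ch. a ` S <= B"
    using S(1,3)
   proof (induction S)
    case empty thus ?case using ne by auto
   next
    case (insert x S)
    then obtain B1 B2 where B12: "B1 : Ch" "a ` S <= B1" "B2 : Ch" "a x : B2" by auto
    then obtain B where "B : Ch" "B1 <= B" "B2 <= B" using dir[of B1 B2] by auto
    thus ?case using B12 by (intro bexI[of _ B]) auto
   qed
   then obtain B where "B : Ch" "a ` S <= B" by blast
   hence "1 : span_ideal B I" using S unfolding span_ideal_def by blast
   thus False using \<open>B : Ch\<close> ch by (auto simp: subset.chain_def FF_def)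
  qed
  ultimately show "\<Union>Ch : FF" by (simp add: FF_def)
 qed
 then obtain A where A: "A : FF" and max: "!!B. B : FF ==> A <= B ==> B = A" by blast
 have A': "subring_set A" "R <= A" "1 ~: span_ideal A I" using A by (auto simp: FF_def)
 have IA: "I <= A" using IR A' by blast
 have "valuation_ring A"
  by (rule maximal_imp_valuation_ring[OF A'(1) IA A'(3)]) (use max A' in \<open>auto simp: FF_def\<close>)
 moreover have "I <= nonunits A"
 proof
  fix x assume x: "x : I"
  hence "x : span_ideal A I" using span_ideal_superset[OF A'(1)] by blast
  hence "inverse x * x : span_ideal A I" if "inverse x : A"
   using span_ideal_mult[OF A'(1) that] by blast
  thus "x : nonunits A" using A'(3) x IA by (auto simp: nonunits_def)
 qed
 ultimately show thesis using that A' by blast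
qed

subsection \<open>The divisibility preorder of a valuation ring\<close>

locale valring =
 fixes A :: "'a::field set"
 assumes valuation_ring: "valuation_ring A"
begin

lemma subring: "subring_set A"
 using valuation_ring by (simp add: valuation_ring_def)

lemmas in_0 = subring_set_0[OF subring] and in_1 = subring_set_1[OF subring]
 and in_add = subring_set_add[OF subring] and in_diff = subring_set_diff[OF subring]
 and in_mult = subring_set_mult[OF subring] and in_uminus = subring_set_uminus[OF subring]
 and in_power = subring_set_power[OF subring] and in_sum = subring_set_sum[OF subring]
 and in_prod = subring_set_prod[OF subring] and in_of_int = subring_set_of_int[OF subring]
 and in_of_nat = subring_set_of_nat[OF subring] and in_poly = subring_set_poly[OF subring]

lemma in_or_inverse_in: "x : A | inverse x : A"
 using valuation_ring by (simp add: valuation_ring_def)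

text \<open>To be read as |x| <= |y|. The preorder stands in for a value group: \<open>A\<close>
  consists of the elements below 1, and 0 is the least element.\<close>

definition vle :: "'a => 'a => bool" where
 "vle x y \<longleftrightarrow> (EX a:A. x = a * y)"

lemma vle_one_iff [simp]: "vle x 1 \<longleftrightarrow> x : A"
 by (auto simp: vle_def)

lemma vle_refl [simp]: "vle x x"
 unfolding vle_def by (rule bexI[of _ 1]) (auto intro: in_1)

lemma vle_zero [simp]: "vle 0 x"
 unfolding vle_def by (rule bexI[of _ 0]) (auto intro: in_0)

lemma vle_zero_right [simp]: "vle x 0 \<longleftrightarrow> x = 0"
 unfolding vle_def using in_0 by auto

lemma vle_trans [trans]: "vle x y ==> vle y z ==> vle x z"
 unfolding vle_def by (metis in_mult mult.assoc)

lemma vle_iff: "y ~= 0 ==> vle x y \<longleftrightarrow> x / y : A"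
 unfolding vle_def by (auto simp: field_simps intro: bexI[of _ "x / y"])

lemma vle_linear: "vle x y | vle y x"
 using in_or_inverse_in[of "x / y"] by (cases "x = 0 | y = 0") (auto simp: vle_iff)

lemma vle_add: "vle x z ==> vle y z ==> vle (x + y) z"
 unfolding vle_def by (metis in_add distrib_right)

lemma vle_uminus [simp]: "vle (- x) z \<longleftrightarrow> vle x z"
 unfolding vle_def by (metis in_uminus minus_mult_left minus_minus)

lemma vle_diff: "vle x z ==> vle y z ==> vle (x - y) z"
 using vle_add[of x z "- y"] by simp

lemma vle_diff_commute: "vle (x - y) z \<longleftrightarrow> vle (y - x) z"
 using vle_uminus[of "x - y" z] by simp

lemma vle_sum: "(!!i. i : I ==> vle (f i) z) ==> vle (sum f I) z"
 by (induction I rule: infinite_finite_induct) (auto intro: vle_add)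

lemma vle_mult: "vle x y ==> vle x' y' ==> vle (x * x') (y * y')"
 unfolding vle_def by (metis in_mult mult.assoc mult.left_commute)

lemma vle_mult_left: "a : A ==> vle x y ==> vle (a * x) y"
 using vle_mult[of a 1 x y] by simp

lemma vle_mult_cancel: "c ~= 0 ==> vle (c * x) (c * y) \<longleftrightarrow> vle x y"
 unfolding vle_def by (simp add: mult.left_commute)

lemma vle_power: "vle x y ==> vle (x ^ n) (y ^ n)"
 by (induction n) (auto intro: vle_mult)

text \<open>Otherwise \<open>inverse x\<close> lies in \<open>A\<close>, and \<open>x\<close> is
  \<open>x ^ n\<close> times the power of exponent \<open>n - 1\<close> of
  \<open>inverse x\<close>.\<close>

lemma in_of_power_in:
 assumes "n > 0" "x ^ n : A" shows "x : A"
proof (rule ccontr)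
 assume x: "x ~: A"
 hence i: "inverse x : A" using in_or_inverse_in by blast
 have "x ~= 0" using x in_0 by auto
 obtain m where n: "n = Suc m" using assms by (cases n) auto
 have "x = x ^ n * inverse x ^ m" using \<open>x ~= 0\<close> by (simp add: n field_simps)
 thus False using x in_mult[OF assms(2) in_power[OF i, of m]] by simp
qed

lemma nonunits_iff: "x : nonunits A \<longleftrightarrow> ~ vle 1 x"
 using in_or_inverse_in[of x] in_0
 by (cases "x = 0") (auto simp: nonunits_def vle_iff divide_inverse)

lemma vle_nonunit: "vle x y ==> y : nonunits A ==> x : nonunits A"
 unfolding nonunits_iff using vle_trans by blast

lemma nonunits_in: "x : nonunits A ==> x : A"
 by (simp add: nonunits_def)

lemma nonunits_0: "0 : nonunits A"
 by (simp add: nonunits_def in_0)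

lemma nonunits_1: "1 ~: nonunits A"
 by (simp add: nonunits_iff)

lemma nonunits_mult: "a : A ==> x : nonunits A ==> a * x : nonunits A"
 using vle_mult_left[of a x x] vle_nonunit by simp

lemma nonunits_add: "x : nonunits A ==> y : nonunits A ==> x + y : nonunits A"
 using vle_linear[of x y] vle_add[of x y y] vle_add[of x x y] vle_nonunit by auto

lemma nonunits_uminus: "x : nonunits A ==> - x : nonunits A"
 using vle_uminus[of x x] vle_nonunit vle_refl by blast

lemma nonunits_diff: "x : nonunits A ==> y : nonunits A ==> x - y : nonunits A"
 using nonunits_add[of x "- y"] nonunits_uminus by simp

lemma nonunits_sum: "(!!i. i : I ==> f i : nonunits A) ==> sum f I : nonunits A"
 by (induction I rule: infinite_finite_induct) (auto intro: nonunits_add nonunits_0)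

lemma nonunits_prime: "x * y : nonunits A ==> x : A ==> y : A ==> x : nonunits A | y : nonunits A"
 unfolding nonunits_iff using vle_mult[of 1 x 1 y] by auto

lemma nonunits_prime_power: "x ^ n : nonunits A ==> x : A ==> x : nonunits A"
 by (induction n) (auto simp: nonunits_1 dest!: nonunits_prime intro: in_power)

lemma not_vle_iff: "y ~= 0 ==> ~ vle y x \<longleftrightarrow> x / y : nonunits A"
 unfolding nonunits_iff using vle_mult_cancel[of y 1 "x / y"] by simp

text \<open>Some factor of a small product is small: this replaces the extraction of roots in the value
  group.\<close>

lemma vle_some_factor:
 assumes "finite I" "I ~= {}" "vle (prod f I) (r ^ card I)"
 shows "EX i:I. vle (f i) r"
proof (rule ccontr)
 assume "~ (EX i:I. vle (f i) r)"
 hence n: "!!i. i : I ==> ~ vle (f i) r" by blast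
 hence f0: "!!i. i : I ==> f i ~= 0" by force
 have q: "!!i. i : I ==> r / f i : nonunits A" using n f0 not_vle_iff by blast
 have "prod (%i. r / f i) I : nonunits A"
  using assms(1,2) q
 proof (induction I rule: finite_ne_induct)
  case (insert i I)
  have "r / f i * prod (%i. r / f i) I : nonunits A"
   by (rule nonunits_mult) (use insert in \<open>auto intro: nonunits_in\<close>)
  thus ?case by (simp only: prod.insert[OF insert(1,3)])
 qed auto
 hence "r ^ card I / prod f I : nonunits A" by (simp add: prod_dividef)
 thus False using assms(1,3) f0 not_vle_iff[of "prod f I" "r ^ card I"] by auto
qed

end

text \<open>Otherwise \<open>inverse x\<close> lies in \<open>A\<close>, and the monic equation
  divided by the power of \<open>x\<close> of exponent \<open>degree p - 1\<close> expresses
  \<open>x\<close> through the coefficients and powers of \<open>inverse x\<close>.\<close>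

lemma (in valring) monic_root_in:
 assumes "lead_coeff p = 1" "!!i. coeff p i : A" "poly p x = 0"
 shows "x : A"
proof (rule ccontr)
 assume x: "x ~: A"
 hence x0: "x ~= 0" using in_0 by auto
 have i: "inverse x : A" using x in_or_inverse_in by blast
 have "degree p > 0"
 proof (rule ccontr)
  assume "~ degree p > 0"
  hence "p = [:1:]" using assms(1) by (auto elim!: degree_eq_zeroE)
  thus False using assms(3) by simp
 qed
 then obtain n where n: "degree p = Suc n" by (cases "degree p") auto
 have "0 = (\<Sum>i\<le>n. coeff p i * x ^ i) + x ^ Suc n"
  using assms(1,3) by (simp add: poly_altdef n)
 hence "x ^ Suc n = - (\<Sum>i\<le>n. coeff p i * x ^ i)" by (simp add: eq_neg_iff_add_eq_0 add.commute)
 hence "x ^ Suc n * inverse x ^ n = - (\<Sum>i\<le>n. coeff p i * (x ^ i * inverse x ^ n))"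
  by (simp add: sum_distrib_right mult.assoc)
 moreover have "x ^ i * inverse x ^ n = inverse x ^ (n - i)" if "i <= n" for i
 proof -
  have "inverse x ^ n = inverse x ^ i * inverse x ^ (n - i)" using that by (simp flip: power_add)
  thus ?thesis using x0 by (simp add: field_simps)
 qed
 moreover have "x ^ Suc n * inverse x ^ n = x" using x0 by (simp add: field_simps)
 ultimately have "x = - (\<Sum>i\<le>n. coeff p i * inverse x ^ (n - i))"
  by (simp cong: sum.cong_simp)
 also have "... : A" using assms i by (intro in_uminus in_sum in_mult in_power) auto
 finally show False using x by blast
qed

text \<open>If \<open>x\<close> is not integral, \<open>inverse x\<close> generates a proper ideal
  of the ring it generates over the integers, and a valuation ring dominating this ideal cannot
  contain \<open>x\<close>. The ring laws for algebraic integers are read off from the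
  intersection.\<close>

lemma algebraic_int_iff_valuation_rings:
 fixes x :: "'a::field_char_0"
 shows "algebraic_int x \<longleftrightarrow> (ALL A. valuation_ring A --> x : A)"
proof (intro iffI allI impI)
 fix A :: "'a set" assume "algebraic_int x" "valuation_ring A"
 then interpret valring A by unfold_locales
 obtain p where p: "poly p x = 0" "lead_coeff p = 1" "!!i. coeff p i : \<int>"
  using \<open>algebraic_int x\<close> by (auto elim: algebraic_int.cases)
 have "coeff p i : A" for i
  using p(3)[of i] in_of_int by (elim Ints_cases) simp
 thus "x : A" by (rule monic_root_in[OF p(2) _ p(1)])
next
 assume all: "ALL A. valuation_ring A --> x : A"
 show "algebraic_int x"
 proof (rule ccontr)
  assume n: "~ algebraic_int x"
  hence x0: "x ~= 0" by auto
  define R where "R = adjoin \<int> (inverse x)"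
  have Z: "subring_set (\<int> :: 'a set)" by (auto simp: subring_set_def)
  have R: "subring_set R" unfolding R_def by (rule adjoin_subring[OF Z])
  have "1 ~: span_ideal R {inverse x}"
  proof
   assume "1 : span_ideal R {inverse x}"
   then obtain S a where S: "finite S" "S <= {inverse x}" "a ` S <= R" "1 = (\<Sum>x\<in>S. a x * x)"
    unfolding span_ideal_def by blast
   hence "S = {inverse x}" by (cases "S = {}") auto
   with S obtain p where p: "1 = poly p (inverse x) * inverse x" "ALL i. coeff p i : \<int>"
    by (auto simp: R_def adjoin_def)
   define n where "n = degree p"
   \<comment> \<open>The relation, multiplied by \<open>x ^ Suc n\<close>, becomes a monic integer
     equation for \<open>x\<close>.\<close>
   define q where "q = monom 1 (Suc n) - (\<Sum>i\<le>n. monom (coeff p i) (n - i))"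
   have cq: "coeff q i = (if i = Suc n then 1 else 0) - (\<Sum>j\<le>n. if n - j = i then coeff p j else 0)" for i
    by (simp add: q_def coeff_sum)
   have "coeff q i = 0" if "i > Suc n" for i using that by (auto simp: cq intro!: sum.neutral)
   hence "degree q <= Suc n" using degree_le by blast
   moreover have "coeff q (Suc n) = 1" by (auto simp: cq intro!: sum.neutral)
   ultimately have lc: "lead_coeff q = 1" by (metis le_antisym le_degree one_neq_zero)
   have "poly q x = x ^ Suc n - (\<Sum>i\<le>n. coeff p i * x ^ (n - i))"
    by (simp add: q_def poly_monom poly_sum)
   also have "(\<Sum>i\<le>n. coeff p i * x ^ (n - i)) = x ^ n * poly p (inverse x)"
    unfolding poly_altdef n_def[symmetric] sum_distrib_left
   proof (intro sum.cong refl)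
    fix i assume "i : {..n}"
    hence "x ^ n = x ^ (n - i) * x ^ i" by (simp flip: power_add)
    thus "coeff p i * x ^ (n - i) = x ^ n * (coeff p i * inverse x ^ i)" using x0 by (simp add: field_simps)
   qed
   also have "x ^ Suc n - x ^ n * poly p (inverse x) = 0"
    using p(1) x0 by (simp add: field_simps)
   finally have "poly q x = 0" .
   moreover have "coeff q i : \<int>" for i using p(2) by (auto simp: cq intro!: Ints_diff Ints_sum)
   ultimately have "algebraic_int x" using lc by (intro algebraic_int.intros[of q]) auto
   thus False using n by blast
  qed
  then obtain A where A: "valuation_ring A" "R <= A" "{inverse x} <= nonunits A"
   by (rule exists_dominating_valuation_ring[OF R, of "{inverse x}", rotated])
    (auto simp: R_def adjoin_gen[OF Z])
  then interpret valring A by unfold_locales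
  have "x : A" using A all by blast
  thus False using A x0 by (auto simp: nonunits_def)
 qed
qed

lemma algebraic_int_add: "algebraic_int (x::'a::field_char_0) ==> algebraic_int y ==> algebraic_int (x + y)"
 and algebraic_int_diff: "algebraic_int x ==> algebraic_int y ==> algebraic_int (x - y)"
 and algebraic_int_mult: "algebraic_int x ==> algebraic_int y ==> algebraic_int (x * y)"
 unfolding algebraic_int_iff_valuation_rings
 by (auto simp: valuation_ring_def intro: subring_set_add subring_set_diff subring_set_mult)

section \<open>Hensel factorization over power series and the Newton-Puiseux theorem\<close>

section \<open>Puiseux series\<close>

lemma hom_poly:
 fixes h :: "'a::comm_ring_1 => 'b::comm_ring_1"
 assumes [simp]: "h 0 = 0" and "!!x y. h (x + y) = h x + h y" "!!x y. h (x * y) = h x * h y"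
 shows "h (poly p x) = poly (map_poly h p) (h x)"
 by (induction p) (auto simp: map_poly_pCons assms)

text \<open>A monic factor takes away exactly its degree. Degree bounds are phrased as vanishing of
  high coefficients because this form also covers the zero polynomial.\<close>

lemma coeff_mult_monic_ge_zero:
 fixes g B :: "'a::idom poly"
 assumes "lead_coeff g = 1" "!!i. i >= n ==> coeff (g * B) i = 0" "degree g <= n"
 shows "i >= n - degree g ==> coeff B i = 0"
proof -
 assume i: "i >= n - degree g"
 show ?thesis
 proof (cases "B = 0")
  case False
  have g0: "g ~= 0" using assms(1) by auto
  have "degree (g * B) < n"
  proof (rule ccontr)
   assume "~ degree (g * B) < n"
   hence "lead_coeff (g * B) = 0" using assms(2) by simp
   thus False using g0 False by simp
  qed
  hence "degree g + degree B < n" using g0 False by (simp add: degree_mult_eq)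
  thus ?thesis using i by (intro coeff_eq_0) simp
 qed simp
qed

text \<open>Reducing \<open>v * R\<close> modulo \<open>g\<close> bounds the first component. The
  quotient is moved into the second component, whose bound is forced by
  \<open>g * B = R - h * A\<close> and monicity of \<open>g\<close>.\<close>

lemma solve_coprime_bounded:
 fixes g h R :: "'a::field poly"
 assumes g: "lead_coeff g = 1" and h: "lead_coeff h = 1" and bez: "u * g + v * h = 1"
  and R: "!!i. i >= degree g + degree h ==> coeff R i = 0"
 shows "EX P. g * snd P + h * fst P = R & (ALL i>=degree g. coeff (fst P) i = 0)
        & (ALL i>=degree h. coeff (snd P) i = 0)"
proof -
 define A where "A = (v * R) mod g"
 define B where "B = u * R + h * ((v * R) div g)"
 have g0: "g ~= 0" using g by auto
 have "g * B + h * A = u * g * R + h * (g * ((v * R) div g) + (v * R) mod g)"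
  unfolding A_def B_def by (simp only: distrib_left mult.assoc mult.left_commute add.assoc)
 also have "... = u * g * R + h * (v * R)" by (simp only: mult_div_mod_eq)
 also have "... = (u * g + v * h) * R"
  by (simp add: algebra_simps)
 finally have eq: "g * B + h * A = R" using bez by simp
 have A: "coeff A i = 0" if "i >= degree g" for i
 proof (cases "A = 0")
  case False
  hence "degree A < degree g" using degree_mod_less[OF g0, of "v * R"] by (simp add: A_def)
  thus ?thesis using that by (intro coeff_eq_0) simp
 qed simp
 have hA: "coeff (h * A) i = 0" if "i >= degree g + degree h" for i
  unfolding coeff_mult
 proof (intro sum.neutral ballI)
  fix j assume "j : {..i}"
  show "coeff h j * coeff A (i - j) = 0"
   using A[of "i - j"] that coeff_eq_0[of h j] \<open>j : {..i}\<close> by (cases "j > degree h") auto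
 qed
 have "coeff B i = 0" if "i >= degree h" for i
 proof (rule coeff_mult_monic_ge_zero[OF g, of "degree g + degree h"])
  fix i assume "i >= degree g + degree h"
  moreover have "g * B = R - h * A" using eq by (simp add: algebra_simps)
  ultimately show "coeff (g * B) i = 0" using hA R by simp
 qed (use that in auto)
 thus ?thesis using eq A by (intro exI[of _ "(A, B)"]) auto
qed

text \<open>Coefficients in \<open>v\<close> of the two factors in Hensel's lemma; \<open>sol\<close> solves
  \<open>g * B + h * A = R\<close>.\<close>

fun hensel_coeffs ::
 "('a::field poly => 'a poly \<times> 'a poly) => (nat => 'a poly) => 'a poly => 'a poly => nat => 'a poly \<times> 'a poly" where
 "hensel_coeffs sol F g h 0 = (g, h)"
| "hensel_coeffs sol F g h (Suc m) = sol (F (Suc m)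
   - (\<Sum>i\<in>{1..m}. fst (hensel_coeffs sol F g h i) * snd (hensel_coeffs sol F g h (Suc m - i))))"

text \<open>A polynomial over power series is viewed as a power series of polynomials; this is the
  Cauchy product rule for its slices, which allows a factorization to be lifted slice by
  slice.\<close>

lemma map_poly_fps_nth_mult:
 fixes F G :: "'a::comm_ring_1 fps poly"
 shows "map_poly (%a. a $ m) (F * G) = (\<Sum>i\<le>m. map_poly (%a. a $ i) F * map_poly (%a. a $ (m - i)) G)"
proof (rule poly_eqI)
 fix j
 have "coeff (map_poly (%a. a $ m) (F * G)) j = (\<Sum>b\<le>j. (coeff F b * coeff G (j - b)) $ m)"
  by (simp add: coeff_map_poly coeff_mult fps_sum_nth)
 also have "... = (\<Sum>b\<le>j. \<Sum>i\<le>m. coeff F b $ i * coeff G (j - b) $ (m - i))"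
  by (simp add: fps_mult_nth atLeast0AtMost)
 also have "... = (\<Sum>i\<le>m. \<Sum>b\<le>j. coeff F b $ i * coeff G (j - b) $ (m - i))" by (rule sum.swap)
 also have "... = coeff (\<Sum>i\<le>m. map_poly (%a. a $ i) F * map_poly (%a. a $ (m - i)) G) j"
  by (simp add: coeff_sum coeff_mult coeff_map_poly)
 finally show "coeff (map_poly (%a. a $ m) (F * G)) j = ..." .
qed

text \<open>The slices of index \<open>m\<close> of the two factors solve a linear equation whose
  right side involves earlier slices only. Slices of positive index have degrees below those of
  \<open>g\<close> and \<open>h\<close>, so \<open>G\<close> keeps the leading coefficient 1 and the
  degree of \<open>g\<close>.\<close>

lemma hensel_fps:
 fixes F :: "'a::field fps poly"
 assumes F: "lead_coeff F = 1" and red: "map_poly (%a. a $ 0) F = g * h"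
  and g: "lead_coeff g = 1" and h: "lead_coeff h = 1" and bez: "u * g + v * h = 1"
 obtains G H where "F = G * H" "lead_coeff G = 1" "degree G = degree g"
proof -
 define n where "n = degree F"
 have F0: "F ~= 0" using F by auto
 have "degree (g * h) = n"
 proof (rule antisym)
  show "degree (g * h) <= n" unfolding red[symmetric] n_def
   by (intro degree_le) (auto simp: coeff_map_poly coeff_eq_0)
  show "n <= degree (g * h)" unfolding red[symmetric] n_def
   by (intro le_degree) (use F in \<open>simp add: coeff_map_poly\<close>)
 qed
 hence n: "n = degree g + degree h" using g h by (subst (asm) degree_mult_eq) auto
 define good where "good = (%R P. g * snd P + h * fst P = R & (ALL i>=degree g. coeff (fst P) i = 0)
        & (ALL i>=degree h. coeff (snd P) i = 0))"
 define sol where "sol = (%R. SOME P. good R P)"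
 have sol: "good R (sol R)" if "!!i. i >= n ==> coeff R i = 0" for R
  using someI_ex[of "good R"] solve_coprime_bounded[OF g h bez, of R] that
  by (auto simp: sol_def good_def n)
 define Fs where "Fs = (%m. map_poly (%a. a $ m) F)"
 have Fs_ge: "coeff (Fs (Suc m)) i = 0" if "i >= n" for i m
  using that F by (cases "i = n") (auto simp: Fs_def coeff_map_poly n_def coeff_eq_0)
 define P where "P = hensel_coeffs sol Fs g h"
 define R where "R = (%m. Fs (Suc m) - (\<Sum>i\<in>{1..m}. fst (P i) * snd (P (Suc m - i))))"
 have P_0: "P 0 = (g, h)" and P_Suc: "P (Suc m) = sol (R m)" for m
  by (simp_all add: P_def R_def)
 have bound: "good (R m) (P (Suc m))" for m
 proof (induction m rule: less_induct)
  case (less m)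
  have "coeff (R m) i = 0" if i: "i >= n" for i
  proof -
   have "coeff (fst (P j) * snd (P (Suc m - j))) i = 0" if j: "j : {1..m}" for j
   proof -
    obtain a b where ab: "j = Suc a" "Suc m - j = Suc b" "a < m" "b < m"
     using j by (cases j; cases "Suc m - j") auto
    have "good (R a) (P j)" "good (R b) (P (Suc m - j))" using less ab by auto
    hence "coeff (fst (P j)) l * coeff (snd (P (Suc m - j))) (i - l) = 0" if "l <= i" for l
     using i n that by (cases "l >= degree g") (auto simp: good_def)
    thus ?thesis unfolding coeff_mult by (intro sum.neutral) auto
   qed
   thus ?thesis using Fs_ge[OF i, of m] by (simp add: R_def coeff_sum)
  qed
  thus ?case unfolding P_Suc by (rule sol)
 qed
 define G where "G = (\<Sum>i\<le>degree g. monom (Abs_fps (%m. coeff (fst (P m)) i)) i)"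
 define H where "H = (\<Sum>i\<le>degree h. monom (Abs_fps (%m. coeff (snd (P m)) i)) i)"
 have cG: "coeff G i $ m = coeff (fst (P m)) i" for i m
 proof (cases "i <= degree g")
  case False
  hence "coeff (fst (P m)) i = 0"
   using bound by (cases m) (auto simp: P_0 coeff_eq_0 good_def)
  thus ?thesis using False by (simp add: G_def coeff_sum)
 qed (simp add: G_def coeff_sum)
 have cH: "coeff H i $ m = coeff (snd (P m)) i" for i m
 proof (cases "i <= degree h")
  case False
  hence "coeff (snd (P m)) i = 0"
   using bound by (cases m) (auto simp: P_0 coeff_eq_0 good_def)
  thus ?thesis using False by (simp add: H_def coeff_sum)
 qed (simp add: H_def coeff_sum)
 have mG: "map_poly (%a. a $ m) G = fst (P m)" and mH: "map_poly (%a. a $ m) H = snd (P m)" for m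
  by (rule poly_eqI; simp add: coeff_map_poly cG cH)+
 have "map_poly (%a. a $ m) (G * H) = Fs m" for m
 proof (cases m)
  case 0 thus ?thesis using red by (simp add: map_poly_fps_nth_mult mG mH P_0 Fs_def)
 next
  case (Suc k)
  have "map_poly (%a. a $ m) (G * H) = (\<Sum>i\<le>Suc k. fst (P i) * snd (P (Suc k - i)))"
   by (simp add: map_poly_fps_nth_mult mG mH Suc)
  \<comment> \<open>The indices \<open>0\<close> and \<open>Suc k\<close> carry the new slices; the
    others form the sum subtracted in \<open>R\<close>.\<close>
  also have "{..Suc k} = insert 0 (insert (Suc k) {1..k})" by auto
  also have "(\<Sum>i\<in>.... fst (P i) * snd (P (Suc k - i)))
    = g * snd (P (Suc k)) + (fst (P (Suc k)) * h + (\<Sum>i\<in>{1..k}. fst (P i) * snd (P (Suc k - i))))"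
   by (simp add: P_0)
  also have "... = Fs m"
   using bound[of k] by (simp add: good_def R_def Suc algebra_simps)
  finally show ?thesis .
 qed
 hence "coeff (map_poly (%a. a $ m) (G * H)) i = coeff (Fs m) i" for i m by simp
 hence "coeff (G * H) i $ m = coeff F i $ m" for i m by (simp add: Fs_def coeff_map_poly)
 hence "F = G * H" by (intro poly_eqI fps_ext) simp
 moreover have lG: "coeff G (degree g) = 1"
 proof (rule fps_ext)
  fix m show "coeff G (degree g) $ m = 1 $ m"
   using bound g by (cases m) (auto simp: cG P_0 good_def)
 qed
 moreover have "degree G = degree g"
 proof (rule antisym)
  show "degree G <= degree g" unfolding G_def
   by (intro degree_sum_le) (auto intro: order_trans[OF degree_monom_le])
  show "degree g <= degree G" using lG by (intro le_degree) auto
 qed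
 ultimately show thesis using that by metis
qed

text \<open>Substitution of \<open>v ^ e\<close> for the variable \<open>v\<close>, that is, passage
  to an \<open>e\<close>-th root of the parameter.\<close>

definition fps_subst_power :: "nat => 'a::field fps => 'a fps" where
 "fps_subst_power e a = fps_compose a (fps_X ^ e)"

context
 fixes e :: nat
 assumes e: "e > 0"
begin

lemma fps_subst_power_0 [simp]: "fps_subst_power e 0 = 0"
 and fps_subst_power_1 [simp]: "fps_subst_power e 1 = 1"
 and fps_subst_power_add: "fps_subst_power e (a + b) = fps_subst_power e a + fps_subst_power e b"
 and fps_subst_power_mult: "fps_subst_power e (a * b) = fps_subst_power e a * fps_subst_power e b"
 and fps_subst_power_const [simp]: "fps_subst_power e (fps_const c) = fps_const c"
 and fps_subst_power_X: "fps_subst_power e fps_X = fps_X ^ e"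
 using e by (auto simp: fps_subst_power_def fps_compose_add_distrib fps_compose_mult_distrib
   fps_X_power_nth)

lemma fps_subst_power_power: "fps_subst_power e (a ^ n) = fps_subst_power e a ^ n"
 by (induction n) (auto simp: fps_subst_power_mult)

end

lemma fps_subst_power_subst_power:
 assumes "e > 0" "d > 0"
 shows "fps_subst_power e (fps_subst_power d a) = fps_subst_power (d * e) a"
proof -
 have 1: "fps_subst_power e (fps_X ^ d) = (fps_X :: 'a fps) ^ (d * e)"
  using assms by (simp add: fps_subst_power_power fps_subst_power_X power_mult[symmetric] mult.commute)
 have 2: "fps_subst_power e (fps_subst_power d a) = fps_compose a (fps_subst_power e (fps_X ^ d))"
  unfolding fps_subst_power_def using assms by (subst fps_compose_assoc) (auto simp: fps_X_power_nth)
 show ?thesis unfolding 2 1 by (simp add: fps_subst_power_def)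
qed

lemma diff_dvd_poly_diff: "x - y dvd poly p x - poly p (y :: 'a::comm_ring_1)"
proof -
 have "poly p x = poly ([:- y, 1:] * synthetic_div p y + [:poly p y:]) x"
  by (simp only: synthetic_div_correct')
 thus ?thesis by (intro dvdI[of _ _ "poly (synthetic_div p y) x"]) (simp add: algebra_simps)
qed

text \<open>A scalar multiple of \<open>h\<close> equals \<open>1 - x\<close> with \<open>x\<close>
  divisible by \<open>[:- c, 1:]\<close>. As \<open>1 - x\<close> divides \<open>1 - x ^ k\<close>,
  while \<open>x ^ k\<close> is a multiple of \<open>[:- c, 1:] ^ k\<close>, the Bezout coefficients
  are explicit.\<close>

lemma poly_root_multiplicity_split:
 fixes f :: "'a::field poly"
 assumes "f ~= 0" "lead_coeff f = 1" "poly f c = 0"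
 obtains k h u v where "f = [:- c, 1:] ^ k * h" "k > 0" "lead_coeff h = 1" "u * [:- c, 1:] ^ k + v * h = 1"
proof -
 define k where "k = order c f"
 obtain h where h: "f = [:- c, 1:] ^ k * h" "~ [:- c, 1:] dvd h"
  using order_decomp[OF assms(1), of c] by (auto simp: k_def)
 have k: "k > 0" using assms order_root[of f c] by (simp add: k_def)
 have lc: "lead_coeff h = 1" using assms(2) by (simp add: h(1) lead_coeff_mult lead_coeff_power)
 have hc: "poly h c ~= 0" using h(2) by (simp add: poly_eq_0_iff_dvd)
 define q where "q = synthetic_div h c"
 have hq: "h = q * [:- c, 1:] + [:poly h c:]"
  unfolding q_def using synthetic_div_correct'[of c h] by (simp only: mult.commute)
 define x where "x = smult (- 1 / poly h c) (q * [:- c, 1:])"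
 have 1: "smult (1 / poly h c) h = 1 - x"
 proof -
  have "smult (1 / poly h c) h = smult (1 / poly h c) (q * [:- c, 1:] + [:poly h c:])"
   using hq by simp
  also have "... = 1 - x"
   using hc by (simp add: x_def smult_add_right one_pCons del: mult_pCons_right)
  finally show ?thesis .
 qed
 have "1 - x dvd 1 - x ^ k"
  using diff_dvd_poly_diff[of 1 x "monom 1 k"] by (simp add: poly_monom)
 then obtain w where w: "1 - x ^ k = (1 - x) * w" by blast
 show thesis
 proof (rule that[OF h(1) k lc])
  show "smult (- 1 / poly h c) q ^ k * [:- c, 1:] ^ k + smult (1 / poly h c) w * h = 1"
  proof -
   have "smult (- 1 / poly h c) q ^ k * [:- c, 1:] ^ k = x ^ k"
    by (simp only: x_def power_mult_distrib[symmetric] mult_smult_left)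
   moreover have "smult (1 / poly h c) w * h = 1 - x ^ k"
    unfolding w 1[symmetric] by (simp add: mult.commute)
   ultimately show ?thesis by simp
  qed
 qed
qed

lemma map_poly_hom_add:
 assumes "h 0 = 0" "!!x y. h (x + y) = h x + h y"
 shows "map_poly h (p + q) = map_poly h p + map_poly h q"
 by (rule poly_eqI) (simp add: coeff_map_poly assms)

lemma map_poly_hom_mult:
 fixes h :: "'a::comm_ring_1 => 'b::comm_ring_1"
 assumes h: "h 0 = 0" "!!x y. h (x + y) = h x + h y" "!!x y. h (x * y) = h x * h y"
 shows "map_poly h (p * q) = map_poly h p * map_poly h q"
proof (rule poly_eqI)
 fix n
 have "h (sum f S) = (\<Sum>x\<in>S. h (f x))" for f :: "nat => 'a" and S
  by (induction S rule: infinite_finite_induct) (auto simp: h)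
 thus "coeff (map_poly h (p * q)) n = coeff (map_poly h p * map_poly h q) n"
  by (simp add: coeff_map_poly coeff_mult h)
qed

lemma hom_poly_shift:
 fixes h :: "'a::comm_ring_1 => 'b::comm_ring_1"
 assumes h: "h 0 = 0" "h 1 = 1" "!!x y. h (x + y) = h x + h y" "!!x y. h (x * y) = h x * h y"
 shows "poly (map_poly h (pcompose F [:b, 1:])) y = poly (map_poly h F) (h b + y)"
 by (induction F)
   (auto simp: pcompose_pCons map_poly_hom_add map_poly_hom_mult map_poly_pCons h algebra_simps
    simp del: mult_pCons_left mult_pCons_right)

text \<open>Dictates the shift that removes the second highest coefficient, so that the reduction in
  the Newton polygon step cannot be a power of a linear factor.\<close>

lemma coeff_pred_Tschirnhaus:
 fixes F :: "'a::idom poly"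
 assumes F: "lead_coeff F = 1" and n: "degree F = Suc n"
 shows "coeff (pcompose F [:b, 1:]) n = coeff F n + of_nat (Suc n) * b"
proof -
 define p where "p = F - monom 1 (Suc n)"
 have "coeff p i = 0" if "i > n" for i
  using that F n by (cases "i = Suc n") (auto simp: p_def coeff_eq_0)
 hence dp: "degree p <= n" by (simp add: degree_le)
 have q: "coeff (pcompose p [:b, 1:]) n = coeff p n"
 proof (cases "degree p = n")
  case True
  have "degree (pcompose p [:b, 1:]) = n" using True by (simp add: degree_pcompose)
  moreover have "lead_coeff (pcompose p [:b, 1:]) = lead_coeff p"
   by (subst lead_coeff_comp) auto
  ultimately show ?thesis using True by simp
 next
  case False
  hence "degree p < n" using dp by simp
  moreover have "degree (pcompose p [:b, 1:]) < n" using calculation by (simp add: degree_pcompose)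
  ultimately show ?thesis by (simp add: coeff_eq_0)
 qed
 have "pcompose ([:0, 1:] ^ k) [:b, 1:] = [:b, 1:] ^ k" for k
  by (induction k) (simp_all only: power_0 power_Suc pcompose_1 pcompose_mult pcompose_pCons, auto)
 hence "pcompose (monom 1 (Suc n)) [:b, 1:] = [:b, 1:] ^ Suc n"
  by (simp only: monom_altdef smult_1_left)
 hence "coeff (pcompose (monom 1 (Suc n)) [:b, 1:]) n = of_nat (Suc n) * b"
  by (simp only: coeff_linear_poly_power) simp
 moreover have "pcompose F [:b, 1:] = pcompose p [:b, 1:] + pcompose (monom 1 (Suc n)) [:b, 1:]"
  by (simp add: p_def flip: pcompose_add)
 ultimately show ?thesis using q by (simp add: p_def)
qed

text \<open>Induction on the degree. After a shift and a rescaling along the least slope, the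
  reduction \<open>f\<close> has coefficient 0 just below the leading one but some nonzero lower
  coefficient, so it is not a power of a linear factor; Hensel's lemma then splits off a factor of
  smaller degree.\<close>

theorem puiseux_root:
 fixes F :: "'a::{alg_closed_field, field_char_0} fps poly"
 assumes "lead_coeff F = 1" "degree F > 0"
 shows "EX e>0. EX s. poly (map_poly (fps_subst_power e) F) s = 0"
 using assms
proof (induction "degree F" arbitrary: F rule: less_induct)
 case (less F0)
 define n where "n = degree F0"
 have n0: "n > 0" using less by (simp add: n_def)
 obtain n' where n': "n = Suc n'" using n0 by (cases n) auto
 define c where "c = fps_const (- 1 / of_nat n) * coeff F0 n'"
 define F where "F = pcompose F0 [:c, 1:]"
 have F: "degree F = n" using less.prems by (simp add: F_def degree_pcompose n_def)
 have "lead_coeff F = 1" unfolding F_def using less.prems by (subst lead_coeff_comp) auto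
 note F = F this
 have Fn': "coeff F n' = 0"
 proof -
  have "coeff F n' = coeff F0 n' + of_nat n * c"
   unfolding F_def n' using less.prems n' by (intro coeff_pred_Tschirnhaus) (auto simp: n_def)
  also have "of_nat n * c = - coeff F0 n'"
  proof -
   have "(of_nat n :: 'a fps) * fps_const (- 1 / of_nat n) = - 1"
    using n0 by (intro fps_ext) (simp add: fps_of_nat[symmetric])
   thus ?thesis by (simp add: c_def mult.assoc[symmetric] del: mult_minus_left)
  qed
  finally show ?thesis by simp
 qed
 have shift: "poly (map_poly (fps_subst_power e) F) y = poly (map_poly (fps_subst_power e) F0) (fps_subst_power e c + y)"
  if "e > 0" for e y
  unfolding F_def by (rule hom_poly_shift) (use that in \<open>auto simp: fps_subst_power_add fps_subst_power_mult\<close>)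
 have "EX e>0. EX s. poly (map_poly (fps_subst_power e) F) s = 0"
 proof (cases "EX i<n. coeff F i ~= 0")
  case False
  hence "coeff F 0 = 0" using n0 by simp
  hence "poly (map_poly (fps_subst_power 1) F) 0 = 0"
   by (simp add: poly_0_coeff_0 coeff_map_poly)
  thus ?thesis by (intro exI[of _ 1]) auto
 next
  case True
  define I where "I = {i. i < n & coeff F i ~= 0}"
  \<comment> \<open>Slopes of the segments joining the leading term to the other points of the
    Newton polygon. The least one, \<open>r / d\<close>, fixes the rescaling
    \<open>v -> v ^ d\<close>, \<open>y -> v ^ r * y\<close>.\<close>
  define slope :: "nat => rat" where
   "slope = (%i. of_nat (subdegree (coeff F i)) / of_nat (n - i))"
  have "finite I" "I ~= {}" using True by (auto simp: I_def)
  then obtain i0 where i0: "i0 : I" "!!i. i : I ==> slope i0 <= slope i"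
   using ex_min_if_finite[of "slope ` I"] by (auto simp: not_less)
  define d where "d = n - i0"
  define r where "r = subdegree (coeff F i0)"
  have d0: "d > 0" using i0 by (auto simp: I_def d_def)
  define u where "u = (%i. fps_shift (subdegree (coeff F i)) (coeff F i))"
  have u: "coeff F i = u i * fps_X ^ subdegree (coeff F i)" for i
   unfolding u_def by (rule subdegree_decompose)
  have slope: "r * (n - i) <= d * subdegree (coeff F i)" if "i : I" for i
  proof -
   have "of_nat r / of_nat d <= (of_nat (subdegree (coeff F i)) / of_nat (n - i) :: rat)"
    using i0(2)[OF that] by (simp add: slope_def r_def d_def)
   hence "of_nat (r * (n - i)) <= (of_nat (d * subdegree (coeff F i)) :: rat)"
    using d0 that by (simp add: I_def field_simps)
   thus ?thesis by (simp only: of_nat_le_iff)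
  qed
  \<comment> \<open>What remains of the \<open>i\<close>-th coefficient after substituting
    \<open>v ^ d\<close> and removing \<open>v ^ (r * (n - i))\<close>. By minimality of the slope
    the natural-number subtraction is exact, and it gives 0 at \<open>i0\<close>.\<close>
  define b where "b = (%i. if i = n then 1 else
   fps_X ^ (d * subdegree (coeff F i) - r * (n - i)) * fps_subst_power d (u i))"
  have b: "fps_subst_power d (coeff F i) = fps_X ^ (r * (n - i)) * b i" if "i <= n" for i
  proof (cases "i : I")
   case True
   have "fps_subst_power d (coeff F i) = fps_subst_power d (u i) * fps_X ^ (d * subdegree (coeff F i))"
    by (subst u) (use d0 in \<open>simp add: fps_subst_power_mult fps_subst_power_power fps_subst_power_X power_mult\<close>)
   also have "d * subdegree (coeff F i) = r * (n - i) + (d * subdegree (coeff F i) - r * (n - i))"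
    using slope[OF True] by simp
   finally show ?thesis using True by (simp add: b_def power_add I_def mult_ac)
  next
   case False
   thus ?thesis using that F d0 by (cases "i = n") (auto simp: I_def b_def u_def)
  qed
  define F2 where "F2 = (\<Sum>i\<le>n. monom (b i) i)"
  have cF2: "coeff F2 i = (if i <= n then b i else 0)" for i
   by (auto simp: F2_def coeff_sum)
  have dF2: "degree F2 = n"
   by (intro antisym degree_le le_degree) (auto simp: cF2 b_def)
  have lF2: "lead_coeff F2 = 1" by (simp add: dF2 cF2 b_def)
  have scale: "poly (map_poly (fps_subst_power (d * e)) F) (fps_X ^ (r * e) * y)
    = fps_X ^ (e * r * n) * poly (map_poly (fps_subst_power e) F2) y" if e: "e > 0" for e y
  proof -
   have deg: "degree (map_poly (fps_subst_power e) F2) = n"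
    by (intro antisym degree_le le_degree) (use e in \<open>auto simp: cF2 b_def coeff_map_poly\<close>)
   have deg': "degree (map_poly (fps_subst_power (d * e)) F) = n"
    by (intro antisym degree_le le_degree) (use e d0 F in \<open>auto simp: coeff_map_poly coeff_eq_0\<close>)
   have "poly (map_poly (fps_subst_power (d * e)) F) (fps_X ^ (r * e) * y)
     = (\<Sum>i\<le>n. fps_subst_power (d * e) (coeff F i) * (fps_X ^ (r * e) * y) ^ i)"
    using e d0 by (simp add: poly_altdef deg' coeff_map_poly)
   also have "... = (\<Sum>i\<le>n. fps_X ^ (e * r * n) * (fps_subst_power e (coeff F2 i) * y ^ i))"
   proof (intro sum.cong refl)
    fix i assume i: "i : {..n}"
    have "fps_subst_power (d * e) (coeff F i) = fps_subst_power e (fps_X ^ (r * (n - i)) * b i)"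
     using e d0 i by (simp add: b fps_subst_power_subst_power[symmetric])
    also have "... = fps_X ^ (e * (r * (n - i))) * fps_subst_power e (b i)"
     using e by (simp add: fps_subst_power_mult fps_subst_power_power fps_subst_power_X power_mult)
    finally have 1: "fps_subst_power (d * e) (coeff F i) * (fps_X ^ (r * e) * y) ^ i
      = (fps_X ^ (e * (r * (n - i))) * fps_X ^ (r * e * i)) * (fps_subst_power e (b i) * y ^ i)"
     by (simp only: power_mult_distrib power_mult[symmetric] mult_ac)
    have "e * (r * (n - i)) + r * e * i = e * r * (n - i + i)" by (simp add: algebra_simps)
    also have "n - i + i = n" using i by simp
    finally have "fps_X ^ (e * (r * (n - i))) * fps_X ^ (r * e * i) = (fps_X :: 'a fps) ^ (e * r * n)"
     by (simp flip: power_add)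
    thus "fps_subst_power (d * e) (coeff F i) * (fps_X ^ (r * e) * y) ^ i
     = fps_X ^ (e * r * n) * (fps_subst_power e (coeff F2 i) * y ^ i)"
     unfolding 1 using i by (simp add: cF2)
   qed
   also have "... = fps_X ^ (e * r * n) * poly (map_poly (fps_subst_power e) F2) y"
    using e by (simp add: poly_altdef deg coeff_map_poly sum_distrib_left)
   finally show ?thesis .
  qed
  define f where "f = map_poly (%a. a $ 0) F2"
  have cf: "coeff f i = coeff F2 i $ 0" for i by (simp add: f_def coeff_map_poly)
  have df: "degree f = n"
   by (intro antisym degree_le le_degree) (auto simp: cf cF2 b_def)
  have lf: "lead_coeff f = 1" by (simp add: df cf cF2 b_def)
  have fn': "coeff f n' = 0" using Fn' d0 by (simp add: cf cF2 b_def n' u_def)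
  have fi0: "coeff f i0 ~= 0"
  proof -
   have "d * subdegree (coeff F i0) - r * (n - i0) = 0" by (simp add: d_def r_def)
   thus ?thesis using i0(1) d0
    by (auto simp: cf cF2 b_def I_def u_def fps_subst_power_def)
  qed
  obtain c0 where c0: "poly f c0 = 0"
   using alg_closed_imp_poly_has_root[of f] df n0 by auto
  have "f ~= 0" using df n0 by auto
  then obtain k h v w where kh: "f = [:- c0, 1:] ^ k * h" "k > 0" "lead_coeff h = 1"
    "v * [:- c0, 1:] ^ k + w * h = 1"
   using poly_root_multiplicity_split[OF _ lf c0] by metis
  have h0: "h ~= 0" using kh by auto
  have kn: "k + degree h = n"
   using df h0 by (simp add: kh(1) degree_mult_eq degree_linear_power)
  have "k < n"
  proof (rule ccontr)
   assume "~ k < n"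
   hence "k = n" "degree h = 0" using kn by auto
   moreover have "h = 1" using calculation(2) kh(3) by (metis degree_eq_zeroE lead_coeff_pCons(2) one_pCons pCons_0_0 coeff_pCons_0 degree_pCons_0)
   ultimately have f: "f = [:- c0, 1:] ^ Suc n'" using kh by (simp add: n')
   hence "coeff f n' = of_nat (Suc n') * (- c0)"
    by (simp only: f coeff_linear_poly_power) simp
   hence "c0 = 0" using fn' by (simp del: of_nat_Suc)
   hence "f = monom 1 n" by (simp add: f n' monom_altdef)
   thus False using fi0 i0 by (auto simp: I_def)
  qed
  obtain G H where GH: "F2 = G * H" "lead_coeff G = 1" "degree G = degree ([:- c0, 1:] ^ k)"
  proof (rule hensel_fps[OF lF2 _ _ kh(3,4)])
   show "map_poly (%a. a $ 0) F2 = [:- c0, 1:] ^ k * h" using kh(1) by (simp add: f_def)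
   show "lead_coeff ([:- c0, 1:] ^ k) = 1" by (simp add: lead_coeff_power)
  qed
  have "degree G = k" using GH(3) by (simp add: degree_linear_power)
  with less.hyps[of G] GH(2) \<open>k < n\<close> \<open>k > 0\<close> obtain e s where
   es: "e > 0" "poly (map_poly (fps_subst_power e) G) s = 0" by (auto simp: n_def)
  have "map_poly (fps_subst_power e) F2 = map_poly (fps_subst_power e) G * map_poly (fps_subst_power e) H"
   unfolding GH(1) by (rule map_poly_hom_mult) (use es in \<open>auto simp: fps_subst_power_add fps_subst_power_mult\<close>)
  hence "poly (map_poly (fps_subst_power e) F2) s = 0" using es by simp
  hence "poly (map_poly (fps_subst_power (d * e)) F) (fps_X ^ (r * e) * s) = 0"
   using scale[OF es(1)] by simp
  thus ?thesis using es d0 by (intro exI[of _ "d * e"]) auto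
 qed
 thus ?case using shift by metis
qed

section \<open>Subfields of a field algebraic over the rationals\<close>

section \<open>Primitive elements\<close>

definition subfield_set :: "'a::field set => bool" where
 "subfield_set A \<longleftrightarrow> subring_set A & (ALL x:A. inverse x : A)"

lemma subfield_set_subring: "subfield_set A ==> subring_set A"
 by (simp add: subfield_set_def)

lemma subfield_set_inverse: "subfield_set A ==> x : A ==> inverse x : A"
 by (simp add: subfield_set_def)

lemma subfield_set_divide: "subfield_set A ==> x : A ==> y : A ==> x / y : A"
 by (simp add: divide_inverse subfield_set_def subring_set_mult)

lemma subfield_set_Rats: "subfield_set (\<rat> :: 'a::field_char_0 set)"
 by (auto simp: subfield_set_def subring_set_def)

definition poly_over :: "'a::field set => 'a poly set" where
 "poly_over A = {p. ALL i. coeff p i : A}"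

lemma adjoin_poly_over: "adjoin A x = {poly p x | p. p : poly_over A}"
 by (simp add: adjoin_def poly_over_def)

context
 fixes A :: "'a::field set"
 assumes A: "subring_set A"
begin

lemma poly_over_0: "0 : poly_over A"
 by (simp add: poly_over_def subring_set_0[OF A])

lemma poly_over_add: "p : poly_over A ==> q : poly_over A ==> p + q : poly_over A"
 by (simp add: poly_over_def subring_set_add[OF A])

lemma poly_over_diff: "p : poly_over A ==> q : poly_over A ==> p - q : poly_over A"
 by (simp add: poly_over_def subring_set_diff[OF A])

lemma poly_over_smult: "c : A ==> p : poly_over A ==> smult c p : poly_over A"
 by (simp add: poly_over_def subring_set_mult[OF A])

lemma poly_over_mult: "p : poly_over A ==> q : poly_over A ==> p * q : poly_over A"
 by (simp add: poly_over_def coeff_mult subring_set_sum[OF A] subring_set_mult[OF A])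

lemma poly_over_pderiv: "p : poly_over A ==> pderiv p : poly_over A"
 by (simp add: poly_over_def coeff_pderiv subring_set_mult[OF A] subring_set_of_nat[OF A] del: of_nat_Suc)

lemma poly_over_monom: "c : A ==> monom c n : poly_over A"
 by (simp add: poly_over_def subring_set_0[OF A])

lemma poly_over_const: "c : A ==> [:c:] : poly_over A"
 using poly_over_monom[of c 0] by (simp add: monom_0)

lemma poly_over_1: "1 : poly_over A"
 unfolding one_pCons by (rule poly_over_const[OF subring_set_1[OF A]])

lemma poly_over_pCons: "pCons a p : poly_over A \<longleftrightarrow> a : A & p : poly_over A"
proof -
 have "(ALL i. coeff (pCons a p) i : A) \<longleftrightarrow> a : A & (ALL i. coeff p i : A)"
  by (metis coeff_pCons_0 coeff_pCons_Suc not0_implies_Suc)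
 thus ?thesis by (simp add: poly_over_def)
qed

lemma poly_over_linear: "b : A ==> c : A ==> [:b, c:] : poly_over A"
 by (simp only: poly_over_pCons[of b] poly_over_const)

lemma poly_over_pcompose: "p : poly_over A ==> q : poly_over A ==> pcompose p q : poly_over A"
proof (induction p)
 case (pCons a p)
 thus ?case unfolding pcompose_pCons poly_over_pCons
  by (intro poly_over_add poly_over_mult poly_over_const) auto
qed (simp add: poly_over_0)

lemma poly_over_poly: "p : poly_over A ==> x : A ==> poly p x : A"
 by (rule subring_set_poly[OF A]) (auto simp: poly_over_def)

lemma poly_over_synthetic_div: "p : poly_over A ==> c : A ==> synthetic_div p c : poly_over A"
proof (induction p)
 case (pCons a p)
 thus ?case using poly_over_poly[of p c] by (auto simp: poly_over_pCons)
qed (simp add: poly_over_0)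

text \<open>As \<open>q\<close> is monic, \<open>r\<close> and \<open>q * r\<close> have the same
  leading coefficient; it is peeled off \<open>r\<close> repeatedly.\<close>

lemma monic_dvd_poly_over:
 assumes q: "q : poly_over A" "lead_coeff q = 1"
 shows "q * r : poly_over A ==> r : poly_over A"
proof (induction "degree r" arbitrary: r rule: less_induct)
 case less
 show ?case
 proof (cases "r = 0")
  case False
  define r' where "r' = r - monom (lead_coeff r) (degree r)"
  have "lead_coeff (q * r) = lead_coeff r" using q by (simp add: lead_coeff_mult)
  moreover have "lead_coeff (q * r) : A" using less.prems unfolding poly_over_def by blast
  ultimately have lr: "lead_coeff r : A" by simp
  have qr: "q * r' : poly_over A"
   unfolding r'_def right_diff_distrib
   by (rule poly_over_diff[OF less.prems poly_over_mult[OF q(1) poly_over_monom[OF lr]]])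
  have "r' : poly_over A"
  proof (cases "r' = 0")
   case False
   have "coeff r' i = 0" if "i >= degree r" for i
    using that by (cases "i = degree r") (auto simp: r'_def coeff_eq_0)
   hence "degree r' < degree r" using False by (metis leading_coeff_0_iff not_less)
   thus ?thesis using less.hyps qr by blast
  qed (simp add: poly_over_0)
  hence "r' + monom (lead_coeff r) (degree r) : poly_over A"
   using lr by (intro poly_over_add poly_over_monom)
  thus ?thesis by (simp add: r'_def)
 qed (simp add: poly_over_0)
qed

end

lemma exists_min_poly:
 fixes be :: "'a::field"
 assumes K: "subfield_set K" and p0: "p0 : poly_over K" "p0 ~= 0" "poly p0 be = 0"
 obtains q where "q : poly_over K" "lead_coeff q = 1" "poly q be = 0"
  "!!p. p : poly_over K ==> poly p be = 0 ==> q dvd p"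
proof -
 note Kr = subfield_set_subring[OF K]
 define Q where "Q = (%p. p : poly_over K & p ~= 0 & poly p be = 0)"
 obtain q0 where q0: "Q q0" "!!p. Q p ==> degree q0 <= degree p"
  using arg_min_nat_lemma[of Q p0 degree] p0 by (auto simp: Q_def)
 define q where "q = smult (inverse (lead_coeff q0)) q0"
 have lc0: "lead_coeff q0 : K" "lead_coeff q0 ~= 0" using q0 by (auto simp: Q_def poly_over_def)
 have q: "q : poly_over K" "lead_coeff q = 1" "poly q be = 0" "degree q = degree q0"
  using q0(1) lc0 poly_over_smult[OF Kr subfield_set_inverse[OF K]] by (auto simp: q_def Q_def)
 have "q dvd p" if "p : poly_over K" "poly p be = 0" for p
  using that
 proof (induction "degree p" arbitrary: p rule: less_induct)
  case less
  show ?case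
  proof (cases "p = 0")
   case False
   hence dle: "degree q <= degree p" using q0(2) less.prems q by (auto simp: Q_def)
   define t where "t = monom (lead_coeff p) (degree p - degree q)"
   have lp: "lead_coeff p : K" using less.prems by (auto simp: poly_over_def)
   have t: "t * q : poly_over K" unfolding t_def using lp q
    by (intro poly_over_mult[OF Kr] poly_over_monom[OF Kr])
   have dt: "degree (t * q) = degree p" "lead_coeff (t * q) = lead_coeff p"
   proof -
    have "t ~= 0" "q ~= 0" using False q by (auto simp: t_def)
    thus "degree (t * q) = degree p" using dle False by (simp add: degree_mult_eq t_def degree_monom_eq)
    show "lead_coeff (t * q) = lead_coeff p" using q False
     by (simp add: lead_coeff_mult t_def degree_monom_eq)
   qed
   define p' where "p' = p - t * q"
   have p': "p' : poly_over K" "poly p' be = 0"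
    using less.prems q t by (auto simp: p'_def intro!: poly_over_diff[OF Kr])
   have "q dvd p'"
   proof (cases "p' = 0")
    case False
    have "coeff p' i = 0" if "i >= degree p" for i
     using that dt by (cases "i = degree p") (auto simp: p'_def coeff_eq_0)
    hence "degree p' < degree p" using False by (metis leading_coeff_0_iff not_less)
    thus ?thesis using less.hyps p' by blast
   qed auto
   moreover have "p = p' + t * q" by (simp add: p'_def)
   ultimately show ?thesis by simp
  qed auto
 qed
 thus thesis by (rule that[OF q(1-3)])
qed

lemma adjoin_subset:
 assumes "subring_set B" "A <= B" "x : B" shows "adjoin A x <= B"
proof
 fix z assume "z : adjoin A x"
 then obtain q where "z = poly q x" "ALL i. coeff q i : A" by (auto simp: adjoin_def)
 thus "z : B" using subring_set_poly[OF assms(1), of q x] assms(2,3) by blast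
qed

context
 assumes all_algebraic: "!!x::'c::{alg_closed_field, field_char_0}. algebraic x"
begin

text \<open>An integer relation for \<open>z\<close> with nonzero constant term \<open>c\<close>
  writes \<open>inverse z\<close> as a polynomial in \<open>z\<close> divided by
  \<open>c\<close>.\<close>

lemma subfield_of_Rats_subset:
 fixes A :: "'c set"
 assumes A: "subring_set A" "\<rat> <= A" shows "subfield_set A"
 unfolding subfield_set_def
proof (intro conjI ballI A)
 fix z assume z: "z : A"
 show "inverse z : A"
 proof (cases "z = 0")
  case False
  obtain p where p: "coeff p 0 ~= 0" "poly (map_poly of_int p) z = 0"
   using algebraicE'_nonzero[OF all_algebraic False] by metis
  obtain c p' where pc: "p = pCons c p'" by (cases p) auto
  define w where "w = poly (map_poly of_int p') z"
  have "w : A" unfolding w_def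
   by (intro subring_set_poly[OF A(1)] z) (auto simp: coeff_map_poly intro: subring_set_of_int[OF A(1)])
  moreover have "(of_int c :: 'c) + z * w = 0" using p(2) by (simp add: pc map_poly_pCons w_def)
  hence "inverse z = - w * inverse (of_int c)"
   using p(1) pc False by (simp add: field_simps eq_neg_iff_add_eq_0)
  moreover have "inverse (of_int c :: 'c) : \<rat>" by simp
  hence "inverse (of_int c) : A" using A(2) by blast
  ultimately show ?thesis
   using subring_set_mult[OF A(1) subring_set_uminus[OF A(1)], of w "inverse (of_int c)"] by simp
 qed (simp add: subring_set_0[OF A(1)])
qed

lemma adjoin_Rats_subfield: "subfield_set (adjoin \<rat> (th::'c))"
 by (rule subfield_of_Rats_subset[OF adjoin_subring adjoin_superset])
   (rule subfield_set_subring[OF subfield_set_Rats])+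

lemma min_poly_Rats_simple_root:
 fixes be :: 'c
 obtains g where "g : poly_over \<rat>" "lead_coeff g = 1" "poly g be = 0" "poly (pderiv g) be ~= 0"
  "!!p. p : poly_over \<rat> ==> poly p be = 0 ==> g dvd p"
proof -
 obtain p0 where p0: "p0 : poly_over \<rat>" "p0 ~= 0" "poly p0 be = 0"
  using all_algebraic[of be] by (auto simp: algebraic_altdef poly_over_def)
 obtain g where g: "g : poly_over \<rat>" "lead_coeff g = 1" "poly g be = 0"
   "!!p. p : poly_over \<rat> ==> poly p be = 0 ==> g dvd p"
  by (rule exists_min_poly[OF subfield_set_Rats p0]) blast
 have "poly (pderiv g) be ~= 0"
 proof
  assume "poly (pderiv g) be = 0"
  hence dvd: "g dvd pderiv g"
   using g(4) poly_over_pderiv[OF subfield_set_subring[OF subfield_set_Rats] g(1)] by blast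
  have "degree g = 0"
  proof (rule ccontr)
   assume "degree g ~= 0"
   moreover have "pderiv g ~= 0" using calculation by (simp add: pderiv_eq_0_iff)
   hence "degree g <= degree (pderiv g)" using dvd dvd_imp_degree_le by blast
   ultimately show False by (simp add: degree_pderiv)
  qed
  hence "g = [:1:]" using g(2) by (auto elim!: degree_eq_zeroE)
  thus False using g(3) by simp
 qed
 thus thesis by (rule that[OF g(1-3) _ g(4)])
qed

text \<open>For \<open>c\<close> outside a finite set, \<open>g\<close> and \<open>h\<close>, which
  is \<open>f\<close> at \<open>th - c X\<close>, share only the root \<open>be\<close>. The minimal
  polynomial \<open>q\<close> of \<open>be\<close> over the field generated by \<open>th\<close>
  divides both, so \<open>be\<close> is its only root, and a simple one because it is simple for
  \<open>g\<close>. Hence \<open>q\<close> is linear and \<open>be\<close> lies in that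
  field.\<close>

lemma primitive_element_two:
 fixes al be :: 'c
 obtains th where "al : adjoin \<rat> th" "be : adjoin \<rat> th"
proof -
 note Q = subfield_set_subring[OF subfield_set_Rats]
 obtain f where f: "f : poly_over \<rat>" "f ~= 0" "poly f al = 0"
  using all_algebraic[of al] by (auto simp: algebraic_altdef poly_over_def)
 obtain g where g: "g : poly_over \<rat>" "lead_coeff g = 1" "poly g be = 0" "poly (pderiv g) be ~= 0"
  by (rule min_poly_Rats_simple_root[of be])
 have g0: "g ~= 0" using g by auto
 have "finite ((%(al', be'). (al' - al) / (be - be')) ` ({x. poly f x = 0} \<times> {x. poly g x = 0}))"
  (is "finite ?bad") using f(2) g0 by (intro finite_imageI finite_cartesian_product poly_roots_finite)
 moreover have "infinite (range of_nat :: 'c set)" by (intro range_inj_infinite inj_of_nat)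
 ultimately have "~ (range of_nat :: 'c set) <= insert 0 ?bad" using finite_subset by blast
 then obtain n where n: "(of_nat n :: 'c) ~: insert 0 ?bad" by blast
 define c where "c = (of_nat n :: 'c)"
 have c: "c ~= 0" "c ~: ?bad" "c : \<rat>" using n unfolding c_def by (blast, blast, simp)
 define th where "th = al + c * be"
 define K where "K = adjoin \<rat> th"
 have K: "subfield_set K" unfolding K_def by (rule adjoin_Rats_subfield)
 note Kr = subfield_set_subring[OF K]
 have QK: "\<rat> <= K" unfolding K_def by (rule adjoin_superset[OF Q])
 have thK: "th : K" unfolding K_def by (rule adjoin_gen[OF Q])
 define h where "h = pcompose f [:th, - c:]"
 have gK: "g : poly_over K" and fK: "f : poly_over K" using g(1) f(1) QK by (auto simp: poly_over_def)
 have hK: "h : poly_over K" unfolding h_def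
  using c(3) QK by (intro poly_over_pcompose[OF Kr fK] poly_over_linear[OF Kr] thK subring_set_uminus[OF Kr]) auto
 have hbe: "poly h be = 0" using f(3) by (simp add: h_def poly_pcompose th_def algebra_simps)
 obtain q where q: "q : poly_over K" "lead_coeff q = 1" "poly q be = 0"
   "!!p. p : poly_over K ==> poly p be = 0 ==> q dvd p"
  by (rule exists_min_poly[OF K gK g0 g(3)]) blast
 have qg: "q dvd g" "q dvd h" using q(4) gK g(3) hK hbe by blast+
 have root: "be' = be" if "poly q be' = 0" for be'
 proof (rule ccontr)
  assume ne: "be' ~= be"
  have "poly g be' = 0" "poly h be' = 0" using that qg by (auto elim!: dvdE)
  hence "poly f (th - c * be') = 0" by (simp add: h_def poly_pcompose algebra_simps)
  moreover have "c = ((th - c * be') - al) / (be - be')" using ne by (simp add: th_def field_simps)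
  ultimately have "c : ?bad" using \<open>poly g be' = 0\<close>
   by (intro image_eqI[of _ _ "(th - c * be', be')"]) auto
  thus False using c by blast
 qed
 obtain q1 where q1: "q = [:- be, 1:] * q1" using q(3) by (auto simp: poly_eq_0_iff_dvd)
 have lq1: "lead_coeff q1 = 1" using q(2) unfolding q1 lead_coeff_mult by simp
 have "degree q1 = 0"
 proof (rule ccontr)
  assume "degree q1 ~= 0"
  then obtain be' where be': "poly q1 be' = 0" using alg_closed_imp_poly_has_root[of q1] by auto
  hence "be' = be" using root by (simp add: q1)
  then obtain q2 where "q1 = [:- be, 1:] * q2" using be' by (auto simp: poly_eq_0_iff_dvd)
  moreover obtain k where "g = q * k" using qg(1) by (elim dvdE)
  ultimately have "g = [:- be, 1:] * ([:- be, 1:] * (q2 * k))" by (simp only: q1 mult.assoc)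
  hence "poly (pderiv g) be = 0" by (simp only: pderiv_mult poly_add poly_mult) simp
  thus False using g by blast
 qed
 hence "q1 = [:1:]" using lq1 by (auto elim!: degree_eq_zeroE)
 hence "coeff q 0 = - be" by (simp add: q1)
 hence "- be : K" using q(1) by (auto simp: poly_over_def dest!: spec[of _ 0])
 hence be: "be : K" using subring_set_uminus[OF Kr, of "- be"] by simp
 have "th - c * be : K" using c QK be thK by (intro subring_set_diff[OF Kr] subring_set_mult[OF Kr]) auto
 hence "al : K" by (simp add: th_def)
 thus thesis using be that by (simp add: K_def)
qed

lemma primitive_element:
 fixes Y :: "'c set"
 assumes "finite Y" shows "EX th. Y <= adjoin \<rat> th"
 using assms
proof induction
 case (insert x Y)
 then obtain th1 where 1: "Y <= adjoin \<rat> th1" by blast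
 obtain th where 2: "th1 : adjoin \<rat> th" "x : adjoin \<rat> th" by (rule primitive_element_two)
 have "adjoin \<rat> th1 <= adjoin \<rat> th"
  using subfield_set_subring[OF subfield_set_Rats] 2
  by (intro adjoin_subset adjoin_subring adjoin_superset) auto
 thus ?case using 1 2 by (intro exI[of _ th]) blast
qed auto

end

section \<open>Infinitely many primes with a place where a given finite set consists of units or
  zero\<close>

section \<open>Places of residue degree one\<close>

text \<open>Euclid's argument: with \<open>c\<close> the constant term and \<open>M\<close> the
  product of the supposedly finitely many primes, values at multiples of \<open>c * M\<close> have
  the form \<open>c * (1 + M * w)\<close>, whose second factor is prime to all of them.\<close>

lemma infinite_prime_divisors_int_poly:
 fixes m :: "int poly"
 assumes "degree m > 0"
 shows "infinite {p::nat. Factorial_Ring.prime p & (EX a. int p dvd poly m a)}"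
proof
 assume fin: "finite {p::nat. Factorial_Ring.prime p & (EX a. int p dvd poly m a)}" (is "finite ?S")
 define c where "c = poly m 0"
 have c0: "c ~= 0"
 proof
  assume "c = 0"
  hence "{p::nat. Factorial_Ring.prime p} <= ?S" by (auto simp: c_def intro!: exI[of _ 0])
  thus False using fin primes_infinite finite_subset by blast
 qed
 define M where "M = \<Prod>?S"
 have M0: "M ~= 0" using fin by (auto simp: M_def prod_zero_iff)
 define N where "N = c * int M"
 have N0: "N ~= 0" using c0 M0 by (simp add: N_def)
 have "finite {a. poly (m - [:c:]) a = 0 | poly (m + [:c:]) a = 0}"
 proof -
  have "m - [:c:] ~= 0" "m + [:c:] ~= 0" using assms
   by (metis eq_iff_diff_eq_0 degree_pCons_0 less_irrefl, metis add_eq_0_iff degree_minus degree_pCons_0 less_irrefl)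
  thus ?thesis unfolding Collect_disj_eq finite_Un by (intro conjI poly_roots_finite)
 qed
 moreover have "infinite (range (%t. N * int t))"
  using N0 by (intro range_inj_infinite) (auto simp: inj_on_def)
 ultimately have "~ range (%t. N * int t) <= {a. poly (m - [:c:]) a = 0 | poly (m + [:c:]) a = 0}"
  using finite_subset by blast
 \<comment> \<open>Avoiding the values \<open>c\<close> and \<open>- c\<close> keeps
   \<open>1 + M * w\<close> different from 1 and -1, so that it has a prime divisor.\<close>
 then obtain t where "poly (m - [:c:]) (N * int t) ~= 0" "poly (m + [:c:]) (N * int t) ~= 0" by blast
 hence t: "poly m (N * int t) ~= c" "poly m (N * int t) ~= - c" by auto
 define x where "x = poly m (N * int t)"
 have "N * int t - 0 dvd x - c" unfolding x_def c_def by (rule diff_dvd_poly_diff)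
 hence "c * int M dvd x - c" by (metis N_def diff_zero dvd_mult_left)
 then obtain w where "x - c = c * int M * w" by (elim dvdE)
 hence w: "x = c * (1 + int M * w)" by (simp add: algebra_simps)
 have "1 + int M * w ~= 1"
 proof
  assume "1 + int M * w = 1"
  hence "x = c" unfolding w by simp
  thus False using t by (simp add: x_def)
 qed
 moreover have "1 + int M * w ~= - 1"
 proof
  assume "1 + int M * w = - 1"
  hence "x = c * (- 1)" unfolding w by (simp only:)
  thus False using t by (simp add: x_def)
 qed
 ultimately have "nat \<bar>1 + int M * w\<bar> ~= 1" by linarith
 then obtain p where p: "Factorial_Ring.prime p" "p dvd nat \<bar>1 + int M * w\<bar>" using prime_factor_nat by blast
 hence "int p dvd \<bar>1 + int M * w\<bar>" by (metis int_dvd_int_iff abs_ge_zero int_nat_eq)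
 hence pd: "int p dvd 1 + int M * w" by simp
 hence "int p dvd x" by (simp add: w)
 hence "p : ?S" using p by (auto simp: x_def)
 hence "p dvd M" using fin unfolding M_def by (intro dvd_prodI[of _ _ id, simplified]) auto
 hence "int p dvd int M * w" by (simp add: int_dvd_int_iff dvd_mult2)
 hence "int p dvd 1" using pd by (metis add_diff_cancel_right' dvd_diff)
 thus False using p by (auto simp: prime_nat_iff)
qed

text \<open>The localization of the integers at \<open>p\<close>, as a subset of a field of
  characteristic 0.\<close>

definition loc_int :: "nat => 'a::field_char_0 set" where
 "loc_int p = {of_int a / of_int b | a b. ~ int p dvd b}"

context
 fixes p :: nat
 assumes p: "Factorial_Ring.prime p"
begin

lemma loc_intI: "~ int p dvd b ==> of_int a / of_int b : loc_int p"
 by (auto simp: loc_int_def)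

lemma subring_loc_int: "subring_set (loc_int p)"
 unfolding subring_set_def
proof (intro conjI ballI)
 show "1 : loc_int p" using loc_intI[of 1 1] p by (auto simp: prime_nat_iff)
next
 fix x y :: 'a assume "x : loc_int p" "y : loc_int p"
 then obtain a b c d where *: "x = of_int a / of_int b" "~ int p dvd b" "y = of_int c / of_int d" "~ int p dvd d"
  by (auto simp: loc_int_def)
 hence nd: "~ int p dvd b * d" using p by (simp add: prime_dvd_mult_iff)
 have nz: "b ~= 0" "d ~= 0" using * by auto
 have "x - y = of_int (a * d - c * b) / of_int (b * d)" using nz by (simp add: * field_simps)
 thus "x - y : loc_int p" using loc_intI[OF nd] by metis
 have "x * y = of_int (a * c) / of_int (b * d)" using nz by (simp add: *)
 thus "x * y : loc_int p" using loc_intI[OF nd] by metis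
qed

lemma one_notin_p_loc_int: "x : loc_int p ==> of_nat p * x ~= 1"
proof
 assume "x : loc_int p" "of_nat p * x = 1"
 then obtain a b where ab: "x = of_int a / of_int b" "~ int p dvd b" by (auto simp: loc_int_def)
 have "b ~= 0" using ab by auto
 hence "x * of_int b = of_int a" by (simp add: ab)
 moreover have "(of_nat p * x) * of_int b = of_int b" using \<open>of_nat p * x = 1\<close> by simp
 ultimately have "(of_int (int p * a) :: 'a) = of_int b" by (simp add: mult.assoc)
 hence "int p * a = b" by (simp only: of_int_eq_iff)
 thus False using ab by auto
qed

lemma loc_int_cases: "x : loc_int p ==> (EX y:loc_int p. x = of_nat p * y) | inverse x : loc_int p"
proof -
 assume "x : loc_int p"
 then obtain a b where ab: "x = of_int a / of_int b" "~ int p dvd b" by (auto simp: loc_int_def)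
 show ?thesis
 proof (cases "int p dvd a")
  case True
  then obtain c where "a = int p * c" by auto
  thus ?thesis using ab loc_intI[OF ab(2), of c] by (intro disjI1 bexI[of _ "of_int c / of_int b"]) auto
 next
  case False
  thus ?thesis using ab loc_intI[of a b] by auto
 qed
qed

end

lemma Rats_loc_int:
 fixes x :: "'a::field_char_0"
 assumes "x : \<rat>" shows "EX D>0. ALL p. Factorial_Ring.prime p --> ~ p dvd D --> x : loc_int p"
proof -
 obtain r where r: "x = of_rat r" using assms by (auto elim: Rats_cases)
 obtain a b where ab: "r = of_int a / of_int b" "b > 0" by (metis Fract_of_int_quotient Rat_cases)
 have x: "x = of_int a / of_int b" by (simp add: r ab of_rat_divide)
 show ?thesis
 proof (intro exI[of _ "nat b"] conjI allI impI)
  fix p :: nat assume "Factorial_Ring.prime p" "~ p dvd nat b"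
  hence "~ int p dvd b" using ab(2) by (simp add: int_dvd_int_iff[symmetric])
  thus "x : loc_int p" using loc_intI \<open>Factorial_Ring.prime p\<close> x by metis
 qed (use ab in auto)
qed

lemma poly_over_Rats_loc_int:
 fixes q :: "'a::field_char_0 poly"
 assumes "q : poly_over \<rat>"
 shows "EX D>0. ALL p. Factorial_Ring.prime p --> ~ p dvd D --> q : poly_over (loc_int p)"
proof -
 have "ALL i. EX D>0. ALL p. Factorial_Ring.prime p --> ~ p dvd D --> coeff q i : loc_int p"
  using assms Rats_loc_int by (auto simp: poly_over_def)
 then obtain D where D: "!!i. D i > 0" "!!i p. Factorial_Ring.prime p ==> ~ p dvd D i ==> coeff q i : loc_int p"
  by metis
 show ?thesis
 proof (intro exI[of _ "\<Prod>i\<le>degree q. D i"] conjI allI impI)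
  fix p :: nat assume p: "Factorial_Ring.prime p" "~ p dvd (\<Prod>i\<le>degree q. D i)"
  have "coeff q i : loc_int p" for i
  proof (cases "i <= degree q")
   case True
   hence "D i dvd (\<Prod>i\<le>degree q. D i)" by (intro dvd_prodI) auto
   hence "~ p dvd D i" using p dvd_trans by blast
   thus ?thesis using D p by blast
  qed (use subring_set_0[OF subring_loc_int] p in \<open>auto simp: coeff_eq_0\<close>)
  thus "q : poly_over (loc_int p)" by (simp add: poly_over_def)
 qed (use D in auto)
qed

text \<open>A place of \<open>F\<close> of degree one, unramified over \<open>p\<close>: by
  \<open>decomp\<close> the prime \<open>p\<close> is a uniformizer of \<open>F\<close>, and by
  \<open>approx\<close> the residue field of \<open>F\<close> is the prime field. In contrast,
  \<open>archimedean\<close> concerns the whole closure and says that powers of \<open>p\<close>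
  measure convergence there.\<close>

locale place = valring A for A :: "'c::{alg_closed_field, field_char_0} set" +
 fixes F :: "'c set" and p :: nat
 assumes p: "Factorial_Ring.prime p"
  and subfield: "subfield_set F"
  and p_nonunit: "of_nat p : nonunits A"
  and decomp: "x : F ==> x ~= 0 ==> EX n u. x = of_nat p powi n * u & u : F & u : A & inverse u : A"
  and approx: "x : F ==> x : A ==> EX m. vle (x - of_int m) (of_nat p)"
  and archimedean: "x ~= 0 ==> EX n. vle (of_nat p ^ n) x"

text \<open>Here \<open>a\<close> is a simple root modulo \<open>p\<close> of the minimal polynomial
  of \<open>th\<close>. The ring dominates the ideal generated by \<open>p\<close> and
  \<open>th - a\<close>; simplicity of the root makes \<open>th - a\<close> a multiple of
  \<open>p\<close>, and this yields both the uniformizer and the residue field.\<close>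

lemma exists_place:
 fixes q :: "'c::{alg_closed_field, field_char_0} poly" and th :: 'c
 assumes all_algebraic: "!!x::'c. algebraic x"
  and p: "Factorial_Ring.prime p" and q: "lead_coeff q = 1" "q : poly_over (loc_int p)" "poly q th = 0"
  and min: "!!g. g : poly_over \<rat> ==> poly g th = 0 ==> q dvd g"
  and a: "poly q (of_int a) = of_nat p * z" "z : loc_int p"
  and a': "!!z'. z' : loc_int p ==> poly (pderiv q) (of_int a) ~= of_nat p * z'"
 obtains A where "place A (adjoin \<rat> th) p" "adjoin (loc_int p) th <= A"
proof -
 define Z where "Z = (loc_int p :: 'c set)"
 define al where "al = (of_int a :: 'c)"
 define \<pi> where "\<pi> = (of_nat p :: 'c)"
 have \<pi>0: "\<pi> ~= 0" using p by (auto simp: \<pi>_def prime_nat_iff)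
 have Z: "subring_set Z" unfolding Z_def by (rule subring_loc_int[OF p])
 have alZ: "al : Z" and \<pi>Z: "\<pi> : Z"
  using subring_set_of_int[OF Z] subring_set_of_nat[OF Z] by (auto simp: al_def \<pi>_def)
 have ZQ: "Z <= \<rat>" by (auto simp: Z_def loc_int_def)
 have polyZQ: "g : poly_over \<rat>" if "g : poly_over Z" for g
  using that ZQ by (auto simp: poly_over_def)
 define R where "R = adjoin Z th"
 have R: "subring_set R" unfolding R_def by (rule adjoin_subring[OF Z])
 have thR: "th : R" unfolding R_def by (rule adjoin_gen[OF Z])
 have ZR: "Z <= R" unfolding R_def by (rule adjoin_superset[OF Z])
 have "1 ~: span_ideal R {\<pi>, th - al}"
 proof
  assume "1 : span_ideal R {\<pi>, th - al}"
  then obtain S c where S: "finite S" "S <= {\<pi>, th - al}" "c ` S <= R" "1 = (\<Sum>x\<in>S. c x * x)"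
   unfolding span_ideal_def by blast
  define c' where "c' = (%x. if x : S then c x else 0)"
  have c': "c' x : R" for x using S subring_set_0[OF R] by (auto simp: c'_def)
  have one: "1 = (\<Sum>x\<in>{\<pi>, th - al}. c' x * x)"
   unfolding S(4) using S by (intro sum.mono_neutral_cong_left) (auto simp: c'_def)
  have "EX c1:R. EX c2:R. 1 = c1 * \<pi> + c2 * (th - al)"
  proof (cases "\<pi> = th - al")
   case True
   thus ?thesis using one c' subring_set_0[OF R]
    by (intro bexI[of _ "c' \<pi>"] bexI[of _ 0]) auto
  next
   case False
   thus ?thesis using one c' by (intro bexI[of _ "c' \<pi>"] bexI[of _ "c' (th - al)"]) auto
  qed
  then obtain g1 g2 where g: "g1 : poly_over Z" "g2 : poly_over Z"
    "1 = poly g1 th * \<pi> + poly g2 th * (th - al)"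
   by (auto simp: R_def adjoin_poly_over)
  \<comment> \<open>A relation putting 1 into the ideal makes \<open>g\<close> vanish at
    \<open>th\<close>, so \<open>g = q * r\<close>. Evaluated at \<open>al\<close>, where
    \<open>q\<close> is divisible by \<open>p\<close>, it would make 1 a multiple of
    \<open>p\<close> in \<open>Z\<close>.\<close>
  define g where "g = 1 - smult \<pi> g1 - g2 * [:- al, 1:]"
  have gZ: "g : poly_over Z" unfolding g_def using g alZ \<pi>Z
   by (intro poly_over_diff[OF Z] poly_over_smult[OF Z] poly_over_mult[OF Z] poly_over_linear[OF Z]
     poly_over_1[OF Z] subring_set_uminus[OF Z] subring_set_1[OF Z])
  have "poly g th = 0" using g(3) by (simp add: g_def algebra_simps)
  then obtain r where r: "g = q * r" using min polyZQ[OF gZ] by (auto elim: dvdE)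
  have rZ: "r : poly_over Z" using monic_dvd_poly_over[OF Z _ q(1), of r] q(2) gZ r by (simp add: Z_def)
  have "1 = \<pi> * (poly g1 al + z * poly r al)"
   using arg_cong[OF r, of "%h. poly h al"] a by (simp add: g_def al_def \<pi>_def algebra_simps)
  moreover have "poly g1 al + z * poly r al : Z" using g rZ alZ a(2)
   by (intro subring_set_add[OF Z] subring_set_mult[OF Z] poly_over_poly[OF Z]) (auto simp: Z_def)
  ultimately show False using one_notin_p_loc_int[OF p] by (metis Z_def \<pi>_def)
 qed
 then obtain A where A: "valuation_ring A" "R <= A" "{\<pi>, th - al} <= nonunits A"
  by (rule exists_dominating_valuation_ring[OF R, of "{\<pi>, th - al}", rotated])
    (use ZR \<pi>Z thR alZ in \<open>auto intro!: subring_set_diff[OF R]\<close>)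
 interpret valring A by unfold_locales (rule A)
 have ZA: "Z <= A" and thA: "th : A" using ZR A(2) thR by blast+
 have \<pi>n: "\<pi> : nonunits A" and thn: "th - al : nonunits A" using A(3) by auto
 have polyA: "poly g th : A" if "g : poly_over Z" for g
  using that A(2) by (auto simp: R_def adjoin_poly_over)
 \<comment> \<open>Polynomials whose value at \<open>al\<close> is a unit of \<open>Z\<close>. Since
   \<open>th - al\<close> is a nonunit of \<open>A\<close>, their values at \<open>th\<close> are
   units of \<open>A\<close>.\<close>
 define good where "good = (%g. g : poly_over Z & inverse (poly g al) : Z & poly g al ~= 0)"
 have good_unit: "inverse (poly g th) : A & poly g th ~= 0" if "good g" for g
 proof -
  have g: "g : poly_over Z" "inverse (poly g al) : A" "poly g al ~= 0" "poly g al : A"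
   using that ZA poly_over_poly[OF Z, of g al] alZ by (auto simp: good_def)
  obtain w where w: "poly g th = poly g al + (th - al) * w" "w : A"
  proof (rule that)
   have "poly g th = poly ([:- al, 1:] * synthetic_div g al + [:poly g al:]) th"
    by (simp only: synthetic_div_correct')
   thus "poly g th = poly g al + (th - al) * poly (synthetic_div g al) th" by (simp add: algebra_simps)
   show "poly (synthetic_div g al) th : A" using g(1) alZ by (intro polyA poly_over_synthetic_div[OF Z])
  qed
  have "poly g th ~: nonunits A"
  proof
   assume "poly g th : nonunits A"
   hence "poly g th - w * (th - al) : nonunits A" using w thn nonunits_mult nonunits_diff by blast
   hence "poly g al : nonunits A" by (simp add: w algebra_simps)
   thus False using g by (auto simp: nonunits_def)
  qed
  thus ?thesis using polyA[OF g(1)] by (auto simp: nonunits_def)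
 qed
 \<comment> \<open>The value of \<open>q1\<close> at \<open>al\<close> is the derivative of
   \<open>q\<close> there, a unit; \<open>q(th) = 0\<close> then expresses \<open>th - al\<close> as
   a multiple of \<open>p\<close>.\<close>
 define q1 where "q1 = synthetic_div q al"
 have q1Z: "q1 : poly_over Z" unfolding q1_def using q(2) alZ by (intro poly_over_synthetic_div[OF Z]) (auto simp: Z_def)
 have q_q1: "q = [:- al, 1:] * q1 + [:poly q al:]" by (simp only: synthetic_div_correct' q1_def)
 have "poly (pderiv q) al = poly q1 al" 
  by (subst q_q1) (simp only: pderiv_add pderiv_mult poly_add poly_mult, simp add: pderiv_pCons)
 hence good_q1: "good q1"
  using loc_int_cases[OF p, of "poly q1 al"] a' poly_over_poly[OF Z q1Z alZ] q1Z
   subring_set_0[OF Z] by (auto simp: good_def al_def Z_def) (metis mult_zero_right)+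
 have good_q1n: "good (q1 ^ n)" for n
 proof (induction n)
  case 0 thus ?case using poly_over_1[OF Z] subring_set_1[OF Z] by (simp add: good_def)
 next
  case (Suc n) thus ?case using good_q1 poly_over_mult[OF Z] subring_set_mult[OF Z] by (simp add: good_def)
 qed
 have thal: "th - al = - (\<pi> * z) / poly q1 th"
 proof -
  have "poly ([:- al, 1:] * q1 + [:poly q al:]) th = 0" using q(3) by (simp only: q_q1[symmetric])
  hence "(th - al) * poly q1 th + \<pi> * z = 0" using a by (simp add: al_def \<pi>_def algebra_simps)
  thus ?thesis using good_unit[OF good_q1] by (simp add: field_simps eq_neg_iff_add_eq_0)
 qed
 \<comment> \<open>If the value at \<open>al\<close> is no unit, a factor \<open>p\<close> can be
   extracted from the value at \<open>th\<close>, at the price of one unit \<open>q1(th)\<close> in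
   the denominator.\<close>
 have red: "good g | (EX g'. g' : poly_over Z & poly g th = \<pi> * poly g' th / poly q1 th)"
  if g: "g : poly_over Z" for g
 proof (cases "good g")
  case False
  have "poly g al = 0 | inverse (poly g al) ~: Z" using False g by (auto simp: good_def)
  then obtain y where y: "y : Z" "poly g al = \<pi> * y"
   using loc_int_cases[OF p, of "poly g al"] poly_over_poly[OF Z g alZ] subring_set_0[OF Z]
   unfolding Z_def \<pi>_def by (metis mult_zero_right)
  have "poly g th = poly ([:- al, 1:] * synthetic_div g al + [:poly g al:]) th"
   by (simp only: synthetic_div_correct')
  also have "... = (th - al) * poly (synthetic_div g al) th + \<pi> * y" by (simp add: y algebra_simps)
  also have "... = \<pi> * poly (smult y q1 - smult z (synthetic_div g al)) th / poly q1 th"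
   unfolding thal using good_unit[OF good_q1] by (simp add: field_simps)
  finally have "poly g th = \<pi> * poly (smult y q1 - smult z (synthetic_div g al)) th / poly q1 th" .
  moreover have "smult y q1 - smult z (synthetic_div g al) : poly_over Z"
   using y a(2) q1Z g alZ
   by (intro poly_over_diff[OF Z] poly_over_smult[OF Z] poly_over_synthetic_div[OF Z]) (auto simp: Z_def)
  ultimately show ?thesis by blast
 qed simp
 have \<pi>_pow: "~ vle (\<pi> ^ n) (\<pi> ^ Suc n)" for n
  using \<pi>n \<pi>0 vle_mult_cancel[of "\<pi> ^ n" 1 \<pi>] by (simp add: nonunits_iff mult.commute)
 \<comment> \<open>The nonzero constant coefficient of an integer relation is a multiple of
   \<open>x\<close> in \<open>A\<close>, and up to a unit it is a power of \<open>p\<close>.\<close>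
 have arch: "EX n. vle (\<pi> ^ n) x" if x: "x ~= 0" for x
 proof (cases "x : A")
  case False
  hence "vle 1 x" using in_or_inverse_in[of x] x by (auto simp: vle_iff divide_inverse)
  thus ?thesis by (intro exI[of _ 0]) simp
 next
  case True
  obtain m where m: "coeff m 0 ~= 0" "poly (map_poly of_int m) x = 0"
   using algebraicE'_nonzero[OF all_algebraic x] by metis
  obtain c m' where mc: "m = pCons c m'" by (cases m) auto
  define w where "w = - poly (map_poly of_int m') x"
  have wA: "w : A" unfolding w_def using True
   by (intro in_uminus in_poly) (auto simp: coeff_map_poly intro: in_of_int)
  have c: "(of_int c :: 'c) = w * x" "c ~= 0"
   using m by (auto simp: mc map_poly_pCons w_def eq_neg_iff_add_eq_0 mult.commute)
  obtain k c' where kc: "c = int p ^ k * c'" "~ int p dvd c'"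
   using multiplicity_decompose'[of c "int p"] c(2) p by (metis not_prime_unit prime_nat_int_transfer)
  have "\<pi> ^ k = (inverse (of_int c') * w) * x"
   using kc c by (auto simp: \<pi>_def field_simps)
  moreover have "inverse (of_int c') : A"
   using loc_intI[OF p kc(2), of 1, where 'a = 'c] ZA by (auto simp: Z_def divide_inverse)
  ultimately have "vle (\<pi> ^ k) x" unfolding vle_def using wA in_mult by blast
  thus ?thesis by blast
 qed
 \<comment> \<open>Extraction of factors \<open>p\<close> comes to an end, because by
   \<open>arch\<close> a nonzero value is not divisible by all powers of \<open>p\<close>.\<close>
 have iter: "EX n g. good g & poly g0 th * poly q1 th ^ n = \<pi> ^ n * poly g th"
  if g0: "g0 : poly_over Z" "poly g0 th ~= 0" for g0
 proof (rule ccontr)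
  assume none: "~ ?thesis"
  have "EX g:poly_over Z. poly g0 th * poly q1 th ^ n = \<pi> ^ n * poly g th" for n
  proof (induction n)
   case 0 thus ?case using g0 by auto
  next
   case (Suc n)
   then obtain g where g: "g : poly_over Z" "poly g0 th * poly q1 th ^ n = \<pi> ^ n * poly g th" by blast
   hence "~ good g" using none by blast
   then obtain g' where g': "g' : poly_over Z" "poly g th = \<pi> * poly g' th / poly q1 th"
    using red[OF g(1)] by blast
   have "poly g0 th * poly q1 th ^ Suc n = \<pi> ^ Suc n * poly g' th"
    using g(2) g'(2) good_unit[OF good_q1] by (simp add: field_simps)
   thus ?case using g' by blast
  qed note all = this
  obtain n where n: "vle (\<pi> ^ n) (poly g0 th)" using arch g0 by blast
  obtain g where g: "g : poly_over Z" "poly g0 th * poly q1 th ^ Suc n = \<pi> ^ Suc n * poly g th"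
   using all by blast
  have "poly g0 th = (poly g th * inverse (poly (q1 ^ Suc n) th)) * \<pi> ^ Suc n"
   using g(2) good_unit[OF good_q1n[of "Suc n"]] by (simp add: field_simps)
  hence "vle (poly g0 th) (\<pi> ^ Suc n)"
   unfolding vle_def using polyA[OF g(1)] good_unit[OF good_q1n] in_mult by blast
  thus False using n \<pi>_pow vle_trans by blast
 qed
 define V where "V = {poly g th / poly h th | g h. good g & good h}"
 have V_unit: "v : A & inverse v : A & v ~= 0" if "v : V" for v
  using that good_unit polyA unfolding V_def
  by (auto simp: divide_inverse good_def intro!: in_mult)
 have V_approx: "EX m. vle (v - of_int m) \<pi>" if v: "v : V" for v
 proof -
  obtain g h where gh: "v = poly g th / poly h th" "good g" "good h" using v by (auto simp: V_def)
  have near: "vle (poly f th - poly f al) \<pi>" if f: "f : poly_over Z" for f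
  proof -
   have "poly f th = poly ([:- al, 1:] * synthetic_div f al + [:poly f al:]) th"
    by (simp only: synthetic_div_correct')
   hence "poly f th - poly f al = (th - al) * poly (synthetic_div f al) th"
    by (simp add: algebra_simps)
   hence "poly f th - poly f al = (- z * inverse (poly q1 th) * poly (synthetic_div f al) th) * \<pi>"
    unfolding thal by (simp add: divide_inverse mult_ac)
   moreover have "- z * inverse (poly q1 th) * poly (synthetic_div f al) th : A"
    using a(2) ZA good_unit[OF good_q1] f alZ
    by (intro in_mult in_uminus polyA poly_over_synthetic_div[OF Z]) (auto simp: Z_def)
   ultimately show ?thesis unfolding vle_def by blast
  qed
  define x where "x = poly g al * inverse (poly h al)"
  have xZ: "x : Z" using gh alZ poly_over_poly[OF Z]
   by (auto simp: x_def good_def intro!: subring_set_mult[OF Z])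
  have gZ: "g : poly_over Z" "h : poly_over Z" using gh by (auto simp: good_def)
  have hA: "poly h al : A" "poly g al : A" using poly_over_poly[OF Z _ alZ] gZ ZA by blast+
  have "v - x = (inverse (poly h th) * inverse (poly h al)) *
    (poly h al * (poly g th - poly g al) - poly g al * (poly h th - poly h al))"
   using good_unit[OF gh(3)] gh(3) by (simp add: gh x_def good_def field_simps)
  moreover have "vle ... \<pi>"
  proof (intro vle_mult_left[OF in_mult] vle_diff vle_mult_left[OF _ near])
   show "inverse (poly h th) : A" using good_unit[OF gh(3)] by blast
   show "inverse (poly h al) : A" using gh(3) ZA by (auto simp: good_def)
  qed (use gZ hA in auto)
  ultimately have vx: "vle (v - x) \<pi>" by simp
  obtain s t where st: "x = of_int s / of_int t" "~ int p dvd t" using xZ by (auto simp: Z_def loc_int_def)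
  have "coprime (int p) t" using st p by (simp add: prime_imp_coprime)
  then obtain t' where "[t * t' = 1] (mod int p)" using cong_solve_coprime_int by (metis coprime_commute)
  then obtain k where k: "1 - t * t' = int p * k" by (auto simp: cong_iff_dvd_diff dvd_diff_commute elim!: dvdE)
  have t0: "t ~= 0" using st by auto
  have "x - of_int (s * t') = of_int (s * (1 - t * t')) / of_int t" using t0 by (simp add: st field_simps)
  also have "... = (of_int s * inverse (of_int t) * of_int k) * \<pi>" unfolding k by (simp add: \<pi>_def field_simps)
  finally have "x - of_int (s * t') = (of_int s * inverse (of_int t) * of_int k) * \<pi>" .
  moreover have "inverse (of_int t) : A"
   using loc_intI[OF p st(2), of 1, where 'a = 'c] ZA by (auto simp: Z_def divide_inverse)
  ultimately have "vle (x - of_int (s * t')) \<pi>"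
   unfolding vle_def using in_mult in_of_int by blast
  hence "vle ((v - x) + (x - of_int (s * t'))) \<pi>" using vx vle_add by blast
  thus ?thesis by (intro exI[of _ "s * t'"]) simp
 qed
 define F where "F = adjoin \<rat> th"
 note Q = subfield_set_subring[OF subfield_set_Rats]
 have F: "subfield_set F" unfolding F_def by (rule adjoin_Rats_subfield[OF all_algebraic])
 have VF: "V <= F"
 proof
  fix v assume "v : V"
  then obtain g h where gh: "v = poly g th / poly h th" "g : poly_over \<rat>" "h : poly_over \<rat>"
   using polyZQ by (auto simp: V_def good_def)
  hence "poly g th : F" "poly h th : F" unfolding F_def adjoin_poly_over by blast+
  thus "v : F" unfolding gh(1) by (rule subfield_set_divide[OF F])
 qed
 have dec: "EX n v. x = \<pi> powi n * v & v : V" if x: "x : F" "x ~= 0" for x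
 proof -
  obtain g where g: "g : poly_over \<rat>" "x = poly g th" using x by (auto simp: F_def adjoin_poly_over)
  have "EX c::int. c ~= 0 & smult (of_int c) g : poly_over Z"
  proof -
   have "ALL i. EX a b::int. b ~= 0 & coeff g i = of_int a / of_int b"
    using g(1) unfolding poly_over_def by (metis Rats_cases' mem_Collect_eq of_int_0_less_iff order_less_irrefl)
   then obtain a b :: "nat => int" where ab: "!!i. b i ~= 0" "!!i. coeff g i = of_int (a i) / of_int (b i)" by metis
   define c where "c = (\<Prod>i\<le>degree g. b i)"
   have "of_int c * coeff g i : Z" for i
   proof (cases "i <= degree g")
    case True
    hence "b i dvd c" unfolding c_def by (intro dvd_prodI) auto
    then obtain k where "c = b i * k" by blast
    hence "of_int c * coeff g i = of_int (k * a i)" using ab by simp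
    thus ?thesis using subring_set_of_int[OF Z] by metis
   qed (use subring_set_0[OF Z] in \<open>simp add: coeff_eq_0\<close>)
   moreover have "c ~= 0" using ab by (simp add: c_def)
   ultimately show ?thesis by (auto simp: poly_over_def)
  qed
  then obtain c where c: "c ~= 0" "smult (of_int c) g : poly_over Z" by blast
  obtain k c' where kc: "c = int p ^ k * c'" "~ int p dvd c'"
   using multiplicity_decompose'[of c "int p"] c(1) p by (metis not_prime_unit prime_nat_int_transfer)
  have c'0: "c' ~= 0" using kc by auto
  obtain n h where nh: "good h" "poly (smult (of_int c) g) th * poly q1 th ^ n = \<pi> ^ n * poly h th"
   using iter[OF c(2)] c(1) x(2) g(2) by auto
  define d where "d = smult (of_int c') (q1 ^ n)"
  have d: "good d"
   using good_q1n[of n] kc(2) c'0 subring_set_of_int[OF Z, of c'] loc_intI[OF p kc(2), of 1, where 'a = 'c]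
   by (auto simp: good_def d_def Z_def[symmetric] divide_inverse
     intro!: poly_over_smult[OF Z] subring_set_mult[OF Z])
  have "x * \<pi> ^ k * poly d th = \<pi> ^ n * poly h th"
   using nh(2) by (simp add: g(2) d_def kc \<pi>_def mult_ac)
  hence "x = \<pi> powi (int n - int k) * (poly h th / poly d th)"
   using \<pi>0 good_unit[OF d] by (simp add: power_int_diff field_simps)
  moreover have "poly h th / poly d th : V" unfolding V_def using nh d by blast
  ultimately show ?thesis by blast
 qed
 have "place A F p"
 proof
  show "Factorial_Ring.prime p" by (rule p)
  show "subfield_set F" by (rule F)
  show "of_nat p : nonunits A" using \<pi>n by (simp add: \<pi>_def)
  show "EX n. vle (of_nat p ^ n) x" if "x ~= 0" for x using arch[OF that] by (simp add: \<pi>_def)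
  show "EX n u. x = of_nat p powi n * u & u : F & u : A & inverse u : A" if "x : F" "x ~= 0" for x
   using dec[OF that] V_unit VF unfolding \<pi>_def by blast
  show "EX m. vle (x - of_int m) (of_nat p)" if x: "x : F" "x : A" for x
  proof (cases "x = 0")
   case True thus ?thesis by (intro exI[of _ 0]) simp
  next
   case False
   obtain n v where nv: "x = \<pi> powi n * v" "v : V" using dec[OF x(1) False] by blast
   note v = V_unit[OF nv(2)]
   consider "n < 0" | "n = 0" | "n > 0" by linarith
   thus ?thesis
   proof cases
    case 1
    then obtain k where k: "n = - int (Suc k)" by (metis negD zero_less_imp_eq_int)
    have "\<pi> powi n = inverse (\<pi> ^ Suc k)" unfolding k by (simp only: power_int_minus power_int_of_nat)
    hence "inverse \<pi> = x * inverse v * \<pi> ^ k"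
     using v \<pi>0 unfolding nv(1) by (simp add: field_simps)
    also have "... : A" using x v \<pi>n nonunits_in by (intro in_mult in_power) auto
    finally show ?thesis using \<pi>n \<pi>0 by (simp add: nonunits_def)
   next
    case 2
    thus ?thesis using V_approx[OF nv(2)] nv(1) by (simp add: \<pi>_def)
   next
    case 3
    then obtain k where k: "n = int (Suc k)" by (metis zero_less_imp_eq_int gr0_implies_Suc)
    have "\<pi> powi n = \<pi> ^ Suc k" unfolding k by (simp only: power_int_of_nat)
    hence "x = (v * \<pi> ^ k) * \<pi>" unfolding nv(1) by (simp add: mult_ac)
    moreover have "v * \<pi> ^ k : A" using v \<pi>n nonunits_in by (intro in_mult in_power) auto
    ultimately have "vle x \<pi>" unfolding vle_def by blast
    thus ?thesis by (intro exI[of _ 0]) (simp add: \<pi>_def)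
   qed
  qed
 qed
 thus thesis using that A(2) by (simp add: F_def R_def Z_def)
qed

text \<open>All of \<open>Y\<close> lies in one field generated by some \<open>th\<close>. The
  Bezout identity between the minimal polynomial \<open>q\<close> of \<open>th\<close> and its
  derivative is \<open>p\<close>-integral for almost all \<open>p\<close>, so roots of
  \<open>q\<close> modulo such \<open>p\<close> are simple, and infinitely many \<open>p\<close>
  admit roots. Having inverses in \<open>A\<close> as well makes the nonzero members of
  \<open>Y\<close> units.\<close>

theorem exists_places:
 fixes Y :: "'c::{alg_closed_field, field_char_0} set"
 assumes all_algebraic: "!!x::'c. algebraic x" and Y: "finite Y"
 obtains F where "Y <= F" "infinite {p. EX A. place A F p & Y <= A & inverse ` Y <= A}"
proof -
 note Q = subfield_set_subring[OF subfield_set_Rats]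
 obtain th where th: "Y <= adjoin \<rat> th" using primitive_element[OF all_algebraic Y] by blast
 define F where "F = adjoin \<rat> th"
 have F: "subfield_set F" unfolding F_def by (rule adjoin_Rats_subfield[OF all_algebraic])
 obtain q where q: "q : poly_over \<rat>" "lead_coeff q = 1" "poly q th = 0" "poly (pderiv q) th ~= 0"
   "!!g. g : poly_over \<rat> ==> poly g th = 0 ==> q dvd g"
  by (rule min_poly_Rats_simple_root[OF all_algebraic, of th]) blast
 have "poly (pderiv q) th : F" using poly_over_pderiv[OF Q q(1)] by (auto simp: F_def adjoin_poly_over)
 hence "inverse (poly (pderiv q) th) : F" using subfield_set_inverse[OF F] by blast
 then obtain v where v: "v : poly_over \<rat>" "poly (pderiv q) th * poly v th = 1"
  using q(4) by (auto simp: F_def adjoin_poly_over) (metis right_inverse)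
 have bQ: "1 - pderiv q * v : poly_over \<rat>"
  using v q by (intro poly_over_diff[OF Q] poly_over_mult[OF Q] poly_over_pderiv[OF Q] poly_over_1[OF Q])
 then obtain u where u: "1 - pderiv q * v = q * u" using q(5)[OF bQ] v by (auto elim: dvdE)
 have uQ: "u : poly_over \<rat>" using monic_dvd_poly_over[OF Q q(1,2), of u] bQ u by simp
 define Y' where "Y' = Y \<union> inverse ` Y"
 have "Y' <= F" using th subfield_set_inverse[OF F] by (auto simp: Y'_def F_def)
 hence "ALL y:Y'. EX g:poly_over \<rat>. y = poly g th" by (auto simp: F_def adjoin_poly_over)
 then obtain gy where gy: "!!y. y : Y' ==> gy y : poly_over \<rat>" "!!y. y : Y' ==> y = poly (gy y) th" by metis
 define Ps where "Ps = insert q (insert u (insert v (gy ` Y')))"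
 have Ps: "finite Ps" "Ps <= poly_over \<rat>" using Y q u v uQ gy by (auto simp: Ps_def Y'_def)
 have "ALL g:Ps. EX D>0. ALL p. Factorial_Ring.prime p --> ~ p dvd D --> g : poly_over (loc_int p)"
  using Ps poly_over_Rats_loc_int by blast
 then obtain D where D: "!!g. g : Ps ==> D g > 0"
   "!!g p. g : Ps ==> Factorial_Ring.prime p ==> ~ p dvd D g ==> g : poly_over (loc_int p)" by metis
 obtain m where m: "EX c. c > 0 & smult (of_int c) q = map_poly of_int (m :: int poly)"
 proof -
  have "EX c m. c > 0 & smult (of_int c) q = map_poly of_int (m :: int poly)"
  proof -
   have "ALL i. EX a b::int. b > 0 & coeff q i = of_int a / of_int b"
    using q(1) unfolding poly_over_def by (metis Rats_cases' mem_Collect_eq)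
   then obtain a b :: "nat => int" where ab: "!!i. b i > 0" "!!i. coeff q i = of_int (a i) / of_int (b i)" by metis
   define c where "c = (\<Prod>i\<le>degree q. b i)"
   have "EX k::int. of_int c * coeff q i = of_int k" for i
   proof (cases "i <= degree q")
    case True
    hence "b i dvd c" unfolding c_def by (intro dvd_prodI) auto
    then obtain k where "c = b i * k" by blast
    hence "of_int c * coeff q i = of_int (k * a i)" using ab(2)[of i] less_imp_neq[OF ab(1)[of i]] by simp
    thus ?thesis by blast
   qed (auto simp: coeff_eq_0 intro: exI[of _ 0])
   then obtain k :: "nat => int" where k: "!!i. of_int c * coeff q i = of_int (k i)" by metis
   have "smult (of_int c) q = map_poly of_int (\<Sum>i\<le>degree q. monom (k i) i)"
   proof (rule poly_eqI)
    fix i show "coeff (smult (of_int c) q) i = coeff (map_poly of_int (\<Sum>i\<le>degree q. monom (k i) i)) i"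
     using k[of i] by (auto simp: coeff_map_poly coeff_sum coeff_eq_0 not_le)
   qed
   moreover have "c > 0" using ab by (auto simp: c_def intro!: prod_pos)
   ultimately show ?thesis by blast
  qed
  thus ?thesis using that by blast
 qed
 then obtain c where c: "c > 0" "smult (of_int c) q = map_poly of_int m" by blast
 have dq: "degree q > 0"
 proof (rule ccontr)
  assume "~ degree q > 0"
  hence "q = [:1:]" using q(2) by (auto elim!: degree_eq_zeroE)
  thus False using q(3) by simp
 qed
 have "degree m = degree q"
  using arg_cong[OF c(2), of degree] c(1) by (simp add: degree_map_poly)
 hence inf: "infinite {p::nat. Factorial_Ring.prime p & (EX a. int p dvd poly m a)}"
  using infinite_prime_divisors_int_poly dq by simp
 \<comment> \<open>For primes not dividing \<open>N\<close>, the polynomials \<open>q\<close>,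
   \<open>u\<close>, \<open>v\<close> and those expressing \<open>Y\<close> and its inverses in
   \<open>th\<close> are \<open>p\<close>-integral, and \<open>p\<close> does not divide
   \<open>c\<close>.\<close>
 define N where "N = nat c * (\<Prod>g\<in>Ps. D g)"
 have N0: "N > 0" using c D Ps by (auto simp: N_def intro!: prod_pos)
 have good: "EX A. place A F p & Y <= A & inverse ` Y <= A"
  if p: "Factorial_Ring.prime p" "int p dvd poly m a" "~ p dvd N" for p a
 proof -
  have loc: "g : poly_over (loc_int p)" if "g : Ps" for g
  proof -
   have "D g dvd N" unfolding N_def using that Ps by (intro dvd_mult dvd_prodI) auto
   thus ?thesis using D(2)[OF that p(1)] p(3) dvd_trans by blast
  qed
  have pc: "~ int p dvd c"
  proof
   assume "int p dvd c"
   hence "int p dvd int (nat c)" using c(1) by simp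
   hence "p dvd nat c" by (simp only: int_dvd_int_iff)
   thus False using p(3) by (simp add: N_def)
  qed
  obtain k where k: "poly m a = int p * k" using p(2) by blast
  have "of_int c * poly q (of_int a) = of_int (poly m a)"
  proof -
   have "of_int c * poly q (of_int a) = poly (map_poly of_int m) (of_int a)" by (simp flip: c(2))
   also have "... = of_int (poly m a)" by (rule hom_poly[symmetric]) auto
   finally show ?thesis .
  qed
  hence qa: "poly q (of_int a) = of_nat p * (of_int k / of_int c)" using c(1) by (simp add: k field_simps)
  have kc: "of_int k / of_int c : (loc_int p :: 'c set)" using loc_intI[OF p(1) pc] .
  note Z = subring_loc_int[OF p(1), where 'a = 'c]
  have aZ: "(of_int a :: 'c) : loc_int p" by (rule subring_set_of_int[OF Z])
  have qa': "poly (pderiv q) (of_int a) ~= of_nat p * z'" if z': "z' : loc_int p" for z' :: 'c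
  proof
   assume *: "poly (pderiv q) (of_int a) = of_nat p * z'"
   have "1 - poly (pderiv q) (of_int a) * poly v (of_int a) = poly q (of_int a) * poly u (of_int a)"
    using arg_cong[OF u, of "%f. poly f (of_int a)"] by simp
   hence "of_nat p * (z' * poly v (of_int a) + (of_int k / of_int c) * poly u (of_int a)) = 1"
    unfolding * qa by (simp add: algebra_simps)
   moreover have "z' * poly v (of_int a) + (of_int k / of_int c) * poly u (of_int a) : loc_int p"
    using z' kc loc[of u] loc[of v] aZ
    by (intro subring_set_add[OF Z] subring_set_mult[OF Z] poly_over_poly[OF Z]) (auto simp: Ps_def)
   ultimately show False using one_notin_p_loc_int[OF p(1)] by blast
  qed
  obtain A where A: "place A F p" "adjoin (loc_int p) th <= A"
   unfolding F_def
  proof (rule exists_place[OF all_algebraic p(1) q(2) _ q(3,5) qa kc qa'])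
   show "q : poly_over (loc_int p)" by (rule loc) (simp add: Ps_def)
  qed (assumption | rule that)+
  have "y : A" if "y : Y'" for y
   using gy(2)[OF that] loc[of "gy y"] that A(2) by (auto simp: Ps_def adjoin_poly_over)
  thus ?thesis using A(1) by (auto simp: Y'_def)
 qed
 have "{p::nat. Factorial_Ring.prime p & (EX a. int p dvd poly m a)} - {..N}
   <= {p. EX A. place A F p & Y <= A & inverse ` Y <= A}"
 proof
  fix p assume "p : {p::nat. Factorial_Ring.prime p & (EX a. int p dvd poly m a)} - {..N}"
  then obtain a where "Factorial_Ring.prime p" "int p dvd poly m a" "p > N" by auto
  moreover have "~ p dvd N" using \<open>p > N\<close> N0 by (auto dest: dvd_imp_le)
  ultimately show "p : {p. EX A. place A F p & Y <= A & inverse ` Y <= A}"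
   using good by blast
 qed
 hence "infinite {p. EX A. place A F p & Y <= A & inverse ` Y <= A}"
  using inf Diff_infinite_finite[of "{..N}"] finite_subset by blast
 thus thesis using that th by (auto simp: F_def)
qed

section \<open>The bicyclic Kummer field of a place: coordinates, sizes and automorphisms\<close>

section \<open>Kummer extensions of a place\<close>

text \<open>Each \<open>p\<close>-th power gains a factor \<open>p\<close>: in
  \<open>c ^ p - 1 = (c - 1) * (\<Sum>i<p. c ^ i)\<close> the \<open>p\<close> summands are all 1
  modulo \<open>p\<close>.\<close>

lemma cong_one_power_prime_power:
 fixes b :: int
 assumes "[b = 1] (mod int p)" shows "[b ^ (p ^ k) = 1] (mod int p ^ Suc k)"
proof (induction k)
 case (Suc k)
 define c where "c = b ^ (p ^ k)"
 have c: "int p ^ Suc k dvd c - 1" using Suc by (simp add: c_def cong_iff_dvd_diff)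
 hence cp: "[c = 1] (mod int p)" by (metis cong_iff_dvd_diff dvd_mult_left power_Suc)
 have "c ^ p - 1 = (c - 1) * (\<Sum>i<p. c ^ i)" by (rule power_diff_1_eq)
 moreover have "int p dvd (\<Sum>i<p. c ^ i)"
 proof -
  have "[(\<Sum>i<p. c ^ i) = (\<Sum>i<p. 1 ^ i)] (mod int p)" by (intro cong_sum cong_pow cp)
  hence "[(\<Sum>i<p. c ^ i) = int p] (mod int p)" by simp
  thus ?thesis by (metis cong_dvd_iff dvd_refl)
 qed
 ultimately have "int p ^ Suc k * int p dvd c ^ p - 1" using c mult_dvd_mono by metis
 moreover have "c ^ p = b ^ (p ^ Suc k)" by (simp add: c_def mult.commute flip: power_mult)
 ultimately show ?case by (simp add: cong_iff_dvd_diff mult_ac)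
qed (use assms in simp)

text \<open>Modulo \<open>p ^ n\<close>, residues congruent to 1 modulo \<open>p\<close> are killed
  by the exponent \<open>p ^ n\<close>, so taking \<open>N\<close>-th powers is inverted by an
  exponent \<open>e\<close> with \<open>N * e\<close> congruent to 1 modulo
  \<open>p ^ n\<close>.\<close>

lemma cong_one_has_root:
 fixes b :: int
 assumes b: "[b = 1] (mod int p)" and cop: "coprime N p" and p: "p > 1"
 shows "EX x. [x ^ N = b] (mod int p ^ n)"
proof (cases "n = 0")
 case False
 have "coprime N (p ^ n)" using cop by simp
 then obtain e where "[N * e = Suc 0] (mod p ^ n)" using cong_solve_coprime_nat by blast
 moreover have "1 < p ^ n" using False by (intro one_less_power p) simp
 ultimately have "N * e mod p ^ n = 1" using False p by (simp add: cong_def)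
 define t where "t = N * e div p ^ n"
 have e: "N * e = 1 + p ^ n * t"
  unfolding t_def using mult_div_mod_eq[of "p ^ n" "N * e"] \<open>N * e mod p ^ n = 1\<close> by linarith
 have "[b ^ (p ^ n) = 1] (mod int p ^ Suc n)" by (rule cong_one_power_prime_power[OF b])
 hence "[b ^ (p ^ n) = 1] (mod int p ^ n)" by (rule cong_dvd_modulus) simp
 hence "[(b ^ (p ^ n)) ^ t = 1 ^ t] (mod int p ^ n)" by (rule cong_pow)
 hence "[b * (b ^ (p ^ n)) ^ t = b * 1] (mod int p ^ n)" by (intro cong_mult) auto
 moreover have "(b ^ e) ^ N = b * (b ^ (p ^ n)) ^ t"
  by (simp add: e power_add mult.commute[of e] flip: power_mult)
 ultimately have "[(b ^ e) ^ N = b] (mod int p ^ n)" by simp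
 thus ?thesis by blast
qed (simp add: cong_def)

context place
begin

lemmas F_ring = subfield_set_subring[OF subfield]
lemmas F_0 = subring_set_0[OF F_ring] and F_1 = subring_set_1[OF F_ring]
 and F_add = subring_set_add[OF F_ring] and F_diff = subring_set_diff[OF F_ring]
 and F_mult = subring_set_mult[OF F_ring] and F_uminus = subring_set_uminus[OF F_ring]
 and F_power = subring_set_power[OF F_ring] and F_sum = subring_set_sum[OF F_ring]
 and F_prod = subring_set_prod[OF F_ring] and F_of_int = subring_set_of_int[OF F_ring]
 and F_of_nat = subring_set_of_nat[OF F_ring]
 and F_inverse = subfield_set_inverse[OF subfield] and F_divide = subfield_set_divide[OF subfield]

lemma p_neq_0: "(of_nat p :: 'c) ~= 0"
 using p by (auto simp: prime_nat_iff)

lemma p_in: "of_nat p : A"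
 by (rule in_of_nat)

lemma of_int_nonunit_iff: "of_int m : nonunits A \<longleftrightarrow> int p dvd m"
proof
 assume "int p dvd m"
 then obtain k where "m = k * int p" by (metis dvd_def mult.commute)
 thus "of_int m : nonunits A" using nonunits_mult[OF in_of_int p_nonunit, of k] by simp
next
 assume m: "of_int m : nonunits A"
 show "int p dvd m"
 proof (rule ccontr)
  assume "~ int p dvd m"
  hence "coprime (int p) m" using p by (simp add: prime_imp_coprime)
  then obtain s t where "s * int p + t * m = 1"
   using bezout_int[of "int p" m] by (auto simp: coprime_iff_gcd_eq_1)
  hence "(of_int (s * int p + t * m) :: 'c) = 1" by simp
  hence "(of_int s * of_nat p + of_int t * of_int m :: 'c) = 1" by simp
  thus False using nonunits_add[OF nonunits_mult[OF in_of_int p_nonunit, of s] nonunits_mult[OF in_of_int m, of t]]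
    nonunits_1 by simp
 qed
qed

text \<open>\<open>approx\<close> can be iterated, since the error divided by \<open>p ^ n\<close>
  is again an integral element of \<open>F\<close>.\<close>

lemma approx_power:
 assumes "x : F" "x : A" shows "EX m. vle (x - of_int m) (of_nat p ^ n)"
proof (induction n)
 case 0 thus ?case using assms by (intro exI[of _ 0]) auto
next
 case (Suc n)
 then obtain m where m: "vle (x - of_int m) (of_nat p ^ n)" by blast
 define y where "y = (x - of_int m) / of_nat p ^ n"
 have yA: "y : A" using m p_neq_0 by (simp add: y_def vle_iff)
 have yF: "y : F" unfolding y_def using assms
  by (intro F_divide F_diff F_power F_of_nat F_of_int)
 obtain k where k: "vle (y - of_int k) (of_nat p)" using approx[OF yF yA] by blast
 have "x - of_int (m + int p ^ n * k) = of_nat p ^ n * (y - of_int k)"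
  using p_neq_0 by (simp add: y_def field_simps)
 moreover have "vle (of_nat p ^ n * (y - of_int k)) (of_nat p ^ n * of_nat p)" using k vle_mult by simp
 ultimately have "vle (x - of_int (m + int p ^ n * k)) (of_nat p ^ Suc n)" by (simp add: mult.commute)
 thus ?case by blast
qed

lemma p_powi_unit:
 assumes "u : A" "inverse u : A" "u ~= 0"
 shows "of_nat p powi n * u : A \<longleftrightarrow> n >= 0" and "of_nat p powi n * u : nonunits A \<longleftrightarrow> n > 0"
proof -
 have pos: "of_nat p powi n * u : nonunits A" if "n > 0" "u : A" for n and u :: 'c
 proof -
  define k where "k = nat n - 1"
  have k: "n = int (Suc k)" using that(1) by (simp add: k_def)
  have eq: "of_nat p powi n * u = (u * of_nat p ^ k) * of_nat p" unfolding k by (simp only: power_int_of_nat) simp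
  show ?thesis unfolding eq by (rule nonunits_mult[OF in_mult[OF that(2) in_power[OF p_in]] p_nonunit])
 qed
 have neg: "of_nat p powi n * u ~: A" if n: "n < 0" for n
 proof
  assume a: "of_nat p powi n * u : A"
  have "of_nat p powi (- n) * inverse u : nonunits A" using pos[of "- n" "inverse u"] n assms by simp
  hence "(of_nat p powi n * u) * (of_nat p powi (- n) * inverse u) : nonunits A" using a nonunits_mult by blast
  moreover have "(of_nat p powi n * u) * (of_nat p powi (- n) * inverse u) = 1"
   using assms p_neq_0 by (simp add: power_int_minus field_simps)
  ultimately show False using nonunits_1 by simp
 qed
 show 1: "of_nat p powi n * u : A \<longleftrightarrow> n >= 0"
 proof (cases n "0 :: int" rule: linorder_cases)
  case greater thus ?thesis using pos[OF _ assms(1)] nonunits_in by force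
 qed (use neg assms in auto)
 show "of_nat p powi n * u : nonunits A \<longleftrightarrow> n > 0"
 proof (cases n "0 :: int" rule: linorder_cases)
  case less thus ?thesis using neg nonunits_in by force
 next
  case equal thus ?thesis using assms by (simp add: nonunits_def)
 qed (use pos assms in auto)
qed

lemma freshman:
 assumes "!!i. i : I ==> x i : A" "finite I"
 shows "(\<Sum>i\<in>I. x i) ^ p - (\<Sum>i\<in>I. x i ^ p) : nonunits A"
 using assms(2,1)
proof (induction I)
 case empty
 thus ?case using p by (simp add: nonunits_0 prime_gt_0_nat power_0_left)
next
 case (insert i I)
 define a b where "a = x i" and "b = sum x I"
 have ab: "a : A" "b : A" using insert by (auto simp: a_def b_def intro!: in_sum)
 have "(a + b) ^ p = (\<Sum>k\<le>p. of_nat (p choose k) * a ^ k * b ^ (p - k))" by (rule binomial_ring)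
 also have "{..p} = insert 0 (insert p {0<..<p})" using p by (auto simp: prime_gt_0_nat)
 also have "(\<Sum>k\<in>.... of_nat (p choose k) * a ^ k * b ^ (p - k))
   = b ^ p + a ^ p + (\<Sum>k\<in>{0<..<p}. of_nat (p choose k) * a ^ k * b ^ (p - k))"
  using p by (simp add: prime_gt_0_nat)
 finally have "(a + b) ^ p - (a ^ p + b ^ p) = (\<Sum>k\<in>{0<..<p}. of_nat (p choose k) * a ^ k * b ^ (p - k))"
  by simp
 also have "... : nonunits A"
 proof (rule nonunits_sum)
  fix k assume k: "k : {0<..<p}"
  then obtain c where "p choose k = c * p" using dvd_choose_prime[OF _ _ _ p, of k]
   by (auto elim!: dvdE simp: mult.commute)
  hence eq: "of_nat (p choose k) * a ^ k * b ^ (p - k) = (of_nat c * a ^ k * b ^ (p - k)) * of_nat p" by simp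
  show "of_nat (p choose k) * a ^ k * b ^ (p - k) : nonunits A"
   unfolding eq using ab by (intro nonunits_mult[OF _ p_nonunit] in_mult in_power in_of_nat)
 qed
 finally have 1: "(a + b) ^ p - (a ^ p + b ^ p) : nonunits A" .
 have 2: "b ^ p - (\<Sum>i\<in>I. x i ^ p) : nonunits A" using insert by (simp add: b_def)
 have "((a + b) ^ p - (a ^ p + b ^ p)) + (b ^ p - (\<Sum>i\<in>I. x i ^ p)) : nonunits A"
  by (rule nonunits_add[OF 1 2])
 thus ?case using insert by (simp add: a_def b_def algebra_simps)
qed

lemma power_diff_nonunit:
 assumes "x : A" "y : A" "x - y : nonunits A" shows "x ^ n - y ^ n : nonunits A"
proof -
 have "x ^ n - y ^ n = (\<Sum>i<n. y ^ (n - Suc i) * x ^ i) * (x - y)"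
  by (subst power_diff_sumr2) (simp add: mult.commute)
 thus ?thesis using assms by (auto intro!: nonunits_mult in_sum in_mult in_power)
qed

end

lemma (in valring) exists_vle_max:
 assumes "finite I" "I ~= {}" shows "EX m:I. ALL i:I. vle (f i) (f m)"
 using assms
proof (induction rule: finite_ne_induct)
 case (insert i I)
 then obtain m where m: "m : I" "!!j. j : I ==> vle (f j) (f m)" by blast
 show ?case
 proof (cases "vle (f i) (f m)")
  case True thus ?thesis using m by blast
 next
  case False
  hence "vle (f m) (f i)" using vle_linear by blast
  thus ?thesis using m vle_trans by (intro bexI[of _ i]) auto
 qed
qed auto

text \<open>The root \<open>ups\<close> of a primitive root \<open>u\<close> modulo \<open>p\<close>
  spans the unramified direction, the root \<open>\<rho>\<close> of the uniformizer \<open>p\<close>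
  the totally ramified one. \<open>\<zeta>_unit\<close> says that the powers of
  \<open>\<zeta>\<close> remain distinct modulo the maximal ideal.\<close>

locale kummer = place A F p for A :: "'c::{alg_closed_field, field_char_0} set" and F p +
 fixes N :: nat and \<zeta> ups \<rho> :: 'c and u :: nat
 assumes all_algebraic: "!!x::'c. algebraic x"
  and N: "N > 0"
  and \<zeta>_F: "\<zeta> : F" and \<zeta>_N: "\<zeta> ^ N = 1"
  and \<zeta>_unit: "!!d. 0 < d ==> d < N ==> \<zeta> ^ d - 1 ~: nonunits A"
  and u: "residue_primroot p u"
  and ups: "ups ^ N = of_nat u" and \<rho>: "\<rho> ^ N = of_nat p"
begin

lemma \<zeta>_in: "\<zeta> : A"
 by (rule in_of_power_in[OF N]) (simp add: \<zeta>_N in_1)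

text \<open>An integer congruent to \<open>\<zeta>\<close> has multiplicative order exactly
  \<open>N\<close> modulo \<open>p\<close>, because the powers of \<open>\<zeta>\<close> are
  distinct in the residue field.\<close>

lemma N_dvd: "N dvd p - 1"
proof -
 obtain m where m: "vle (\<zeta> - of_int m) (of_nat p)" using approx[OF \<zeta>_F \<zeta>_in] by blast
 hence m': "\<zeta> - of_int m : nonunits A" using vle_nonunit p_nonunit by blast
 define z where "z = nat (m mod int p)"
 have zm: "[int z = m] (mod int p)" using p by (simp add: z_def prime_gt_0_nat cong_def)
 have pow: "[z ^ d = 1] (mod p) \<longleftrightarrow> \<zeta> ^ d - 1 : nonunits A" for d
 proof -
  have "[z ^ d = 1] (mod p) \<longleftrightarrow> [int z ^ d = 1] (mod int p)"
   by (metis cong_int_iff of_nat_1 of_nat_power)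
  also have "... \<longleftrightarrow> [m ^ d = 1] (mod int p)"
   using cong_pow[OF zm, of d] cong_trans cong_sym by metis
  also have "... \<longleftrightarrow> of_int (m ^ d - 1) : nonunits A"
   unfolding of_int_nonunit_iff by (simp add: cong_iff_dvd_diff)
  also have "... \<longleftrightarrow> \<zeta> ^ d - 1 : nonunits A"
  proof -
   have "\<zeta> ^ d - of_int m ^ d : nonunits A" by (rule power_diff_nonunit[OF \<zeta>_in in_of_int m'])
   thus ?thesis using nonunits_add[of "\<zeta> ^ d - of_int m ^ d" "of_int m ^ d - 1"]
     nonunits_diff[of "\<zeta> ^ d - 1" "\<zeta> ^ d - of_int m ^ d"] by auto
  qed
  finally show ?thesis .
 qed
 have dvdN: "ord p z dvd N"
  unfolding ord_divides[symmetric] pow by (simp add: \<zeta>_N nonunits_0)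
 have "ord p z > 0" using dvdN N by (auto intro: gr0I)
 moreover have "\<zeta> ^ ord p z - 1 : nonunits A" unfolding pow[symmetric] by (rule ord)
 ultimately have "~ ord p z < N" using \<zeta>_unit by blast
 hence "ord p z = N" using dvdN N by (meson dvd_imp_le le_neq_implies_less)
 moreover have "ord p z dvd totient p"
  using \<open>ord p z > 0\<close> by (intro order_divides_totient) (metis ord_eq_0 less_irrefl)
 ultimately show ?thesis using p by (simp add: totient_prime)
qed

lemma N_less: "N < p"
 using N_dvd p N by (metis One_nat_def Suc_pred dvd_imp_le less_Suc_eq_le not_less prime_gt_0_nat prime_gt_1_nat zero_less_diff)

lemma N_coprime: "coprime N p"
 using p N N_less by (metis coprime_commute dvd_imp_le not_less prime_imp_coprime)

lemma N_unit: "(of_nat N :: 'c) ~: nonunits A"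
 using of_int_nonunit_iff[of "int N"] N N_less by (auto dest: zdvd_imp_le)

lemma u_coprime: "coprime p u"
 using u by (simp add: residue_primroot_def)

lemma ups_in: "ups : A" and ups_inv: "inverse ups : A" and ups_neq_0: "ups ~= 0"
 and \<rho>_in: "\<rho> : A" and \<rho>_nonunit: "\<rho> : nonunits A" and \<rho>_neq_0: "\<rho> ~= 0"
proof -
 have "~ p dvd u" using u_coprime p by (metis coprime_absorb_left not_prime_unit is_unit_gcd coprime_iff_gcd_eq_1 gcd_nat.absorb1)
 hence "of_int (int u) ~: nonunits A" unfolding of_int_nonunit_iff by (simp add: int_dvd_int_iff)
 hence u': "(of_nat u :: 'c) ~= 0" "inverse (of_nat u :: 'c) : A" using in_of_nat[of u] by (auto simp: nonunits_def)
 show "ups : A" by (rule in_of_power_in[OF N]) (simp add: ups in_of_nat)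
 show "inverse ups : A" by (rule in_of_power_in[OF N]) (use u' in \<open>simp add: power_inverse ups\<close>)
 show "ups ~= 0" using ups u' N by (metis power_0_left less_irrefl)
 show 1: "\<rho> : A" by (rule in_of_power_in[OF N]) (simp add: \<rho> in_of_nat)
 show "\<rho> : nonunits A" using \<rho> p_nonunit 1 nonunits_prime_power by metis
 show "\<rho> ~= 0" using \<rho> p_neq_0 N by (metis power_0_left less_irrefl)
qed

text \<open>The residue of \<open>ups\<close> has degree \<open>N\<close> over the prime field: Frobenius multiplies it by a primitive
  root of unity, so the powers of \<open>ups\<close> are separated by a discrete Fourier transform.\<close>

lemma residue_independent:
 fixes a :: "nat => int"
 assumes S: "(\<Sum>i<N. of_int (a i) * ups ^ i) : nonunits A" and j: "j < N"
 shows "int p dvd a j"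
proof -
 define k where "k = (p - 1) div N"
 have k: "p = Suc (N * k)" using N_dvd p by (simp add: k_def prime_gt_0_nat)
 \<comment> \<open>With \<open>p = N * k + 1\<close>, the \<open>p\<close>-th power of
   \<open>ups\<close> is \<open>ups * u ^ k\<close>; as \<open>u\<close> is a primitive root,
   \<open>z\<close> has order \<open>N\<close> modulo \<open>p\<close>.\<close>
 define z where "z = u ^ k"
 have z_pow: "[z ^ d = 1] (mod p) \<longleftrightarrow> N dvd d" for d
 proof -
  have "[z ^ d = 1] (mod p) \<longleftrightarrow> ord p u dvd k * d"
   unfolding z_def power_mult[symmetric] by (rule ord_divides)
  also have "ord p u = k * N" using u p k by (simp add: residue_primroot_def totient_prime mult.commute)
  also have "k * N dvd k * d \<longleftrightarrow> N dvd d"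
  proof -
   have "k ~= 0" using k p by (auto simp: prime_nat_iff)
   thus ?thesis by simp
  qed
  finally show ?thesis .
 qed
 \<comment> \<open>By \<open>step\<close>, the \<open>r\<close>-th Frobenius image of the relation;
   the integer coefficients are unchanged by Fermat's little theorem.\<close>
 define T where "T = (%r. \<Sum>i<N. of_int (a i) * of_nat z ^ (r * i) * ups ^ i :: 'c)"
 have fermat: "of_int c ^ p - of_int c : nonunits A" for c :: int
 proof -
  have "int p dvd c ^ p - c"
  proof -
   define m where "m = nat (c mod int p)"
   have mc: "[int m = c] (mod int p)" using p by (simp add: m_def prime_gt_0_nat cong_def)
   have pp: "x * x ^ (p - 1) = x ^ p" for x :: nat using p by (metis power_eq_if prime_gt_0_nat less_irrefl)
   have "[m * m ^ (p - 1) = m] (mod p)"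
   proof (cases "p dvd m")
    case True thus ?thesis by (auto simp: cong_def)
   next
    case False
    hence "[m ^ (p - 1) = 1] (mod p)" by (rule fermat_theorem[OF p])
    hence "[m * m ^ (p - 1) = m * 1] (mod p)" by (intro cong_mult) auto
    thus ?thesis by simp
   qed
   hence "[int m ^ p = int m] (mod int p)" unfolding pp by (metis cong_int_iff of_nat_power)
   hence "[c ^ p = c] (mod int p)" using cong_pow[OF mc, of p] mc by (meson cong_sym cong_trans)
   thus ?thesis by (simp add: cong_iff_dvd_diff)
  qed
  thus ?thesis using of_int_nonunit_iff[of "c ^ p - c"] by simp
 qed
 have step: "T r ^ p - T (Suc r) : nonunits A" for r
 proof -
  have 1: "T r ^ p - (\<Sum>i<N. (of_int (a i) * of_nat z ^ (r * i) * ups ^ i) ^ p) : nonunits A"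
   unfolding T_def by (rule freshman) (auto intro!: in_mult in_power in_of_int in_of_nat ups_in)
  have "(of_int (a i) * of_nat z ^ (r * i) * ups ^ i) ^ p - of_int (a i) * of_nat z ^ (Suc r * i) * ups ^ i : nonunits A" for i
  proof -
   define c where "c = a i * int z ^ (r * i)"
   have "ups ^ p = ups * of_nat z"
    unfolding k by (simp add: power_mult ups z_def)
   hence "(ups ^ i) ^ p = ups ^ i * of_nat z ^ i"
    by (metis mult.commute power_mult power_mult_distrib)
   hence "(of_int (a i) * of_nat z ^ (r * i) * ups ^ i) ^ p - of_int (a i) * of_nat z ^ (Suc r * i) * ups ^ i
     = (of_nat z ^ i * ups ^ i) * (of_int c ^ p - of_int c)"
    by (simp add: c_def power_mult_distrib power_add algebra_simps)
   thus ?thesis using fermat by (auto intro!: nonunits_mult in_mult in_power in_of_nat ups_in)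
  qed
  hence "(\<Sum>i<N. (of_int (a i) * of_nat z ^ (r * i) * ups ^ i) ^ p - of_int (a i) * of_nat z ^ (Suc r * i) * ups ^ i) : nonunits A"
   by (rule nonunits_sum)
  hence 2: "(\<Sum>i<N. (of_int (a i) * of_nat z ^ (r * i) * ups ^ i) ^ p) - T (Suc r) : nonunits A"
   by (simp add: T_def sum_subtractf)
  show ?thesis using nonunits_add[OF 1 2] by simp
 qed
 have T: "T r : nonunits A" for r
 proof (induction r)
  case 0 thus ?case using S by (simp add: T_def)
 next
  case (Suc r)
  have "T r ^ p : nonunits A" using Suc p nonunits_mult[OF in_power[OF nonunits_in[OF Suc]] Suc, of "p - 1"]
   by (metis power_eq_if mult.commute prime_gt_0_nat less_irrefl)
  from nonunits_diff[OF this step[of r]] show ?case by simp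
 qed
 \<comment> \<open>Orthogonality of the powers of \<open>z\<close>. The exponent
   \<open>N - j\<close> plays the part of \<open>- j\<close> within the natural numbers.\<close>
 have geo: "(\<Sum>r<N. of_nat z ^ (r * (N - j)) * of_nat z ^ (r * i) :: 'c) - (if i = j then of_nat N else 0) : nonunits A"
  if i: "i < N" for i
 proof -
  define t where "t = int z ^ (N - j + i)"
  have "of_nat z ^ (r * (N - j)) * of_nat z ^ (r * i) = (of_int t ^ r :: 'c)" for r
  proof -
   have "of_nat z ^ (r * (N - j)) * of_nat z ^ (r * i) = (of_nat z ^ (r * (N - j + i)) :: 'c)"
    by (simp only: distrib_left power_add)
   also have "... = (of_nat z ^ (N - j + i)) ^ r" by (simp only: mult.commute[of r] power_mult)
   finally show ?thesis by (simp add: t_def)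
  qed
  hence eq: "(\<Sum>r<N. of_nat z ^ (r * (N - j)) * of_nat z ^ (r * i) :: 'c) = of_int (\<Sum>r<N. t ^ r)" by simp
  have t1: "[t = 1] (mod int p) \<longleftrightarrow> i = j"
  proof -
   have "[t = 1] (mod int p) \<longleftrightarrow> [z ^ (N - j + i) = 1] (mod p)"
    unfolding t_def by (metis cong_int_iff of_nat_1 of_nat_power)
   also have "... \<longleftrightarrow> N dvd N - j + i" by (rule z_pow)
   also have "... \<longleftrightarrow> i = j"
   proof
    assume "N dvd N - j + i"
    then obtain q where q: "N - j + i = N * q" by blast
    have "0 < N * q" "N * q < N * 2" using i j q by linarith+
    hence "q = 1" by (simp add: N)
    thus "i = j" using q j by simp
   qed (use j in simp)
   finally show ?thesis .
  qed
  have "int p dvd (\<Sum>r<N. t ^ r) - (if i = j then int N else 0)"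
  proof (cases "i = j")
   case True
   have "[(\<Sum>r<N. t ^ r) = (\<Sum>r<N. 1 ^ r)] (mod int p)" using t1 True by (intro cong_sum cong_pow) auto
   thus ?thesis using True by (simp add: cong_iff_dvd_diff)
  next
   case False
   have "[int z ^ N = 1] (mod int p)" using z_pow[of N] by (metis cong_int_iff dvd_refl of_nat_1 of_nat_power)
   hence "[(int z ^ N) ^ (N - j + i) = 1 ^ (N - j + i)] (mod int p)" by (rule cong_pow)
   hence "int p dvd t ^ N - 1"
    by (simp add: t_def cong_iff_dvd_diff mult.commute flip: power_mult)
   also have "t ^ N - 1 = (t - 1) * (\<Sum>r<N. t ^ r)" by (rule power_diff_1_eq)
   finally have "int p dvd t - 1 | int p dvd (\<Sum>r<N. t ^ r)" using p by (simp add: prime_dvd_mult_iff)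
   thus ?thesis using t1 False by (auto simp: cong_iff_dvd_diff)
  qed
  hence "of_int ((\<Sum>r<N. t ^ r) - (if i = j then int N else 0)) : nonunits A" by (simp only: of_int_nonunit_iff)
  thus ?thesis unfolding eq by (auto split: if_splits)
 qed
 have "(\<Sum>r<N. of_nat z ^ (r * (N - j)) * T r) : nonunits A"
  using T by (intro nonunits_sum nonunits_mult in_power in_of_nat)
 also have "(\<Sum>r<N. of_nat z ^ (r * (N - j)) * T r)
   = (\<Sum>i<N. (of_int (a i) * ups ^ i) * (\<Sum>r<N. of_nat z ^ (r * (N - j)) * of_nat z ^ (r * i)))"
  unfolding T_def sum_distrib_left by (subst sum.swap) (simp add: mult_ac)
 finally have 1: "... : nonunits A" .
 have 2: "(\<Sum>i<N. (of_int (a i) * ups ^ i) * ((\<Sum>r<N. of_nat z ^ (r * (N - j)) * of_nat z ^ (r * i))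
   - (if i = j then of_nat N else 0))) : nonunits A"
  using geo by (intro nonunits_sum nonunits_mult in_mult in_of_int in_power ups_in) auto
 have "(\<Sum>i<N. (of_int (a i) * ups ^ i) * (if i = j then of_nat N else 0)) = of_int (a j) * ups ^ j * of_nat N"
  using j by (simp add: if_distrib[of "(*) _"] cong: if_cong)
 hence "of_int (a j) * ups ^ j * of_nat N : nonunits A"
  using nonunits_diff[OF 1 2] by (simp add: right_diff_distrib sum_subtractf)
 from nonunits_prime[OF this in_mult[OF in_of_int in_power[OF ups_in]] in_of_nat]
 have "of_int (a j) * ups ^ j : nonunits A" using N_unit by blast
 hence "inverse ups ^ j * (of_int (a j) * ups ^ j) : nonunits A" by (rule nonunits_mult[OF in_power[OF ups_inv]])
 moreover have "inverse ups ^ j * (of_int (a j) * ups ^ j) = of_int (a j)"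
  using ups_neq_0 by (simp add: power_inverse)
 ultimately show ?thesis by (simp add: of_int_nonunit_iff)
qed

end

context kummer
begin

definition kum :: "(nat => nat => 'c) => 'c" where
 "kum a = (\<Sum>i<N. \<Sum>j<N. a i j * ups ^ i * \<rho> ^ j)"

text \<open>The value of an element is read off its coordinates: this makes the valuation invariant
  under the automorphisms below.\<close>

lemma kum_coordinate_vle:
 assumes aF: "!!i j. a i j : F" and ij: "i < N" "j < N"
 shows "vle (a i j * \<rho> ^ j) (kum a)"
proof (cases "ALL i<N. ALL j<N. a i j = 0")
 case True thus ?thesis using ij by simp
next
 case False
 define I where "I = {..<N} \<times> {..<N}"
 have fin: "finite I" "I ~= {}" using N by (auto simp: I_def)
 \<comment> \<open>A term of largest size. The aim is that the sum divided by this term is not in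
   the maximal ideal.\<close>
 obtain i0 j0 where m: "i0 < N" "j0 < N"
   "!!i j. i < N ==> j < N ==> vle (a i j * \<rho> ^ j) (a i0 j0 * \<rho> ^ j0)"
  using exists_vle_max[OF fin, of "%(i, j). a i j * \<rho> ^ j"] by (auto simp: I_def)
 define r where "r = a i0 j0 * \<rho> ^ j0"
 have r0: "r ~= 0"
 proof
  assume "r = 0"
  hence "a i j = 0" if "i < N" "j < N" for i j using m(3)[OF that] \<rho>_neq_0 by (simp add: r_def)
  thus False using False by blast
 qed
 have a0: "a i0 j0 ~= 0" using r0 by (auto simp: r_def)
 define b where "b = (%i. a i j0 / a i0 j0)"
 have bF: "b i : F" for i unfolding b_def by (intro F_divide aF)
 have bA: "b i : A" if "i < N" for i
 proof -
  have "vle (\<rho> ^ j0 * a i j0) (\<rho> ^ j0 * a i0 j0)" using m(3)[OF that m(2)] by (simp add: mult.commute)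
  hence "vle (a i j0) (a i0 j0)" using \<rho>_neq_0 by (subst (asm) vle_mult_cancel) auto
  thus ?thesis using a0 by (simp add: b_def vle_iff)
 qed
 \<comment> \<open>Sizes of elements of \<open>F\<close> are those of powers of
   \<open>p = \<rho> ^ N\<close>, so terms with different \<open>j < N\<close> never have equal
   size. Only the column \<open>j0\<close> survives modulo the maximal ideal.\<close>
 have small: "a i j * \<rho> ^ j / r : nonunits A" if ij: "i < N" "j < N" "j ~= j0" for i j
 proof (cases "a i j = 0")
  case False
  define t where "t = a i j * \<rho> ^ j / r"
  have tA: "t : A" using m(3)[OF ij(1,2)] r0 by (simp add: t_def r_def vle_iff)
  obtain n v where nv: "a i j / a i0 j0 = of_nat p powi n * v" "v : A" "inverse v : A"
   using decomp[of "a i j / a i0 j0"] aF False a0 F_divide by auto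
  have v0: "v ~= 0" using nv(1) False a0 by auto
  have "t ^ N = (a i j / a i0 j0) ^ N * ((\<rho> ^ j) ^ N / (\<rho> ^ j0) ^ N)"
   by (simp add: t_def r_def power_divide power_mult_distrib)
  also have "... = (a i j / a i0 j0) ^ N * (of_nat p ^ j / of_nat p ^ j0)"
   by (metis \<rho> mult.commute power_mult)
  finally have "t ^ N = of_nat p powi (n * int N + int j - int j0) * v ^ N"
   using p_neq_0 by (simp add: nv(1) power_mult_distrib power_int_add power_int_diff power_int_mult field_simps)
  moreover have "n * int N + int j - int j0 ~= 0"
  proof
   assume "n * int N + int j - int j0 = 0"
   hence "int j0 - int j = n * int N" by simp
   hence "int N dvd int j0 - int j" by simp
   moreover have "\<bar>int j0 - int j\<bar> < int N" using ij m by linarith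
   ultimately show False using ij(3) zdvd_not_zless by (metis abs_of_nonneg dvd_abs_iff eq_iff_diff_eq_0 of_nat_eq_iff zdvd_imp_le zero_less_abs_iff not_less)
  qed
  moreover have "t ^ N : A" using tA by (rule in_power)
  moreover have "v ^ N : A" "inverse (v ^ N) : A" "v ^ N ~= 0"
   using nv v0 by (auto simp: power_inverse[symmetric] intro: in_power)
  ultimately have "t ^ N : nonunits A" using p_powi_unit[of "v ^ N"] by simp
  thus ?thesis using nonunits_prime_power[OF _ tA] by (simp add: t_def)
 qed (simp add: nonunits_0)
 have "kum a / r ~: nonunits A"
 proof
  assume k: "kum a / r : nonunits A"
  \<comment> \<open>Coefficients in the surviving column are replaced by integers, for which the
    independence of the residues of powers of \<open>ups\<close> applies; it contradicts that the
    coefficient at \<open>i0\<close> is 1.\<close>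
  obtain c where c: "!!i. i < N ==> vle (b i - of_int (c i)) (of_nat p)"
   using approx[OF bF bA] by metis
  have "kum a / r = (\<Sum>i<N. \<Sum>j<N. (a i j * \<rho> ^ j / r) * ups ^ i)"
   by (simp add: kum_def sum_divide_distrib mult_ac)
  also have "... = (\<Sum>i<N. b i * ups ^ i + (\<Sum>j\<in>{..<N} - {j0}. (a i j * \<rho> ^ j / r) * ups ^ i))"
   using m(2) \<rho>_neq_0 by (intro sum.cong refl, subst sum.remove[of _ j0]) (auto simp: b_def r_def)
  also have "... = (\<Sum>i<N. b i * ups ^ i) + (\<Sum>i<N. \<Sum>j\<in>{..<N} - {j0}. ups ^ i * (a i j * \<rho> ^ j / r))"
   by (simp add: sum.distrib mult.commute)
  finally have 1: "kum a / r = ..." .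
  have 2: "(\<Sum>i<N. \<Sum>j\<in>{..<N} - {j0}. ups ^ i * (a i j * \<rho> ^ j / r)) : nonunits A"
   by (intro nonunits_sum nonunits_mult[OF in_power[OF ups_in]] small) auto
  have "(\<Sum>i<N. ups ^ i * (b i - of_int (c i))) : nonunits A"
   using c vle_nonunit[OF _ p_nonunit] by (intro nonunits_sum nonunits_mult[OF in_power[OF ups_in]]) auto
  from nonunits_diff[OF nonunits_diff[OF k 2] this]
  have "(\<Sum>i<N. of_int (c i) * ups ^ i) : nonunits A"
   by (simp add: 1 right_diff_distrib sum_subtractf mult.commute)
  hence "int p dvd c i0" using residue_independent m(1) by blast
  hence "of_int (c i0) : nonunits A" by (simp only: of_int_nonunit_iff)
  moreover have "b i0 - of_int (c i0) : nonunits A" using c[OF m(1)] vle_nonunit[OF _ p_nonunit] by blast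
  ultimately have "b i0 : nonunits A" using nonunits_add by fastforce
  thus False using a0 nonunits_1 by (simp add: b_def)
 qed
 hence "vle r (kum a)" using not_vle_iff[OF r0] by blast
 thus ?thesis using m(3)[OF ij] vle_trans by (simp add: r_def)
qed

definition kum_field :: "'c set" where
 "kum_field = {kum a | a. ALL i j. a i j : F}"

text \<open>Prescribing zeros outside the index range pins down the whole function, so that
  identities between coordinates are equalities of functions.\<close>

definition crd :: "'c => nat => nat => 'c" where
 "crd x = (SOME a. (ALL i j. a i j : F) & (ALL i j. ~ (i < N & j < N) --> a i j = 0) & x = kum a)"

lemma kum_eqD:
 assumes "!!i j. a i j : F" "!!i j. b i j : F" "kum a = kum b" "i < N" "j < N"
 shows "a i j = b i j"
proof -
 have "vle ((a i j - b i j) * \<rho> ^ j) (kum (%i j. a i j - b i j))"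
  using assms by (intro kum_coordinate_vle F_diff) auto
 also have "kum (%i j. a i j - b i j) = kum a - kum b"
  by (simp add: kum_def sum_subtractf left_diff_distrib)
 finally show ?thesis using assms(3) \<rho>_neq_0 by simp
qed

lemma crd:
 assumes "x : kum_field"
 shows crd_F: "crd x i j : F" and crd_outside: "~ (i < N & j < N) ==> crd x i j = 0"
  and kum_crd: "kum (crd x) = x"
proof -
 obtain a where a: "ALL i j. a i j : F" "x = kum a" using assms by (auto simp: kum_field_def)
 define b where "b = (%i j. if i < N & j < N then a i j else 0)"
 have "kum b = kum a" unfolding kum_def by (intro sum.cong refl) (simp add: b_def)
 define Q where "Q = (%a. (ALL i j. a i j : F) & (ALL i j. ~ (i < N & j < N) --> a i j = 0) & x = kum a)"
 have "Q b" using a F_0 \<open>kum b = kum a\<close> by (auto simp: b_def Q_def)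
 hence "Q (SOME a. Q a)" by (rule someI[of Q b])
 hence "(ALL i j. crd x i j : F) & (ALL i j. ~ (i < N & j < N) --> crd x i j = 0) & x = kum (crd x)"
  by (simp add: Q_def crd_def)
 thus "crd x i j : F" "~ (i < N & j < N) ==> crd x i j = 0" "kum (crd x) = x" by auto
qed

lemma kum_in_field: "(!!i j. a i j : F) ==> kum a : kum_field"
 by (auto simp: kum_field_def)

lemma crd_kum:
 assumes "!!i j. a i j : F" "i < N" "j < N" shows "crd (kum a) i j = a i j"
 using kum_eqD[OF crd_F[OF kum_in_field[OF assms(1)]] assms(1) kum_crd[OF kum_in_field[OF assms(1)]] assms(2,3)] .

lemma crd_eqI:
 assumes "!!i j. a i j : F" "!!i j. ~ (i < N & j < N) ==> a i j = 0" "x = kum a"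
 shows "crd x = a"
proof (intro ext)
 fix i j show "crd x i j = a i j"
  using crd_kum[OF assms(1)] crd_outside[OF kum_in_field[OF assms(1)]] assms(2,3)
  by (cases "i < N & j < N") auto
qed

lemma kum_add: "kum (%i j. a i j + b i j) = kum a + kum b"
 and kum_diff: "kum (%i j. a i j - b i j) = kum a - kum b"
 and kum_cmult: "kum (%i j. c * a i j) = c * kum a"
 by (simp_all add: kum_def sum.distrib sum_subtractf sum_distrib_left algebra_simps)

lemma kum_field_add: "x : kum_field ==> y : kum_field ==> x + y : kum_field"
 and crd_add: "x : kum_field ==> y : kum_field ==> crd (x + y) = (%i j. crd x i j + crd y i j)"
proof -
 assume xy: "x : kum_field" "y : kum_field"
 have eq: "x + y = kum (%i j. crd x i j + crd y i j)" using xy by (simp add: kum_add kum_crd)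
 show "x + y : kum_field" unfolding eq using xy by (intro kum_in_field F_add crd_F)
 show "crd (x + y) = (%i j. crd x i j + crd y i j)"
  using xy by (intro crd_eqI[OF _ _ eq]) (auto intro: F_add crd_F simp: crd_outside)
qed

lemma kum_field_diff: "x : kum_field ==> y : kum_field ==> x - y : kum_field"
 and crd_diff: "x : kum_field ==> y : kum_field ==> crd (x - y) = (%i j. crd x i j - crd y i j)"
proof -
 assume xy: "x : kum_field" "y : kum_field"
 have eq: "x - y = kum (%i j. crd x i j - crd y i j)" using xy by (simp add: kum_diff kum_crd)
 show "x - y : kum_field" unfolding eq using xy by (intro kum_in_field F_diff crd_F)
 show "crd (x - y) = (%i j. crd x i j - crd y i j)"
  using xy by (intro crd_eqI[OF _ _ eq]) (auto intro: F_diff crd_F simp: crd_outside)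
qed

text \<open>Exponents are reduced by \<open>ups ^ N = u\<close> and \<open>\<rho> ^ N = p\<close>.
  Products in the field are sums of such monomials, on which multiplicativity of the automorphisms
  is checked.\<close>

lemma kum_monomial:
 assumes "c : F"
 shows monomial_in_field: "c * ups ^ i * \<rho> ^ j : kum_field"
  and crd_monomial: "crd (c * ups ^ i * \<rho> ^ j)
   = (%k l. if k = i mod N & l = j mod N then c * of_nat u ^ (i div N) * of_nat p ^ (j div N) else 0)"
proof -
 define d where "d = c * of_nat u ^ (i div N) * of_nat p ^ (j div N)"
 have d: "d : F" unfolding d_def using assms by (intro F_mult F_power F_of_nat)
 define a where "a = (%k l. if k = i mod N & l = j mod N then d else 0)"
 have aF: "a k l : F" for k l using d F_0 by (simp add: a_def)
 have lt: "i mod N < N" "j mod N < N" using N by simp_all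
 have "ups ^ i = (ups ^ N) ^ (i div N) * ups ^ (i mod N)" "\<rho> ^ j = (\<rho> ^ N) ^ (j div N) * \<rho> ^ (j mod N)"
  by (simp_all flip: power_mult power_add)
 hence "c * ups ^ i * \<rho> ^ j = d * ups ^ (i mod N) * \<rho> ^ (j mod N)"
  by (simp add: d_def ups \<rho> mult_ac)
 also have "... = (\<Sum>k<N. if k = i mod N then (\<Sum>l<N. if l = j mod N then d * ups ^ (i mod N) * \<rho> ^ (j mod N) else 0) else 0)"
  using lt by simp
 also have "... = kum a"
  unfolding kum_def
 proof (intro sum.cong refl)
  fix k
  show "(if k = i mod N then \<Sum>l<N. if l = j mod N then d * ups ^ (i mod N) * \<rho> ^ (j mod N) else 0 else 0)
    = (\<Sum>l<N. a k l * ups ^ k * \<rho> ^ l)"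
  proof (cases "k = i mod N")
   case True
   have "(\<Sum>l<N. if l = j mod N then d * ups ^ (i mod N) * \<rho> ^ (j mod N) else 0)
     = (\<Sum>l<N. a k l * ups ^ k * \<rho> ^ l)"
    by (intro sum.cong refl) (simp add: a_def True)
   thus ?thesis using True by (simp only: if_True refl)
  qed (simp add: a_def)
 qed
 finally have eq: "c * ups ^ i * \<rho> ^ j = kum a" .
 show "c * ups ^ i * \<rho> ^ j : kum_field" unfolding eq using aF by (rule kum_in_field)
 have "crd (c * ups ^ i * \<rho> ^ j) = a" by (rule crd_eqI[OF aF _ eq]) (use lt in \<open>auto simp: a_def\<close>)
 thus "crd (c * ups ^ i * \<rho> ^ j)
   = (%k l. if k = i mod N & l = j mod N then c * of_nat u ^ (i div N) * of_nat p ^ (j div N) else 0)"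
  unfolding a_def d_def .
qed

lemma F_subset_kum_field: "c : F ==> c : kum_field"
 using monomial_in_field[of c 0 0] by simp

lemma crd_const: "c : F ==> crd c = (%k l. if k = 0 & l = 0 then c else 0)"
 using crd_monomial[of c 0 0] by (simp cong: if_cong)

lemma kum_field_0: "0 : kum_field"
 by (rule F_subset_kum_field[OF F_0])

lemma kum_field_sum: "(!!i. i : I ==> f i : kum_field) ==> sum f I : kum_field"
 by (induction I rule: infinite_finite_induct) (auto intro: kum_field_0 kum_field_add)

lemma kum_product: "kum a * kum b = (\<Sum>i<N. \<Sum>j<N. \<Sum>k<N. \<Sum>l<N. (a i j * b k l) * ups ^ (i + k) * \<rho> ^ (j + l))"
 unfolding kum_def sum_distrib_right unfolding sum_distrib_left by (simp add: power_add mult_ac)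

lemma kum_field_mult: "x : kum_field ==> y : kum_field ==> x * y : kum_field"
proof -
 assume xy: "x : kum_field" "y : kum_field"
 have "x * y = kum (crd x) * kum (crd y)" using xy by (simp add: kum_crd)
 also have "... : kum_field" unfolding kum_product
  using xy by (intro kum_field_sum monomial_in_field F_mult crd_F)
 finally show ?thesis .
qed

lemma kum_field_subfield: "subfield_set kum_field"
proof (rule subfield_of_Rats_subset[OF all_algebraic])
 show "subring_set kum_field"
  unfolding subring_set_def using F_subset_kum_field[OF F_1] kum_field_diff kum_field_mult by blast
 show "\<rat> <= kum_field"
  using F_subset_kum_field F_divide F_of_int by (auto elim!: Rats_cases')
qed

text \<open>The automorphism over \<open>F\<close> with \<open>ups -> \<zeta> ^ al * ups\<close> and
  \<open>\<rho> -> \<zeta> ^ be * \<rho>\<close>. The exponents are arbitrary natural numbers, so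
  that composition is addition.\<close>

definition kum_aut :: "nat => nat => 'c => 'c" where
 "kum_aut al be x = kum (%i j. crd x i j * \<zeta> ^ (al * i + be * j))"

lemma kum_aut_in: "x : kum_field ==> kum_aut al be x : kum_field"
 unfolding kum_aut_def by (intro kum_in_field F_mult crd_F F_power \<zeta>_F)

lemma crd_kum_aut:
 "x : kum_field ==> crd (kum_aut al be x) = (%i j. crd x i j * \<zeta> ^ (al * i + be * j))"
 by (rule crd_eqI[OF _ _ kum_aut_def]) (auto simp: crd_outside intro!: F_mult crd_F F_power \<zeta>_F)

lemma kum_aut_add:
 "x : kum_field ==> y : kum_field ==> kum_aut al be (x + y) = kum_aut al be x + kum_aut al be y"
 by (simp add: kum_aut_def crd_add distrib_right kum_add)

lemma kum_aut_diff:
 "x : kum_field ==> y : kum_field ==> kum_aut al be (x - y) = kum_aut al be x - kum_aut al be y"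
 by (simp add: kum_aut_def crd_diff left_diff_distrib kum_diff)

lemma kum_aut_sum:
 "(!!i. i : I ==> f i : kum_field) ==> kum_aut al be (sum f I) = (\<Sum>i\<in>I. kum_aut al be (f i))"
proof (induction I rule: infinite_finite_induct)
 case (insert i I)
 thus ?case by (simp add: kum_aut_add kum_field_sum)
qed (simp_all add: kum_aut_def crd_const[OF F_0], simp_all add: kum_def)

lemma kum_aut_monomial:
 assumes "c : F"
 shows "kum_aut al be (c * ups ^ i * \<rho> ^ j) = c * \<zeta> ^ (al * i + be * j) * ups ^ i * \<rho> ^ j"
proof -
 have z: "\<zeta> ^ (al * i + be * j) = \<zeta> ^ (al * (i mod N) + be * (j mod N))"
 proof -
  have "\<zeta> ^ (\<gamma> * k) = \<zeta> ^ (\<gamma> * (k mod N))" for \<gamma> k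
  proof -
   have "\<gamma> * k = N * (\<gamma> * (k div N)) + \<gamma> * (k mod N)"
    by (metis distrib_left mult.left_commute mult_div_mod_eq)
   hence "\<zeta> ^ (\<gamma> * k) = (\<zeta> ^ N) ^ (\<gamma> * (k div N)) * \<zeta> ^ (\<gamma> * (k mod N))"
    by (simp only: power_add power_mult)
   thus ?thesis by (simp add: \<zeta>_N)
  qed
  thus ?thesis by (simp only: power_add)
 qed
 have c': "c * \<zeta> ^ (al * i + be * j) : F" using assms by (intro F_mult F_power \<zeta>_F)
 have "crd (kum_aut al be (c * ups ^ i * \<rho> ^ j)) = crd (c * \<zeta> ^ (al * i + be * j) * ups ^ i * \<rho> ^ j)"
  using assms c' by (auto simp: crd_kum_aut monomial_in_field crd_monomial z fun_eq_iff)
 thus ?thesis using kum_crd[OF kum_aut_in[OF monomial_in_field[OF assms]]] kum_crd[OF monomial_in_field[OF c']]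
  by metis
qed

lemma kum_aut_const: "c : F ==> kum_aut al be c = c"
 using kum_aut_monomial[of c al be 0 0] by simp

lemma kum_aut_mult:
 assumes xy: "x : kum_field" "y : kum_field"
 shows "kum_aut al be (x * y) = kum_aut al be x * kum_aut al be y"
proof -
 define t where "t = (%i j k l. (crd x i j * crd y k l) * ups ^ (i + k) * \<rho> ^ (j + l))"
 have t: "t i j k l : kum_field" for i j k l
  unfolding t_def by (rule monomial_in_field[OF F_mult[OF crd_F[OF xy(1)] crd_F[OF xy(2)]]])
 have "x * y = kum (crd x) * kum (crd y)" using xy by (simp add: kum_crd)
 also have "... = (\<Sum>i<N. \<Sum>j<N. \<Sum>k<N. \<Sum>l<N. t i j k l)"
  unfolding kum_product t_def ..
 also have "kum_aut al be ... = (\<Sum>i<N. \<Sum>j<N. \<Sum>k<N. \<Sum>l<N. kum_aut al be (t i j k l))"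
  by (simp only: kum_aut_sum kum_field_sum t)
 also have "... = (\<Sum>i<N. \<Sum>j<N. \<Sum>k<N. \<Sum>l<N.
   ((crd x i j * \<zeta> ^ (al * i + be * j)) * (crd y k l * \<zeta> ^ (al * k + be * l))) * ups ^ (i + k) * \<rho> ^ (j + l))"
 proof (intro sum.cong refl)
  fix i j k l
  have "\<zeta> ^ (al * (i + k) + be * (j + l)) = \<zeta> ^ (al * i + be * j) * \<zeta> ^ (al * k + be * l)"
   by (simp add: distrib_left ac_simps flip: power_add)
  thus "kum_aut al be (t i j k l)
   = ((crd x i j * \<zeta> ^ (al * i + be * j)) * (crd y k l * \<zeta> ^ (al * k + be * l))) * ups ^ (i + k) * \<rho> ^ (j + l)"
   unfolding t_def kum_aut_monomial[OF F_mult[OF crd_F[OF xy(1)] crd_F[OF xy(2)]]] by (simp add: mult_ac)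
 qed
 also have "... = kum_aut al be x * kum_aut al be y"
  unfolding kum_aut_def kum_product ..
 finally show ?thesis .
qed

lemma kum_aut_power: "x : kum_field ==> kum_aut al be (x ^ n) = kum_aut al be x ^ n"
 by (induction n)
   (simp_all add: kum_aut_mult subring_set_power[OF subfield_set_subring[OF kum_field_subfield]] kum_aut_const[OF F_1])

lemma kum_aut_poly:
 assumes "s : poly_over F" "x : kum_field"
 shows "kum_aut al be (poly s x) = poly s (kum_aut al be x)"
proof -
 have "coeff s i : F" for i using assms by (simp add: poly_over_def)
 thus ?thesis unfolding poly_altdef
  using assms(2) subring_set_power[OF subfield_set_subring[OF kum_field_subfield] assms(2)]
  by (simp add: kum_aut_sum kum_aut_mult kum_aut_power kum_aut_const F_subset_kum_field kum_field_mult)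
qed

lemma kum_aut_kum_aut:
 "x : kum_field ==> kum_aut al be (kum_aut \<gamma> \<delta> x) = kum_aut (al + \<gamma>) (be + \<delta>) x"
 by (simp add: kum_aut_def[of _ _ "kum_aut _ _ _"] crd_kum_aut)
   (simp add: kum_aut_def mult.assoc algebra_simps flip: power_add)

lemma kum_aut_N: "x : kum_field ==> kum_aut (N * al) (N * be) x = x"
 by (simp add: kum_aut_def power_add power_mult \<zeta>_N mult.assoc kum_crd)

lemma crd_vle: "x : kum_field ==> vle (crd x i j * \<rho> ^ j) x"
 using kum_coordinate_vle[of "crd x" i j] crd_F crd_outside kum_crd
 by (cases "i < N & j < N") auto

text \<open>By \<open>crd_vle\<close> every term of the expansion is bounded by \<open>x\<close>, up
  to a unit the term is unchanged, and sums do not increase sizes.\<close>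

lemma kum_aut_vle:
 assumes "x : kum_field" "vle x r" shows "vle (kum_aut al be x) r"
 unfolding kum_aut_def kum_def
proof (intro vle_sum)
 fix i j
 have "crd x i j * \<zeta> ^ (al * i + be * j) * ups ^ i * \<rho> ^ j = (\<zeta> ^ (al * i + be * j) * ups ^ i) * (crd x i j * \<rho> ^ j)"
  by (simp add: mult_ac)
 also have "vle ... r"
  using vle_trans[OF crd_vle[OF assms(1)] assms(2)]
  by (rule vle_mult_left[OF in_mult[OF in_power[OF \<zeta>_in] in_power[OF ups_in]]])
 finally show "vle (crd x i j * \<zeta> ^ (al * i + be * j) * ups ^ i * \<rho> ^ j) r" .
qed

text \<open>The size of a coordinate is that of a power of \<open>p = \<rho> ^ N\<close>; a negative
  exponent could not be compensated by \<open>\<rho> ^ j\<close> with \<open>j < N\<close>.\<close>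

lemma crd_in:
 assumes x: "x : kum_field" "x : A" shows "crd x i j : A"
proof (cases "i < N & j < N & crd x i j ~= 0")
 case True
 obtain n v where nv: "crd x i j = of_nat p powi n * v" "v : A" "inverse v : A"
  using decomp[OF crd_F[OF x(1)]] True by metis
 have v0: "v ~= 0" using nv(1) True by auto
 have "crd x i j * \<rho> ^ j : A" using crd_vle[OF x(1), of i j] x(2) vle_trans by (metis vle_one_iff)
 hence "(crd x i j * \<rho> ^ j) ^ N : A" by (rule in_power)
 moreover have "(\<rho> ^ j) ^ N = of_nat p ^ j" by (metis \<rho> mult.commute power_mult)
 ultimately have "of_nat p powi (n * int N + int j) * v ^ N : A"
  using p_neq_0 by (simp add: nv(1) power_mult_distrib power_int_add power_int_mult mult_ac)
 moreover have "v ^ N : A" "inverse (v ^ N) : A" "v ^ N ~= 0"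
  using nv v0 by (auto simp: power_inverse[symmetric] intro: in_power)
 ultimately have "n * int N + int j >= 0" using p_powi_unit(1)[of "v ^ N"] by blast
 hence "n >= 0"
 proof -
  have "n * int N > - int N" using True \<open>n * int N + int j >= 0\<close> by linarith
  hence "(n + 1) * int N > 0" by (simp add: algebra_simps)
  thus ?thesis using N by (simp add: zero_less_mult_iff)
 qed
 thus ?thesis unfolding nv(1) using p_powi_unit(1)[OF nv(2,3) v0] by blast
qed (use crd_outside[OF x(1)] in_0 in auto)

text \<open>First exponent 0 means that \<open>ups\<close> is fixed, so only terms with a positive
  power of \<open>\<rho>\<close> change.\<close>

lemma kum_aut_inertia:
 assumes x: "x : kum_field" "x : A" shows "vle (x - kum_aut 0 be x) \<rho>"
proof -
 have "x - kum_aut 0 be x = kum (%i j. crd x i j - crd x i j * \<zeta> ^ (be * j))"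
  using x(1) by (simp add: kum_diff kum_aut_def kum_crd)
 also have "vle ... \<rho>" unfolding kum_def
 proof (intro vle_sum)
  fix i j
  show "vle ((crd x i j - crd x i j * \<zeta> ^ (be * j)) * ups ^ i * \<rho> ^ j) \<rho>"
  proof (cases j)
   case (Suc k)
   have "(crd x i j - crd x i j * \<zeta> ^ (be * j)) * ups ^ i * \<rho> ^ j
     = ((crd x i j - crd x i j * \<zeta> ^ (be * j)) * ups ^ i * \<rho> ^ k) * \<rho>" by (simp add: Suc)
   moreover have "(crd x i j - crd x i j * \<zeta> ^ (be * j)) * ups ^ i * \<rho> ^ k : A"
    by (intro in_mult in_diff in_power crd_in[OF x] \<zeta>_in ups_in \<rho>_in)
   ultimately show ?thesis unfolding vle_def by blast
  qed simp
 qed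
 finally show ?thesis .
qed

text \<open>The residue of \<open>c\<close> is a power of the primitive root \<open>u\<close>, and
  the remaining factor is congruent to 1, hence an \<open>N\<close>-th power to any precision. Thus
  \<open>c\<close> has approximate \<open>N\<close>-th roots of the form \<open>ups ^ a\<close>
  times an integer.\<close>

lemma unit_approx_power:
 assumes c: "c : F" "c : A" "c ~: nonunits A"
 shows "EX a x. vle (c - of_nat u ^ a * of_int x ^ N) (of_nat p ^ n)"
proof -
 \<comment> \<open>One power of \<open>p\<close> more, so that the approximation also determines the
   residue of \<open>c\<close> when \<open>n = 0\<close>.\<close>
 define n' where "n' = Suc n"
 obtain m where m: "vle (c - of_int m) (of_nat p ^ n')" using approx_power[OF c(1,2)] by blast
 have "~ int p dvd m"
 proof
  assume "int p dvd m"
  hence "of_int m : nonunits A" by (simp only: of_int_nonunit_iff)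
  moreover have "of_nat p ^ n' : nonunits A"
   using nonunits_mult[OF in_power[OF p_in, of n] p_nonunit] by (simp add: n'_def mult.commute)
  hence "c - of_int m : nonunits A" by (rule vle_nonunit[OF m])
  ultimately have "of_int m + (c - of_int m) : nonunits A" by (rule nonunits_add)
  thus False using c(3) by simp
 qed
 define m' where "m' = nat (m mod int p)"
 have m'm: "[int m' = m] (mod int p)" using p by (simp add: m'_def prime_gt_0_nat cong_def)
 have "~ p dvd m'" using \<open>~ int p dvd m\<close> cong_dvd_iff[OF m'm] by (metis int_dvd_int_iff cong_dvd_iff)
 have "m' < p" using p by (simp add: m'_def prime_gt_0_nat nat_less_iff)
 have "m' > 0" using \<open>~ p dvd m'\<close> by (metis dvd_0_right gr0I)
 have "coprime p m'" by (rule prime_imp_coprime[OF p \<open>~ p dvd m'\<close>])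
 hence "m' : totatives p"
  using \<open>m' < p\<close> \<open>m' > 0\<close> by (auto simp: totatives_def coprime_commute[of m'])
 hence "m' : (%i. u ^ i mod p) ` {..<totient p}"
  using residue_primroot_is_generator[OF prime_gt_1_nat[OF p] u] by (simp add: bij_betw_def)
 then obtain a where "m' = u ^ a mod p" by blast
 hence ua: "[int u ^ a = m] (mod int p)"
  using m'm by (metis cong_int_iff cong_mod_left cong_refl cong_sym cong_trans of_nat_power)
 have "coprime (int u ^ a) (int p ^ n')" using u_coprime by (simp add: coprime_commute)
 then obtain v where v: "[int u ^ a * v = 1] (mod int p ^ n')" using cong_solve_coprime_int by blast
 have v': "[int u ^ a * v = 1] (mod int p)" using v by (rule cong_dvd_modulus) (simp add: n'_def)
 have "[m * v = 1] (mod int p)"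
  using cong_mult[OF ua cong_refl, of v] v' by (meson cong_sym cong_trans)
 then obtain x where x: "[x ^ N = m * v] (mod int p ^ n')"
  using cong_one_has_root[OF _ N_coprime] p prime_gt_1_nat by blast
 have "[int u ^ a * x ^ N = int u ^ a * (m * v)] (mod int p ^ n')" using x by (intro cong_mult) auto
 also have "int u ^ a * (m * v) = m * (int u ^ a * v)" by simp
 also have "[... = m * 1] (mod int p ^ n')" using v by (intro cong_mult) auto
 finally have "int p ^ n' dvd m - int u ^ a * x ^ N" by (simp add: cong_iff_dvd_diff dvd_diff_commute)
 then obtain k where k: "m - int u ^ a * x ^ N = int p ^ n' * k" by blast
 have "of_int m - of_nat u ^ a * of_int x ^ N = (of_int (m - int u ^ a * x ^ N) :: 'c)" by simp
 also have "... = of_int k * of_nat p ^ n'" unfolding k by simp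
 finally have "vle (of_int m - of_nat u ^ a * of_int x ^ N) (of_nat p ^ n')"
  unfolding vle_def using in_of_int by blast
 hence "vle ((c - of_int m) + (of_int m - of_nat u ^ a * of_int x ^ N)) (of_nat p ^ n')"
  using m vle_add by blast
 also have "vle (of_nat p ^ n') (of_nat p ^ n)"
  unfolding vle_def n'_def by (rule bexI[of _ "of_nat p"]) (auto simp: in_of_nat)
 finally show ?thesis by auto
qed

end

text \<open>A solution of \<open>f(t + v\<^sup>N, s) = 0\<close> up to order \<open>M\<close> in \<open>v\<close>.\<close>

definition puiseux_approx :: "nat => 'c::comm_ring_1 poly poly => nat => 'c => 'c poly => 'c poly => bool" where
 "puiseux_approx N f M t s g \<longleftrightarrow>
   poly (map_poly (%a. pcompose a ([:t:] + monom 1 N)) f) s = monom 1 M * g"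

section \<open>The approximation estimate for roots of a specialized polynomial\<close>

context kummer
begin

lemma w_not_vle:
 assumes c: "c ~: nonunits A" and d: "d : A" and m: "m > 0"
 shows "~ vle (c * \<rho> ^ k) (d * \<rho> ^ (k + m))"
proof
 assume "vle (c * \<rho> ^ k) (d * \<rho> ^ (k + m))"
 hence "vle (\<rho> ^ k * c) (\<rho> ^ k * (d * \<rho> ^ m))" by (simp add: power_add mult_ac)
 hence "vle c (d * \<rho> ^ m)" using \<rho>_neq_0 by (subst (asm) vle_mult_cancel) auto
 moreover obtain m' where "m = Suc m'" using m by (cases m) auto
 hence eq: "d * \<rho> ^ m = (d * \<rho> ^ m') * \<rho>" by simp
 have "d * \<rho> ^ m : nonunits A"
  unfolding eq by (rule nonunits_mult[OF in_mult[OF d in_power[OF \<rho>_in]] \<rho>_nonunit])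
 ultimately show False using vle_nonunit c by blast
qed

text \<open>If \<open>D\<close> is a unit at \<open>x0\<close>, inertia with
  \<open>r = \<rho>\<close> suffices. Otherwise \<open>x0\<close> is close to a root
  \<open>t\<close> of \<open>D\<close>, and an approximate \<open>N\<close>-th root \<open>w\<close>
  of \<open>x0 - t\<close> is fixed by an automorphism nontrivial at level \<open>l\<close>; so is
  the Puiseux value \<open>S\<close>, and a root near \<open>S\<close> is moved little.
  Automorphism, radius and required accuracy \<open>M\<close> are fixed before the roots
  \<open>y\<close>, which are later known only as terms of Cauchy sequences.\<close>

lemma krasner:
 fixes f :: "'c poly poly" and D :: "'c poly" and l :: nat
 assumes l: "l dvd N" "l > 1"
  and f: "lead_coeff f = 1" "degree f = n" "n > 0" "!!j. coeff f j : poly_over A"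
  and D: "D = smult c (\<Prod>t\<leftarrow>ts. [:- t, 1:])" "c ~: nonunits A" "c : A" "set ts <= A" "set ts <= F"
  and D1: "!!t. t : set ts ==> D = [:- t, 1:] ^ \<mu> t * D1 t & D1 t : poly_over A & poly (D1 t) t ~: nonunits A"
  and s: "!!t. t : set ts ==> puiseux_approx N f (n * (N * \<mu> t + 1)) t (s t) (g t)
    & s t : poly_over F & s t : poly_over A & g t : poly_over A"
  and x0: "x0 : F" "x0 : A" "poly D x0 ~= 0"
 obtains al be r M where "~ (l dvd al & l dvd be)" "~ vle (poly D x0) r" "r : A" "r ~= 0"
  "!!I y. finite (I :: 'i set) ==> card I = n ==> (!!i. i : I ==> y i : kum_field) ==>
    (!!j. vle (coeff (\<Prod>i\<in>I. [:- y i, 1:]) j - poly (coeff f j) x0) (of_nat p ^ M)) ==>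
    (ALL i:I. y i : A) & (EX i:I. vle (y i - kum_aut al be (y i)) r)"
proof -
 have fx0: "poly (coeff f j) x0 : A" for j by (rule poly_over_poly[OF subring f(4) x0(2)])
 have yA: "y i : A" if I: "finite (I :: 'i set)" "i : I"
   and c: "!!j. vle (coeff (\<Prod>i\<in>I. [:- y i, 1:]) j - poly (coeff f j) x0) (of_nat p ^ M)" for I y M i
 proof (rule monic_root_in[of "\<Prod>i\<in>I. [:- y i, 1:]"])
  show "lead_coeff (\<Prod>i\<in>I. [:- y i, 1:]) = 1" by (simp add: lead_coeff_prod)
  show "poly (\<Prod>i\<in>I. [:- y i, 1:]) (y i) = 0" using I by (auto simp: poly_prod prod_zero_iff)
  fix j
  have "coeff (\<Prod>i\<in>I. [:- y i, 1:]) j - poly (coeff f j) x0 : A"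
   using c[of j] in_power[OF p_in, of M] vle_trans[of _ _ 1] vle_one_iff by blast
  from in_add[OF this fx0[of j]] show "coeff (\<Prod>i\<in>I. [:- y i, 1:]) j : A" by simp
 qed
 show thesis
 proof (cases "poly D x0 : nonunits A")
  case False
  show thesis
  proof (rule that[of 0 1 \<rho> 0])
   show "~ (l dvd 0 & l dvd 1)" using l by auto
   show "~ vle (poly D x0) \<rho>" using False vle_nonunit \<rho>_nonunit by blast
   fix I :: "'i set" and y
   assume I: "finite I" "card I = n" "!!i. i : I ==> y i : kum_field"
    and c: "!!j. vle (coeff (\<Prod>i\<in>I. [:- y i, 1:]) j - poly (coeff f j) x0) (of_nat p ^ 0)"
   have "I ~= {}" using I f by auto
   then obtain i where i: "i : I" by blast
   show "(ALL i:I. y i : A) & (EX i:I. vle (y i - kum_aut 0 1 (y i)) \<rho>)"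
    using yA[OF I(1) _ c] kum_aut_inertia[OF I(3)[OF i] yA[OF I(1) i c], of 1] i by blast
  qed (use \<rho>_in \<rho>_neq_0 in auto)
 next
  case True
  obtain t where t: "t : set ts" "x0 - t : nonunits A"
  proof -
   have "poly (\<Prod>t\<leftarrow>ts'. [:- t, 1:]) x0 = (\<Prod>t\<leftarrow>ts'. x0 - t)" for ts'
    by (induction ts') (auto simp: algebra_simps)
   hence "poly D x0 = c * (\<Prod>t\<leftarrow>ts. x0 - t)" by (simp add: D(1))
   hence "c * (\<Prod>t\<leftarrow>ts. x0 - t) : nonunits A" using True by simp
   moreover have inA: "(\<Prod>t\<leftarrow>ts'. x0 - t) : A" if "set ts' <= A" for ts'
    using that by (induction ts') (auto intro: in_1 in_mult in_diff x0)
   ultimately have "(\<Prod>t\<leftarrow>ts. x0 - t) : nonunits A" using nonunits_prime[OF _ D(3) inA[OF D(4)]] D(2) by blast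
   hence "EX t:set ts. x0 - t : nonunits A" using D(4)
   proof (induction ts)
    case (Cons t ts)
    hence "(x0 - t) * (\<Prod>t\<leftarrow>ts. x0 - t) : nonunits A" by simp
    moreover have "x0 - t : A" "(\<Prod>t\<leftarrow>ts. x0 - t) : A" using Cons.prems inA x0 by (auto intro: in_diff)
    ultimately show ?case using nonunits_prime Cons by auto
   qed (simp add: nonunits_1)
   thus thesis using that by blast
  qed
  have tA: "t : A" and tF: "t : F" using t D by auto
  note D1t = D1[OF t(1)]
  \<comment> \<open>Since \<open>x0\<close> is congruent to \<open>t\<close>, the cofactor
    \<open>D1 t\<close> stays a unit at \<open>x0\<close>. Thus \<open>D\<close> at
    \<open>x0\<close> has exactly the size of \<open>(x0 - t) ^ \<mu> t\<close>.\<close>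
  have D1x: "poly (D1 t) x0 ~: nonunits A"
  proof
   assume a: "poly (D1 t) x0 : nonunits A"
   obtain q where q: "poly (D1 t) x0 - poly (D1 t) t = (x0 - t) * q" "q : A"
   proof (rule that)
    have "poly (D1 t) x0 = poly ([:- t, 1:] * synthetic_div (D1 t) t + [:poly (D1 t) t:]) x0"
     by (simp only: synthetic_div_correct')
    thus "poly (D1 t) x0 - poly (D1 t) t = (x0 - t) * poly (synthetic_div (D1 t) t) x0"
     by (simp add: algebra_simps)
    show "poly (synthetic_div (D1 t) t) x0 : A"
     using D1t by (intro poly_over_poly[OF subring _ x0(2)] poly_over_synthetic_div[OF subring _ tA]) blast
   qed
   have "q * (x0 - t) : nonunits A" by (rule nonunits_mult[OF q(2) t(2)])
   hence "poly (D1 t) x0 - q * (x0 - t) : nonunits A" by (rule nonunits_diff[OF a])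
   moreover have "poly (D1 t) x0 - q * (x0 - t) = poly (D1 t) t" using q(1) by (simp add: algebra_simps)
   ultimately show False using D1t by simp
  qed
  define e where "e = x0 - t"
  have Dx0: "poly D x0 = e ^ \<mu> t * poly (D1 t) x0"
  proof -
   have "poly D x0 = poly ([:- t, 1:] ^ \<mu> t * D1 t) x0" using D1t by simp
   thus ?thesis by (simp add: e_def)
  qed
  have \<mu>0: "\<mu> t > 0" using Dx0 True D1x by (cases "\<mu> t") auto
  have e0: "e ~= 0" using Dx0 x0(3) \<mu>0 by (auto simp: power_0_left)
  have eF: "e : F" unfolding e_def by (rule F_diff[OF x0(1) tF])
  obtain m' v where mv: "e = of_nat p powi m' * v" "v : F" "v : A" "inverse v : A"
   using decomp[OF eF e0] by blast
  have v0: "v ~= 0" using mv e0 by auto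
  have "m' > 0" using t(2) p_powi_unit(2)[OF mv(3,4) v0, of m'] mv(1) by (simp add: e_def)
  define m where "m = nat m'"
  have m: "m > 0" "e = of_nat p ^ m * v"
   using \<open>m' > 0\<close> mv(1) by (auto simp: m_def power_int_def)
  have vu: "v ~: nonunits A" using mv v0 by (auto simp: nonunits_def)
  \<comment> \<open>With \<open>w ^ N\<close> of the size of \<open>x0 - t\<close>, the power
    \<open>w ^ (N * \<mu> t)\<close> has the size of \<open>D\<close> at \<open>x0\<close>; the
    extra 1 makes \<open>r = w ^ N2\<close> strictly smaller.\<close>
  define N2 where "N2 = N * \<mu> t + 1"
  \<comment> \<open>Large enough for \<open>p ^ M\<close> to be below \<open>r ^ n\<close>, which
    has the size of \<open>\<rho> ^ (m * n * N2)\<close>; the successor also makes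
    \<open>p ^ M\<close> a nonunit.\<close>
  define M where "M = Suc (m * n * N2)"
  obtain a x where ax: "vle (v - of_nat u ^ a * of_int x ^ N) (of_nat p ^ M)"
   using unit_approx_power[OF mv(2,3) vu] by blast
  \<comment> \<open>An approximate \<open>N\<close>-th root of \<open>x0 - t = p ^ m * v\<close>,
    using \<open>u ^ a * x ^ N\<close> in place of the unit \<open>v\<close>.\<close>
  define w where "w = of_int x * ups ^ a * \<rho> ^ m"
  define w1 where "w1 = of_int x * ups ^ a"
  have w1A: "w1 : A" unfolding w1_def by (intro in_mult in_of_int in_power ups_in)
  have w: "w = w1 * \<rho> ^ m" by (simp add: w_def w1_def)
  have w1N: "w1 ^ N = of_nat u ^ a * of_int x ^ N"
   unfolding w1_def power_mult_distrib by (metis ups mult.commute power_mult)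
  have pM: "of_nat p ^ M : nonunits A"
   unfolding M_def using nonunits_mult[OF in_power[OF p_in] p_nonunit] by (simp add: mult.commute)
  have w1u: "w1 ~: nonunits A"
  proof
   assume "w1 : nonunits A"
   hence "w1 ^ N : nonunits A" using nonunits_mult[OF in_power[OF w1A, of "N - 1"]] N
    by (metis mult.commute power_eq_if less_irrefl)
   moreover have "v - w1 ^ N : nonunits A" using vle_nonunit[OF ax pM] by (simp only: w1N)
   ultimately have "(v - w1 ^ N) + w1 ^ N : nonunits A" using nonunits_add by blast
   thus False using vu by simp
  qed
  have w10: "w1 ~= 0" using w1u nonunits_0 by auto
  have w0: "w ~= 0" using w10 \<rho>_neq_0 by (simp add: w)
  have wA: "w : A" unfolding w by (intro in_mult w1A in_power \<rho>_in)
  have \<rho>N: "(\<rho> ^ N) ^ k = \<rho> ^ (N * k)" for k by (simp add: power_mult)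
  have wN: "w ^ N = of_nat u ^ a * of_int x ^ N * of_nat p ^ m"
  proof -
   have "(\<rho> ^ m) ^ N = of_nat p ^ m" by (metis \<rho> mult.commute power_mult)
   thus ?thesis by (simp add: w power_mult_distrib w1N)
  qed
  define r where "r = w ^ N2"
  have rn: "r ^ n = w1 ^ (n * N2) * \<rho> ^ (m * n * N2)"
   by (simp add: r_def w power_mult_distrib mult_ac flip: power_mult)
  have pMr: "vle (of_nat p ^ M) (r ^ n)"
  proof -
   have "inverse w1 : A" using w1u w1A by (auto simp: nonunits_def)
   moreover have "m * n * N2 <= N * M"
   proof -
    have "m * n * N2 <= M" by (simp add: M_def)
    moreover have "1 * M <= N * M" using N by (intro mult_le_mono1) simp
    ultimately have "m * n * N2 <= M" "M <= N * M" by simp_all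
    thus ?thesis by (rule order_trans)
   qed
   hence "N * M = N * M - m * n * N2 + m * n * N2" by simp
   hence "of_nat p ^ M = \<rho> ^ (N * M - m * n * N2) * \<rho> ^ (m * n * N2)"
    by (simp only: \<rho>[symmetric] \<rho>N power_add[symmetric])
   hence "of_nat p ^ M = (\<rho> ^ (N * M - m * n * N2) * inverse w1 ^ (n * N2)) * r ^ n"
    using w10 by (simp add: rn field_simps)
   ultimately show ?thesis unfolding vle_def using in_mult in_power \<rho>_in by blast
  qed
  \<comment> \<open>The exponents \<open>(a, m)\<close> of \<open>w\<close> are divided by their gcd
    and rotated to solve \<open>al * a + be * m = 0\<close> modulo \<open>N\<close>, where
    \<open>N - 1\<close> stands for -1. Coprimality of the two quotients prevents \<open>l\<close>
    from dividing both \<open>al\<close> and \<open>be\<close>.\<close>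
  define h where "h = gcd a m"
  have h: "h > 0" using m(1) by (simp add: h_def)
  define al where "al = m div h"
  define be where "be = (N - 1) * (a div h)"
  have albe: "al * a + be * m = N * (a div h * m)"
  proof -
   have "a = h * (a div h)" "m = h * (m div h)" by (simp_all add: h_def)
   hence "al * a = a div h * m" unfolding al_def by (metis mult.assoc mult.commute)
   moreover have "N = Suc (N - 1)" using N by simp
   hence "N * (a div h * m) = a div h * m + (N - 1) * (a div h * m)" by (metis mult_Suc)
   ultimately show ?thesis by (simp add: be_def mult.assoc)
  qed
  have nl: "~ (l dvd al & l dvd be)"
  proof
   assume l': "l dvd al & l dvd be"
   have "coprime l (N - 1)"
   proof -
    have "coprime (Suc (N - 1)) (N - 1)" by (rule coprime_Suc_left_nat)
    moreover have "Suc (N - 1) = N" using N by simp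
    ultimately have "coprime N (N - 1)" by (simp only:)
    thus ?thesis using l(1) coprime_divisors dvd_refl by blast
   qed
   hence "l dvd a div h" using l' by (simp add: be_def coprime_dvd_mult_right_iff)
   moreover have "coprime (a div h) (m div h)" unfolding h_def using m(1) by (intro div_gcd_coprime) auto
   ultimately have "is_unit l" 
    using coprime_common_divisor[of "a div h" "m div h" l] l' by (simp add: al_def)
   thus False using l(2) by simp
  qed
  have wk: "w : kum_field" unfolding w_def by (rule monomial_in_field[OF F_of_int])
  have \<sigma>w: "kum_aut al be w = w"
   unfolding w_def kum_aut_monomial[OF F_of_int] albe by (simp add: power_mult \<zeta>_N)
  \<comment> \<open>The Puiseux value. Its coefficients lie in \<open>F\<close> and \<open>w\<close>
    is fixed, so the automorphism fixes \<open>S\<close>.\<close>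
  define S where "S = poly (s t) w"
  note st = s[OF t(1)]
  have SA: "S : A" unfolding S_def using st by (intro poly_over_poly[OF subring _ wA]) blast
  have sF: "s t : poly_over F" using st by blast
  have Sk: "S : kum_field" unfolding S_def
  proof (rule poly_over_poly[OF subfield_set_subring[OF kum_field_subfield] _ wk])
   show "s t : poly_over kum_field" using sF F_subset_kum_field by (auto simp: poly_over_def)
  qed
  have \<sigma>S: "kum_aut al be S = S" unfolding S_def kum_aut_poly[OF sF wk] \<sigma>w ..
  have ev: "poly (poly (map_poly (%a. pcompose a ([:t:] + monom 1 N)) f) (s t)) w
    = (\<Sum>j\<le>n. poly (coeff f j) (t + w ^ N) * S ^ j)"
  proof -
   have dg: "degree (map_poly (%a. pcompose a ([:t:] + monom 1 N)) f) = n"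
    by (intro antisym degree_le le_degree) (use f in \<open>auto simp: coeff_map_poly coeff_eq_0 pcompose_1\<close>)
   show ?thesis unfolding poly_altdef[of "map_poly _ f"] dg
    by (simp add: poly_sum coeff_map_poly poly_pcompose poly_monom S_def)
  qed
  have near: "vle (x0 - (t + w ^ N)) (of_nat p ^ M)"
  proof -
   have "x0 - (t + w ^ N) = of_nat p ^ m * (v - of_nat u ^ a * of_int x ^ N)"
    using m(2) by (simp add: e_def wN algebra_simps)
   thus ?thesis using vle_mult_left[OF in_power[OF p_in] ax] by simp
  qed
  have twA: "t + w ^ N : A" by (intro in_add tA in_power wA)
  have fnear: "vle (poly (coeff f j) x0 - poly (coeff f j) (t + w ^ N)) (of_nat p ^ M)" for j
  proof -
   define y where "y = t + w ^ N"
   have "poly (coeff f j) x0 = poly ([:- y, 1:] * synthetic_div (coeff f j) y + [:poly (coeff f j) y:]) x0"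
    by (simp only: synthetic_div_correct')
   hence "poly (coeff f j) x0 - poly (coeff f j) y = poly (synthetic_div (coeff f j) y) x0 * (x0 - y)"
    by (simp add: algebra_simps)
   moreover have "poly (synthetic_div (coeff f j) y) x0 : A"
    using twA f(4) by (intro poly_over_poly[OF subring _ x0(2)] poly_over_synthetic_div[OF subring]) (auto simp: y_def)
   ultimately show ?thesis using vle_mult_left[OF _ near] by (simp add: y_def)
  qed
  show thesis
  proof (rule that[of al be r M])
   show "~ (l dvd al & l dvd be)" by (rule nl)
   show "r : A" unfolding r_def by (intro in_power wA)
   show "r ~= 0" using w0 by (simp add: r_def)
   show "~ vle (poly D x0) r"
   proof -
    have "e ^ \<mu> t = v ^ \<mu> t * \<rho> ^ (N * (m * \<mu> t))"
     by (simp add: m(2) power_mult_distrib mult_ac \<rho> power_mult)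
    hence D': "poly D x0 = (v ^ \<mu> t * poly (D1 t) x0) * \<rho> ^ (N * (m * \<mu> t))"
     by (simp add: Dx0 mult_ac)
    have r': "r = w1 ^ N2 * \<rho> ^ (N * (m * \<mu> t) + m)"
    proof -
     have "m * N2 = N * (m * \<mu> t) + m" by (simp add: N2_def algebra_simps)
     thus ?thesis by (simp only: r_def w power_mult_distrib power_mult[symmetric])
    qed
    have "v ^ \<mu> t * poly (D1 t) x0 ~: nonunits A"
     using nonunits_prime[of "v ^ \<mu> t" "poly (D1 t) x0"] nonunits_prime_power[of v] vu D1x mv(3) D1t
      poly_over_poly[OF subring _ x0(2), of "D1 t"] in_power[OF mv(3)] by blast
    thus ?thesis unfolding D' r' using w_not_vle[OF _ in_power[OF w1A] m(1)] by blast
   qed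
   fix I :: "'i set" and y
   assume I: "finite I" "card I = n" "!!i. i : I ==> y i : kum_field"
    and c: "!!j. vle (coeff (\<Prod>i\<in>I. [:- y i, 1:]) j - poly (coeff f j) x0) (of_nat p ^ M)"
   have I0: "I ~= {}" using I(2) f(3) by auto
   define P where "P = (\<Prod>i\<in>I. [:- y i, 1:])"
   have dP: "degree P = n" unfolding P_def using I(2) by (subst degree_prod_eq_sum_degree) auto
   \<comment> \<open>The value of \<open>P\<close> at \<open>S\<close> differs from the Puiseux
     remainder, a multiple of \<open>r ^ n\<close>, by errors below \<open>p ^ M\<close>. So the
     product of \<open>n\<close> factors is at most \<open>r ^ n\<close>, and one factor is at most
     \<open>r\<close>.\<close>
   have "(\<Prod>i\<in>I. S - y i) = poly P S" by (simp add: P_def poly_prod)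
   also have "... = (\<Sum>j\<le>n. (coeff P j - poly (coeff f j) x0) * S ^ j)
     + (\<Sum>j\<le>n. (poly (coeff f j) x0 - poly (coeff f j) (t + w ^ N)) * S ^ j)
     + (\<Sum>j\<le>n. poly (coeff f j) (t + w ^ N) * S ^ j)"
    by (simp add: poly_altdef dP algebra_simps sum.distrib sum_subtractf)
   also have "(\<Sum>j\<le>n. poly (coeff f j) (t + w ^ N) * S ^ j) = poly (g t) w * r ^ n"
   proof -
    have "r ^ n = w ^ (n * (N * \<mu> t + 1))"
     by (simp only: r_def N2_def power_mult[symmetric] mult.commute[of n])
    moreover have "poly (map_poly (%a. pcompose a ([:t:] + monom 1 N)) f) (s t)
      = monom 1 (n * (N * \<mu> t + 1)) * g t"
     using st unfolding puiseux_approx_def by blast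
    ultimately show ?thesis unfolding ev[symmetric] by (simp only: poly_mult poly_monom mult_1 mult.commute)
   qed
   finally have eq: "(\<Prod>i\<in>I. S - y i) = (\<Sum>j\<le>n. S ^ j * (coeff P j - poly (coeff f j) x0))
     + (\<Sum>j\<le>n. S ^ j * (poly (coeff f j) x0 - poly (coeff f j) (t + w ^ N))) + poly (g t) w * r ^ n"
    by (simp add: mult.commute)
   have gA: "poly (g t) w : A" using st poly_over_poly[OF subring _ wA] by blast
   have "vle (\<Prod>i\<in>I. S - y i) (r ^ n)" unfolding eq
   proof (intro vle_add vle_sum vle_mult_left[OF in_power[OF SA]] vle_mult_left[OF gA])
    show "vle (coeff P j - poly (coeff f j) x0) (r ^ n)" for j
     using c[of j] pMr vle_trans unfolding P_def by blast
    show "vle (poly (coeff f j) x0 - poly (coeff f j) (t + w ^ N)) (r ^ n)" for j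
     using fnear[of j] pMr vle_trans by blast
   qed simp
   then obtain i where i: "i : I" "vle (S - y i) r"
    using vle_some_factor[OF I(1) I0, of "%i. S - y i" r] I(2) by auto
   have yk: "y i : kum_field" using I(3) i by blast
   have "vle (kum_aut al be (S - y i)) r" by (rule kum_aut_vle[OF kum_field_diff[OF Sk yk] i(2)])
   hence "vle (S - kum_aut al be (y i)) r" by (simp add: kum_aut_diff[OF Sk yk] \<sigma>S)
   hence "vle ((S - kum_aut al be (y i)) - (S - y i)) r" using i(2) by (rule vle_diff)
   hence "vle (y i - kum_aut al be (y i)) r" by simp
   thus "(ALL i:I. y i : A) & (EX i:I. vle (y i - kum_aut al be (y i)) r)"
    using yA[OF I(1) _ c] i(1) by blast
  qed
 qed
qed

end

section \<open>Cauchy sequences in the algebraic closure\<close>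

section \<open>Completions\<close>

context place
begin

definition null :: "(nat => 'c) => bool" where
 "null x \<longleftrightarrow> (ALL n. EX M. ALL i>=M. vle (x i) (of_nat p ^ n))"

definition cau :: "(nat => 'c) => bool" where
 "cau x \<longleftrightarrow> (ALL n. EX M. ALL i>=M. ALL j>=M. vle (x i - x j) (of_nat p ^ n))"

lemma nullD: "null x ==> EX M. ALL i>=M. vle (x i) (of_nat p ^ n)"
 by (auto simp: null_def)

lemma p_pow_neq_0: "(of_nat p :: 'c) ^ n ~= 0"
 using p_neq_0 by simp

lemma p_pow_mono: "m <= n ==> vle (of_nat p ^ n) (of_nat p ^ m)"
 unfolding vle_def by (rule bexI[of _ "of_nat p ^ (n - m)"]) (auto simp: in_power p_in simp flip: power_add)

lemma null_0: "null (%_. 0)"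
 by (simp add: null_def)

lemma null_add: "null x ==> null y ==> null (%i. x i + y i)"
 unfolding null_def
proof
 fix n assume "ALL n. EX M. ALL i>=M. vle (x i) (of_nat p ^ n)" "ALL n. EX M. ALL i>=M. vle (y i) (of_nat p ^ n)"
 then obtain M M' where "ALL i>=M. vle (x i) (of_nat p ^ n)" "ALL i>=M'. vle (y i) (of_nat p ^ n)" by meson
 thus "EX M. ALL i>=M. vle (x i + y i) (of_nat p ^ n)"
  by (intro exI[of _ "max M M'"]) (auto intro: vle_add)
qed

lemma null_uminus: "null x ==> null (%i. - x i)"
 by (simp add: null_def)

lemma null_diff: "null x ==> null y ==> null (%i. x i - y i)"
 using null_add[of x "%i. - y i"] null_uminus[of y] by simp

lemma null_sum: "(!!k. k : I ==> null (f k)) ==> null (%i. \<Sum>k\<in>I. f k i)"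
 by (induction I rule: infinite_finite_induct) (auto intro: null_0 null_add)

lemma null_eventually: "null x ==> (!!i. i >= M ==> vle (y i) (x i)) ==> null y"
 unfolding null_def
proof
 fix n assume a: "ALL n. EX M. ALL i>=M. vle (x i) (of_nat p ^ n)" "!!i. i >= M ==> vle (y i) (x i)"
 then obtain M' where "ALL i>=M'. vle (x i) (of_nat p ^ n)" by blast
 thus "EX M. ALL i>=M. vle (y i) (of_nat p ^ n)" using a(2) vle_trans
  by (intro exI[of _ "max M M'"]) (metis max.bounded_iff)
qed

lemma null_vle: "null x ==> (!!i. vle (y i) (x i)) ==> null y"
 by (rule null_eventually[of x 0])

lemma null_const: "null (%_. c) ==> c = 0"
proof (rule ccontr)
 assume "null (%_. c)" "c ~= 0"
 then obtain n where n: "vle (of_nat p ^ n) c" using archimedean by blast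
 have "vle c (of_nat p ^ Suc n)" using nullD[OF \<open>null _\<close>, of "Suc n"] by auto
 hence "vle (of_nat p ^ n * 1) (of_nat p ^ n * of_nat p)" using vle_trans[OF n] by (simp add: mult.commute)
 hence "vle 1 (of_nat p)" using vle_mult_cancel[OF p_pow_neq_0] by blast
 thus False using p_nonunit by (simp add: nonunits_iff)
qed

lemma cau_const: "cau (%_. c)"
 by (simp add: cau_def)

lemma cau_common:
 assumes "cau x" "cau y"
 obtains M where "!!i j. i >= M ==> j >= M ==> vle (x i - x j) (of_nat p ^ n)"
  "!!i j. i >= M ==> j >= M ==> vle (y i - y j) (of_nat p ^ n')"
proof -
 obtain M where 1: "ALL i>=M. ALL j>=M. vle (x i - x j) (of_nat p ^ n)" using assms(1) unfolding cau_def by blast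
 obtain M' where 2: "ALL i>=M'. ALL j>=M'. vle (y i - y j) (of_nat p ^ n')" using assms(2) unfolding cau_def by blast
 show thesis by (rule that[of "max M M'"]) (use 1 2 in auto)
qed

lemma cau_add: assumes "cau x" "cau y" shows "cau (%i. x i + y i)"
 unfolding cau_def
proof
 fix n
 obtain M where M: "!!i j. i >= M ==> j >= M ==> vle (x i - x j) (of_nat p ^ n)"
  "!!i j. i >= M ==> j >= M ==> vle (y i - y j) (of_nat p ^ n)" by (rule cau_common[OF assms]) blast
 have "vle (x i + y i - (x j + y j)) (of_nat p ^ n)" if "i >= M" "j >= M" for i j
  using vle_add[OF M(1)[OF that] M(2)[OF that]] by (simp add: algebra_simps)
 thus "EX M. ALL i>=M. ALL j>=M. vle (x i + y i - (x j + y j)) (of_nat p ^ n)" by blast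
qed

lemma cau_uminus: "cau x ==> cau (%i. - x i)"
 unfolding cau_def by (metis minus_diff_minus vle_uminus)

lemma cau_diff: "cau x ==> cau y ==> cau (%i. x i - y i)"
 using cau_add[of x "%i. - y i"] cau_uminus[of y] by simp

lemma null_imp_cau: assumes "null x" shows "cau x"
 unfolding cau_def
proof
 fix n
 obtain M where "ALL i>=M. vle (x i) (of_nat p ^ n)" using nullD[OF assms] by blast
 thus "EX M. ALL i>=M. ALL j>=M. vle (x i - x j) (of_nat p ^ n)" by (blast intro: vle_diff)
qed

lemma cau_bounded:
 assumes "cau x" obtains m M where "!!i. i >= M ==> of_nat p ^ m * x i : A"
proof -
 obtain M where M: "ALL i>=M. ALL j>=M. vle (x i - x j) (of_nat p ^ 0)" using assms unfolding cau_def by blast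
 obtain m where m: "of_nat p ^ m * x M : A"
 proof (cases "x M = 0")
  case True thus ?thesis using that[of 0] in_0 by simp
 next
  case False
  then obtain m where "vle (of_nat p ^ m) (inverse (x M))" using archimedean by (metis nonzero_imp_inverse_nonzero)
  hence "of_nat p ^ m * x M : A" using False by (simp add: vle_iff divide_inverse)
  thus ?thesis by (rule that)
 qed
 have "of_nat p ^ m * x i : A" if "i >= M" for i
 proof -
  have "x i - x M : A" using M that by simp
  hence "of_nat p ^ m * x M + of_nat p ^ m * (x i - x M) : A" by (rule in_add[OF m in_mult[OF in_power[OF p_in]]])
  thus ?thesis by (simp add: algebra_simps)
 qed
 thus thesis using that by blast
qed

lemma null_mult_cau:
 assumes x: "null x" and y: "cau y" shows "null (%i. x i * y i)"
 unfolding null_def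
proof
 fix n
 obtain m M where m: "!!i. i >= M ==> of_nat p ^ m * y i : A" by (rule cau_bounded[OF y]) blast
 obtain M' where M': "!!i. i >= M' ==> vle (x i) (of_nat p ^ (n + m))" using nullD[OF x] by blast
 have "vle (x i * y i) (of_nat p ^ n)" if "i >= max M M'" for i
 proof -
  have "vle (x i * (of_nat p ^ m * y i)) (of_nat p ^ (n + m) * 1)"
   using M'[of i] m[of i] that by (intro vle_mult) auto
  hence "vle (of_nat p ^ m * (x i * y i)) (of_nat p ^ m * of_nat p ^ n)" by (simp add: power_add mult_ac)
  thus ?thesis using vle_mult_cancel[OF p_pow_neq_0] by blast
 qed
 thus "EX M. ALL i>=M. vle (x i * y i) (of_nat p ^ n)" by blast
qed

lemma cau_mult: assumes x: "cau x" and y: "cau y" shows "cau (%i. x i * y i)"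
 unfolding cau_def
proof
 fix n
 obtain m1 M1 where 1: "!!i. i >= M1 ==> of_nat p ^ m1 * x i : A" by (rule cau_bounded[OF x]) blast
 obtain m2 M2 where 2: "!!i. i >= M2 ==> of_nat p ^ m2 * y i : A" by (rule cau_bounded[OF y]) blast
 obtain M where M: "!!i j. i >= M ==> j >= M ==> vle (x i - x j) (of_nat p ^ (n + m2))"
  "!!i j. i >= M ==> j >= M ==> vle (y i - y j) (of_nat p ^ (n + m1))" by (rule cau_common[OF x y]) blast
 have "vle (x i * y i - x j * y j) (of_nat p ^ n)" if ij: "i >= max M (max M1 M2)" "j >= max M (max M1 M2)" for i j
 proof -
  have "vle ((of_nat p ^ m1 * x i) * (y i - y j)) (1 * of_nat p ^ (n + m1))"
   using ij 1 M by (intro vle_mult) auto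
  hence "vle (of_nat p ^ m1 * (x i * (y i - y j))) (of_nat p ^ m1 * of_nat p ^ n)" by (simp add: power_add mult_ac)
  hence a: "vle (x i * (y i - y j)) (of_nat p ^ n)" using vle_mult_cancel[OF p_pow_neq_0] by blast
  have "vle ((of_nat p ^ m2 * y j) * (x i - x j)) (1 * of_nat p ^ (n + m2))"
   using ij 2 M by (intro vle_mult) auto
  hence "vle (of_nat p ^ m2 * (y j * (x i - x j))) (of_nat p ^ m2 * of_nat p ^ n)" by (simp add: power_add mult_ac)
  hence b: "vle (y j * (x i - x j)) (of_nat p ^ n)" using vle_mult_cancel[OF p_pow_neq_0] by blast
  show ?thesis using vle_add[OF a b] by (simp add: algebra_simps)
 qed
 thus "EX M. ALL i>=M. ALL j>=M. vle (x i * y i - x j * y j) (of_nat p ^ n)" by blast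
qed

text \<open>Some late term exceeds \<open>p ^ m\<close>; once increments are below
  \<open>p ^ m\<close>, a later term dropping below it would force that term down too.\<close>

lemma cau_not_null:
 assumes x: "cau x" and n: "~ null x"
 obtains m M where "!!i. i >= M ==> vle (of_nat p ^ m) (x i)"
proof -
 obtain m where m: "!!M. EX i>=M. ~ vle (x i) (of_nat p ^ m)" using n unfolding null_def by blast
 obtain M where M: "ALL i>=M. ALL j>=M. vle (x i - x j) (of_nat p ^ m)" using x unfolding cau_def by blast
 obtain i0 where i0: "i0 >= M" "~ vle (x i0) (of_nat p ^ m)" using m by blast
 have "vle (of_nat p ^ m) (x i)" if "i >= M" for i
 proof (rule ccontr)
  assume "~ vle (of_nat p ^ m) (x i)"
  hence "vle (x i) (of_nat p ^ m)" using vle_linear by blast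
  moreover have "vle (x i - x i0) (of_nat p ^ m)" using M that i0 by blast
  ultimately have "vle (x i - (x i - x i0)) (of_nat p ^ m)" by (rule vle_diff)
  thus False using i0 by simp
 qed
 thus thesis using that by blast
qed

lemma cau_inverse:
 assumes x: "cau x" and n: "~ null x"
 shows "cau (%i. inverse (x i))" "null (%i. x i * inverse (x i) - 1)"
proof -
 obtain m M where m: "!!i. i >= M ==> vle (of_nat p ^ m) (x i)" by (rule cau_not_null[OF x n]) blast
 have nz: "x i ~= 0" if "i >= M" for i using m[OF that] p_pow_neq_0 by (metis vle_zero_right)
 have iv: "of_nat p ^ m * inverse (x i) : A" if "i >= M" for i
  using m[OF that] nz[OF that] by (simp add: vle_iff divide_inverse)
 show "cau (%i. inverse (x i))" unfolding cau_def
 proof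
  fix k
  obtain M' where M': "ALL i>=M'. ALL j>=M'. vle (x i - x j) (of_nat p ^ (k + m + m))"
   using x unfolding cau_def by blast
  have "vle (inverse (x i) - inverse (x j)) (of_nat p ^ k)" if ij: "i >= max M M'" "j >= max M M'" for i j
  proof -
   have "vle ((of_nat p ^ m * inverse (x i)) * (of_nat p ^ m * inverse (x j)) * (x j - x i)) (1 * of_nat p ^ (k + m + m))"
    using ij M' iv by (intro vle_mult) (auto intro: in_mult)
   moreover have "(of_nat p ^ m * inverse (x i)) * (of_nat p ^ m * inverse (x j)) * (x j - x i)
     = of_nat p ^ (m + m) * (inverse (x i) - inverse (x j))"
    using nz[of i] nz[of j] ij by (simp add: field_simps power_add)
   ultimately have "vle (of_nat p ^ (m + m) * (inverse (x i) - inverse (x j))) (1 * of_nat p ^ (k + m + m))"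
    by (simp only:)
   also have "1 * of_nat p ^ (k + m + m) = (of_nat p ^ (m + m) * of_nat p ^ k :: 'c)" by (simp add: power_add)
   finally have "vle (of_nat p ^ (m + m) * (inverse (x i) - inverse (x j))) (of_nat p ^ (m + m) * of_nat p ^ k)" .
   thus ?thesis using vle_mult_cancel[OF p_pow_neq_0] by blast
  qed
  thus "EX M. ALL i>=M. ALL j>=M. vle (inverse (x i) - inverse (x j)) (of_nat p ^ k)" by blast
 qed
 show "null (%i. x i * inverse (x i) - 1)"
  by (rule null_eventually[OF null_0, of M]) (use nz in auto)
qed

lemma null_mult_cases:
 assumes x: "cau x" and y: "cau y" and xy: "null (%i. x i * y i)" shows "null x | null y"
proof (rule ccontr)
 assume n: "~ (null x | null y)"
 have "null (%i. (x i * y i) * inverse (x i))"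
  using n by (intro null_mult_cau[OF xy] cau_inverse[OF x]) auto
 moreover have "null (%i. (x i * inverse (x i) - 1) * y i)"
  using n by (intro null_mult_cau[OF _ y] cau_inverse[OF x]) auto
 ultimately have "null (%i. (x i * y i) * inverse (x i) - (x i * inverse (x i) - 1) * y i)" by (rule null_diff)
 hence "null y" by (simp add: algebra_simps)
 thus False using n by blast
qed

lemma cau_prod: "(!!k. k : I ==> cau (f k)) ==> cau (%i. \<Prod>k\<in>I. f k i)"
 by (induction I rule: infinite_finite_induct) (auto intro: cau_const cau_mult)

lemma cau_power: "cau f ==> cau (%i. f i ^ n)"
 by (induction n) (auto intro: cau_const cau_mult)

lemma null_prod_cases:
 assumes "finite I" "!!k. k : I ==> cau (f k)" "null (%i. \<Prod>k\<in>I. f k i)"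
 shows "EX k:I. null (f k)"
 using assms
proof (induction I)
 case empty thus ?case using null_const[of 1] by simp
next
 case (insert k I)
 hence "null (%i. f k i * (\<Prod>k\<in>I. f k i))" by simp
 hence "null (f k) | null (%i. \<Prod>k\<in>I. f k i)" using insert by (intro null_mult_cases cau_prod) auto
 thus ?case using insert by auto
qed

lemma cau_null_diff: "cau x ==> null (%i. y i - x i) ==> cau y"
 using cau_add[of x "%i. y i - x i"] null_imp_cau by simp

lemma null_prod_diff:
 assumes "cau x" "cau y" "null (%i. x' i - x i)" "null (%i. y' i - y i)"
 shows "null (%i. x' i * y' i - x i * y i)"
proof -
 have "cau x'" using assms cau_null_diff by blast
 have "null (%i. (x' i - x i) * y i + (y' i - y i) * x' i)"
  using assms \<open>cau x'\<close> by (intro null_add null_mult_cau)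
 thus ?thesis by (simp add: algebra_simps)
qed

text \<open>Fractions whose denominators are powers of \<open>p\<close> are dense in
  \<open>F\<close>. They also lie in \<open>k\<close>, so passing from \<open>k\<close> to
  \<open>F\<close> does not enlarge the completion.\<close>

lemma F_approx:
 assumes "c : F" shows "EX m k. vle (c - of_int m / of_nat p ^ k) (of_nat p ^ n)"
proof (cases "c = 0")
 case True thus ?thesis by (intro exI[of _ 0]) simp
next
 case False
 then obtain k where k: "vle (of_nat p ^ k) (inverse c)" using archimedean by (metis nonzero_imp_inverse_nonzero)
 hence A: "of_nat p ^ k * c : A" using False by (simp add: vle_iff divide_inverse)
 obtain m where m: "vle (of_nat p ^ k * c - of_int m) (of_nat p ^ (n + k))"
  using approx_power[OF _ A] assms F_mult F_power F_of_nat by blast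
 have "of_nat p ^ k * c - of_int m = of_nat p ^ k * (c - of_int m / of_nat p ^ k)"
  using p_neq_0 by (simp add: algebra_simps)
 hence "vle (of_nat p ^ k * (c - of_int m / of_nat p ^ k)) (of_nat p ^ k * of_nat p ^ n)"
  using m by (simp add: power_add mult.commute)
 thus ?thesis using vle_mult_cancel[OF p_pow_neq_0] by blast
qed

end

lemma pointwise_cring:
 fixes Y :: "(nat => 'a::comm_ring_1) set"
 assumes "(%_. 1) : Y" "!!x y. x : Y ==> y : Y ==> (%i. x i + y i) : Y"
  "!!x y. x : Y ==> y : Y ==> (%i. x i * y i) : Y" "!!x. x : Y ==> (%i. - x i) : Y"
 shows "cring \<lparr>carrier = Y, monoid.mult = (%x y i. x i * y i), one = (%_. 1),
   ring.zero = (%_. 0), add = (%x y i. x i + y i)\<rparr>" (is "cring ?R")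
proof (rule cringI)
 have 0: "(%_. 0) : Y" using assms(2)[OF assms(1) assms(4)[OF assms(1)]] by simp
 show "abelian_group ?R"
 proof (rule abelian_groupI)
  fix x assume "x : carrier ?R"
  thus "EX y:carrier ?R. y \<oplus>\<^bsub>?R\<^esub> x = \<zero>\<^bsub>?R\<^esub>"
   using assms(4) by (intro bexI[of _ "%i. - x i"]) auto
 qed (use assms 0 in \<open>auto simp: algebra_simps\<close>)
 show "comm_monoid ?R" by (rule comm_monoidI) (use assms in \<open>auto simp: algebra_simps\<close>)
qed (auto simp: algebra_simps)

text \<open>Lets a ring whose operations are defined through chosen representatives inherit its laws
  from the ring of Cauchy sequences.\<close>

lemma surj_hom_imp_cring:
 fixes R :: "'b ring"
 assumes S: "cring S" and h: "h : ring_hom S R" "h ` carrier S = carrier R" "h \<zero>\<^bsub>S\<^esub> = \<zero>\<^bsub>R\<^esub>"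
 shows "cring R"
proof -
 interpret S: cring S by fact
 have eq: "R\<lparr>carrier := h ` carrier S, zero := h \<zero>\<^bsub>S\<^esub>\<rparr> = R"
  unfolding h(2,3) by (cases R) simp
 have ringR: "ring R"
  by (rule subst[OF eq, of "%R. ring R", OF S.ring_hom_imp_img_ring[OF h(1)]])
 have "x \<otimes>\<^bsub>R\<^esub> y = y \<otimes>\<^bsub>R\<^esub> x" if xy: "x : carrier R" "y : carrier R" for x y
 proof -
  obtain a b where ab: "a : carrier S" "b : carrier S" "x = h a" "y = h b" using xy h(2) by blast
  have "h a \<otimes>\<^bsub>R\<^esub> h b = h (a \<otimes>\<^bsub>S\<^esub> b)" by (rule ring_hom_mult[OF h(1) ab(1,2), symmetric])
  also have "... = h (b \<otimes>\<^bsub>S\<^esub> a)" using S.m_comm[OF ab(1,2)] by simp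
  also have "... = h b \<otimes>\<^bsub>R\<^esub> h a" by (rule ring_hom_mult[OF h(1) ab(2,1)])
  finally show ?thesis unfolding ab .
 qed
 hence "comm_monoid R" by (rule monoid.monoid_comm_monoidI[OF ring.is_monoid[OF ringR]])
 thus "cring R" by (rule cring.intro[OF ringR])
qed

lemma cring_imp_field:
 assumes "cring R" "\<one>\<^bsub>R\<^esub> ~= \<zero>\<^bsub>R\<^esub>"
  "!!x. x : carrier R ==> x ~= \<zero>\<^bsub>R\<^esub> ==> EX y:carrier R. x \<otimes>\<^bsub>R\<^esub> y = \<one>\<^bsub>R\<^esub>"
 shows "field R"
proof -
 interpret cring R by fact
 show ?thesis
 proof (rule cring_fieldI)
  show "Units R = carrier R - {\<zero>\<^bsub>R\<^esub>}"
  proof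
   show "Units R <= carrier R - {\<zero>\<^bsub>R\<^esub>}"
    using assms(2) by (auto simp: Units_def)
   show "carrier R - {\<zero>\<^bsub>R\<^esub>} <= Units R"
   proof
    fix x assume "x : carrier R - {\<zero>\<^bsub>R\<^esub>}"
    thus "x : Units R" using assms(3)[of x] by (auto simp: Units_def m_comm)
   qed
  qed
 qed
qed

section \<open>The completed Kummer field as a Galois extension of \<open>k_P\<close>\<close>

section \<open>The bicyclic local extension\<close>

context kummer
begin

text \<open>\<open>\<rho> ^ j\<close> divides \<open>p\<close> for \<open>j < N\<close>, which
  bounds all coordinates by the element up to the fixed factor \<open>p\<close>. Convergence is
  therefore coordinatewise convergence.\<close>

lemma p_crd_vle:
 assumes "x : kum_field" shows "vle (of_nat p * crd x i j) x"
proof (cases "i < N & j < N")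
 case True
 hence "\<rho> ^ N = \<rho> ^ (N - j) * \<rho> ^ j" by (simp flip: power_add)
 hence eq: "of_nat p * crd x i j = \<rho> ^ (N - j) * (crd x i j * \<rho> ^ j)" by (simp add: \<rho> mult_ac flip: \<rho>)
 show ?thesis unfolding eq by (rule vle_mult_left[OF in_power[OF \<rho>_in] crd_vle[OF assms]])
qed (use crd_outside[OF assms] in auto)

lemma p_cancel: "of_nat p * y * inverse (of_nat p) = (y :: 'c)"
 using p_neq_0 by (simp add: field_simps)

lemma null_crd:
 assumes x: "!!n. x n : kum_field"
 shows "null x \<longleftrightarrow> (ALL i<N. ALL j<N. null (%n. crd (x n) i j))"
proof (intro iffI allI impI)
 fix i j assume "null x"
 have "null (%n. of_nat p * crd (x n) i j)" by (rule null_vle[OF \<open>null x\<close>]) (rule p_crd_vle[OF x])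
 from null_mult_cau[OF this cau_const[of "inverse (of_nat p)"]]
 show "null (%n. crd (x n) i j)" by (simp add: p_cancel)
next
 assume *: "ALL i<N. ALL j<N. null (%n. crd (x n) i j)"
 have "null (%n. crd (x n) i j * (ups ^ i * \<rho> ^ j))" if "i < N" "j < N" for i j
  using * that by (intro null_mult_cau cau_const) auto
 hence "null (%n. \<Sum>i<N. \<Sum>j<N. crd (x n) i j * (ups ^ i * \<rho> ^ j))"
  by (intro null_sum) auto
 moreover have "(\<Sum>i<N. \<Sum>j<N. crd (x n) i j * (ups ^ i * \<rho> ^ j)) = x n" for n
  using kum_crd[OF x[of n]] by (simp add: kum_def mult.assoc)
 ultimately show "null x" by simp
qed

lemma null_kum_aut: "(!!n. x n : kum_field) ==> null x ==> null (%n. kum_aut al be (x n))"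
 by (rule null_vle[of x]) (auto intro: kum_aut_vle)

lemma cau_kum_aut:
 assumes x: "!!n. x n : kum_field" and "cau x" shows "cau (%n. kum_aut al be (x n))"
 unfolding cau_def
proof
 fix n
 obtain M where "ALL i>=M. ALL j>=M. vle (x i - x j) (of_nat p ^ n)" using assms(2) unfolding cau_def by blast
 hence "ALL i>=M. ALL j>=M. vle (kum_aut al be (x i - x j)) (of_nat p ^ n)"
  using kum_aut_vle[OF kum_field_diff[OF x x]] by blast
 thus "EX M. ALL i>=M. ALL j>=M. vle (kum_aut al be (x i) - kum_aut al be (x j)) (of_nat p ^ n)"
  by (simp only: kum_aut_diff[OF x x]) blast
qed

lemma cau_crd:
 assumes x: "!!n. x n : kum_field" and "cau x" shows "cau (%n. crd (x n) i j)"
proof -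
 have "cau (%n. of_nat p * crd (x n) i j)" unfolding cau_def
 proof
  fix n
  obtain M where M: "ALL i>=M. ALL j>=M. vle (x i - x j) (of_nat p ^ n)" using assms(2) unfolding cau_def by blast
  have "vle (of_nat p * crd (x k) i j - of_nat p * crd (x l) i j) (x k - x l)" for k l
   using p_crd_vle[OF kum_field_diff[OF x x], of k l i j] by (simp add: crd_diff[OF x x] right_diff_distrib)
  thus "EX M. ALL k>=M. ALL l>=M. vle (of_nat p * crd (x k) i j - of_nat p * crd (x l) i j) (of_nat p ^ n)"
   using M vle_trans by blast
 qed
 from cau_mult[OF this cau_const[of "inverse (of_nat p)"]] show ?thesis by (simp add: p_cancel)
qed

end

text \<open>Ties the place to a prime \<open>P\<close> of \<open>k\<close>: the
  \<open>P\<close>-adic neighbourhoods are those induced by \<open>A\<close>, and \<open>k\<close>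
  is embedded in \<open>F\<close>.\<close>

locale local_field = kummer A F p N \<zeta> ups \<rho> u
 for A :: "'k::field_char_0 alg_closure set" and F p N \<zeta> ups \<rho> u +
 fixes P :: "'k set"
 assumes adic: "x : adic_nbhd P n \<longleftrightarrow> vle (to_ac x) (of_nat p ^ n)"
  and to_ac_F: "to_ac x : F"
begin

lemma adic_Cauchy_iff: "x : adic_Cauchy P \<longleftrightarrow> cau (%i. to_ac (x i))"
 by (simp add: adic_Cauchy_def cau_def adic)

lemma adic_null_iff: "x : adic_null P \<longleftrightarrow> null (%i. to_ac (x i))"
 by (simp add: adic_null_def null_def adic)

lemma Cauchy_cring: "cring (Cauchy_ring P)"
 unfolding Cauchy_ring_def
 by (rule pointwise_cring) (auto simp: adic_Cauchy_iff cau_const intro: cau_add cau_mult cau_uminus)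

lemma Cauchy_uminus:
 assumes "x : adic_Cauchy P" shows "\<ominus>\<^bsub>Cauchy_ring P\<^esub> x = (%i. - x i)"
proof -
 interpret cring "Cauchy_ring P" by (rule Cauchy_cring)
 show ?thesis
  by (rule minus_equality)
    (use assms in \<open>auto simp: Cauchy_ring_def adic_Cauchy_iff intro: cau_uminus\<close>)
qed

lemma null_ideal: "ideal (adic_null P) (Cauchy_ring P)"
proof -
 interpret cring "Cauchy_ring P" by (rule Cauchy_cring)
 show ?thesis
 proof (rule idealI)
  show "ring (Cauchy_ring P)" by (rule ring_axioms)
  show "subgroup (adic_null P) (add_monoid (Cauchy_ring P))"
  proof (rule add.subgroupI)
   show "adic_null P <= carrier (Cauchy_ring P)"
    by (auto simp: Cauchy_ring_def adic_Cauchy_iff adic_null_iff null_imp_cau)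
   show "adic_null P ~= {}" using null_0 adic_null_iff[of "%_. 0"] by auto
   fix a assume a: "a : adic_null P"
   thus "\<ominus>\<^bsub>Cauchy_ring P\<^esub> a : adic_null P"
    by (subst Cauchy_uminus) (auto simp: adic_Cauchy_iff adic_null_iff null_imp_cau null_uminus)
   fix b assume "b : adic_null P"
   thus "a \<oplus>\<^bsub>Cauchy_ring P\<^esub> b : adic_null P" using a
    by (auto simp: Cauchy_ring_def adic_null_iff null_add)
  qed
  fix a x assume "a : adic_null P" "x : carrier (Cauchy_ring P)"
  thus "x \<otimes>\<^bsub>Cauchy_ring P\<^esub> a : adic_null P" "a \<otimes>\<^bsub>Cauchy_ring P\<^esub> x : adic_null P"
   by (auto simp: Cauchy_ring_def adic_null_iff adic_Cauchy_iff mult.commute[of "to_ac (x _)"] intro!: null_mult_cau)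
 qed
qed

text \<open>The class of a sequence modulo null sequences, written as a set in the same shape as the
  coordinate cosets of \<open>q\<close>.\<close>

definition kap :: "(nat => 'k) => 'k completion" where
 "kap x = {z. null (%i. to_ac (z i) - to_ac (x i))}"

lemma coset_eq_kap:
 shows "adic_null P +>\<^bsub>Cauchy_ring P\<^esub> x = kap x"
proof (intro equalityI subsetI)
 fix z assume "z : adic_null P +>\<^bsub>Cauchy_ring P\<^esub> x"
 thus "z : kap x" by (auto simp: a_r_coset_def' Cauchy_ring_def kap_def adic_null_iff)
next
 fix z assume "z : kap x"
 thus "z : adic_null P +>\<^bsub>Cauchy_ring P\<^esub> x"
  by (auto simp: a_r_coset_def' Cauchy_ring_def kap_def adic_null_iff intro!: bexI[of _ "%i. z i - x i"])
qed

lemma kap_eq_iff: "kap x = kap y \<longleftrightarrow> null (%i. to_ac (x i) - to_ac (y i))"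
proof
 assume "kap x = kap y"
 moreover have "x : kap x" using null_0 by (simp add: kap_def)
 ultimately show "null (%i. to_ac (x i) - to_ac (y i))" by (simp add: kap_def)
next
 assume n: "null (%i. to_ac (x i) - to_ac (y i))"
 have "null (%i. to_ac (z i) - to_ac (x i)) \<longleftrightarrow> null (%i. to_ac (z i) - to_ac (y i))" for z
  using null_add[OF _ n, of "%i. to_ac (z i) - to_ac (x i)"] null_diff[OF _ n, of "%i. to_ac (z i) - to_ac (y i)"] by auto
 thus "kap x = kap y" by (simp add: kap_def)
qed

lemma comp_carrier: "carrier (completion P) = kap ` adic_Cauchy P"
 unfolding completion_def FactRing_def A_RCOSETS_def' coset_eq_kap by (auto simp: Cauchy_ring_def)

lemma kap_hom: "kap : ring_hom (Cauchy_ring P) (completion P)"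
proof -
 have "kap = (+>\<^bsub>Cauchy_ring P\<^esub>) (adic_null P)" by (rule ext) (simp add: coset_eq_kap)
 thus ?thesis using ideal.rcos_ring_hom[OF null_ideal] by (simp add: completion_def)
qed

lemma kap_carrier: "x : adic_Cauchy P ==> kap x : carrier (completion P)"
 by (simp add: comp_carrier)

lemma comp_one: "\<one>\<^bsub>completion P\<^esub> = kap (%_. 1)"
 using ring_hom_one[OF kap_hom] by (simp add: Cauchy_ring_def)

lemma comp_zero: "\<zero>\<^bsub>completion P\<^esub> = kap (%_. 0)"
 by (simp add: completion_def FactRing_def kap_def) (auto simp: adic_null_iff)

lemma comp_add:
 "x : adic_Cauchy P ==> y : adic_Cauchy P ==> kap x \<oplus>\<^bsub>completion P\<^esub> kap y = kap (%i. x i + y i)"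
 using ring_hom_add[OF kap_hom, of x y] by (simp add: Cauchy_ring_def)

lemma comp_mult:
 "x : adic_Cauchy P ==> y : adic_Cauchy P ==> kap x \<otimes>\<^bsub>completion P\<^esub> kap y = kap (%i. x i * y i)"
 using ring_hom_mult[OF kap_hom, of x y] by (simp add: Cauchy_ring_def)

lemma to_completion_eq: "to_completion P a = kap (%_. a)"
 by (simp add: to_completion_def coset_eq_kap)

lemma completion_field: "field (completion P)"
proof (rule cring_imp_field)
 show "cring (completion P)" unfolding completion_def
  by (rule ideal.quotient_is_cring[OF null_ideal Cauchy_cring])
 show "\<one>\<^bsub>completion P\<^esub> ~= \<zero>\<^bsub>completion P\<^esub>"
  using null_const[of 1] by (auto simp: comp_one comp_zero kap_eq_iff)
 fix a assume "a : carrier (completion P)" "a ~= \<zero>\<^bsub>completion P\<^esub>"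
 then obtain x where x: "a = kap x" "x : adic_Cauchy P" by (auto simp: comp_carrier)
 moreover have "~ null (%i. to_ac (x i))"
  using \<open>a ~= \<zero>\<^bsub>completion P\<^esub>\<close> kap_eq_iff[of x "%_. 0"] by (simp add: comp_zero x(1))
 ultimately have x: "a = kap x" "x : adic_Cauchy P" "~ null (%i. to_ac (x i))" by blast+
 have c: "cau (%i. to_ac (x i))" using x by (simp add: adic_Cauchy_iff)
 define y where "y = (%i. inverse (x i))"
 have y: "y : adic_Cauchy P" using cau_inverse(1)[OF c x(3)] by (simp add: y_def adic_Cauchy_iff)
 have "a \<otimes>\<^bsub>completion P\<^esub> kap y = \<one>\<^bsub>completion P\<^esub>"
  using cau_inverse(2)[OF c x(3)] x y by (simp add: comp_mult comp_one kap_eq_iff) (simp add: y_def)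
 thus "EX b:carrier (completion P). a \<otimes>\<^bsub>completion P\<^esub> b = \<one>\<^bsub>completion P\<^esub>"
  using kap_carrier[OF y] by blast
qed

lemma F_seq_approx:
 assumes "!!n. c n : F" shows "EX z :: nat => 'k. null (%n. to_ac (z n) - c n)"
proof -
 have "EX z::'k. vle (c n - to_ac z) (of_nat p ^ n)" for n
 proof -
  obtain m k where "vle (c n - of_int m / of_nat p ^ k) (of_nat p ^ n)" using F_approx[OF assms] by blast
  thus ?thesis by (intro exI[of _ "of_int m / of_nat p ^ k"]) simp
 qed
 then obtain z :: "nat => 'k" where z: "!!n. vle (c n - to_ac (z n)) (of_nat p ^ n)" by metis
 have "null (%n. to_ac (z n) - c n)" unfolding null_def
 proof
  fix m
  have "vle (to_ac (z i) - c i) (of_nat p ^ m)" if "i >= m" for i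
   using vle_trans[OF z[of i] p_pow_mono[OF that]] by (simp add: vle_diff_commute)
  thus "EX M. ALL i>=M. vle (to_ac (z i) - c i) (of_nat p ^ m)" by blast
 qed
 thus ?thesis by blast
qed

text \<open>A sequence is encoded by the cosets of its coordinates; this puts the completed extension on
  the prescribed element type.\<close>

definition q :: "(nat => 'k alg_closure) => 'k local_ext_elem" where
 "q x = map (%(i, j). {z. null (%n. to_ac (z n) - crd (x n) i j)}) (List.product [0..<N] [0..<N])"

lemma q_eq_iff:
 assumes x: "!!n. x n : kum_field" and y: "!!n. y n : kum_field"
 shows "q x = q y \<longleftrightarrow> null (%n. x n - y n)"
proof -
 have set_eq: "{z. null (%n. to_ac (z n) - c n)} = {z. null (%n. to_ac (z n) - d n)} \<longleftrightarrow> null (%n. c n - d n)"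
  if c: "!!n. c n : F" for c d
 proof
  assume eq: "{z. null (%n. to_ac (z n) - c n)} = {z. null (%n. to_ac (z n) - d n)}"
  obtain z :: "nat => 'k" where z: "null (%n. to_ac (z n) - c n)" using F_seq_approx[of c] c by blast
  hence "null (%n. to_ac (z n) - d n)" using eq by blast
  from null_diff[OF this z] show "null (%n. c n - d n)" by simp
 next
  assume n: "null (%n. c n - d n)"
  have "null (%i. to_ac (z i) - c i) \<longleftrightarrow> null (%i. to_ac (z i) - d i)" for z :: "nat => 'k"
   using null_add[OF _ n, of "%i. to_ac (z i) - c i"] null_diff[OF _ n, of "%i. to_ac (z i) - d i"] by auto
  thus "{z. null (%n. to_ac (z n) - c n)} = {z. null (%n. to_ac (z n) - d n)}" by simp
 qed
 have "q x = q y \<longleftrightarrow> (ALL i<N. ALL j<N. null (%n. crd (x n) i j - crd (y n) i j))"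
  unfolding q_def map_eq_conv using set_eq[OF crd_F[OF x]] by auto
 also have "... \<longleftrightarrow> null (%n. x n - y n)"
  by (subst null_crd[OF kum_field_diff[OF x y]]) (simp add: crd_diff[OF x y])
 finally show ?thesis .
qed

definition CS :: "(nat => 'k alg_closure) set" where
 "CS = {x. cau x & (ALL n. x n : kum_field)}"

lemma CS_D: "x : CS ==> cau x" "x : CS ==> x n : kum_field"
 by (auto simp: CS_def)

lemma CS_const: "c : kum_field ==> (%_. c) : CS"
 and CS_add: "x : CS ==> y : CS ==> (%n. x n + y n) : CS"
 and CS_diff: "x : CS ==> y : CS ==> (%n. x n - y n) : CS"
 and CS_mult: "x : CS ==> y : CS ==> (%n. x n * y n) : CS"
 and CS_uminus: "x : CS ==> (%n. - x n) : CS"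
 and CS_aut: "x : CS ==> (%n. kum_aut al be (x n)) : CS"
 using kum_field_diff[OF kum_field_0]
 by (auto simp: CS_def cau_const cau_add cau_diff cau_mult cau_uminus cau_kum_aut kum_aut_in
   kum_field_add kum_field_diff kum_field_mult)

lemma CS_F: "(!!n. c n : F) ==> cau c ==> c : CS"
 by (simp add: CS_def F_subset_kum_field)

lemma CS_to_ac: "z : adic_Cauchy P ==> (%n. to_ac (z n)) : CS"
 by (rule CS_F) (simp_all add: to_ac_F adic_Cauchy_iff)

lemma q_eq: "x : CS ==> y : CS ==> q x = q y \<longleftrightarrow> null (%n. x n - y n)"
 by (rule q_eq_iff) (auto simp: CS_def)

definition rep :: "'k local_ext_elem => nat => 'k alg_closure" where
 "rep a = (SOME x. x : CS & q x = a)"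

lemma rep: "x : CS ==> rep (q x) : CS & q (rep (q x)) = q x"
 unfolding rep_def by (rule someI[of "%x'. x' : CS & q x' = q x" x]) simp

lemma rep_null: "x : CS ==> null (%n. rep (q x) n - x n)"
 using rep[of x] q_eq[of "rep (q x)" x] by blast

text \<open>Classes of Cauchy sequences in the Kummer field, each encoded by \<open>q\<close>. The
  operations use chosen representatives; \<open>Lp_mult\<close> and \<open>Lp_add\<close> show that
  the choice does not matter.\<close>

definition Lp :: "'k local_ext_elem ring" where
 "Lp = \<lparr>carrier = q ` CS, monoid.mult = (%a b. q (%n. rep a n * rep b n)), one = q (%_. 1),
   ring.zero = q (%_. 0), add = (%a b. q (%n. rep a n + rep b n))\<rparr>"

lemma Lp_carrier: "carrier Lp = q ` CS" and Lp_one: "\<one>\<^bsub>Lp\<^esub> = q (%_. 1)" and Lp_zero: "\<zero>\<^bsub>Lp\<^esub> = q (%_. 0)"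
 by (simp_all add: Lp_def)

lemma q_in: "x : CS ==> q x : carrier Lp"
 by (simp add: Lp_def)

lemma Lp_mult:
 assumes "x : CS" "y : CS" shows "q x \<otimes>\<^bsub>Lp\<^esub> q y = q (%n. x n * y n)"
proof -
 have "q (%n. rep (q x) n * rep (q y) n) = q (%n. x n * y n)"
  using assms rep[OF assms(1)] rep[OF assms(2)]
  by (subst q_eq) (auto intro!: CS_mult null_prod_diff rep_null CS_D(1))
 thus ?thesis by (simp add: Lp_def)
qed

lemma Lp_add:
 assumes "x : CS" "y : CS" shows "q x \<oplus>\<^bsub>Lp\<^esub> q y = q (%n. x n + y n)"
proof -
 have "null (%n. (rep (q x) n - x n) + (rep (q y) n - y n))"
  using assms by (intro null_add rep_null)
 hence "q (%n. rep (q x) n + rep (q y) n) = q (%n. x n + y n)"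
  using assms rep[OF assms(1)] rep[OF assms(2)]
  by (subst q_eq) (auto intro!: CS_add simp: algebra_simps)
 thus ?thesis by (simp add: Lp_def)
qed

lemma kum_1: "1 : kum_field"
 by (rule F_subset_kum_field[OF F_1])

lemma Lp_cring: "cring Lp"
proof -
 let ?S = "\<lparr>carrier = CS, monoid.mult = (%x y i. x i * y i), one = (%_. 1),
   ring.zero = (%_. 0), add = (%x y i. x i + y i)\<rparr>"
 have "cring ?S" by (rule pointwise_cring) (auto intro: CS_const kum_1 CS_add CS_mult CS_uminus)
 moreover have "q : ring_hom ?S Lp"
  by (rule ring_hom_memI) (auto simp: q_in Lp_mult Lp_add Lp_one)
 ultimately show ?thesis by (rule surj_hom_imp_cring) (auto simp: Lp_carrier Lp_zero)
qed

lemma q_zero_iff: "x : CS ==> q x = \<zero>\<^bsub>Lp\<^esub> \<longleftrightarrow> null x"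
 using q_eq[of x "%_. 0"] CS_const[OF kum_field_0] by (simp add: Lp_zero)

lemma Lp_field: "field Lp"
proof (rule cring_imp_field[OF Lp_cring])
 show "\<one>\<^bsub>Lp\<^esub> ~= \<zero>\<^bsub>Lp\<^esub>"
  using null_const[of 1] q_zero_iff[OF CS_const[OF kum_1]] by (auto simp: Lp_one)
 fix a assume "a : carrier Lp" "a ~= \<zero>\<^bsub>Lp\<^esub>"
 then obtain x where x: "a = q x" "x : CS" "~ null x" by (auto simp: Lp_carrier q_zero_iff)
 have c: "cau x" using x CS_D by blast
 have y: "(%n. inverse (x n)) : CS"
  using cau_inverse(1)[OF c x(3)] CS_D(2)[OF x(2)] subfield_set_inverse[OF kum_field_subfield] by (simp add: CS_def)
 have "a \<otimes>\<^bsub>Lp\<^esub> q (%n. inverse (x n)) = \<one>\<^bsub>Lp\<^esub>"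
  using cau_inverse(2)[OF c x(3)] q_eq[OF CS_mult[OF x(2) y] CS_const[OF kum_1]]
  by (simp add: x(1) Lp_mult[OF x(2) y] Lp_one)
 thus "EX b:carrier Lp. a \<otimes>\<^bsub>Lp\<^esub> b = \<one>\<^bsub>Lp\<^esub>" using q_in[OF y] by blast
qed

definition nu :: "'k completion => 'k local_ext_elem" where
 "nu c = q (%n. to_ac ((SOME z. z : adic_Cauchy P & kap z = c) n))"

lemma nu_kap:
 assumes "z : adic_Cauchy P" shows "nu (kap z) = q (%n. to_ac (z n))"
proof -
 define z' where "z' = (SOME z'. z' : adic_Cauchy P & kap z' = kap z)"
 have z': "z' : adic_Cauchy P & kap z' = kap z" 
  unfolding z'_def by (rule someI[of "%z'. z' : adic_Cauchy P & kap z' = kap z" z]) (simp add: assms)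
 hence "q (%n. to_ac (z' n)) = q (%n. to_ac (z n))"
  using assms by (subst q_eq) (auto intro: CS_to_ac simp: kap_eq_iff)
 thus ?thesis by (simp add: nu_def z'_def)
qed

lemma nu_hom: "nu : ring_hom (completion P) Lp"
proof (rule ring_hom_memI)
 have mult: "(%i. x i * y i) : adic_Cauchy P" and add: "(%i. x i + y i) : adic_Cauchy P"
  if "x : adic_Cauchy P" "y : adic_Cauchy P" for x y
  using that by (auto simp: adic_Cauchy_iff cau_mult cau_add)
 fix a assume "a : carrier (completion P)"
 then obtain x where x: "a = kap x" "x : adic_Cauchy P" by (auto simp: comp_carrier)
 show "nu a : carrier Lp" using x by (simp add: nu_kap q_in CS_to_ac)
 fix b assume "b : carrier (completion P)"
 then obtain y where y: "b = kap y" "y : adic_Cauchy P" by (auto simp: comp_carrier)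
 show "nu (a \<otimes>\<^bsub>completion P\<^esub> b) = nu a \<otimes>\<^bsub>Lp\<^esub> nu b"
  using x y by (simp add: comp_mult nu_kap mult Lp_mult CS_to_ac)
 show "nu (a \<oplus>\<^bsub>completion P\<^esub> b) = nu a \<oplus>\<^bsub>Lp\<^esub> nu b"
  using x y by (simp add: comp_add nu_kap add Lp_add CS_to_ac)
next
 have "(%_. 1) : adic_Cauchy P" by (simp add: adic_Cauchy_iff cau_const)
 thus "nu \<one>\<^bsub>completion P\<^esub> = \<one>\<^bsub>Lp\<^esub>" by (simp add: comp_one nu_kap Lp_one)
qed

lemma field_ext_nu: "field_ext (completion P) Lp nu"
 by (simp add: field_ext_def completion_field Lp_field nu_hom)

text \<open>A Cauchy sequence in \<open>F\<close> differs by a null sequence from one in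
  \<open>k\<close>; so coordinates in \<open>F\<close> represent elements of
  \<open>k_P\<close>.\<close>

lemma F_seq_in_nu:
 assumes "!!n. c n : F" "cau c" shows "q c : nu ` carrier (completion P)"
proof -
 obtain z :: "nat => 'k" where z: "null (%n. to_ac (z n) - c n)" using F_seq_approx[of c] assms(1) by blast
 have zC: "z : adic_Cauchy P" unfolding adic_Cauchy_iff by (rule cau_null_diff[OF assms(2) z])
 have "q (%n. to_ac (z n)) = q c" using z by (simp add: q_eq CS_to_ac[OF zC] CS_F[OF assms])
 hence "q c = nu (kap z)" using nu_kap[OF zC] by simp
 thus ?thesis using kap_carrier[OF zC] by blast
qed

end

context kummer
begin

lemma \<zeta>_pow_eq_iff: "a < N ==> b < N ==> \<zeta> ^ a = \<zeta> ^ b \<longleftrightarrow> a = b"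
proof (induction a b rule: linorder_wlog)
 case (le a b)
 show ?case
 proof
  assume eq: "\<zeta> ^ a = \<zeta> ^ b"
  have "\<zeta> ~= 0" using \<zeta>_N N by (metis power_0_left less_irrefl zero_neq_one)
  moreover have "\<zeta> ^ b = \<zeta> ^ a * \<zeta> ^ (b - a)" using le by (simp flip: power_add)
  ultimately have "\<zeta> ^ (b - a) = 1" using eq by simp
  moreover have "b - a < N" using le by linarith
  ultimately have "~ (0 < b - a)" using \<zeta>_unit[of "b - a"] nonunits_0 by auto
  thus "a = b" using le by simp
 qed simp
qed (simp add: eq_commute)

lemma \<zeta>_pow_mod: "\<zeta> ^ (a mod N) = \<zeta> ^ a"
proof -
 have "\<zeta> ^ a = \<zeta> ^ (N * (a div N) + a mod N)" by simp
 also have "... = \<zeta> ^ (a mod N)" by (simp only: power_add power_mult \<zeta>_N power_one mult_1)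
 finally show ?thesis by simp
qed

text \<open>Both sides are monic of degree \<open>N\<close> in \<open>x\<close>, so their difference
  has degree below \<open>N\<close>, yet it vanishes at the \<open>N\<close> points
  \<open>\<zeta> ^ a * y\<close>. These are distinct only for \<open>y ~= 0\<close>, whence the case
  distinction.\<close>

lemma prod_roots_of_unity: "(\<Prod>a<N. x - \<zeta> ^ a * y) = x ^ N - y ^ N"
proof -
 define d where "d = (\<Prod>a<N. [:- (\<zeta> ^ a * y), 1:]) - (monom 1 N - [:y ^ N:])"
 show ?thesis
 proof (cases "y = 0")
  case True thus ?thesis using N by (simp add: power_0_left)
 next
  case False
  have "coeff d i = 0" if "i >= N" for i
  proof -
   have dP: "degree (\<Prod>a<N. [:- (\<zeta> ^ a * y), 1:]) = N"
    by (subst degree_prod_eq_sum_degree) auto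
   have lP: "lead_coeff (\<Prod>a<N. [:- (\<zeta> ^ a * y), 1:]) = 1" by (simp add: lead_coeff_prod)
   show ?thesis
    using that dP lP N by (cases "i = N") (auto simp: d_def coeff_eq_0 coeff_pCons split: nat.split)
  qed
  hence deg: "d ~= 0 ==> degree d < N" by (metis leading_coeff_0_iff not_less)
  have "d = 0"
  proof (rule ccontr)
   assume d0: "d ~= 0"
   have "(%a. \<zeta> ^ a * y) ` {..<N} <= {x. poly d x = 0}"
   proof
    fix x assume "x : (%a. \<zeta> ^ a * y) ` {..<N}"
    then obtain a where a: "a < N" "x = \<zeta> ^ a * y" by blast
    have "(\<zeta> ^ a) ^ N = 1" using \<zeta>_N by (metis mult.commute power_mult power_one)
    hence "x ^ N = y ^ N" by (simp add: a power_mult_distrib)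
    moreover have "poly (\<Prod>a<N. [:- (\<zeta> ^ a * y), 1:]) x = 0" using a by (auto simp: poly_prod prod_zero_iff)
    ultimately show "x : {x. poly d x = 0}" by (simp add: d_def poly_monom)
   qed
   moreover have "card ((%a. \<zeta> ^ a * y) ` {..<N}) = N"
    using False \<zeta>_pow_eq_iff by (subst card_image) (auto simp: inj_on_def)
   ultimately have "N <= card {x. poly d x = 0}" using poly_roots_finite[OF d0] card_mono by metis
   also have "... <= degree d" by (rule card_poly_roots_bound[OF d0])
   finally show False using deg[OF d0] by simp
  qed
  hence "poly (\<Prod>a<N. [:- (\<zeta> ^ a * y), 1:]) x = poly (monom 1 N - [:y ^ N:]) x" by (simp add: d_def)
  thus ?thesis by (simp add: poly_prod poly_monom)
 qed
qed

end

context local_field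
begin

definition sg :: "nat => nat => 'k local_ext_elem => 'k local_ext_elem" where
 "sg al be a = q (%n. kum_aut al be (rep a n))"

lemma sg_q:
 assumes x: "x : CS" shows "sg al be (q x) = q (%n. kum_aut al be (x n))"
proof -
 have r: "rep (q x) : CS" using rep[OF x] by blast
 have "null (%n. kum_aut al be (rep (q x) n - x n))"
  using r x by (intro null_kum_aut rep_null kum_field_diff CS_D(2))
 thus ?thesis unfolding sg_def using r x
  by (subst q_eq) (auto intro: CS_aut simp: kum_aut_diff CS_D(2))
qed

lemma sg_in: "a : carrier Lp ==> sg al be a : carrier Lp"
 by (auto simp: Lp_carrier sg_q CS_aut)

lemma sg_mult: "a : carrier Lp ==> b : carrier Lp ==> sg al be (a \<otimes>\<^bsub>Lp\<^esub> b) = sg al be a \<otimes>\<^bsub>Lp\<^esub> sg al be b"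
 by (auto simp: Lp_carrier Lp_mult sg_q CS_mult CS_aut kum_aut_mult CS_D(2))

lemma sg_add: "a : carrier Lp ==> b : carrier Lp ==> sg al be (a \<oplus>\<^bsub>Lp\<^esub> b) = sg al be a \<oplus>\<^bsub>Lp\<^esub> sg al be b"
 by (auto simp: Lp_carrier Lp_add sg_q CS_add CS_aut kum_aut_add CS_D(2))

lemma sg_one: "sg al be \<one>\<^bsub>Lp\<^esub> = \<one>\<^bsub>Lp\<^esub>"
 by (simp add: Lp_one sg_q CS_const kum_1 kum_aut_const F_1)

lemma sg_sg: "a : carrier Lp ==> sg al be (sg \<gamma> \<delta> a) = sg (al + \<gamma>) (be + \<delta>) a"
 by (auto simp: Lp_carrier sg_q CS_aut kum_aut_kum_aut CS_D(2))

lemma sg_N: "a : carrier Lp ==> sg (N * al) (N * be) a = a"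
 by (auto simp: Lp_carrier sg_q kum_aut_N CS_D(2))

lemma sg_nu: "c : carrier (completion P) ==> sg al be (nu c) = nu c"
 by (auto simp: comp_carrier nu_kap sg_q CS_to_ac kum_aut_const to_ac_F)

lemma sg_bij: "bij_betw (sg al be) (carrier Lp) (carrier Lp)"
proof (rule bij_betw_byWitness[of _ "sg ((N - 1) * al) ((N - 1) * be)"])
 have "(N - 1) * \<gamma> + \<gamma> = N * \<gamma>" for \<gamma> using N by (cases N) auto
 thus "ALL a:carrier Lp. sg ((N - 1) * al) ((N - 1) * be) (sg al be a) = a"
  "ALL a:carrier Lp. sg al be (sg ((N - 1) * al) ((N - 1) * be) a) = a"
  by (simp_all add: sg_sg sg_N add.commute[of al] add.commute[of be])
qed (auto intro: sg_in)

text \<open>Restricted to the carrier because elements of the Galois group must be extensional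
  functions.\<close>

definition aut :: "nat => nat => 'k local_ext_elem => 'k local_ext_elem" where
 "aut al be = restrict (sg al be) (carrier Lp)"

abbreviation Gal :: "('k local_ext_elem => 'k local_ext_elem) monoid" where
 "Gal \<equiv> galois_group (completion P) Lp nu"

lemma Gal_iff: "\<sigma> : carrier Gal \<longleftrightarrow> \<sigma> : Bij (carrier Lp) & \<sigma> : ring_iso Lp Lp
  & (ALL c:carrier (completion P). \<sigma> (nu c) = nu c)"
 by (auto simp: galois_group_def)

lemma nu_in: "c : carrier (completion P) ==> nu c : carrier Lp"
 using nu_hom by (rule ring_hom_closed)

lemma aut_Gal: "aut al be : carrier Gal"
proof -
 interpret field Lp by (rule Lp_field)
 have b: "bij_betw (aut al be) (carrier Lp) (carrier Lp)"
  using sg_bij unfolding aut_def by (simp add: bij_betw_def inj_on_def image_def)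
 have "aut al be : ring_hom Lp Lp"
  by (rule ring_hom_memI) (auto simp: aut_def sg_in sg_mult sg_add sg_one)
 hence "aut al be : ring_iso Lp Lp" using b by (simp add: ring_iso_def)
 moreover have "aut al be : Bij (carrier Lp)" using b by (auto simp: Bij_def aut_def)
 ultimately show ?thesis unfolding Gal_iff by (auto simp: aut_def sg_nu nu_in)
qed

text \<open>Invariance leaves \<open>crd (x n) i j\<close> times
  \<open>\<zeta> ^ (al * i + be * j) - 1\<close> null. For \<open>(i, j) ~= (0, 0)\<close> suitable
  exponents make the second factor a nonzero constant, so only the coordinate \<open>(0, 0)\<close>,
  a sequence in \<open>F\<close>, remains.\<close>

lemma fixed_imp_nu:
 assumes a: "a : carrier Lp" and inv: "!!al be. sg al be a = a"
 shows "a : nu ` carrier (completion P)"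
proof -
 obtain x where x: "a = q x" "x : CS" using a by (auto simp: Lp_carrier)
 have nul: "null (%n. crd (x n) i j * (\<zeta> ^ (al * i + be * j) - 1))" for al be i j
 proof -
  have "null (%n. kum_aut al be (x n) - x n)" using inv[of al be] x by (simp add: sg_q q_eq CS_aut)
  moreover have k: "kum_aut al be (x n) - x n : kum_field" for n
   using x by (intro kum_field_diff kum_aut_in CS_D(2))
  ultimately have "ALL i<N. ALL j<N. null (%n. crd (kum_aut al be (x n) - x n) i j)" by (simp add: null_crd)
  moreover have "crd (kum_aut al be (x n) - x n) i j = crd (x n) i j * (\<zeta> ^ (al * i + be * j) - 1)" for n i j
   using x by (simp add: crd_diff crd_kum_aut kum_aut_in CS_D(2) algebra_simps)
  ultimately have "ALL i<N. ALL j<N. null (%n. crd (x n) i j * (\<zeta> ^ (al * i + be * j) - 1))" by simp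
  thus ?thesis using crd_outside[OF CS_D(2)[OF x(2)]] null_0 by (cases "i < N & j < N") auto
 qed
 have zero: "null (%n. crd (x n) i j)" if ij: "i < N" "j < N" "(i, j) ~= (0, 0)" for i j
 proof -
  obtain al be where ne: "\<zeta> ^ (al * i + be * j) - 1 ~= 0"
  proof (cases "i = 0")
   case True
   hence "\<zeta> ^ j ~= \<zeta> ^ 0" using ij N by (subst \<zeta>_pow_eq_iff) auto
   thus thesis using that[of 0 1] by simp
  next
   case False
   hence "\<zeta> ^ i ~= \<zeta> ^ 0" using ij N by (subst \<zeta>_pow_eq_iff) auto
   thus thesis using that[of 1 0] by simp
  qed
  from null_mult_cau[OF nul[of i j al be] cau_const[of "inverse (\<zeta> ^ (al * i + be * j) - 1)"]]
  show ?thesis using ne by (simp add: mult.assoc)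
 qed
 define c where "c = (%n. crd (x n) 0 0)"
 have cF: "c n : F" for n using crd_F[OF CS_D(2)[OF x(2)]] by (simp add: c_def)
 have cc: "cau c" unfolding c_def by (rule cau_crd[OF CS_D(2)[OF x(2)] CS_D(1)[OF x(2)]])
 have "null (%n. x n - c n)"
 proof (subst null_crd)
  show "x n - c n : kum_field" for n using x cF by (intro kum_field_diff CS_D(2) F_subset_kum_field)
  have "crd (x n - c n) i j = (if i = 0 & j = 0 then 0 else crd (x n) i j)" for n i j
   using x cF by (simp add: crd_diff CS_D(2) F_subset_kum_field crd_const c_def)
  moreover have "null (%n. if i = 0 & j = 0 then 0 else crd (x n) i j)" if "i < N" "j < N" for i j
   using zero[OF that] null_0 by (cases "i = 0 & j = 0") auto
  ultimately show "ALL i<N. ALL j<N. null (%n. crd (x n - c n) i j)" by simp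
 qed
 hence "q x = q c" using q_eq[OF x(2) CS_F[OF cF cc]] by simp
 thus ?thesis using F_seq_in_nu[OF cF cc] x(1) by simp
qed

text \<open>The induction principle for \<open>Lp\<close>, used both to exhibit a finite spanning
  list and to show that an automorphism is determined by its values at \<open>ups\<close> and
  \<open>\<rho>\<close>.\<close>

lemma q_span:
 assumes mono: "!!c i j. (!!n. c n : F) ==> cau c ==> i < N ==> j < N ==> q (%n. c n * ups ^ i * \<rho> ^ j) : Y"
  and add: "!!a b. a : Y ==> b : Y ==> a \<oplus>\<^bsub>Lp\<^esub> b : Y"
 shows "carrier Lp <= Y"
proof
 fix a assume "a : carrier Lp"
 then obtain x where x: "a = q x" "x : CS" by (auto simp: Lp_carrier)
 note xk = CS_D(2)[OF x(2)]
 have zero: "q (%_. 0) : Y" using mono[of "%_. 0" 0 0] N F_0 cau_const by simp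
 have sum: "q (%n. \<Sum>k\<in>I. f k n) : Y & (%n. \<Sum>k\<in>I. f k n) : CS"
  if "!!k. k : I ==> q (f k) : Y & f k : CS" "finite I" for I :: "nat set" and f
  using that(2,1)
 proof (induction I)
  case empty thus ?case using zero CS_const[OF kum_field_0] by simp
 next
  case (insert k I)
  thus ?case using add[of "q (f k)" "q (%n. \<Sum>k\<in>I. f k n)"] Lp_add[of "f k" "%n. \<Sum>k\<in>I. f k n"]
   CS_add[of "f k" "%n. \<Sum>k\<in>I. f k n"] by auto
 qed
 have "q (%n. crd (x n) i j * ups ^ i * \<rho> ^ j) : Y & (%n. crd (x n) i j * ups ^ i * \<rho> ^ j) : CS"
  if "i < N" "j < N" for i j
  using mono[OF crd_F[OF xk] cau_crd[OF xk CS_D(1)[OF x(2)]] that]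
   cau_mult[OF cau_mult[OF cau_crd[OF xk CS_D(1)[OF x(2)]] cau_const] cau_const] monomial_in_field[OF crd_F[OF xk]]
  by (simp add: CS_def)
 hence "q (%n. \<Sum>i<N. \<Sum>j<N. crd (x n) i j * ups ^ i * \<rho> ^ j) : Y" by (intro sum[THEN conjunct1] sum) auto
 moreover have "(\<Sum>i<N. \<Sum>j<N. crd (x n) i j * ups ^ i * \<rho> ^ j) = x n" for n
  using kum_crd[OF xk[of n]] by (simp add: kum_def)
 ultimately show "a : Y" by (simp add: x)
qed

lemma ups_kum: "ups : kum_field" and \<rho>_kum: "\<rho> : kum_field"
 using monomial_in_field[OF F_1, of 1 0] monomial_in_field[OF F_1, of 0 1] by simp_all

lemma kum_power: "x : kum_field ==> x ^ n : kum_field"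
 by (rule subring_set_power[OF subfield_set_subring[OF kum_field_subfield]])

lemma nu_subfield: "subfield (nu ` carrier (completion P)) Lp"
proof -
 interpret K: field "completion P" by (rule completion_field)
 interpret L: field Lp by (rule Lp_field)
 interpret ring_hom_ring "completion P" Lp nu
  by (rule ring_hom_ringI2[OF K.ring_axioms L.ring_axioms nu_hom])
 show ?thesis by (rule img_is_subfield(2)[OF K.carrier_is_subfield]) simp
qed

lemma Lp_finite_dimension: "ring.finite_dimension Lp (nu ` carrier (completion P)) (carrier Lp)"
proof -
 interpret field Lp by (rule Lp_field)
 let ?K = "nu ` carrier (completion P)"
 note K = nu_subfield
 define Us where "Us = map (%(i, j). q (%_. ups ^ i * \<rho> ^ j)) (List.product [0..<N] [0..<N])"
 have cs: "(%_. ups ^ i * \<rho> ^ j) : CS" for i j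
  by (intro CS_const kum_field_mult kum_power ups_kum \<rho>_kum)
 have Us: "set Us <= carrier Lp" unfolding Us_def using q_in[OF cs] by auto
 have "carrier Lp <= Span ?K Us"
 proof (rule q_span)
  fix c :: "nat => 'k alg_closure" and i j
  assume c: "!!n. c n : F" "cau c" and ij: "i < N" "j < N"
  have "q (%_. ups ^ i * \<rho> ^ j) : set Us" unfolding Us_def using ij by force
  hence "q (%_. ups ^ i * \<rho> ^ j) : Span ?K Us" using Span_base_incl[OF K Us] by blast
  hence "q c \<otimes>\<^bsub>Lp\<^esub> q (%_. ups ^ i * \<rho> ^ j) : Span ?K Us"
   by (rule Span_smult_closed[OF K Us F_seq_in_nu[OF c]])
  thus "q (%n. c n * ups ^ i * \<rho> ^ j) : Span ?K Us" by (simp add: Lp_mult CS_F[OF c] cs mult.assoc)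
 next
  fix a b assume "a : Span ?K Us" "b : Span ?K Us"
  thus "a \<oplus>\<^bsub>Lp\<^esub> b : Span ?K Us" by (rule Span_subgroup_props(3)[OF K Us])
 qed
 hence "Span ?K Us = carrier Lp" using Span_subgroup_props(1)[OF K Us] by blast
 thus ?thesis using Span_finite_dimension[OF K Us] by simp
qed

lemma finite_galois_Lp: "finite_galois (completion P) Lp nu"
 unfolding finite_galois_def
proof (intro conjI field_ext_nu Lp_finite_dimension equalityI subsetI)
 fix a assume "a : {x : carrier Lp. ALL \<sigma>:carrier Gal. \<sigma> x = x}"
 hence a: "a : carrier Lp" "!!al be. aut al be a = a" using aut_Gal by auto
 hence "sg al be a = a" for al be by (simp add: aut_def)
 thus "a : nu ` carrier (completion P)" by (rule fixed_imp_nu[OF a(1)])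
next
 fix a assume "a : nu ` carrier (completion P)"
 thus "a : {x : carrier Lp. ALL \<sigma>:carrier Gal. \<sigma> x = x}" by (auto simp: Gal_iff nu_in)
qed

lemma Gal_hom: "\<sigma> : carrier Gal ==> \<sigma> : ring_hom Lp Lp"
 by (simp add: Gal_iff ring_iso_def)

lemma Gal_F: "\<sigma> : carrier Gal ==> (!!n. c n : F) ==> cau c ==> \<sigma> (q c) = q c"
 using F_seq_in_nu[of c] by (auto simp: Gal_iff)

lemma Gal_eqI:
 assumes \<sigma>: "\<sigma> : carrier Gal" and \<tau>: "\<tau> : carrier Gal"
  and ups: "\<sigma> (q (%_. ups)) = \<tau> (q (%_. ups))" and \<rho>: "\<sigma> (q (%_. \<rho>)) = \<tau> (q (%_. \<rho>))"
 shows "\<sigma> = \<tau>"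
proof -
 note h = Gal_hom[OF \<sigma>] Gal_hom[OF \<tau>]
 note F1 = Gal_F[OF \<sigma> _ cau_const[of 1]] Gal_F[OF \<tau> _ cau_const[of 1]]
 have pow: "\<sigma> (q (%_. t ^ i)) = \<tau> (q (%_. t ^ i))"
  if t: "t : kum_field" "\<sigma> (q (%_. t)) = \<tau> (q (%_. t))" for t i
 proof (induction i)
  case (Suc i)
  have "q (%_. t ^ Suc i) = q (%_. t) \<otimes>\<^bsub>Lp\<^esub> q (%_. t ^ i)" using t by (simp add: Lp_mult CS_const kum_power)
  thus ?case using Suc t ring_hom_mult[OF h(1)] ring_hom_mult[OF h(2)]
   by (simp add: q_in CS_const kum_power)
 qed (use F1 F_1 in simp)
 have "carrier Lp <= {a : carrier Lp. \<sigma> a = \<tau> a}"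
 proof (rule q_span)
  fix c :: "nat => 'k alg_closure" and i j
  assume c: "!!n. c n : F" "cau c"
  have cs: "(%_. ups ^ i) : CS" "(%_. \<rho> ^ j) : CS" "c : CS"
   using CS_const kum_power ups_kum \<rho>_kum CS_F[OF c] by auto
  have eq: "q (%n. c n * ups ^ i * \<rho> ^ j) = (q c \<otimes>\<^bsub>Lp\<^esub> q (%_. ups ^ i)) \<otimes>\<^bsub>Lp\<^esub> q (%_. \<rho> ^ j)"
   using cs by (simp add: Lp_mult CS_mult)
  have in1: "q c \<otimes>\<^bsub>Lp\<^esub> q (%_. ups ^ i) : carrier Lp" using cs by (simp add: Lp_mult CS_mult q_in)
  have in2: "q (%n. c n * ups ^ i * \<rho> ^ j) : carrier Lp" using cs by (intro q_in CS_mult)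
  show "q (%n. c n * ups ^ i * \<rho> ^ j) : {a : carrier Lp. \<sigma> a = \<tau> a}"
   using in2 unfolding eq
   by (simp add: ring_hom_mult[OF h(1) in1 q_in[OF cs(2)]] ring_hom_mult[OF h(2) in1 q_in[OF cs(2)]]
     ring_hom_mult[OF h(1) q_in[OF cs(3)] q_in[OF cs(1)]] ring_hom_mult[OF h(2) q_in[OF cs(3)] q_in[OF cs(1)]]
     Gal_F[OF \<sigma> c] Gal_F[OF \<tau> c] pow[OF ups_kum ups] pow[OF \<rho>_kum \<rho>])
 next
  interpret field Lp by (rule Lp_field)
  fix a b assume "a : {a : carrier Lp. \<sigma> a = \<tau> a}" "b : {a : carrier Lp. \<sigma> a = \<tau> a}"
  thus "a \<oplus>\<^bsub>Lp\<^esub> b : {a : carrier Lp. \<sigma> a = \<tau> a}"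
   using ring_hom_add[OF h(1)] ring_hom_add[OF h(2)] by auto
 qed
 moreover have "\<sigma> : extensional (carrier Lp)" "\<tau> : extensional (carrier Lp)"
  using \<sigma> \<tau> by (auto simp: Gal_iff Bij_def)
 ultimately show ?thesis by (intro extensionalityI) auto
qed

text \<open>The image of the class of \<open>t\<close> has \<open>N\<close>-th power
  \<open>t ^ N\<close>. Factoring the difference of \<open>N\<close>-th powers over the roots of
  unity, one linear factor must be a null sequence.\<close>

lemma Gal_root:
 assumes \<sigma>: "\<sigma> : carrier Gal" and t: "t : kum_field" "t ^ N : F"
 shows "EX a<N. \<sigma> (q (%_. t)) = q (%_. \<zeta> ^ a * t)"
proof -
 note h = Gal_hom[OF \<sigma>]
 have tC: "(%_. t ^ i) : CS" for i by (rule CS_const[OF kum_power[OF t(1)]])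
 have "\<sigma> (q (%_. t)) : carrier Lp" using ring_hom_closed[OF h q_in[OF tC[of 1]]] by simp
 then obtain y where y: "\<sigma> (q (%_. t)) = q y" "y : CS" by (auto simp: Lp_carrier)
 have yp: "(%n. y n ^ i) : CS" for i using y(2) by (auto simp: CS_def cau_power kum_power)
 have "\<sigma> (q (%_. t ^ i)) = q (%n. y n ^ i)" for i
 proof (induction i)
  case 0 thus ?case using Gal_F[OF \<sigma> _ cau_const[of 1]] F_1 by simp
 next
  case (Suc i)
  have "\<sigma> (q (%_. t) \<otimes>\<^bsub>Lp\<^esub> q (%_. t ^ i)) = q y \<otimes>\<^bsub>Lp\<^esub> q (%n. y n ^ i)"
   using ring_hom_mult[OF h q_in[OF tC[of 1]] q_in[OF tC[of i]]] Suc y(1) by simp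
  thus ?case using Lp_mult[OF tC[of 1] tC[of i]] Lp_mult[OF y(2) yp[of i]] by simp
 qed
 hence "q (%n. y n ^ N) = q (%_. t ^ N)" using Gal_F[OF \<sigma> _ cau_const[of "t ^ N"]] t(2) by simp
 hence "null (%n. y n ^ N - t ^ N)" using q_eq[OF yp tC] by simp
 hence "null (%n. \<Prod>a<N. y n - \<zeta> ^ a * t)" by (simp add: prod_roots_of_unity)
 hence "EX a:{..<N}. null (%n. y n - \<zeta> ^ a * t)"
  by (intro null_prod_cases) (auto intro: cau_diff cau_const CS_D(1)[OF y(2)])
 then obtain a where a: "a < N" "null (%n. y n - \<zeta> ^ a * t)" by blast
 have "(%_. \<zeta> ^ a * t) : CS" by (intro CS_const kum_field_mult F_subset_kum_field F_power \<zeta>_F t)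
 hence "q y = q (%_. \<zeta> ^ a * t)" using q_eq[OF y(2)] a(2) by blast
 thus ?thesis using a(1) y(1) by auto
qed

definition gal_exp :: "'k alg_closure => ('k local_ext_elem => 'k local_ext_elem) => nat" where
 "gal_exp t \<sigma> = (SOME a. a < N & \<sigma> (q (%_. t)) = q (%_. \<zeta> ^ a * t))"

lemma gal_exp:
 assumes "\<sigma> : carrier Gal" "t : kum_field" "t ^ N : F"
 shows "gal_exp t \<sigma> < N" "\<sigma> (q (%_. t)) = q (%_. \<zeta> ^ gal_exp t \<sigma> * t)"
proof -
 have "gal_exp t \<sigma> < N & \<sigma> (q (%_. t)) = q (%_. \<zeta> ^ gal_exp t \<sigma> * t)"
  unfolding gal_exp_def using someI_ex[OF Gal_root[OF assms]] by simp
 thus "gal_exp t \<sigma> < N" "\<sigma> (q (%_. t)) = q (%_. \<zeta> ^ gal_exp t \<sigma> * t)" by auto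
qed

lemma gal_exp_unique:
 assumes "a < N" "b < N" "t : kum_field" "t ~= 0" "q (%_. \<zeta> ^ a * t) = q (%_. \<zeta> ^ b * t)"
 shows "a = b"
proof -
 have "(%_. \<zeta> ^ a * t) : CS" for a by (intro CS_const kum_field_mult F_subset_kum_field F_power \<zeta>_F assms)
 hence "null (%_. \<zeta> ^ a * t - \<zeta> ^ b * t)" using assms(5) q_eq by blast
 hence "\<zeta> ^ a * t - \<zeta> ^ b * t = 0" by (rule null_const)
 thus ?thesis using assms \<zeta>_pow_eq_iff by simp
qed

lemma Gal_mult: "\<sigma> : carrier Gal ==> \<tau> : carrier Gal ==> \<sigma> \<otimes>\<^bsub>Gal\<^esub> \<tau> = compose (carrier Lp) \<sigma> \<tau>"
 by (simp add: galois_group_def BijGroup_def)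

lemma Gal_mult_closed: "\<sigma> : carrier Gal ==> \<tau> : carrier Gal ==> \<sigma> \<otimes>\<^bsub>Gal\<^esub> \<tau> : carrier Gal"
proof -
 assume \<sigma>\<tau>: "\<sigma> : carrier Gal" "\<tau> : carrier Gal"
 note h = Gal_hom[OF \<sigma>\<tau>(1)] Gal_hom[OF \<sigma>\<tau>(2)]
 have b: "compose (carrier Lp) \<sigma> \<tau> : Bij (carrier Lp)" using \<sigma>\<tau> by (auto simp: Gal_iff intro: compose_Bij)
 interpret field Lp by (rule Lp_field)
 have "compose (carrier Lp) \<sigma> \<tau> : ring_hom Lp Lp"
  by (rule ring_hom_memI)
    (auto simp: compose_def ring_hom_mult[OF h(1)] ring_hom_mult[OF h(2)] ring_hom_add[OF h(1)] ring_hom_add[OF h(2)]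
     ring_hom_one[OF h(1)] ring_hom_one[OF h(2)] ring_hom_closed[OF h(1)] ring_hom_closed[OF h(2)])
 thus ?thesis using b \<sigma>\<tau> unfolding Gal_mult[OF \<sigma>\<tau>] Gal_iff
  by (auto simp: ring_iso_def Bij_def compose_def nu_in)
qed

lemma gal_exp_mult:
 assumes \<sigma>: "\<sigma> : carrier Gal" and \<tau>: "\<tau> : carrier Gal" and t: "t : kum_field" "t ^ N : F" "t ~= 0"
 shows "gal_exp t (\<sigma> \<otimes>\<^bsub>Gal\<^esub> \<tau>) = (gal_exp t \<sigma> + gal_exp t \<tau>) mod N"
proof (rule gal_exp_unique[OF _ _ t(1,3)])
 note st = Gal_mult_closed[OF \<sigma> \<tau>]
 note h = Gal_hom[OF \<sigma>]
 have tC: "(%_. \<zeta> ^ a * t) : CS" for a by (intro CS_const kum_field_mult F_subset_kum_field F_power \<zeta>_F t)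
 have zC: "(%_. \<zeta> ^ a) : CS" for a by (intro CS_const F_subset_kum_field F_power \<zeta>_F)
 have tC1: "(%_. t) : CS" by (rule CS_const[OF t(1)])
 let ?a = "gal_exp t \<sigma>" and ?b = "gal_exp t \<tau>"
 have "q (%_. \<zeta> ^ gal_exp t (\<sigma> \<otimes>\<^bsub>Gal\<^esub> \<tau>) * t) = (\<sigma> \<otimes>\<^bsub>Gal\<^esub> \<tau>) (q (%_. t))"
  using gal_exp(2)[OF st t(1,2)] by simp
 also have "... = \<sigma> (\<tau> (q (%_. t)))" by (simp add: Gal_mult[OF \<sigma> \<tau>] compose_def q_in[OF tC1])
 also have "\<tau> (q (%_. t)) = q (%_. \<zeta> ^ ?b) \<otimes>\<^bsub>Lp\<^esub> q (%_. t)"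
  using gal_exp(2)[OF \<tau> t(1,2)] Lp_mult[OF zC tC1] by simp
 also have "\<sigma> ... = q (%_. \<zeta> ^ ?b) \<otimes>\<^bsub>Lp\<^esub> q (%_. \<zeta> ^ ?a * t)"
  using ring_hom_mult[OF h q_in[OF zC] q_in[OF tC1]] gal_exp(2)[OF \<sigma> t(1,2)]
   Gal_F[OF \<sigma> _ cau_const[of "\<zeta> ^ ?b"]] F_power[OF \<zeta>_F] by simp
 also have "... = q (%_. \<zeta> ^ ((?a + ?b) mod N) * t)"
  unfolding Lp_mult[OF zC tC] \<zeta>_pow_mod by (simp add: power_add mult_ac)
 finally show "q (%_. \<zeta> ^ gal_exp t (\<sigma> \<otimes>\<^bsub>Gal\<^esub> \<tau>) * t) = q (%_. \<zeta> ^ ((?a + ?b) mod N) * t)" .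
 show "gal_exp t (\<sigma> \<otimes>\<^bsub>Gal\<^esub> \<tau>) < N" by (rule gal_exp(1)[OF st t(1,2)])
qed (use N in simp)

text \<open>The exponents of an automorphism at \<open>ups\<close> and \<open>\<rho>\<close>
  determine it and add modulo \<open>N\<close>; mapping them to powers of the commuting elements
  \<open>g\<close> and \<open>h\<close> is injective by \<open>indep\<close>.\<close>

lemma Gal_embeds:
 fixes G :: "'g monoid"
 assumes G: "group G" and gh: "g : carrier G" "h : carrier G" "g \<otimes>\<^bsub>G\<^esub> h = h \<otimes>\<^bsub>G\<^esub> g"
  "g [^]\<^bsub>G\<^esub> N = \<one>\<^bsub>G\<^esub>" "h [^]\<^bsub>G\<^esub> N = \<one>\<^bsub>G\<^esub>"
  and indep: "!!a b c d. a < N ==> b < N ==> c < N ==> d < N ==>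
   g [^]\<^bsub>G\<^esub> a \<otimes>\<^bsub>G\<^esub> h [^]\<^bsub>G\<^esub> b = g [^]\<^bsub>G\<^esub> c \<otimes>\<^bsub>G\<^esub> h [^]\<^bsub>G\<^esub> d ==> a = c & b = d"
 shows "EX \<phi>:hom Gal G. inj_on \<phi> (carrier Gal)"
proof -
 interpret G: group G by fact
 have ups': "ups : kum_field" "ups ^ N : F" "ups ~= 0" and \<rho>': "\<rho> : kum_field" "\<rho> ^ N : F" "\<rho> ~= 0"
  using ups_kum \<rho>_kum ups_neq_0 \<rho>_neq_0 F_of_nat by (auto simp: ups \<rho>)
 define \<phi> where "\<phi> = (%\<sigma>. g [^]\<^bsub>G\<^esub> gal_exp ups \<sigma> \<otimes>\<^bsub>G\<^esub> h [^]\<^bsub>G\<^esub> gal_exp \<rho> \<sigma>)"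
 have pow_mod: "x [^]\<^bsub>G\<^esub> (a mod N) = x [^]\<^bsub>G\<^esub> a" if "x : carrier G" "x [^]\<^bsub>G\<^esub> N = \<one>\<^bsub>G\<^esub>" for x and a :: nat
 proof -
  have "x [^]\<^bsub>G\<^esub> a = x [^]\<^bsub>G\<^esub> (N * (a div N) + a mod N)" by simp
  also have "... = (x [^]\<^bsub>G\<^esub> N) [^]\<^bsub>G\<^esub> (a div N) \<otimes>\<^bsub>G\<^esub> x [^]\<^bsub>G\<^esub> (a mod N)"
   using that(1) by (simp only: G.nat_pow_mult[symmetric] G.nat_pow_pow)
  finally show ?thesis using that by simp
 qed
 have comm: "h [^]\<^bsub>G\<^esub> b \<otimes>\<^bsub>G\<^esub> g [^]\<^bsub>G\<^esub> c = g [^]\<^bsub>G\<^esub> c \<otimes>\<^bsub>G\<^esub> h [^]\<^bsub>G\<^esub> b" for b c :: nat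
 proof -
  have 1: "h \<otimes>\<^bsub>G\<^esub> g [^]\<^bsub>G\<^esub> c = g [^]\<^bsub>G\<^esub> c \<otimes>\<^bsub>G\<^esub> h"
   using G.group_commutes_pow[OF gh(3,1,2), of c] by simp
  show ?thesis using G.group_commutes_pow[OF 1 gh(2) G.nat_pow_closed[OF gh(1)], of b] by simp
 qed
 have "\<phi> : hom Gal G"
 proof (rule homI)
  fix \<sigma> \<tau> assume \<sigma>\<tau>: "\<sigma> : carrier Gal" "\<tau> : carrier Gal"
  let ?a = "gal_exp ups \<sigma>" and ?b = "gal_exp \<rho> \<sigma>" and ?c = "gal_exp ups \<tau>" and ?d = "gal_exp \<rho> \<tau>"
  have "\<phi> (\<sigma> \<otimes>\<^bsub>Gal\<^esub> \<tau>) = g [^]\<^bsub>G\<^esub> (?a + ?c) \<otimes>\<^bsub>G\<^esub> h [^]\<^bsub>G\<^esub> (?b + ?d)"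
   using gal_exp_mult[OF \<sigma>\<tau> ups'] gal_exp_mult[OF \<sigma>\<tau> \<rho>'] gh by (simp add: \<phi>_def pow_mod)
  also have "... = (g [^]\<^bsub>G\<^esub> ?a \<otimes>\<^bsub>G\<^esub> g [^]\<^bsub>G\<^esub> ?c) \<otimes>\<^bsub>G\<^esub> (h [^]\<^bsub>G\<^esub> ?b \<otimes>\<^bsub>G\<^esub> h [^]\<^bsub>G\<^esub> ?d)"
   using gh by (simp only: G.nat_pow_mult)
  also have "... = g [^]\<^bsub>G\<^esub> ?a \<otimes>\<^bsub>G\<^esub> ((g [^]\<^bsub>G\<^esub> ?c \<otimes>\<^bsub>G\<^esub> h [^]\<^bsub>G\<^esub> ?b) \<otimes>\<^bsub>G\<^esub> h [^]\<^bsub>G\<^esub> ?d)"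
   using gh by (simp add: G.m_assoc)
  also have "... = \<phi> \<sigma> \<otimes>\<^bsub>G\<^esub> \<phi> \<tau>"
   unfolding comm[symmetric] using gh by (simp add: \<phi>_def G.m_assoc)
  finally show "\<phi> (\<sigma> \<otimes>\<^bsub>Gal\<^esub> \<tau>) = \<phi> \<sigma> \<otimes>\<^bsub>G\<^esub> \<phi> \<tau>" .
 qed (use gh in \<open>simp add: \<phi>_def\<close>)
 moreover have "inj_on \<phi> (carrier Gal)"
 proof (rule inj_onI)
  fix \<sigma> \<tau> assume \<sigma>\<tau>: "\<sigma> : carrier Gal" "\<tau> : carrier Gal" and eq: "\<phi> \<sigma> = \<phi> \<tau>"
  have "gal_exp ups \<sigma> = gal_exp ups \<tau> & gal_exp \<rho> \<sigma> = gal_exp \<rho> \<tau>"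
   by (rule indep) (use eq gal_exp(1)[OF \<sigma>\<tau>(1) ups'(1,2)] gal_exp(1)[OF \<sigma>\<tau>(2) ups'(1,2)]
    gal_exp(1)[OF \<sigma>\<tau>(1) \<rho>'(1,2)] gal_exp(1)[OF \<sigma>\<tau>(2) \<rho>'(1,2)] in \<open>auto simp: \<phi>_def\<close>)
  thus "\<sigma> = \<tau>"
   using gal_exp(2)[OF \<sigma>\<tau>(1) ups'(1,2)] gal_exp(2)[OF \<sigma>\<tau>(2) ups'(1,2)]
    gal_exp(2)[OF \<sigma>\<tau>(1) \<rho>'(1,2)] gal_exp(2)[OF \<sigma>\<tau>(2) \<rho>'(1,2)]
   by (intro Gal_eqI[OF \<sigma>\<tau>]) simp_all
 qed
 ultimately show ?thesis by blast
qed

end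

section \<open>Characteristic polynomials in ring records\<close>

section \<open>Polynomials with prescribed roots over a ring record\<close>

text \<open>The coefficients of the monic polynomial with root list \<open>xs\<close>, as a function of the degree.\<close>

primrec root_coeff :: "('a, 'b) ring_scheme => 'a list => nat => 'a" where
 "root_coeff R [] j = (if j = 0 then \<one>\<^bsub>R\<^esub> else \<zero>\<^bsub>R\<^esub>)"
| "root_coeff R (x # xs) j =
   (case j of 0 => \<zero>\<^bsub>R\<^esub> | Suc i => root_coeff R xs i) \<ominus>\<^bsub>R\<^esub> x \<otimes>\<^bsub>R\<^esub> root_coeff R xs j"

text \<open>Value at \<open>c\<close> of the polynomial with coefficient function \<open>a\<close>
  up to degree \<open>n\<close>. Coefficient functions match \<open>root_coeff\<close> and avoid the
  normalization of coefficient lists.\<close>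

primrec horner :: "('a, 'b) ring_scheme => 'a => nat => (nat => 'a) => 'a" where
 "horner R c 0 a = a 0"
| "horner R c (Suc n) a = a 0 \<oplus>\<^bsub>R\<^esub> c \<otimes>\<^bsub>R\<^esub> horner R c n (%j. a (Suc j))"

context cring
begin

lemma root_coeff_closed [simp]: "set xs <= carrier R ==> root_coeff R xs j : carrier R"
 by (induction xs arbitrary: j) (auto split: nat.split)

lemma root_coeff_outside: "set xs <= carrier R ==> length xs < j ==> root_coeff R xs j = \<zero>"
 by (induction xs arbitrary: j) (auto split: nat.split simp: minus_eq)

lemma root_coeff_lead: "set xs <= carrier R ==> root_coeff R xs (length xs) = \<one>"
 by (induction xs) (auto simp: minus_eq root_coeff_outside)

lemma root_coeff_swap_aux:
 assumes "a : carrier R" "b : carrier R" "c : carrier R" "x : carrier R" "y : carrier R"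
 shows "(c \<ominus> y \<otimes> b) \<ominus> x \<otimes> (b \<ominus> y \<otimes> a) = (c \<ominus> x \<otimes> b) \<ominus> y \<otimes> (b \<ominus> x \<otimes> a)"
 using assms by algebra

lemma root_coeff_swap:
 assumes "x : carrier R" "y : carrier R" "set xs <= carrier R"
 shows "root_coeff R (x # y # xs) j = root_coeff R (y # x # xs) j"
proof (cases j)
 case 0
 have "(\<zero> \<ominus> x \<otimes> (\<zero> \<ominus> y \<otimes> a)) = (\<zero> \<ominus> y \<otimes> (\<zero> \<ominus> x \<otimes> a))" if "a : carrier R" for a
  using that assms by algebra
 thus ?thesis using 0 assms by simp
next
 case (Suc i)
 show ?thesis
 proof (cases i)
  case 0
  have "(\<zero> \<ominus> y \<otimes> b) \<ominus> x \<otimes> (b \<ominus> y \<otimes> a) = (\<zero> \<ominus> x \<otimes> b) \<ominus> y \<otimes> (b \<ominus> x \<otimes> a)"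
   if "a : carrier R" "b : carrier R" for a b
   using root_coeff_swap_aux[OF that zero_closed assms(1,2)] .
  thus ?thesis using 0 Suc assms by simp
 next
  case (Suc k)
  thus ?thesis using \<open>j = Suc i\<close> assms root_coeff_swap_aux[of "root_coeff R xs j" "root_coeff R xs i" "root_coeff R xs k" x y]
   by simp
 qed
qed

lemma root_coeff_rotate:
 assumes "y : carrier R" "set xs <= carrier R" "set ys <= carrier R"
 shows "root_coeff R (xs @ y # ys) = root_coeff R (y # xs @ ys)"
 using assms(2)
proof (induction xs)
 case (Cons x xs)
 hence IH: "root_coeff R (xs @ y # ys) = root_coeff R (y # xs @ ys)" by (simp del: root_coeff.simps)
 have "root_coeff R ((x # xs) @ y # ys) j = root_coeff R (x # y # xs @ ys) j" for j
  unfolding append_Cons root_coeff.simps(2)[of R x] IH by (rule refl)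
 also have "root_coeff R (x # y # xs @ ys) j = root_coeff R (y # (x # xs) @ ys) j" for j
  using root_coeff_swap[of x y "xs @ ys" j] Cons.prems assms by simp
 finally show ?case by (rule ext)
qed simp

text \<open>Symmetry in the roots. It makes the coefficients invariant under automorphisms that
  merely permute a list of conjugates.\<close>

lemma root_coeff_mset:
 "set xs <= carrier R ==> mset xs = mset ys ==> root_coeff R xs = root_coeff R ys"
proof (induction xs arbitrary: ys)
 case (Cons x xs)
 have "x : set ys" using Cons.prems(2) by (metis list.set_intros(1) set_mset_mset)
 then obtain us vs where ys: "ys = us @ x # vs" by (meson split_list)
 have s: "set ys <= carrier R" using Cons.prems by (metis set_mset_mset)
 have "root_coeff R xs = root_coeff R (us @ vs)" using Cons ys by simp
 hence "root_coeff R (x # xs) j = root_coeff R (x # us @ vs) j" for j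
  unfolding root_coeff.simps by (rule arg_cong)
 hence "root_coeff R (x # xs) = root_coeff R (x # us @ vs)" by (rule ext)
 thus ?case using root_coeff_rotate[of x us vs] s Cons.prems ys by simp
qed simp

lemma horner_closed [simp]: "c : carrier R ==> (!!j. a j : carrier R) ==> horner R c n a : carrier R"
 by (induction n arbitrary: a) auto

text \<open>Multiplication by a linear factor in coefficient form. The constant entry
  \<open>v\<close> is general because in the induction the coefficient \<open>a 0\<close> takes its
  place.\<close>

lemma horner_linear_factor:
 assumes "c : carrier R" "x : carrier R" "v : carrier R" "!!j. a j : carrier R" "a (Suc n) = \<zero>"
 shows "horner R c (Suc n) (%j. (case j of 0 => v | Suc i => a i) \<ominus> x \<otimes> a j)
  = v \<oplus> (c \<ominus> x) \<otimes> horner R c n a"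
 using assms(3-5)
proof (induction n arbitrary: v a)
 case 0
 have "(v \<ominus> x \<otimes> b) \<oplus> c \<otimes> (b \<ominus> x \<otimes> \<zero>) = v \<oplus> (c \<ominus> x) \<otimes> b" if "b : carrier R" for b
  using that assms 0 by algebra
 thus ?case using 0 by simp
next
 case (Suc n)
 have "(v \<ominus> x \<otimes> b) \<oplus> c \<otimes> (b \<oplus> (c \<ominus> x) \<otimes> h) = v \<oplus> (c \<ominus> x) \<otimes> (b \<oplus> c \<otimes> h)"
  if "b : carrier R" "h : carrier R" for b h
  using that assms(1,2) Suc.prems(1) by algebra
 from this[of "a 0" "horner R c n (%j. a (Suc j))"] show ?case
  using Suc.IH[of "a 0" "%j. a (Suc j)"] Suc.prems assms(1) by simp
qed

lemma foldr_factor_closed: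
 "c : carrier R ==> set xs <= carrier R ==> foldr (%x z. (c \<ominus> x) \<otimes> z) xs \<one> : carrier R"
 by (induction xs) auto

lemma horner_root_coeff:
 "c : carrier R ==> set xs <= carrier R ==>
  horner R c (length xs) (root_coeff R xs) = foldr (%x z. (c \<ominus> x) \<otimes> z) xs \<one>"
proof (induction xs)
 case (Cons x xs)
 have "root_coeff R (x # xs) = (%j. (case j of 0 => \<zero> | Suc i => root_coeff R xs i) \<ominus> x \<otimes> root_coeff R xs j)"
  by (rule ext) simp
 hence "horner R c (Suc (length xs)) (root_coeff R (x # xs)) = \<zero> \<oplus> (c \<ominus> x) \<otimes> horner R c (length xs) (root_coeff R xs)"
  using horner_linear_factor[of c x \<zero> "root_coeff R xs" "length xs"] Cons.prems root_coeff_outside[of xs]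
  by (simp del: horner.simps)
 thus ?case using Cons foldr_factor_closed[of c xs] by (simp del: horner.simps root_coeff.simps)
qed simp

lemma horner_at_root:
 assumes "set xs <= carrier R" "c : set xs"
 shows "horner R c (length xs) (root_coeff R xs) = \<zero>"
proof -
 have "foldr (%x z. (c \<ominus> x) \<otimes> z) xs \<one> = \<zero>" using assms
 proof (induction xs)
  case (Cons x xs)
  have "foldr (%x z. (c \<ominus> x) \<otimes> z) xs \<one> : carrier R" using Cons.prems by (intro foldr_factor_closed) auto
  thus ?case using Cons by (auto simp: minus_eq r_neg)
 qed simp
 thus ?thesis using horner_root_coeff[of c xs] assms by auto
qed

text \<open>Homogeneity of the elementary symmetric functions; it serves to clear the denominators
  of a characteristic polynomial.\<close>

lemma root_coeff_scale:
 assumes d: "d : carrier R"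
 shows "set xs <= carrier R ==> j <= length xs ==>
  root_coeff R (map (%x. d \<otimes> x) xs) j = d [^] (length xs - j) \<otimes> root_coeff R xs j"
proof (induction xs arbitrary: j)
 case (Cons x xs)
 have s: "set (map (%x. d \<otimes> x) xs) <= carrier R" using Cons.prems d by auto
 have alg0: "\<zero> \<ominus> (d \<otimes> x) \<otimes> (e \<otimes> b) = (e \<otimes> d) \<otimes> (\<zero> \<ominus> x \<otimes> b)"
  and alg1: "(e \<otimes> d) \<otimes> a \<ominus> (d \<otimes> x) \<otimes> (e \<otimes> b) = (e \<otimes> d) \<otimes> (a \<ominus> x \<otimes> b)"
  if "a : carrier R" "b : carrier R" "e : carrier R" for a b e
  using that d Cons.prems by (simp_all, algebra+)
 show ?case
 proof (cases j)
  case 0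
  thus ?thesis using Cons alg0[of \<zero> "root_coeff R xs 0" "d [^] length xs"] d by simp
 next
  case (Suc i)
  show ?thesis
  proof (cases "i = length xs")
   case True
   have "root_coeff R (map (%x. d \<otimes> x) (x # xs)) (length (map (%x. d \<otimes> x) (x # xs))) = \<one>"
    by (rule root_coeff_lead) (use Cons.prems d in auto)
   moreover have "root_coeff R (x # xs) (length (x # xs)) = \<one>" by (rule root_coeff_lead) (use Cons.prems in auto)
   ultimately show ?thesis using True Suc by (simp del: root_coeff.simps)
  next
   case False
   hence i: "i < length xs" using Cons.prems Suc by simp
   hence e: "length xs - i = Suc (length xs - Suc i)" by simp
   have s': "set xs <= carrier R" using Cons.prems by simp
   show ?thesis using Cons.IH[OF s', of i] Cons.IH[OF s', of "Suc i"] i d s' Suc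
    alg1[of "root_coeff R xs i" "root_coeff R xs (Suc i)" "d [^] (length xs - Suc i)"]
    by (simp add: e)
  qed
 qed
qed simp

lemma horner_top:
 assumes "c : carrier R" "!!j. a j : carrier R"
 shows "horner R c (Suc n) a = a (Suc n) \<otimes> c [^] Suc n \<oplus> horner R c n a"
 using assms(2)
proof (induction n arbitrary: a)
 case 0
 have "b \<oplus> c \<otimes> b' = b' \<otimes> c \<oplus> b" if "b : carrier R" "b' : carrier R" for b b'
  using that assms(1) by algebra
 thus ?case using 0 assms(1) by simp
next
 case (Suc n)
 have *: "b \<oplus> c \<otimes> (b' \<otimes> e \<oplus> h) = b' \<otimes> (e \<otimes> c) \<oplus> (b \<oplus> c \<otimes> h)"
  if "b : carrier R" "b' : carrier R" "h : carrier R" "e : carrier R" for b b' h e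
  using that assms(1) by algebra
 have "horner R c (Suc (Suc n)) a = a 0 \<oplus> c \<otimes> horner R c (Suc n) (%j. a (Suc j))" by simp
 also have "... = a 0 \<oplus> c \<otimes> (a (Suc (Suc n)) \<otimes> c [^] Suc n \<oplus> horner R c n (%j. a (Suc j)))"
  using Suc.IH[of "%j. a (Suc j)"] Suc.prems by (simp del: horner.simps)
 also have "... = a (Suc (Suc n)) \<otimes> (c [^] Suc n \<otimes> c) \<oplus> (a 0 \<oplus> c \<otimes> horner R c n (%j. a (Suc j)))"
  by (rule *) (use Suc.prems assms(1) in auto)
 finally show ?case by simp
qed

lemma eval_horner:
 assumes "c : carrier R" "!!j. a j : carrier R"
 shows "eval (map a (rev [0..<Suc n])) c = horner R c n a"
proof (induction n)
 case (Suc n)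
 have "eval (map a (rev [0..<Suc (Suc n)])) c = a (Suc n) \<otimes> c [^] Suc n \<oplus> eval (map a (rev [0..<Suc n])) c"
  by simp
 thus ?case using Suc horner_top[OF assms, of n] by (simp del: horner.simps)
qed (use assms in simp)

end

context domain
begin

lemma horner_root_imp:
 assumes "set xs <= carrier R" "c : carrier R" "horner R c (length xs) (root_coeff R xs) = \<zero>"
 shows "c : set xs"
proof -
 have "foldr (%x z. (c \<ominus> x) \<otimes> z) xs \<one> = \<zero>" using horner_root_coeff[of c xs] assms by simp
 thus ?thesis using assms(1)
 proof (induction xs)
  case (Cons x xs)
  have "foldr (%x z. (c \<ominus> x) \<otimes> z) xs \<one> : carrier R" using Cons.prems assms(2) by (intro foldr_factor_closed) auto
  moreover have "c \<ominus> x : carrier R" using Cons.prems assms(2) by auto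
  ultimately have "c \<ominus> x = \<zero> | foldr (%x z. (c \<ominus> x) \<otimes> z) xs \<one> = \<zero>"
   using Cons.prems integral by auto
  thus ?case using Cons assms(2) r_right_minus_eq[of c x] by auto
 qed simp
qed

lemma root_coeff_0_nonzero:
 "set xs <= carrier R ==> \<zero> ~: set xs ==> root_coeff R xs 0 ~= \<zero>"
proof (induction xs)
 case (Cons x xs)
 have "\<zero> \<ominus> x \<otimes> root_coeff R xs 0 = \<zero> \<longleftrightarrow> x \<otimes> root_coeff R xs 0 = \<zero>"
  using r_right_minus_eq[of \<zero> "x \<otimes> root_coeff R xs 0"] Cons.prems by auto
 thus ?case using Cons integral[of x "root_coeff R xs 0"] by auto
qed simp

end

lemma root_coeff_hom:
 assumes "cring R" "cring S" "h : ring_hom R S" "set xs <= carrier R"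
 shows "h (root_coeff R xs j) = root_coeff S (map h xs) j"
proof -
 interpret ring_hom_cring R S h using assms by (simp add: ring_hom_cring_def ring_hom_cring_axioms_def)
 show ?thesis using assms(4)
  by (induction xs arbitrary: j) (auto split: nat.split simp: a_minus_def)
qed

lemma horner_hom:
 assumes "cring R" "cring S" "h : ring_hom R S" "c : carrier R" "!!j. a j : carrier R"
 shows "h (horner R c n a) = horner S (h c) n (%j. h (a j))"
proof -
 interpret ring_hom_cring R S h using assms by (simp add: ring_hom_cring_def ring_hom_cring_axioms_def)
 show ?thesis using assms(5) by (induction n arbitrary: a) (auto simp: assms(4))
qed

section \<open>Finite coverings of a vector space, the substitute for generic elements\<close>

section \<open>Coverings by equalizers\<close>

text \<open>A vector space over an infinite field is not a finite union of proper subspaces. Take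
  \<open>x\<close> outside \<open>U j\<close> and \<open>y\<close> outside the other members: the
  line of all \<open>comb x c y\<close> meets \<open>U j\<close> at most once, so infinitely many of
  its points fall into the others, two of them into the same one, which then contains
  \<open>y\<close>.\<close>

lemma finite_cover:
 fixes V :: "'a set" and comb :: "'a => 'k => 'a => 'a"
 assumes inf: "infinite (UNIV :: 'k set)" and I: "finite I" and V: "V ~= {}" "!!x y c. x : V ==> y : V ==> comb x c y : V"
  and U: "!!i x y c c'. i : I ==> x : V ==> y : V ==> c ~= c' ==> comb x c y : U i ==> comb x c' y : U i ==> x : U i & y : U i"
  and cover: "V <= (\<Union>i\<in>I. U i)"
 shows "EX i:I. V <= U i"
 using I U cover
proof (induction I)
 case empty
 thus ?case using V by auto
next
 case (insert j J)
 show ?case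
 proof (cases "V <= U j | V <= (\<Union>i\<in>J. U i)")
  case True
  thus ?thesis
  proof
   assume "V <= (\<Union>i\<in>J. U i)"
   moreover have "!!i x y c c'. i : J ==> x : V ==> y : V ==> c ~= c' ==> comb x c y : U i ==> comb x c' y : U i ==> x : U i & y : U i"
    by (rule insert.prems(1)[OF insertI2])
   ultimately have "EX i:J. V <= U i" using insert.IH by blast
   thus ?thesis by blast
  qed blast
 next
  case False
  then obtain x y where xy: "x : V" "x ~: U j" "y : V" "y ~: (\<Union>i\<in>J. U i)" by blast
  have one: "c = c'" if "comb x c y : U j" "comb x c' y : U j" for c c'
   using insert.prems(1)[of j x y c c'] that xy by blast
  define C where "C = {c. comb x c y ~: U j}"
  have "finite (- C)"
  proof (cases "- C = {}")
   case False
   then obtain c where "c : - C" by blast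
   hence "- C <= {c}" using one unfolding C_def by blast
   thus ?thesis by (rule finite_subset) simp
  qed simp
  hence infC: "infinite C" using inf by (metis Compl_partition finite_Un)
  have "EX i:J. comb x c y : U i" if "c : C" for c
   using insert.prems(2) V(2)[OF xy(1,3), of c] that unfolding C_def by blast
  then obtain g where g: "!!c. c : C ==> g c : J & comb x c y : U (g c)" by metis
  have "~ inj_on g C"
  proof
   assume "inj_on g C"
   moreover have "g ` C <= J" using g by blast
   ultimately show False using infC insert.hyps(1) by (meson finite_imageD finite_subset)
  qed
  then obtain c c' where c: "c : C" "c' : C" "c ~= c'" "g c = g c'" unfolding inj_on_def by blast
  have "comb x c y : U (g c)" "comb x c' y : U (g c)" "g c : J" using g[OF c(1)] g[OF c(2)] c(4) by auto
  hence "y : U (g c)" using insert.prems(1)[of "g c" x y c c'] xy c by blast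
  thus ?thesis using xy(4) \<open>g c : J\<close> by blast
 qed
qed

text \<open>The elements where two linear maps agree form a subspace. Hence agreement with some
  member of a finite family, chosen element by element, is agreement with one member
  throughout.\<close>

lemma equalizer_cover:
 fixes V :: "'a set" and comb :: "'a => 'k => 'a => 'a" and M :: "'m ring"
 assumes M: "domain M" and inf: "infinite (UNIV :: 'k set)" and I: "finite I"
  and V: "V ~= {}" "!!x y c. x : V ==> y : V ==> comb x c y : V"
  and \<kappa>: "!!c. \<kappa> c : carrier M" "inj \<kappa>"
  and g: "!!i x. i : I ==> x : V ==> g i x : carrier M"
   "!!i x y c. i : I ==> x : V ==> y : V ==> g i (comb x c y) = g i x \<oplus>\<^bsub>M\<^esub> \<kappa> c \<otimes>\<^bsub>M\<^esub> g i y"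
  and h: "!!i x. i : I ==> x : V ==> h i x : carrier M"
   "!!i x y c. i : I ==> x : V ==> y : V ==> h i (comb x c y) = h i x \<oplus>\<^bsub>M\<^esub> \<kappa> c \<otimes>\<^bsub>M\<^esub> h i y"
  and cover: "!!x. x : V ==> EX i:I. g i x = h i x"
 shows "EX i:I. ALL x:V. g i x = h i x"
proof -
 interpret M: domain M by (rule M)
 have key: "a = a' & b = b'"
  if c: "a : carrier M" "a' : carrier M" "b : carrier M" "b' : carrier M" "c : carrier M" "c' : carrier M"
   "c ~= c'" "a \<oplus>\<^bsub>M\<^esub> c \<otimes>\<^bsub>M\<^esub> b = a' \<oplus>\<^bsub>M\<^esub> c \<otimes>\<^bsub>M\<^esub> b'" "a \<oplus>\<^bsub>M\<^esub> c' \<otimes>\<^bsub>M\<^esub> b = a' \<oplus>\<^bsub>M\<^esub> c' \<otimes>\<^bsub>M\<^esub> b'"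
  for a a' b b' c c'
 proof -
  have "(c \<ominus>\<^bsub>M\<^esub> c') \<otimes>\<^bsub>M\<^esub> (b \<ominus>\<^bsub>M\<^esub> b') =
    ((a \<oplus>\<^bsub>M\<^esub> c \<otimes>\<^bsub>M\<^esub> b) \<ominus>\<^bsub>M\<^esub> (a' \<oplus>\<^bsub>M\<^esub> c \<otimes>\<^bsub>M\<^esub> b')) \<ominus>\<^bsub>M\<^esub> ((a \<oplus>\<^bsub>M\<^esub> c' \<otimes>\<^bsub>M\<^esub> b) \<ominus>\<^bsub>M\<^esub> (a' \<oplus>\<^bsub>M\<^esub> c' \<otimes>\<^bsub>M\<^esub> b'))"
   using c(1-6) by algebra
  also have "... = \<zero>\<^bsub>M\<^esub>" unfolding c(8,9) using c(1-6) by algebra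
  finally have "c \<ominus>\<^bsub>M\<^esub> c' = \<zero>\<^bsub>M\<^esub> | b \<ominus>\<^bsub>M\<^esub> b' = \<zero>\<^bsub>M\<^esub>"
   by (rule M.integral) (use c(1-6) in auto)
  hence b: "b = b'" using c(1-7) by auto
  hence "a = a'" using c by (metis M.add.r_cancel M.m_closed)
  thus ?thesis using b by blast
 qed
 have "EX i:I. V <= {x : V. g i x = h i x}"
 proof (rule finite_cover[OF inf I V])
  fix i x y c c' assume i: "i : I" "x : V" "y : V" "c ~= c'"
   "comb x c y : {x : V. g i x = h i x}" "comb x c' y : {x : V. g i x = h i x}"
  have "g i x = h i x & g i y = h i y"
  proof (rule key[of _ _ _ _ "\<kappa> c" "\<kappa> c'"])
   show "\<kappa> c ~= \<kappa> c'" using i(4) \<kappa>(2) by (auto dest: injD)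
  qed (use i g h \<kappa>(1) in auto)
  thus "x : {x : V. g i x = h i x} & y : {x : V. g i x = h i x}" using i by blast
 next
  show "V <= (\<Union>i\<in>I. {x : V. g i x = h i x})"
  proof
   fix x assume "x : V"
   moreover from this obtain i where "i : I" "g i x = h i x" using cover[of x] by blast
   ultimately show "x : (\<Union>i\<in>I. {x : V. g i x = h i x})" by blast
  qed
 qed
 thus ?thesis by blast
qed

section \<open>Local rings of the rational function field\<close>

definition ev :: "'k::field_char_0 poly fract => 'k poly => 'k poly fract" where
 "ev u f = poly (map_poly const_fract f) u"

lemma const_fract_simps [simp]:
 "const_fract 0 = 0" "const_fract 1 = 1" "const_fract (a + b) = const_fract a + const_fract b"
 "const_fract (a * b) = const_fract a * const_fract b" "const_fract a = const_fract b \<longleftrightarrow> a = b"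
 by (simp_all add: const_fract_def Zero_fract_def One_fract_def eq_fract pCons_one)

lemma const_fract_0_iff [simp]: "const_fract a = 0 \<longleftrightarrow> a = 0"
 using const_fract_simps(5)[of a 0] by simp

lemma ev_0 [simp]: "ev u 0 = 0" by (simp add: ev_def)

lemma ev_pCons [simp]: "ev u (pCons a f) = const_fract a + u * ev u f"
 by (simp add: ev_def map_poly_pCons)

lemma ev_1 [simp]: "ev u 1 = 1" by (simp flip: pCons_one)

lemma ev_add [simp]: "ev u (f + g) = ev u f + ev u g"
 by (induction f g rule: poly_induct2) (simp_all add: algebra_simps)

lemma ev_smult [simp]: "ev u (smult a f) = const_fract a * ev u f"
 by (induction f) (simp_all add: algebra_simps)

lemma ev_mult [simp]: "ev u (f * g) = ev u f * ev u g"
 by (induction f) (simp_all add: algebra_simps)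

lemma ev_diff [simp]: "ev u (f - g) = ev u f - ev u g"
 using ev_add[of u "f - g" g] by (simp add: algebra_simps)

lemma ev_power [simp]: "ev u (f ^ n) = ev u f ^ n"
 by (induction n) simp_all

lemma ev_monom_1 [simp]: "ev u (monom 1 n) = u ^ n"
 by (induction n) (simp_all add: monom_Suc monom_0)

text \<open>\<open>u\<close> generates \<open>k(T)\<close> over \<open>k\<close> and is
  transcendental. Stated through polynomials in \<open>u\<close>, so that \<open>T\<close>, its
  translates and their inverses are treated alike.\<close>

definition coordinate :: "'k::field_char_0 poly fract => bool" where
 "coordinate u \<longleftrightarrow> (ALL f. ev u f = 0 --> f = 0) & (ALL r. EX a b. b ~= 0 & r = ev u a / ev u b)"

lemma coordinate_inj: "coordinate u ==> ev u f = 0 \<longleftrightarrow> f = 0"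
 by (auto simp: coordinate_def)

lemma coordinate_quotient: "coordinate u ==> EX a b. b ~= 0 & r = ev u a / ev u b"
 by (auto simp: coordinate_def)

lemma ev_shift: "ev (Fract [:- t, 1:] 1) f = Fract (pcompose f [:- t, 1:]) 1"
 by (induction f) (simp_all add: pcompose_pCons const_fract_def Zero_fract_def)

lemma coordinate_shift: "coordinate (Fract [:- t, 1:] 1)"
 unfolding coordinate_def
proof (intro conjI allI impI)
 fix f assume "ev (Fract [:- t, 1:] 1) f = 0"
 hence "pcompose f [:- t, 1:] = 0" by (simp add: ev_shift Zero_fract_def eq_fract)
 thus "f = 0" by (rule pcompose_eq_0) simp
next
 fix r :: "'a poly fract"
 have bck: "pcompose (pcompose a [:t, 1:]) [:- t, 1:] = a" for a
  by (simp flip: pcompose_assoc add: pcompose_pCons pcompose_idR)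
 obtain a b where r: "r = Fract a b" "b ~= 0" by (cases r) auto
 have "pcompose b [:t, 1:] ~= 0" using bck[of b] r(2) by (metis pcompose_0)
 moreover have "r = ev (Fract [:- t, 1:] 1) (pcompose a [:t, 1:]) / ev (Fract [:- t, 1:] 1) (pcompose b [:t, 1:])"
  by (simp add: ev_shift bck r)
 ultimately show "EX a b. b ~= 0 & r = ev (Fract [:- t, 1:] 1) a / ev (Fract [:- t, 1:] 1) b" by blast
qed

lemma coordinate_nonzero: "coordinate u ==> u ~= 0"
 using coordinate_inj[of u "[:0, 1:]"] by auto

lemma ev_reflect:
 assumes "u ~= 0" shows "ev u (reflect_poly f) = u ^ degree f * ev (inverse u) f"
proof -
 have d: "degree (map_poly const_fract f) = degree f"
  by (rule degree_map_poly) simp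
 have "map_poly const_fract (reflect_poly f) = reflect_poly (map_poly const_fract f)"
  by (rule poly_eqI) (simp add: coeff_map_poly coeff_reflect_poly d)
 thus ?thesis using poly_reflect_poly_nz[OF assms, of "map_poly const_fract f"] by (simp add: ev_def d)
qed

text \<open>Reflected polynomials exchange \<open>u\<close> and \<open>inverse u\<close> up to a
  power of \<open>u\<close>.\<close>

lemma coordinate_inverse:
 assumes u: "coordinate u" shows "coordinate (inverse u)"
 unfolding coordinate_def
proof (intro conjI allI impI)
 note nz = coordinate_nonzero[OF u]
 fix f assume "ev (inverse u) f = 0"
 hence "ev u (reflect_poly f) = 0" using ev_reflect[OF nz, of f] by simp
 thus "f = 0" using coordinate_inj[OF u] by simp
next
 note nz = coordinate_nonzero[OF u]
 have bck: "ev u a = u ^ degree a * ev (inverse u) (reflect_poly a)" for a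
  using ev_reflect[of "inverse u" a] nz by (simp add: power_inverse field_simps)
 fix r
 obtain a b where ab: "b ~= 0" "r = ev u a / ev u b" using coordinate_quotient[OF u] by blast
 have "r = ev (inverse u) (reflect_poly a * monom 1 (degree b)) / ev (inverse u) (reflect_poly b * monom 1 (degree a))"
  using nz unfolding ab(2) bck[of a] bck[of b] by (simp add: power_inverse field_simps)
 moreover have "reflect_poly b * monom 1 (degree a) ~= 0" using ab(1) by simp
 ultimately show "EX a b. b ~= 0 & r = ev (inverse u) a / ev (inverse u) b" by blast
qed

lemma Fract_inverse_T: "Fract 1 [:0, 1:] = inverse (Fract [:0, 1:] (1 :: 'k::field_char_0 poly))"
 by simp

lemma coordinate_T: "coordinate (Fract [:0, 1:] 1)" and coordinate_inverse_T: "coordinate (Fract 1 [:0, 1:])"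
 using coordinate_shift[of 0] coordinate_inverse[OF coordinate_shift[of 0]] by simp_all

lemma coordinate_local_parameter: "coordinate (local_parameter t)"
 using coordinate_shift coordinate_inverse_T by (cases t) auto

lemma local_ring_iff:
 "x : local_ring t \<longleftrightarrow> (EX f g. poly g 0 ~= 0 & x = ev (local_parameter t) f / ev (local_parameter t) g)"
 by (auto simp: local_ring_def ev_def)

lemma ev_local_unit: "poly g 0 ~= 0 ==> ev (local_parameter t) g ~= 0"
 using coordinate_inj[OF coordinate_local_parameter, of t g] by (metis poly_0)

lemma local_ring_ev: "ev (local_parameter t) f : local_ring t"
 unfolding local_ring_iff by (rule exI[of _ f], rule exI[of _ 1]) simp

lemma local_ring_const: "const_fract a : local_ring t" and local_ring_parameter: "local_parameter t : local_ring t"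
 using local_ring_ev[of t "[:a:]"] local_ring_ev[of t "[:0, 1:]"] by simp_all

lemma local_ring_subring: "subring_set (local_ring t)"
 unfolding subring_set_def
proof (intro conjI ballI)
 show "1 : local_ring t" using local_ring_const[of 1] by simp
 fix x y assume "x : local_ring t" "y : local_ring t"
 then obtain f g f' g' where *: "poly g 0 ~= 0" "x = ev (local_parameter t) f / ev (local_parameter t) g"
   "poly g' 0 ~= 0" "y = ev (local_parameter t) f' / ev (local_parameter t) g'" unfolding local_ring_iff by blast
 note nz = ev_local_unit[OF *(1), of t] ev_local_unit[OF *(3), of t]
 have "x - y = ev (local_parameter t) (f * g' - f' * g) / ev (local_parameter t) (g * g')"
  using nz by (simp add: *(2,4) field_simps)
 moreover have "x * y = ev (local_parameter t) (f * f') / ev (local_parameter t) (g * g')"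
  using nz by (simp add: *(2,4) field_simps)
 moreover have "poly (g * g') 0 ~= 0" using * by simp
 ultimately show "x - y : local_ring t" "x * y : local_ring t" unfolding local_ring_iff by blast+
qed

lemma monom_factor: "f ~= 0 ==> EX n g. f = monom 1 n * g & poly g (0 :: 'k::field_char_0) ~= 0"
proof -
 assume "f ~= 0"
 then obtain g where "f = [:- 0, 1:] ^ order 0 f * g" "~ [:- 0, 1:] dvd g" using order_decomp by blast
 thus ?thesis by (intro exI[of _ "order 0 f"] exI[of _ g]) (auto simp: monom_altdef poly_eq_0_iff_dvd)
qed

text \<open>Splitting the largest powers of the local parameter off numerator and denominator leaves
  units; comparing the two exponents decides.\<close>

lemma local_ring_valuation_ring: "valuation_ring (local_ring t)"
proof -
 let ?u = "local_parameter t"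
 have "r : local_ring t | inverse r : local_ring t" for r
 proof (cases "r = 0")
  case True
  thus ?thesis using local_ring_const[of 0 t] by simp
 next
  case False
  obtain a b where ab: "b ~= 0" "r = ev ?u a / ev ?u b" using coordinate_quotient[OF coordinate_local_parameter] by blast
  have "a ~= 0" using False ab by auto
  obtain i a' where a': "a = monom 1 i * a'" "poly a' 0 ~= 0" using monom_factor[OF \<open>a ~= 0\<close>] by blast
  obtain j b' where b': "b = monom 1 j * b'" "poly b' 0 ~= 0" using monom_factor[OF ab(1)] by blast
  have u: "?u ~= 0" by (rule coordinate_nonzero[OF coordinate_local_parameter])
  note nz = ev_local_unit[OF a'(2), of t] ev_local_unit[OF b'(2), of t] u
  show ?thesis
  proof (cases "j <= i")
   case True
   hence "r = ev ?u (monom 1 (i - j) * a') / ev ?u b'" using nz by (simp add: ab a' b' power_diff field_simps)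
   thus ?thesis using b'(2) unfolding local_ring_iff by blast
  next
   case False
   hence "inverse r = ev ?u (monom 1 (j - i) * b') / ev ?u a'" using nz by (simp add: ab a' b' power_diff field_simps)
   thus ?thesis using a'(2) unfolding local_ring_iff by blast
  qed
 qed
 thus ?thesis by (simp add: valuation_ring_def local_ring_subring)
qed

section \<open>Conjugates, integral closures and residue maps of the function field
  extension\<close>

section \<open>Galois extensions of the rational function field\<close>

locale gal_ext =
 fixes E :: "'e ring" and \<iota> :: "'k::field_char_0 poly fract => 'e"
 assumes galois: "finite_galois ring_of_type_algebra E \<iota>"
  and finite_group: "finite (carrier (galois_group ring_of_type_algebra E \<iota>))"

sublocale gal_ext \<subseteq> E: field E
 using galois by (simp add: finite_galois_def field_ext_def)

context gal_ext
begin

abbreviation "Gm \<equiv> carrier (galois_group ring_of_type_algebra E \<iota>)"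

lemma \<iota>_hom: "\<iota> : ring_hom ring_of_type_algebra E"
 using galois by (simp add: finite_galois_def field_ext_def)

lemma \<iota>_in [simp]: "\<iota> a : carrier E"
 and \<iota>_add: "\<iota> (a + b) = \<iota> a \<oplus>\<^bsub>E\<^esub> \<iota> b"
 and \<iota>_mult: "\<iota> (a * b) = \<iota> a \<otimes>\<^bsub>E\<^esub> \<iota> b"
 and \<iota>_1: "\<iota> 1 = \<one>\<^bsub>E\<^esub>"
 using \<iota>_hom by (auto simp: ring_hom_def ring_of_type_algebra_def)

lemma \<iota>_0: "\<iota> 0 = \<zero>\<^bsub>E\<^esub>"
 using \<iota>_add[of 0 0] E.add.r_cancel_one'[of "\<iota> 0" "\<iota> 0"] by simp

lemma \<iota>_eq_0: "\<iota> a = \<zero>\<^bsub>E\<^esub> \<longleftrightarrow> a = 0"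
proof
 assume "\<iota> a = \<zero>\<^bsub>E\<^esub>"
 hence "\<iota> (inverse a * a) = \<zero>\<^bsub>E\<^esub>" by (simp add: \<iota>_mult)
 thus "a = 0" using \<iota>_1 by (cases "a = 0") auto
qed (simp add: \<iota>_0)

lemma \<iota>_diff: "\<iota> (a - b) = \<iota> a \<ominus>\<^bsub>E\<^esub> \<iota> b"
proof -
 have "\<iota> a = \<iota> (a - b) \<oplus>\<^bsub>E\<^esub> \<iota> b" by (simp flip: \<iota>_add)
 moreover have "(x \<oplus>\<^bsub>E\<^esub> y) \<ominus>\<^bsub>E\<^esub> y = x" if "x : carrier E" "y : carrier E" for x y
  using that by algebra
 ultimately show ?thesis by simp
qed

lemma \<iota>_inj: "\<iota> a = \<iota> b \<longleftrightarrow> a = b"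
 using \<iota>_eq_0[of "a - b"] by (auto simp: \<iota>_diff E.r_right_minus_eq)

lemma \<iota>_power: "\<iota> (a ^ n) = \<iota> a [^]\<^bsub>E\<^esub> n"
 by (induction n) (simp_all add: \<iota>_1 \<iota>_mult E.m_comm)

lemma Gm_iff: "\<sigma> : Gm \<longleftrightarrow> \<sigma> : Bij (carrier E) & \<sigma> : ring_iso E E & (ALL a. \<sigma> (\<iota> a) = \<iota> a)"
 by (auto simp: galois_group_def ring_of_type_algebra_def)

lemma Gm_\<iota>: "\<sigma> : Gm ==> \<sigma> (\<iota> a) = \<iota> a"
 by (simp add: Gm_iff)

lemma Gm_hom: "\<sigma> : Gm ==> \<sigma> : ring_hom E E"
 by (simp add: Gm_iff ring_iso_def)

lemma Gm_in: "\<sigma> : Gm ==> x : carrier E ==> \<sigma> x : carrier E"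
 and Gm_add: "\<sigma> : Gm ==> x : carrier E ==> y : carrier E ==> \<sigma> (x \<oplus>\<^bsub>E\<^esub> y) = \<sigma> x \<oplus>\<^bsub>E\<^esub> \<sigma> y"
 and Gm_mult: "\<sigma> : Gm ==> x : carrier E ==> y : carrier E ==> \<sigma> (x \<otimes>\<^bsub>E\<^esub> y) = \<sigma> x \<otimes>\<^bsub>E\<^esub> \<sigma> y"
 using Gm_hom by (auto simp: ring_hom_def)

lemma Gm_inj: "\<sigma> : Gm ==> inj_on \<sigma> (carrier E)"
 by (simp add: Gm_iff ring_iso_def bij_betw_def)

lemma Gm_0: "\<sigma> : Gm ==> \<sigma> \<zero>\<^bsub>E\<^esub> = \<zero>\<^bsub>E\<^esub>"
 using Gm_\<iota>[of \<sigma> 0] by (simp add: \<iota>_0)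

lemma Gm_diff:
 assumes "\<sigma> : Gm" "x : carrier E" "y : carrier E" shows "\<sigma> (x \<ominus>\<^bsub>E\<^esub> y) = \<sigma> x \<ominus>\<^bsub>E\<^esub> \<sigma> y"
proof -
 have cancel: "(x \<oplus>\<^bsub>E\<^esub> y) \<ominus>\<^bsub>E\<^esub> y = x" "(x \<ominus>\<^bsub>E\<^esub> y) \<oplus>\<^bsub>E\<^esub> y = x" if "x : carrier E" "y : carrier E" for x y
  using that by (algebra, algebra)
 have "\<sigma> x = \<sigma> (x \<ominus>\<^bsub>E\<^esub> y) \<oplus>\<^bsub>E\<^esub> \<sigma> y"
  using Gm_add[OF assms(1), of "x \<ominus>\<^bsub>E\<^esub> y" y] assms cancel(2)[of x y] by simp
 thus ?thesis using cancel(1) assms by (simp add: Gm_in)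
qed

lemma ext_iso_Gm:
 assumes "\<sigma> : extensional (carrier E)" "\<sigma> : ring_hom E E" "bij_betw \<sigma> (carrier E) (carrier E)" "!!a. \<sigma> (\<iota> a) = \<iota> a"
 shows "\<sigma> : Gm"
 using assms by (simp add: Gm_iff Bij_def ring_iso_def)

lemma Gm_id: "(\<lambda>x\<in>carrier E. x) : Gm"
proof (rule ext_iso_Gm)
 show "bij_betw (\<lambda>x\<in>carrier E. x) (carrier E) (carrier E)"
  by (auto simp: bij_betw_def inj_on_def)
qed (auto simp: ring_hom_def)

lemma Gm_comp:
 assumes "\<sigma> : Gm" "\<tau> : Gm" shows "compose (carrier E) \<sigma> \<tau> : Gm"
proof (rule ext_iso_Gm)
 show "compose (carrier E) \<sigma> \<tau> : ring_hom E E"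
  by (rule ring_hom_memI)
    (auto simp: compose_def assms Gm_in Gm_add Gm_mult ring_hom_one[OF Gm_hom[OF assms(1)]] ring_hom_one[OF Gm_hom[OF assms(2)]])
 have "compose (carrier E) \<sigma> \<tau> : Bij (carrier E)"
  using assms by (intro compose_Bij) (simp_all add: Gm_iff)
 thus "compose (carrier E) \<sigma> \<tau> : extensional (carrier E)" "bij_betw (compose (carrier E) \<sigma> \<tau>) (carrier E) (carrier E)"
  by (simp_all add: Bij_def)
qed (simp add: compose_def assms Gm_\<iota>)

lemma Gm_eqI:
 assumes "\<sigma> : Gm" "\<tau> : Gm" "!!x. x : carrier E ==> \<sigma> x = \<tau> x" shows "\<sigma> = \<tau>"
 by (rule extensionalityI[of _ "carrier E"]) (use assms in \<open>auto simp: Gm_iff Bij_def\<close>)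

lemma fixed_imp_\<iota>: "x : carrier E ==> (!!\<sigma>. \<sigma> : Gm ==> \<sigma> x = x) ==> EX a. x = \<iota> a"
 using galois by (auto simp: finite_galois_def ring_of_type_algebra_def)

definition Gms :: "('e => 'e) list" where
 "Gms = (SOME l. set l = Gm & distinct l)"

lemma Gms: "set Gms = Gm" "distinct Gms"
proof -
 obtain l where "set l = Gm & distinct l" using finite_distinct_list[OF finite_group] by blast
 hence "set Gms = Gm & distinct Gms" unfolding Gms_def by (rule someI[of "%l. set l = Gm & distinct l"])
 thus "set Gms = Gm" "distinct Gms" by blast+
qed

text \<open>Conjugates with multiplicity, so that the associated monic polynomial always has degree
  \<open>card Gm\<close> and its constant coefficient is the norm up to sign.\<close>

definition orb :: "'e => 'e list" where
 "orb x = map (%\<sigma>. \<sigma> x) Gms"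

lemma orb_set: "set (orb x) = (%\<sigma>. \<sigma> x) ` Gm"
 by (simp add: orb_def Gms)

lemma orb_subset: "x : carrier E ==> set (orb x) <= carrier E"
 by (auto simp: orb_set Gm_in)

lemma orb_self: "x : carrier E ==> x : set (orb x)"
 unfolding orb_set by (rule image_eqI[OF _ Gm_id]) simp

lemma length_orb: "length (orb x) = card Gm"
 using distinct_card[OF Gms(2)] by (simp add: orb_def Gms(1))

lemma left_mult_Gm:
 assumes "\<tau> : Gm" shows "inj_on (compose (carrier E) \<tau>) Gm" "compose (carrier E) \<tau> ` Gm = Gm"
proof -
 show inj: "inj_on (compose (carrier E) \<tau>) Gm"
 proof (rule inj_onI)
  fix \<sigma> \<sigma>' assume s: "\<sigma> : Gm" "\<sigma>' : Gm" "compose (carrier E) \<tau> \<sigma> = compose (carrier E) \<tau> \<sigma>'"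
  show "\<sigma> = \<sigma>'"
  proof (rule Gm_eqI[OF s(1,2)])
   fix x assume x: "x : carrier E"
   have "\<tau> (\<sigma> x) = \<tau> (\<sigma>' x)" using fun_cong[OF s(3), of x] x by (simp add: compose_def)
   thus "\<sigma> x = \<sigma>' x" using Gm_inj[OF assms] x s by (auto simp: inj_on_def Gm_in)
  qed
 qed
 show "compose (carrier E) \<tau> ` Gm = Gm"
  by (rule endo_inj_surj[OF finite_group _ inj]) (use Gm_comp[OF assms] in blast)
qed

lemma Gm_right_inverse:
 assumes "\<tau> : Gm" shows "EX \<sigma>:Gm. ALL x:carrier E. \<tau> (\<sigma> x) = x"
proof -
 obtain \<sigma> where "\<sigma> : Gm" "compose (carrier E) \<tau> \<sigma> = (\<lambda>x\<in>carrier E. x)"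
  using left_mult_Gm(2)[OF assms] Gm_id by (metis imageE)
 thus ?thesis by (intro bexI[of _ \<sigma>] ballI) (drule fun_cong, auto simp: compose_def split: if_splits)
qed

lemma orb_mset:
 assumes "\<tau> : Gm" "x : carrier E" shows "mset (map \<tau> (orb x)) = mset (orb x)"
proof -
 have "mset (map (compose (carrier E) \<tau>) Gms) = mset Gms"
  by (subst set_eq_iff_mset_eq_distinct[symmetric]) (use left_mult_Gm[OF assms(1)] in \<open>auto simp: Gms distinct_map\<close>)
 hence eq: "mset (map (%\<sigma>. \<sigma> x) (map (compose (carrier E) \<tau>) Gms)) = mset (orb x)"
  by (simp only: orb_def mset_map)
 have "map (%\<sigma>. \<sigma> x) (map (compose (carrier E) \<tau>) Gms) = map \<tau> (orb x)"
  using assms(2) by (simp add: orb_def compose_def)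
 thus ?thesis using eq by (simp only:)
qed

lemma orb_coeff:
 assumes x: "x : carrier E" shows "EX a. root_coeff E (orb x) j = \<iota> a"
proof (rule fixed_imp_\<iota>)
 show "root_coeff E (orb x) j : carrier E" using orb_subset[OF x] by simp
 fix \<sigma> assume s: "\<sigma> : Gm"
 have "\<sigma> (root_coeff E (orb x) j) = root_coeff E (map \<sigma> (orb x)) j"
  by (rule root_coeff_hom[OF E.is_cring E.is_cring Gm_hom[OF s] orb_subset[OF x]])
 also have "mset (orb x) = mset (map \<sigma> (orb x))" by (simp only: orb_mset[OF s x])
 hence "root_coeff E (map \<sigma> (orb x)) j = root_coeff E (orb x) j"
  by (simp only: E.root_coeff_mset[OF orb_subset[OF x]])
 finally show "\<sigma> (root_coeff E (orb x) j) = root_coeff E (orb x) j" .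
qed

text \<open>For two distinct automorphisms, the elements with equal images form a proper subspace
  over the infinite field of constants; the finitely many pairs cannot cover
  \<open>E\<close>.\<close>

lemma separating_element: "EX y:carrier E. ALL \<sigma>:Gm. ALL \<tau>:Gm. \<sigma> ~= \<tau> --> \<sigma> y ~= \<tau> y"
proof (rule ccontr)
 assume *: "~ ?thesis"
 let ?I = "{s : Gm \<times> Gm. fst s ~= snd s}"
 have "EX s:?I. ALL x:carrier E. fst s x = snd s x"
 proof (rule equalizer_cover[where comb = "%x c y. x \<oplus>\<^bsub>E\<^esub> \<iota> (const_fract (c :: 'k)) \<otimes>\<^bsub>E\<^esub> y" and \<kappa> = "%c. \<iota> (const_fract c)" and M = E])
  show "inj (%c::'k. \<iota> (const_fract c))" by (auto simp: inj_def \<iota>_inj)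
  show "finite ?I" using finite_group by simp
  show "EX s:?I. fst s x = snd s x" if "x : carrier E" for x using * that by force
 qed (auto simp: E.domain_axioms infinite_UNIV_char_0 Gm_in Gm_add Gm_mult Gm_\<iota>)
 thus False using Gm_eqI by auto
qed

text \<open>A separating element is scaled by a common denominator so that its characteristic
  polynomial \<open>f\<close> has coefficients in \<open>k[W]\<close>. \<open>D\<close> takes the
  part of the discriminant: it is a multiple of the norm of every difference of conjugates, with
  cofactor \<open>d \<sigma> \<tau>\<close> again polynomial in \<open>W\<close>, which is what lets
  \<open>D\<close> bound such differences.\<close>

lemma chart:
 assumes X: "coordinate W"
 shows "EX y f D d. y : carrier E & lead_coeff f = 1 & degree f = card Gm & D ~= 0
  & (ALL j. root_coeff E (orb y) j = \<iota> (ev W (coeff f j)))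
  & (ALL \<sigma>:Gm. ALL \<tau>:Gm. \<sigma> ~= \<tau> -->
    \<iota> (ev W D) = \<iota> (ev W (d \<sigma> \<tau>)) \<otimes>\<^bsub>E\<^esub> root_coeff E (orb (\<sigma> y \<ominus>\<^bsub>E\<^esub> \<tau> y)) 0)"
proof -
 let ?n = "card Gm"
 obtain y0 where y0: "y0 : carrier E" "!!\<sigma> \<tau>. \<sigma> : Gm ==> \<tau> : Gm ==> \<sigma> ~= \<tau> ==> \<sigma> y0 ~= \<tau> y0"
  using separating_element by blast
 obtain r where r: "!!j. root_coeff E (orb y0) j = \<iota> (r j)" using orb_coeff[OF y0(1)] by metis
 have "EX a b. b ~= 0 & r j = ev W a / ev W b" for j using coordinate_quotient[OF X] .
 then obtain a b where ab: "!!j. b j ~= 0 & r j = ev W (a j) / ev W (b j)" by metis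
 define e where "e = (\<Prod>j<?n. b j)"
 have e0: "e ~= 0" using ab by (simp add: e_def)
 define c where "c j = a j * (\<Prod>i\<in>{..<?n}-{j}. b i)" for j
 have c: "ev W e * r j = ev W (c j)" if "j < ?n" for j
 proof -
  have "e = b j * (\<Prod>i\<in>{..<?n}-{j}. b i)" unfolding e_def using that by (simp add: prod.remove)
  moreover have "ev W (b j) ~= 0" using ab coordinate_inj[OF X] by blast
  ultimately show ?thesis using ab[of j] by (simp add: c_def)
 qed
 define y where "y = \<iota> (ev W e) \<otimes>\<^bsub>E\<^esub> y0"
 have y: "y : carrier E" using y0 by (simp add: y_def)
 have \<sigma>y: "\<sigma> y = \<iota> (ev W e) \<otimes>\<^bsub>E\<^esub> \<sigma> y0" if "\<sigma> : Gm" for \<sigma>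
  using that y0 by (simp add: y_def Gm_mult Gm_\<iota>)
 have orb_y: "orb y = map (%x. \<iota> (ev W e) \<otimes>\<^bsub>E\<^esub> x) (orb y0)"
  by (simp add: orb_def \<sigma>y Gms)
 \<comment> \<open>Scaling the roots by \<open>e\<close> multiplies coefficient \<open>j\<close> by
   \<open>e ^ (card Gm - j)\<close>; one factor \<open>e\<close> clears the denominator and gives
   \<open>c j\<close>.\<close>
 define F where "F j = (if j < ?n then e ^ (?n - Suc j) * c j else if j = ?n then 1 else 0)" for j
 define f where "f = (\<Sum>j\<le>?n. monom (F j) j)"
 have f: "coeff f j = F j" for j
  by (auto simp: f_def coeff_sum F_def)
 have deg: "degree f = ?n"
  by (rule antisym[OF degree_le le_degree]) (simp_all add: f F_def)
 have coeff: "root_coeff E (orb y) j = \<iota> (ev W (coeff f j))" for j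
 proof (cases "j < ?n")
  case True
  have "root_coeff E (orb y) j = \<iota> (ev W e) [^]\<^bsub>E\<^esub> (?n - j) \<otimes>\<^bsub>E\<^esub> \<iota> (r j)"
   unfolding orb_y using E.root_coeff_scale[of "\<iota> (ev W e)" "orb y0" j] orb_subset[OF y0(1)] True
   by (simp add: length_orb r)
  also have "... = \<iota> (ev W e ^ (?n - j) * r j)" by (simp add: \<iota>_mult \<iota>_power)
  also have "ev W e ^ (?n - j) * r j = ev W (F j)"
  proof -
   have "?n - j = Suc (?n - Suc j)" using True by simp
   thus ?thesis using c[OF True] True by (simp add: F_def)
  qed
  finally show ?thesis by (simp add: f)
 next
  case False
  thus ?thesis using E.root_coeff_lead[OF orb_subset[OF y]] E.root_coeff_outside[OF orb_subset[OF y], of j]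
   by (auto simp: f F_def \<iota>_1 \<iota>_0 length_orb)
 qed
 let ?z = "%s. fst s y \<ominus>\<^bsub>E\<^esub> snd s y"
 let ?I = "{s : Gm \<times> Gm. fst s ~= snd s}"
 have I: "finite ?I" using finite_group by simp
 have N: "ALL s:?I. EX v. fst v ~= 0 & snd v ~= 0 & root_coeff E (orb (?z s)) 0 = \<iota> (ev W (fst v) / ev W (snd v))"
 proof
  fix s assume s: "s : ?I"
  have eq: "?z s = \<iota> (ev W e) \<otimes>\<^bsub>E\<^esub> (fst s y0 \<ominus>\<^bsub>E\<^esub> snd s y0)"
   using s y0(1) by (auto simp: \<sigma>y E.r_distr E.minus_eq E.r_minus Gm_in)
  have w: "fst s y0 \<ominus>\<^bsub>E\<^esub> snd s y0 ~= \<zero>\<^bsub>E\<^esub>" using s y0 by (auto simp: Gm_in)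
  have e1: "\<iota> (ev W e) ~= \<zero>\<^bsub>E\<^esub>" using e0 by (simp add: \<iota>_eq_0 coordinate_inj[OF X])
  have w1: "fst s y0 \<ominus>\<^bsub>E\<^esub> snd s y0 : carrier E" using s y0 by (auto simp: Gm_in)
  have z: "?z s ~= \<zero>\<^bsub>E\<^esub>" "?z s : carrier E"
   unfolding eq using w e1 w1 E.integral_iff[OF \<iota>_in w1] by simp_all
  have "\<zero>\<^bsub>E\<^esub> ~: set (orb (?z s))"
  proof
   assume "\<zero>\<^bsub>E\<^esub> : set (orb (?z s))"
   then obtain \<gamma> where g: "\<gamma> : Gm" "\<gamma> (?z s) = \<gamma> \<zero>\<^bsub>E\<^esub>" by (auto simp: orb_set Gm_0)
   hence "?z s = \<zero>\<^bsub>E\<^esub>" using Gm_inj[OF g(1)] z(2) by (auto dest: inj_onD)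
   thus False using z by blast
  qed
  hence nz: "root_coeff E (orb (?z s)) 0 ~= \<zero>\<^bsub>E\<^esub>" by (rule E.root_coeff_0_nonzero[OF orb_subset[OF z(2)]])
  obtain x where x: "root_coeff E (orb (?z s)) 0 = \<iota> x" using orb_coeff[OF z(2)] by blast
  obtain a b where ab: "b ~= 0" "x = ev W a / ev W b" using coordinate_quotient[OF X] by blast
  have "a ~= 0" using nz x ab by (auto simp: \<iota>_0)
  thus "EX v. fst v ~= 0 & snd v ~= 0 & root_coeff E (orb (?z s)) 0 = \<iota> (ev W (fst v) / ev W (snd v))"
   using ab x by (intro exI[of _ "(a, b)"]) simp
 qed
 from bchoice[OF N] obtain v where v: "ALL s:?I. fst (v s) ~= 0 & snd (v s) ~= 0
   & root_coeff E (orb (?z s)) 0 = \<iota> (ev W (fst (v s)) / ev W (snd (v s)))" by (elim exE)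
 define a' b' where "a' s = fst (v s)" and "b' s = snd (v s)" for s
 have ab': "s : ?I ==> a' s ~= 0 & b' s ~= 0 & root_coeff E (orb (?z s)) 0 = \<iota> (ev W (a' s) / ev W (b' s))" for s
  unfolding a'_def b'_def by (rule bspec[OF v])
 \<comment> \<open>The norm belonging to the pair \<open>s\<close> is \<open>a' s / b' s\<close>.
   The product of all numerators is a multiple of each norm, with the denominator \<open>b'\<close>
   absorbed by the cofactor \<open>d\<close>.\<close>
 define D where "D = (\<Prod>s\<in>?I. a' s)"
 define d where "d \<sigma> \<tau> = b' (\<sigma>, \<tau>) * (\<Prod>s\<in>?I - {(\<sigma>, \<tau>)}. a' s)" for \<sigma> \<tau>
 have D0: "D ~= 0" using ab' I by (simp add: D_def)
 have norm: "\<iota> (ev W D) = \<iota> (ev W (d \<sigma> \<tau>)) \<otimes>\<^bsub>E\<^esub> root_coeff E (orb (\<sigma> y \<ominus>\<^bsub>E\<^esub> \<tau> y)) 0"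
  if "\<sigma> : Gm" "\<tau> : Gm" "\<sigma> ~= \<tau>" for \<sigma> \<tau>
 proof -
  have s: "(\<sigma>, \<tau>) : ?I" using that by simp
  have D: "D = a' (\<sigma>, \<tau>) * (\<Prod>s\<in>?I - {(\<sigma>, \<tau>)}. a' s)" unfolding D_def by (rule prod.remove[OF I s])
  have nz: "ev W (b' (\<sigma>, \<tau>)) ~= 0" using ab'[OF s] coordinate_inj[OF X] by blast
  have "ev W D = ev W (d \<sigma> \<tau>) * (ev W (a' (\<sigma>, \<tau>)) / ev W (b' (\<sigma>, \<tau>)))"
   unfolding D d_def using nz by simp
  thus ?thesis using ab'[OF s] by (simp flip: \<iota>_mult)
 qed
 have lead: "lead_coeff f = 1" by (simp add: deg) (simp add: f F_def)
 show ?thesis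
  by (rule exI[of _ y], rule exI[of _ f], rule exI[of _ D], rule exI[of _ d])
    (intro conjI ballI allI impI; (rule y lead deg D0 coeff | rule norm, assumption+))
qed

abbreviation "B \<equiv> %t. integral_closure E (\<iota> ` local_ring t)"

lemma closure_ring_carrier: "carrier (closure_ring E \<iota> t) = B t"
 by (simp add: closure_ring_def)

lemma B_E: "x : B t ==> x : carrier E"
 by (simp add: integral_closure_def)

lemma B_iff: "x : B t \<longleftrightarrow> x : carrier E \<and>
  (EX p. set p <= \<iota> ` local_ring t & p ~= [] & hd p = \<one>\<^bsub>E\<^esub> & E.eval p x = \<zero>\<^bsub>E\<^esub>)"
 by (auto simp: integral_closure_def univ_poly_def polynomial_def)

lemma B_I:
 assumes "x : carrier E" "!!j. c j : \<iota> ` local_ring t" "c n = \<one>\<^bsub>E\<^esub>" "horner E x n c = \<zero>\<^bsub>E\<^esub>"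
 shows "x : B t"
proof -
 have "c j : carrier E" for j using assms(2)[of j] by auto
 hence "E.eval (map c (rev [0..<Suc n])) x = \<zero>\<^bsub>E\<^esub>" using E.eval_horner[OF assms(1), of c] assms(4) by simp
 moreover have "set (map c (rev [0..<Suc n])) <= \<iota> ` local_ring t" using assms(2) by (simp add: image_subset_iff)
 moreover have "hd (map c (rev [0..<Suc n])) = \<one>\<^bsub>E\<^esub>" using assms(3) by simp
 ultimately show ?thesis unfolding B_iff using assms(1) by (intro conjI exI[of _ "map c (rev [0..<Suc n])"]) auto
qed

lemma B_\<iota>_in:
 assumes "a : local_ring t" shows "\<iota> a : B t"
proof (rule B_I[of _ "%j. if j = 0 then \<iota> (- a) else \<one>\<^bsub>E\<^esub>" t 1])
 note sub = local_ring_subring[of t]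
 show "(if j = 0 then \<iota> (- a) else \<one>\<^bsub>E\<^esub>) : \<iota> ` local_ring t" for j
  using subring_set_uminus[OF sub assms] subring_set_1[OF sub] by (auto simp flip: \<iota>_1)
 show "horner E (\<iota> a) 1 (%j. if j = 0 then \<iota> (- a) else \<one>\<^bsub>E\<^esub>) = \<zero>\<^bsub>E\<^esub>"
  by (simp flip: \<iota>_add \<iota>_0)
qed simp_all

lemma eval_\<iota>: "E.eval (map \<iota> q) (\<iota> r) = \<iota> (poly (Poly (rev q)) r)"
 by (induction q) (simp_all add: \<iota>_0 \<iota>_add \<iota>_mult \<iota>_power Poly_append poly_monom E.a_comm E.m_comm mult.commute)

text \<open>The local ring is a valuation ring, hence integrally closed. The equation is first
  pulled back to \<open>k(T)\<close> by inverting \<open>\<iota>\<close> on its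
  coefficients.\<close>

lemma B_\<iota>:
 assumes "\<iota> r : B t" shows "r : local_ring t"
proof -
 interpret valring "local_ring t" by unfold_locales (rule local_ring_valuation_ring)
 obtain p where p: "set p <= \<iota> ` local_ring t" "p ~= []" "hd p = \<one>\<^bsub>E\<^esub>" "E.eval p (\<iota> r) = \<zero>\<^bsub>E\<^esub>"
  using assms unfolding B_iff by (elim conjE exE) (rule that)
 define g where "g = inv_into (local_ring t) \<iota>"
 have g: "g y : local_ring t" "\<iota> (g y) = y" if "y : set p" for y
  using p(1) that inv_into_into[of y \<iota> "local_ring t"] f_inv_into_f[of y \<iota> "local_ring t"] unfolding g_def by blast+
 define q where "q = map g p"
 have q: "p = map \<iota> q" "set q <= local_ring t"
  unfolding q_def map_map using g by (auto intro!: map_idI[symmetric])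
 have q0: "q ~= []" using p q by auto
 have hd: "hd q = 1" using p(3) q0 by (simp add: q(1) hd_map flip: \<iota>_1) (simp add: \<iota>_inj)
 let ?P = "Poly (rev q)"
 have c: "coeff ?P (length q - 1) = 1" using hd q0 by (simp add: nth_default_def rev_nth hd_conv_nth)
 have "degree ?P = length q - 1"
  by (rule antisym[OF degree_le le_degree]) (use q0 c in \<open>auto simp: nth_default_def\<close>)
 hence "lead_coeff ?P = 1" using c by simp
 moreover have "coeff ?P i : local_ring t" for i
  using q(2) in_0 by (auto simp: nth_default_def rev_nth subset_eq)
 moreover have "poly ?P r = 0" using p(4) by (simp add: q(1) eval_\<iota> \<iota>_eq_0)
 ultimately show ?thesis by (rule monic_root_in)
qed

lemma B_Gm:
 assumes "\<sigma> : Gm" "x : B t" shows "\<sigma> x : B t"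
proof -
 obtain p where p: "set p <= \<iota> ` local_ring t" "p ~= []" "hd p = \<one>\<^bsub>E\<^esub>" "E.eval p x = \<zero>\<^bsub>E\<^esub>"
  using assms(2) unfolding B_iff by (elim conjE exE) (rule that)
 have x: "x : carrier E" by (rule B_E[OF assms(2)])
 have pow: "\<sigma> (x [^]\<^bsub>E\<^esub> n) = \<sigma> x [^]\<^bsub>E\<^esub> n" for n :: nat
  by (induction n) (simp_all add: assms(1) Gm_mult x ring_hom_one[OF Gm_hom[OF assms(1)]])
 have "set p <= range \<iota> ==> E.eval p (\<sigma> x) = \<sigma> (E.eval p x) & E.eval p x : carrier E"
  by (induction p) (auto simp: assms(1) Gm_0 Gm_add Gm_mult Gm_\<iota> x pow)
 hence "E.eval p (\<sigma> x) = \<zero>\<^bsub>E\<^esub>" using p by (auto simp: Gm_0[OF assms(1)])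
 thus ?thesis unfolding B_iff using p Gm_in[OF assms(1) x] by blast
qed

lemma B_orb:
 assumes "x : carrier E" "!!j. root_coeff E (orb x) j : \<iota> ` local_ring t" shows "x : B t"
 by (rule B_I[of _ "root_coeff E (orb x)" t "length (orb x)"])
   (use assms orb_subset orb_self in \<open>auto simp: E.root_coeff_lead E.horner_at_root simp del: image_iff\<close>)

definition \<iota>_inv :: "'e => 'k poly fract" where
 "\<iota>_inv x = (SOME a. \<iota> a = x)"

lemma \<iota>_inv: "\<iota>_inv (\<iota> a) = a"
 by (simp add: \<iota>_inv_def \<iota>_inj)

end

context gal_ext
begin

text \<open>The residue in \<open>k\<close> of an element regular at \<open>t\<close>, read off from
  some representation; by \<open>\<Phi>_quotient\<close> every representation gives the value seen
  by a point.\<close>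

definition loc_value :: "'k proj_line => 'k poly fract => 'k" where
 "loc_value t a = (SOME c. EX f g. poly g 0 ~= 0 & a = ev (local_parameter t) f / ev (local_parameter t) g
   & c = poly f 0 / poly g 0)"

text \<open>Coefficients over \<open>k\<close> of the characteristic polynomial of \<open>x\<close>,
  reduced at the point \<open>t\<close>.\<close>

definition res_coeff :: "'k proj_line => 'e => nat => 'k" where
 "res_coeff t x j = loc_value t (\<iota>_inv (root_coeff E (orb x) j))"

lemma loc_value:
 assumes "a : local_ring t"
 obtains f g where "poly g 0 ~= 0" "a = ev (local_parameter t) f / ev (local_parameter t) g"
  "loc_value t a = poly f 0 / poly g 0"
proof -
 have "EX c f g. poly g 0 ~= 0 & a = ev (local_parameter t) f / ev (local_parameter t) g & c = poly f 0 / poly g 0"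
  using assms unfolding local_ring_iff by blast
 from someI_ex[OF this] show thesis unfolding loc_value_def[symmetric] by (elim exE conjE) (rule that)
qed

end

lemma (in ideal) root_coeff_0_in:
 assumes "cring R" "set xs <= carrier R" "x : set xs" "x : I" shows "root_coeff R xs 0 : I"
proof -
 interpret R: cring R by (rule assms(1))
 show ?thesis using assms(2,3)
 proof (induction xs)
  case (Cons y ys)
  have c: "root_coeff R ys 0 : carrier R" "y : carrier R" using Cons.prems by simp_all
  have "y \<otimes> root_coeff R ys 0 : I"
  proof (cases "x = y")
   case True
   thus ?thesis using I_r_closed[OF assms(4), of "root_coeff R ys 0"] c by simp
  next
   case False
   hence "root_coeff R ys 0 : I" using Cons by simp
   thus ?thesis using I_l_closed c by simp
  qed
  from I_l_closed[OF this, of "\<ominus> \<one>"] have "\<ominus> (y \<otimes> root_coeff R ys 0) : I"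
   using c by (simp add: l_minus)
  thus ?case using c by (simp add: a_minus_def)
 qed simp
qed

text \<open>The additive inverse in a ring record is chosen from its carrier, so it has to be
  compared when the carrier shrinks to the integral closure.\<close>

lemma (in cring) subring_a_inv_eq:
 assumes "cring (R\<lparr>carrier := B\<rparr>)" "B <= carrier R" "x : B"
 shows "\<ominus>\<^bsub>R\<lparr>carrier := B\<rparr>\<^esub> x = \<ominus> x"
proof -
 interpret B: cring "R\<lparr>carrier := B\<rparr>" by (rule assms(1))
 have a: "\<ominus>\<^bsub>R\<lparr>carrier := B\<rparr>\<^esub> x : B" and b: "\<ominus>\<^bsub>R\<lparr>carrier := B\<rparr>\<^esub> x \<oplus> x = \<zero>"
  using B.a_inv_closed[of x] B.l_neg[of x] assms(3) by simp_all
 show ?thesis using minus_equality[OF b] a assms(2,3) by (simp add: subset_eq)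
qed

lemma (in cring) subring_root_coeff_eq:
 assumes "cring (R\<lparr>carrier := B\<rparr>)" "B <= carrier R" "set xs <= B"
 shows "root_coeff (R\<lparr>carrier := B\<rparr>) xs j = root_coeff R xs j"
proof -
 interpret B: cring "R\<lparr>carrier := B\<rparr>" by (rule assms(1))
 show ?thesis using assms(3)
 proof (induction xs arbitrary: j)
  case (Cons x xs)
  have "root_coeff (R\<lparr>carrier := B\<rparr>) xs j : B" using B.root_coeff_closed[of xs j] Cons.prems by simp
  hence "x \<otimes> root_coeff R xs j : B" using B.m_closed[of x "root_coeff R xs j"] Cons by simp
  thus ?case using Cons subring_a_inv_eq[OF assms(1,2)] by (auto simp: a_minus_def split: nat.split)
 qed simp
qed

text \<open>A point of \<open>E\<close> above \<open>t\<close> with values in \<open>M\<close>: a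
  homomorphism from the integral closure of the local ring that kills the parameter. That this
  closure is a ring is recorded as \<open>B_cring\<close>; a prime ideal of it carries this
  information.\<close>

locale gal_point = gal_ext E \<iota> + M: field M
 for E :: "'e ring" and \<iota> :: "'k::field_char_0 poly fract => 'e" and M :: "'m ring" +
 fixes t :: "'k proj_line" and \<Phi> :: "'e => 'm"
 assumes B_cring: "cring (closure_ring E \<iota> t)"
  and \<Phi>_hom: "\<Phi> : ring_hom (closure_ring E \<iota> t) M"
  and \<Phi>_parameter: "\<Phi> (\<iota> (local_parameter t)) = \<zero>\<^bsub>M\<^esub>"
begin

definition \<kappa> :: "'k => 'm" where "\<kappa> a = \<Phi> (\<iota> (const_fract a))"

lemma B_ops: "carrier (closure_ring E \<iota> t) = B t" "x \<oplus>\<^bsub>closure_ring E \<iota> t\<^esub> y = x \<oplus>\<^bsub>E\<^esub> y"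
 "x \<otimes>\<^bsub>closure_ring E \<iota> t\<^esub> y = x \<otimes>\<^bsub>E\<^esub> y" "\<one>\<^bsub>closure_ring E \<iota> t\<^esub> = \<one>\<^bsub>E\<^esub>" "\<zero>\<^bsub>closure_ring E \<iota> t\<^esub> = \<zero>\<^bsub>E\<^esub>"
 by (simp_all add: closure_ring_def)

interpretation BR: cring "closure_ring E \<iota> t" by (rule B_cring)

lemma B_add: "x : B t ==> y : B t ==> x \<oplus>\<^bsub>E\<^esub> y : B t"
 and B_mult: "x : B t ==> y : B t ==> x \<otimes>\<^bsub>E\<^esub> y : B t"
 using BR.a_closed[of x y] BR.m_closed[of x y] by (simp_all add: B_ops)

lemma B_minus: "x : B t ==> \<ominus>\<^bsub>E\<^esub> x : B t"
 using BR.a_inv_closed[of x] E.subring_a_inv_eq[of "B t" x] B_cring B_E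
 by (auto simp: closure_ring_def subset_eq)

lemma B_diff: "x : B t ==> y : B t ==> x \<ominus>\<^bsub>E\<^esub> y : B t"
 by (simp add: E.minus_eq B_add B_minus)

lemma root_coeff_B: "set xs <= B t ==> root_coeff (closure_ring E \<iota> t) xs j = root_coeff E xs j"
 using E.subring_root_coeff_eq[of "B t" xs j] B_cring B_E by (auto simp: closure_ring_def subset_eq)

lemma root_coeff_in_B: "set xs <= B t ==> root_coeff E xs j : B t"
 using BR.root_coeff_closed[of xs j] root_coeff_B[of xs j] by (simp add: B_ops)

lemma orb_B: "x : B t ==> set (orb x) <= B t"
 by (auto simp: orb_set B_Gm)

lemma \<Phi>_in: "x : B t ==> \<Phi> x : carrier M"
 and \<Phi>_add: "x : B t ==> y : B t ==> \<Phi> (x \<oplus>\<^bsub>E\<^esub> y) = \<Phi> x \<oplus>\<^bsub>M\<^esub> \<Phi> y"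
 and \<Phi>_mult: "x : B t ==> y : B t ==> \<Phi> (x \<otimes>\<^bsub>E\<^esub> y) = \<Phi> x \<otimes>\<^bsub>M\<^esub> \<Phi> y"
 and \<Phi>_1: "\<Phi> \<one>\<^bsub>E\<^esub> = \<one>\<^bsub>M\<^esub>"
 using \<Phi>_hom by (auto simp: ring_hom_def B_ops)

lemma \<Phi>_0: "\<Phi> \<zero>\<^bsub>E\<^esub> = \<zero>\<^bsub>M\<^esub>"
 using ring_hom_zero[OF \<Phi>_hom] BR.ring_axioms M.ring_axioms by (simp add: B_ops)

lemma \<Phi>_diff:
 assumes "x : B t" "y : B t" shows "\<Phi> (x \<ominus>\<^bsub>E\<^esub> y) = \<Phi> x \<ominus>\<^bsub>M\<^esub> \<Phi> y"
proof -
 have x: "x \<ominus>\<^bsub>E\<^esub> y \<oplus>\<^bsub>E\<^esub> y = x" if "x : carrier E" "y : carrier E" for x y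
  using that by algebra
 have m: "a \<oplus>\<^bsub>M\<^esub> b \<ominus>\<^bsub>M\<^esub> b = a" if "a : carrier M" "b : carrier M" for a b
  using that by algebra
 have "\<Phi> x = \<Phi> (x \<ominus>\<^bsub>E\<^esub> y) \<oplus>\<^bsub>M\<^esub> \<Phi> y"
  using \<Phi>_add[OF B_diff[OF assms] assms(2)] x[OF B_E[OF assms(1)] B_E[OF assms(2)]] by simp
 thus ?thesis using m \<Phi>_in[OF B_diff[OF assms]] \<Phi>_in[OF assms(2)] by simp
qed

lemma \<Phi>_root_coeff:
 "set xs <= B t ==> \<Phi> (root_coeff E xs j) = root_coeff M (map \<Phi> xs) j"
 using root_coeff_hom[OF B_cring M.is_cring \<Phi>_hom, of xs j] root_coeff_B[of xs j] by (simp add: B_ops)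

lemma \<iota>_B [simp]: "a : local_ring t ==> \<iota> a : B t"
 by (rule B_\<iota>_in)

lemma \<kappa>_in [simp]: "\<kappa> a : carrier M"
 by (simp add: \<kappa>_def \<Phi>_in local_ring_const)

lemma \<kappa>_add: "\<kappa> (a + b) = \<kappa> a \<oplus>\<^bsub>M\<^esub> \<kappa> b" and \<kappa>_mult: "\<kappa> (a * b) = \<kappa> a \<otimes>\<^bsub>M\<^esub> \<kappa> b"
 and \<kappa>_1: "\<kappa> 1 = \<one>\<^bsub>M\<^esub>" and \<kappa>_0: "\<kappa> 0 = \<zero>\<^bsub>M\<^esub>"
 by (simp_all add: \<kappa>_def \<iota>_add \<iota>_mult \<Phi>_add \<Phi>_mult local_ring_const \<iota>_1 \<Phi>_1 \<iota>_0 \<Phi>_0)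

lemma \<kappa>_eq_0: "\<kappa> a = \<zero>\<^bsub>M\<^esub> ==> a = 0"
proof (rule ccontr)
 assume "\<kappa> a = \<zero>\<^bsub>M\<^esub>" "a ~= 0"
 hence "\<kappa> (a * inverse a) = \<zero>\<^bsub>M\<^esub>" unfolding \<kappa>_mult by simp
 thus False using \<open>a ~= 0\<close> by (simp add: \<kappa>_1)
qed

lemma inj_\<kappa>: "inj \<kappa>"
proof (rule injI)
 fix a b assume ab: "\<kappa> a = \<kappa> b"
 have "\<kappa> (a - b) \<oplus>\<^bsub>M\<^esub> \<kappa> b = \<zero>\<^bsub>M\<^esub> \<oplus>\<^bsub>M\<^esub> \<kappa> b" using ab by (simp flip: \<kappa>_add)
 hence "\<kappa> (a - b) = \<zero>\<^bsub>M\<^esub>" by (simp only: M.add.r_cancel \<kappa>_in M.zero_closed)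
 from \<kappa>_eq_0[OF this] show "a = b" by simp
qed

lemma \<Phi>_ev:
 assumes W: "W : local_ring t" "\<Phi> (\<iota> W) = \<kappa> x0"
 shows "ev W f : local_ring t & \<Phi> (\<iota> (ev W f)) = \<kappa> (poly f x0)"
proof (induction f)
 case 0
 show ?case using subring_set_0[OF local_ring_subring] by (simp add: \<iota>_0 \<Phi>_0 \<kappa>_0)
next
 case (pCons a f)
 hence "W * ev W f : local_ring t" using subring_set_mult[OF local_ring_subring W(1)] by blast
 thus ?case using pCons W subring_set_add[OF local_ring_subring local_ring_const]
  by (simp add: \<iota>_add \<iota>_mult \<Phi>_add \<Phi>_mult local_ring_const B_mult \<kappa>_add \<kappa>_mult \<kappa>_def[symmetric])
qed

lemma \<Phi>_ev_parameter: "\<Phi> (\<iota> (ev (local_parameter t) f)) = \<kappa> (poly f 0)"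
 using \<Phi>_ev[OF local_ring_parameter, of 0] by (simp add: \<kappa>_0 \<Phi>_parameter)

lemma \<Phi>_quotient:
 assumes g: "poly g 0 ~= 0" and a: "a = ev (local_parameter t) f / ev (local_parameter t) g"
 shows "\<Phi> (\<iota> a) = \<kappa> (poly f 0 / poly g 0)"
proof -
 have aL: "a : local_ring t" using assms unfolding local_ring_iff by blast
 have "a * ev (local_parameter t) g = ev (local_parameter t) f" using ev_local_unit[OF g] a by simp
 hence "\<Phi> (\<iota> a \<otimes>\<^bsub>E\<^esub> \<iota> (ev (local_parameter t) g)) = \<kappa> (poly f 0)" by (simp flip: \<iota>_mult add: \<Phi>_ev_parameter)
 hence *: "\<Phi> (\<iota> a) \<otimes>\<^bsub>M\<^esub> \<kappa> (poly g 0) = \<kappa> (poly f 0)" by (simp add: \<Phi>_mult aL local_ring_ev \<Phi>_ev_parameter)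
 have "\<Phi> (\<iota> a) \<otimes>\<^bsub>M\<^esub> \<kappa> (poly g 0) \<otimes>\<^bsub>M\<^esub> \<kappa> (inverse (poly g 0)) = \<Phi> (\<iota> a)"
  using aL g by (simp add: M.m_assoc \<Phi>_in \<kappa>_1 flip: \<kappa>_mult)
 thus ?thesis unfolding * by (simp add: divide_inverse flip: \<kappa>_mult)
qed

lemma \<Phi>_loc_value: "a : local_ring t ==> \<Phi> (\<iota> a) = \<kappa> (loc_value t a)"
 by (metis loc_value \<Phi>_quotient)

lemma chart_T:
 assumes "t = Finite_point c"
 shows "Fract [:0, 1:] 1 : local_ring t" "\<Phi> (\<iota> (Fract [:0, 1:] 1)) = \<kappa> c"
proof -
 have eq: "Fract [:0, 1:] 1 = ev (local_parameter t) [:c, 1:]"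
  using assms by (simp add: const_fract_def)
 show "Fract [:0, 1:] 1 : local_ring t" unfolding eq by (rule local_ring_ev)
 show "\<Phi> (\<iota> (Fract [:0, 1:] 1)) = \<kappa> c" unfolding eq \<Phi>_ev_parameter by simp
qed

lemma chart_inverse_T:
 assumes "t = Finite_point c" "c ~= 0"
 shows "Fract 1 [:0, 1:] : local_ring t" "\<Phi> (\<iota> (Fract 1 [:0, 1:])) = \<kappa> (inverse c)"
proof -
 have "Fract [:0, 1:] 1 = ev (local_parameter t) [:c, 1:]"
  using assms by (simp add: const_fract_def)
 hence eq: "Fract 1 [:0, 1:] = ev (local_parameter t) 1 / ev (local_parameter t) [:c, 1:]"
  by (simp add: Fract_inverse_T inverse_eq_divide)
 have nz: "poly [:c, 1:] 0 ~= 0" using assms by simp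
 show "Fract 1 [:0, 1:] : local_ring t" unfolding local_ring_iff using eq nz by blast
 show "\<Phi> (\<iota> (Fract 1 [:0, 1:])) = \<kappa> (inverse c)" using \<Phi>_quotient[OF nz eq] by (simp add: inverse_eq_divide)
qed

text \<open>The images of the conjugates of \<open>x\<close> are roots of a polynomial over
  \<open>k\<close> that depends on \<open>t\<close> but not on \<open>\<Phi>\<close>. Its roots can
  therefore be put into a test set before any place or point is chosen.\<close>

lemma root_coeff_\<Phi>_orb:
 assumes x: "x : B t" shows "root_coeff M (map \<Phi> (orb x)) j = \<kappa> (res_coeff t x j)"
proof -
 obtain a where a: "root_coeff E (orb x) j = \<iota> a" using orb_coeff[OF B_E[OF x]] by blast
 have "a : local_ring t" using root_coeff_in_B[OF orb_B[OF x], of j] unfolding a by (rule B_\<iota>)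
 hence "\<Phi> (root_coeff E (orb x) j) = \<kappa> (res_coeff t x j)"
  by (simp add: a res_coeff_def \<iota>_inv \<Phi>_loc_value)
 thus ?thesis by (simp add: \<Phi>_root_coeff[OF orb_B[OF x]])
qed

lemma \<Phi>_orb_in: "x : B t ==> set (map \<Phi> (orb x)) <= carrier M"
 using orb_B[of x] \<Phi>_in by auto

abbreviation comb :: "'e => 'k => 'e => 'e" where
 "comb x c y \<equiv> x \<oplus>\<^bsub>E\<^esub> \<iota> (const_fract c) \<otimes>\<^bsub>E\<^esub> y"

lemma comb_B: "x : B t ==> y : B t ==> comb x c y : B t"
 by (simp add: B_add B_mult local_ring_const)

lemma \<Phi>_comb: "x : B t ==> y : B t ==> \<Phi> (comb x c y) = \<Phi> x \<oplus>\<^bsub>M\<^esub> \<kappa> c \<otimes>\<^bsub>M\<^esub> \<Phi> y"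
 by (simp add: \<Phi>_add \<Phi>_mult B_mult local_ring_const \<kappa>_def)

lemma Gm_comb: "\<sigma> : Gm ==> x : B t ==> y : B t ==> \<sigma> (comb x c y) = comb (\<sigma> x) c (\<sigma> y)"
 by (simp add: Gm_add Gm_mult Gm_\<iota> B_E)

text \<open>Both \<open>s \<circ> \<Phi>\<close> and the \<open>\<Phi> \<circ> \<sigma>\<close> satisfy, at each element, the same characteristic polynomial.\<close>

lemma automorphism_lifts:
 assumes s: "s : ring_hom M M" and fixd: "!!c. s (\<kappa> c) = \<kappa> c"
 shows "EX \<rho>:Gm. ALL x:B t. s (\<Phi> x) = \<Phi> (\<rho> x)"
proof (rule equalizer_cover[where comb = comb and \<kappa> = \<kappa> and M = M])
 have s_in: "s a : carrier M" and s_add: "s (a \<oplus>\<^bsub>M\<^esub> b) = s a \<oplus>\<^bsub>M\<^esub> s b" and s_mult: "s (a \<otimes>\<^bsub>M\<^esub> b) = s a \<otimes>\<^bsub>M\<^esub> s b"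
  if "a : carrier M" "b : carrier M" for a b using s that by (auto simp: ring_hom_def)
 show "s (\<Phi> x) : carrier M" if "x : B t" for x using that by (simp add: s_in[OF \<Phi>_in \<Phi>_in])
 show "s (\<Phi> (comb x c y)) = s (\<Phi> x) \<oplus>\<^bsub>M\<^esub> \<kappa> c \<otimes>\<^bsub>M\<^esub> s (\<Phi> y)" if "x : B t" "y : B t" for x y c
  using that by (simp add: \<Phi>_comb s_add s_mult \<Phi>_in fixd)
 show "EX \<rho>:Gm. s (\<Phi> x) = \<Phi> (\<rho> x)" if x: "x : B t" for x
 proof -
  let ?xs = "map \<Phi> (orb x)"
  have xs: "set ?xs <= carrier M" by (rule \<Phi>_orb_in[OF x])
  have "\<Phi> x : set ?xs" using orb_self[OF B_E[OF x]] by simp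
  hence "horner M (\<Phi> x) (length ?xs) (root_coeff M ?xs) = \<zero>\<^bsub>M\<^esub>" by (rule M.horner_at_root[OF xs])
  hence "s (horner M (\<Phi> x) (length ?xs) (root_coeff M ?xs)) = \<zero>\<^bsub>M\<^esub>"
   using ring_hom_zero[OF s M.ring_axioms M.ring_axioms] by simp
  moreover have "s (horner M (\<Phi> x) (length ?xs) (root_coeff M ?xs)) = horner M (s (\<Phi> x)) (length ?xs) (%j. s (root_coeff M ?xs j))"
   using xs by (intro horner_hom[OF M.is_cring M.is_cring s \<Phi>_in[OF x]]) simp
  moreover have "(%j. s (root_coeff M ?xs j)) = root_coeff M ?xs"
   by (rule ext) (simp only: root_coeff_\<Phi>_orb[OF x] fixd)
  ultimately have "horner M (s (\<Phi> x)) (length ?xs) (root_coeff M ?xs) = \<zero>\<^bsub>M\<^esub>" by simp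
  hence "s (\<Phi> x) : set ?xs" by (rule M.horner_root_imp[OF xs s_in[OF \<Phi>_in[OF x] \<Phi>_in[OF x]]])
  thus ?thesis by (auto simp: orb_set)
 qed
 show "B t ~= {}" using B_\<iota>_in[OF local_ring_const] by blast
qed (auto simp: M.domain_axioms infinite_UNIV_char_0 finite_group comb_B inj_\<kappa> Gm_comb \<Phi>_comb B_Gm \<Phi>_in)

text \<open>For \<open>x : Q\<close> the norm lies in \<open>Q\<close> and in the local ring, so its
  residue is 0 and some conjugate of \<open>x\<close> is killed by \<open>\<Phi>\<close>;
  \<open>equalizer_cover\<close>, comparing with the zero map, makes the conjugation uniform. This
  links the prime for which residue generators were fixed in advance with the one underlying
  \<open>\<Phi>\<close>.\<close>

lemma prime_conjugate_kernel:
 assumes Q: "primeideal Q (closure_ring E \<iota> t)" "\<iota> (local_parameter t) : Q"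
 shows "EX \<tau>:Gm. ALL x:Q. \<Phi> (\<tau> x) = \<zero>\<^bsub>M\<^esub>"
proof (rule equalizer_cover[where comb = comb and \<kappa> = \<kappa> and M = M])
 interpret Q: primeideal Q "closure_ring E \<iota> t" by (rule Q(1))
 have QB: "x : B t" if "x : Q" for x using Q.a_subset that by (auto simp: B_ops)
 show "comb x c y : Q" if "x : Q" "y : Q" for x y c
  using Q.a_closed[OF that(1) Q.I_l_closed[OF that(2), of "\<iota> (const_fract c)"]] by (simp add: B_ops local_ring_const)
 show "\<Phi> (\<tau> (comb x c y)) = \<Phi> (\<tau> x) \<oplus>\<^bsub>M\<^esub> \<kappa> c \<otimes>\<^bsub>M\<^esub> \<Phi> (\<tau> y)" if "\<tau> : Gm" "x : Q" "y : Q" for \<tau> x y c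
  using that by (simp add: QB Gm_comb \<Phi>_comb B_Gm)
 show "EX \<tau>:Gm. \<Phi> (\<tau> x) = \<zero>\<^bsub>M\<^esub>" if xQ: "x : Q" for x
 proof -
  note x = QB[OF xQ]
  let ?c = "root_coeff E (orb x) 0"
  have cQ: "?c : Q"
   using Q.root_coeff_0_in[OF B_cring _ orb_self[OF B_E[OF x]] xQ] orb_B[OF x] root_coeff_B[OF orb_B[OF x]] by (simp add: B_ops)
  obtain a where a: "?c = \<iota> a" using orb_coeff[OF B_E[OF x]] by blast
  have aL: "a : local_ring t" using QB[OF cQ] unfolding a by (rule B_\<iota>)
  then obtain f g where fg: "poly g 0 ~= 0" "a = ev (local_parameter t) f / ev (local_parameter t) g"
   unfolding local_ring_iff by blast
  have "poly f 0 = 0"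
  proof (rule ccontr)
   assume f: "poly f 0 ~= 0"
   have "inverse a : local_ring t" unfolding local_ring_iff using fg f by (intro exI[of _ g] exI[of _ f]) simp
   hence "\<iota> (inverse a) \<otimes>\<^bsub>E\<^esub> \<iota> a : Q" using Q.I_l_closed[of "\<iota> a" "\<iota> (inverse a)"] cQ by (simp add: a B_ops)
   moreover have "inverse a * a = 1" using fg ev_local_unit[OF f] ev_local_unit[OF fg(1)] by simp
   ultimately have "\<one>\<^bsub>closure_ring E \<iota> t\<^esub> : Q" by (simp add: B_ops \<iota>_1 flip: \<iota>_mult)
   thus False using Q.one_imp_carrier Q.I_notcarr by blast
  qed
  hence "\<Phi> ?c = \<zero>\<^bsub>M\<^esub>" using \<Phi>_quotient[OF fg] by (simp add: a \<kappa>_0)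
  hence "root_coeff M (map \<Phi> (orb x)) 0 = \<zero>\<^bsub>M\<^esub>" by (simp add: \<Phi>_root_coeff[OF orb_B[OF x]])
  hence "\<zero>\<^bsub>M\<^esub> : set (map \<Phi> (orb x))" using M.root_coeff_0_nonzero[OF \<Phi>_orb_in[OF x]] by blast
  thus ?thesis by (auto simp: orb_set)
 qed
 show "Q ~= {}" using Q(2) by blast
 show "\<Phi> (\<tau> x) : carrier M" if "\<tau> : Gm" "x : Q" for \<tau> x using that by (simp add: QB B_Gm \<Phi>_in)
qed (auto simp: M.domain_axioms infinite_UNIV_char_0 finite_group inj_\<kappa>)

end

section \<open>Contradictions at nonexceptional and at exceptional points\<close>

section \<open>Specializations at a place\<close>

context local_field
begin

lemma Lp_minus:
 assumes "x : CS" "y : CS" shows "q x \<ominus>\<^bsub>Lp\<^esub> q y = q (%n. x n - y n)"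
proof -
 interpret L: field Lp by (rule Lp_field)
 have "a \<oplus>\<^bsub>Lp\<^esub> b \<ominus>\<^bsub>Lp\<^esub> b = a" if "a : carrier Lp" "b : carrier Lp" for a b
  using that by algebra
 from this[OF q_in[OF CS_diff[OF assms]] q_in[OF assms(2)]] show ?thesis
  by (simp add: Lp_add[OF CS_diff[OF assms] assms(2)])
qed

lemma root_coeff_q:
 "set xs <= CS ==> (%n. coeff (\<Prod>x\<leftarrow>xs. [:- x n, 1:]) j) : CS \<and>
   root_coeff Lp (map q xs) j = q (%n. coeff (\<Prod>x\<leftarrow>xs. [:- x n, 1:]) j)"
proof (induction xs arbitrary: j)
 case Nil
 show ?case using CS_const[OF kum_1] CS_const[OF kum_field_0] by (simp add: coeff_1 Lp_one Lp_zero)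
next
 case (Cons x xs)
 define c where "c j = (%n. coeff (\<Prod>x\<leftarrow>xs. [:- x n, 1:]) j)" for j
 have IH: "c i : CS" "root_coeff Lp (map q xs) i = q (c i)" for i using Cons by (simp_all add: c_def)
 define b where "b n = (case j of 0 => 0 | Suc i => c i n)" for n
 have b: "b : CS" "(case j of 0 => \<zero>\<^bsub>Lp\<^esub> | Suc i => root_coeff Lp (map q xs) i) = q b"
  using IH CS_const[OF kum_field_0] unfolding b_def by (cases j; simp add: Lp_zero)+
 have x: "x : CS" using Cons.prems by simp
 have eq: "(%n. coeff (\<Prod>x\<leftarrow>x # xs. [:- x n, 1:]) j) = (%n. b n - x n * c j n)"
  by (rule ext) (simp add: b_def c_def coeff_pCons split: nat.split)
 show ?case unfolding eq using b IH[of j] x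
  by (simp add: Lp_mult Lp_minus CS_diff CS_mult)
qed

lemma sg_hom: "sg al be : ring_hom Lp Lp"
 by (rule ring_hom_memI) (auto simp: sg_in sg_mult sg_add sg_one)

lemma \<zeta>_pow_1: "\<zeta> ^ a = 1 ==> N dvd a"
 using \<zeta>_pow_eq_iff[of "a mod N" 0] N \<zeta>_pow_mod[of a] by auto

lemma sg_trivial:
 assumes "!!a. a : carrier Lp ==> sg al be a = a" shows "N dvd al & N dvd be"
proof -
 have "\<zeta> ^ a * x = x" if x: "x : kum_field" "kum_aut al be x = \<zeta> ^ a * x" for x a
 proof -
  have C: "(%_. x) : CS" "(%_. kum_aut al be x) : CS" using CS_const x(1) kum_aut_in by blast+
  have "q (%_. kum_aut al be x) = q (%_. x)" using assms[OF q_in[OF C(1)]] sg_q[OF C(1)] by simp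
  hence "null (%_. kum_aut al be x - x)" using q_eq[OF C(2,1)] by simp
  from null_const[OF this] show ?thesis using x(2) by simp
 qed
 from this[of ups al] this[of \<rho> be] show ?thesis
  using kum_aut_monomial[of 1 al be 1 0] kum_aut_monomial[of 1 al be 0 1] F_1 ups_kum \<rho>_kum ups_neq_0 \<rho>_neq_0
  by (auto intro!: \<zeta>_pow_1)
qed

lemma null_eventually_vle:
 assumes "null x" "r ~= 0" shows "\<forall>\<^sub>F n in sequentially. vle (x n) r"
proof -
 obtain k where k: "vle (of_nat p ^ k) r" using archimedean[OF assms(2)] by blast
 obtain m where "ALL i>=m. vle (x i) (of_nat p ^ k)" using assms(1) unfolding null_def by blast
 thus ?thesis unfolding eventually_sequentially using vle_trans k by blast
qed

text \<open>Expresses that \<open>k_P\<close> and the image of \<open>C\<close> generate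
  \<open>Lp\<close>, in the form in which it is applied: no endomorphism other than the identity
  fixes both.\<close>

definition generates :: "'e set => ('e => 'k local_ext_elem) => bool" where
 "generates C \<Phi> \<longleftrightarrow> (ALL s:ring_hom Lp Lp. (ALL c:carrier (completion P). s (nu c) = nu c) -->
   (ALL x:C. s (\<Phi> x) = \<Phi> x) --> (ALL a:carrier Lp. s a = a))"

lemma generates_sg:
 assumes "generates C \<Phi>" "!!x. x : C ==> sg al be (\<Phi> x) = \<Phi> x" shows "N dvd al & N dvd be"
proof (rule sg_trivial)
 show "sg al be a = a" if "a : carrier Lp" for a
  using assms that sg_hom[of al be] sg_nu[of _ al be] unfolding generates_def by blast
qed

lemma nu_to_completion: "nu (to_completion P c) = q (%_. to_ac c)"
 unfolding to_completion_eq by (rule nu_kap) (simp add: adic_Cauchy_iff cau_const)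

lemma to_completion_in: "to_completion P c : carrier (completion P)"
 unfolding to_completion_eq by (rule kap_carrier) (simp add: adic_Cauchy_iff cau_const)

lemma to_ac_CS: "(%_. to_ac c) : CS"
 by (rule CS_const[OF F_subset_kum_field[OF to_ac_F]])

text \<open>\<open>sg al be\<close> lifts to an element of the Galois group, which is not the
  identity because otherwise generators of \<open>Lp\<close> would be fixed. Composition with it has
  no fixed point on the group, so the root supplied by \<open>kr\<close> yields two distinct
  conjugates of \<open>y\<close> at distance at most \<open>r\<close>. This distance is one factor
  of \<open>D\<close> at \<open>x0\<close> and the others are integral, against \<open>D\<close> at
  \<open>x0\<close> exceeding \<open>r\<close>.\<close>

lemma generic_point:
 fixes E :: "'e ring" and \<iota> :: "'k poly fract => 'e"
 defines "Gm \<equiv> carrier (galois_group ring_of_type_algebra E \<iota>)"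
 assumes gp: "gal_point E \<iota> Lp t \<Phi>" and \<Phi>k: "!!c. \<Phi> (\<iota> (const_fract c)) = nu (to_completion P c)"
  and gen: "generates (integral_closure E (\<iota> ` local_ring t)) \<Phi>"
  and W: "W : local_ring t" "\<Phi> (\<iota> W) = \<Phi> (\<iota> (const_fract x0))"
  and y: "y : carrier E" and f: "degree f = card Gm"
  and coeff: "!!j. root_coeff E (gal_ext.orb E \<iota> y) j = \<iota> (ev W (coeff f j))"
  and norm: "!!\<sigma> \<tau>. \<sigma> : Gm ==> \<tau> : Gm ==> \<sigma> ~= \<tau> ==>
    \<iota> (ev W D) = \<iota> (ev W (d \<sigma> \<tau>)) \<otimes>\<^bsub>E\<^esub> root_coeff E (gal_ext.orb E \<iota> (\<sigma> y \<ominus>\<^bsub>E\<^esub> \<tau> y)) 0"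
  and d: "!!\<sigma> \<tau>. \<sigma> : Gm ==> \<tau> : Gm ==> to_ac (poly (d \<sigma> \<tau>) x0) : A"
  and nontriv: "~ (N dvd al & N dvd be)" and r: "~ vle (to_ac (poly D x0)) r" "r ~= 0"
  and kr: "!!Y. (!!\<sigma>. \<sigma> : Gm ==> Y \<sigma> : kum_field) ==>
    (!!j. vle (coeff (\<Prod>\<sigma>\<in>Gm. [:- Y \<sigma>, 1:]) j - to_ac (poly (coeff f j) x0)) (of_nat p ^ M)) ==>
    (ALL \<sigma>:Gm. Y \<sigma> : A) & (EX \<sigma>:Gm. vle (Y \<sigma> - kum_aut al be (Y \<sigma>)) r)"
 shows False
proof -
 interpret G: gal_point E \<iota> Lp t \<Phi> by (rule gp)
 note Gm = Gm_def
 have \<kappa>: "G.\<kappa> c = q (%_. to_ac c)" for c by (simp add: G.\<kappa>_def \<Phi>k nu_to_completion)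
 have W': "\<Phi> (\<iota> W) = G.\<kappa> x0" by (simp add: W(2) G.\<kappa>_def)
 have evW: "ev W h : local_ring t" "\<Phi> (\<iota> (ev W h)) = q (%_. to_ac (poly h x0))" for h
  using G.\<Phi>_ev[OF W(1) W'] by (simp_all add: \<kappa>)
 have yB: "y : G.B t" by (rule G.B_orb[OF y]) (use evW(1) in \<open>simp add: coeff\<close>)
 have fin: "finite Gm" unfolding Gm by (rule G.finite_group)
 obtain \<rho>' where \<rho>': "\<rho>' : Gm" "ALL x:G.B t. sg al be (\<Phi> x) = \<Phi> (\<rho>' x)"
  using G.automorphism_lifts[OF sg_hom[of al be]] sg_nu[OF to_completion_in] unfolding G.\<kappa>_def \<Phi>k Gm by blast
 have \<rho>'_id: "\<rho>' ~= (\<lambda>x\<in>carrier E. x)"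
 proof
  assume eq: "\<rho>' = (\<lambda>x\<in>carrier E. x)"
  have "N dvd al & N dvd be" by (rule generates_sg[OF gen]) (use \<rho>'(2) G.B_E eq in auto)
  thus False using nontriv by blast
 qed
 have rho_comp: "compose (carrier E) \<rho>' \<sigma> : Gm" "compose (carrier E) \<rho>' \<sigma> ~= \<sigma>" if s: "\<sigma> : Gm" for \<sigma>
 proof -
  show "compose (carrier E) \<rho>' \<sigma> : Gm" using G.Gm_comp \<rho>'(1) s unfolding Gm by blast
  show "compose (carrier E) \<rho>' \<sigma> ~= \<sigma>"
  proof
   assume eq: "compose (carrier E) \<rho>' \<sigma> = \<sigma>"
   obtain \<tau> where \<tau>: "\<tau> : Gm" "ALL x:carrier E. \<sigma> (\<tau> x) = x" using G.Gm_right_inverse s unfolding Gm by blast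
   have "\<rho>' x = x" if x: "x : carrier E" for x
    using fun_cong[OF eq, of "\<tau> x"] \<tau> x G.Gm_in[of \<tau> x] unfolding Gm by (simp add: compose_def)
   hence "\<rho>' = (\<lambda>x\<in>carrier E. x)" using \<rho>'(1) unfolding Gm by (intro G.Gm_eqI[OF _ G.Gm_id]) auto
   thus False using \<rho>'_id by blast
  qed
 qed
 \<comment> \<open>Representing sequences of the residues. Equalities in \<open>Lp\<close> become
   the null sequences of \<open>c_null\<close>, \<open>sg_null\<close> and
   \<open>D_null\<close>.\<close>
 define Y where "Y x = rep (\<Phi> x)" for x
 have Y: "Y x : CS" "q (Y x) = \<Phi> x" if x: "x : G.B t" for x
 proof -
  obtain z where z: "z : CS" "\<Phi> x = q z" using G.\<Phi>_in[OF x] by (auto simp: Lp_carrier)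
  show "Y x : CS" "q (Y x) = \<Phi> x" using rep[OF z(1)] by (simp_all add: Y_def z(2))
 qed
 have \<sigma>B: "\<sigma> x : G.B t" if "\<sigma> : Gm" "x : G.B t" for \<sigma> x using G.B_Gm that unfolding Gm by blast
 have prod_list: "(\<Prod>x\<leftarrow>map h G.Gms. g x) = (\<Prod>\<sigma>\<in>Gm. g (h \<sigma>))" for h :: "('e => 'e) => 'z" and g :: "'z => 'k alg_closure poly"
  using prod.distinct_set_conv_list[OF G.Gms(2), of "g \<circ> h"] by (simp add: G.Gms(1) Gm comp_def)
 have c_null: "null (%n. coeff (\<Prod>\<sigma>\<in>Gm. [:- Y (\<sigma> y) n, 1:]) j - to_ac (poly (coeff f j) x0))" for j
 proof -
  let ?xs = "map (%\<sigma>. Y (\<sigma> y)) G.Gms"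
  have xs: "set ?xs <= CS" using Y(1) \<sigma>B yB by (auto simp: G.Gms Gm)
  have "map q ?xs = map \<Phi> (G.orb y)" using Y(2) \<sigma>B yB by (auto simp: G.orb_def G.Gms Gm)
  hence "root_coeff Lp (map q ?xs) j = q (%_. to_ac (poly (coeff f j) x0))"
   using G.\<Phi>_root_coeff[OF G.orb_B[OF yB], of j] by (simp add: coeff evW)
  hence "q (%n. coeff (\<Prod>x\<leftarrow>?xs. [:- x n, 1:]) j) = q (%_. to_ac (poly (coeff f j) x0))"
   using root_coeff_q[OF xs] by simp
  hence "null (%n. coeff (\<Prod>x\<leftarrow>?xs. [:- x n, 1:]) j - to_ac (poly (coeff f j) x0))"
   using root_coeff_q[OF xs, of j] q_eq to_ac_CS by blast
  thus ?thesis by (simp only: prod_list)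
 qed
 have sg_null: "null (%n. kum_aut al be (Y (\<sigma> y) n) - Y (compose (carrier E) \<rho>' \<sigma> y) n)" if s: "\<sigma> : Gm" for \<sigma>
 proof -
  note b = \<sigma>B[OF s yB]
  have "q (%n. kum_aut al be (Y (\<sigma> y) n)) = sg al be (\<Phi> (\<sigma> y))" using sg_q[OF Y(1)[OF b]] Y(2)[OF b] by simp
  also have "... = q (Y (compose (carrier E) \<rho>' \<sigma> y))"
   using \<rho>'(2) b Y(2)[OF \<sigma>B[OF \<rho>'(1) b]] y by (simp add: compose_def)
  finally show ?thesis using q_eq[OF CS_aut[OF Y(1)[OF b]] Y(1)[OF \<sigma>B[OF rho_comp(1)[OF s] yB]]] by blast
 qed
 have D_null: "null (%n. to_ac (poly D x0) - to_ac (poly (d \<sigma> \<tau>) x0) * (\<Prod>\<gamma>\<in>Gm. - (Y (\<gamma> (\<sigma> y)) n - Y (\<gamma> (\<tau> y)) n)))"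
  if st: "\<sigma> : Gm" "\<tau> : Gm" "\<sigma> ~= \<tau>" for \<sigma> \<tau>
 proof -
  let ?xs = "map (%\<gamma> n. Y (\<gamma> (\<sigma> y)) n - Y (\<gamma> (\<tau> y)) n) G.Gms"
  note b = \<sigma>B[OF st(1) yB] \<sigma>B[OF st(2) yB]
  have z: "\<sigma> y \<ominus>\<^bsub>E\<^esub> \<tau> y : G.B t" by (rule G.B_diff[OF b])
  have xs: "set ?xs <= CS" using Y(1) \<sigma>B b CS_diff by (auto simp: G.Gms Gm)
  have "q (%n. Y (\<gamma> (\<sigma> y)) n - Y (\<gamma> (\<tau> y)) n) = \<Phi> (\<gamma> (\<sigma> y \<ominus>\<^bsub>E\<^esub> \<tau> y))" if g: "\<gamma> : Gm" for \<gamma>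
   using Lp_minus[OF Y(1) Y(1), of "\<gamma> (\<sigma> y)" "\<gamma> (\<tau> y)"] Y(2) \<sigma>B[OF g] b
    G.Gm_diff[of \<gamma> "\<sigma> y" "\<tau> y"] G.\<Phi>_diff[of "\<gamma> (\<sigma> y)" "\<gamma> (\<tau> y)"] g G.B_E unfolding Gm by simp
  hence "map q ?xs = map \<Phi> (G.orb (\<sigma> y \<ominus>\<^bsub>E\<^esub> \<tau> y))" by (simp add: G.orb_def G.Gms Gm)
  moreover have "\<Phi> (\<iota> (ev W D)) = \<Phi> (\<iota> (ev W (d \<sigma> \<tau>))) \<otimes>\<^bsub>Lp\<^esub> root_coeff Lp (map \<Phi> (G.orb (\<sigma> y \<ominus>\<^bsub>E\<^esub> \<tau> y))) 0"
   unfolding norm[OF st] using G.\<Phi>_mult[OF G.\<iota>_B[OF evW(1)] G.root_coeff_in_B[OF G.orb_B[OF z]]] G.\<Phi>_root_coeff[OF G.orb_B[OF z]]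
   by simp
  ultimately have "q (%_. to_ac (poly D x0)) = q (%_. to_ac (poly (d \<sigma> \<tau>) x0)) \<otimes>\<^bsub>Lp\<^esub> q (%n. coeff (\<Prod>x\<leftarrow>?xs. [:- x n, 1:]) 0)"
   using root_coeff_q[OF xs, of 0] by (simp add: evW)
  hence "q (%_. to_ac (poly D x0)) = q (%n. to_ac (poly (d \<sigma> \<tau>) x0) * coeff (\<Prod>x\<leftarrow>?xs. [:- x n, 1:]) 0)"
   using Lp_mult[OF to_ac_CS] root_coeff_q[OF xs, of 0] by simp
  hence n: "null (%n. to_ac (poly D x0) - to_ac (poly (d \<sigma> \<tau>) x0) * coeff (\<Prod>x\<leftarrow>?xs. [:- x n, 1:]) 0)"
   using q_eq[OF to_ac_CS CS_mult[OF to_ac_CS]] root_coeff_q[OF xs, of 0] by blast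
  have "coeff (\<Prod>x\<leftarrow>?xs. [:- x n, 1:]) 0 = (\<Prod>\<gamma>\<in>Gm. - (Y (\<gamma> (\<sigma> y)) n - Y (\<gamma> (\<tau> y)) n))" for n
   unfolding prod_list by (simp add: poly_prod flip: poly_0_coeff_0)
  thus ?thesis using n by (simp only:)
 qed
 have p0: "(of_nat p :: 'k alg_closure) ^ M ~= 0" by (rule p_pow_neq_0)
 have "\<forall>\<^sub>F n in sequentially. (ALL j:{..card Gm}. vle (coeff (\<Prod>\<sigma>\<in>Gm. [:- Y (\<sigma> y) n, 1:]) j - to_ac (poly (coeff f j) x0)) (of_nat p ^ M))
   & (ALL \<sigma>:Gm. vle (kum_aut al be (Y (\<sigma> y) n) - Y (compose (carrier E) \<rho>' \<sigma> y) n) r)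
   & (ALL \<sigma>:Gm. vle (to_ac (poly D x0) - to_ac (poly (d \<sigma> (compose (carrier E) \<rho>' \<sigma>)) x0) *
      (\<Prod>\<gamma>\<in>Gm. - (Y (\<gamma> (\<sigma> y)) n - Y (\<gamma> (compose (carrier E) \<rho>' \<sigma> y)) n))) r)" (is "eventually ?P sequentially")
  by (intro eventually_conj eventually_ball_finite fin finite_atMost ballI null_eventually_vle[OF c_null p0]
    null_eventually_vle[OF sg_null r(2)] null_eventually_vle[OF D_null[OF _ rho_comp(1) rho_comp(2)[symmetric]] r(2)])
 \<comment> \<open>Only finitely many null conditions are involved, so one index meets all of them
   to the needed accuracy. From here on the argument takes place in the algebraic closure.\<close>
 then obtain n where n: "?P n" using eventually_happens'[OF sequentially_bot] by blast
 have n1: "vle (coeff (\<Prod>\<sigma>\<in>Gm. [:- Y (\<sigma> y) n, 1:]) j - to_ac (poly (coeff f j) x0)) (of_nat p ^ M)" if "j <= card Gm" for j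
  by (rule bspec[OF conjunct1[OF n]]) (simp add: that)
 have n2: "vle (kum_aut al be (Y (\<sigma> y) n) - Y (compose (carrier E) \<rho>' \<sigma> y) n) r" if "\<sigma> : Gm" for \<sigma>
  by (rule bspec[OF conjunct1[OF conjunct2[OF n]] that])
 have n3: "vle (to_ac (poly D x0) - to_ac (poly (d \<sigma> (compose (carrier E) \<rho>' \<sigma>)) x0) *
   (\<Prod>\<gamma>\<in>Gm. - (Y (\<gamma> (\<sigma> y)) n - Y (\<gamma> (compose (carrier E) \<rho>' \<sigma> y)) n))) r" if "\<sigma> : Gm" for \<sigma>
  by (rule bspec[OF conjunct2[OF conjunct2[OF n]] that])
 have "vle (coeff (\<Prod>\<sigma>\<in>Gm. [:- Y (\<sigma> y) n, 1:]) j - to_ac (poly (coeff f j) x0)) (of_nat p ^ M)" for j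
 proof (cases "j <= card Gm")
  case False
  have "degree (\<Prod>\<sigma>\<in>Gm. [:- Y (\<sigma> y) n, 1:]) = card Gm" by (subst degree_prod_eq_sum_degree) auto
  thus ?thesis using False f by (simp add: coeff_eq_0)
 qed (rule n1)
 from kr[of "%\<sigma>. Y (\<sigma> y) n", OF _ this]
 have YA: "!!\<sigma>. \<sigma> : Gm ==> Y (\<sigma> y) n : A" and ex: "EX \<sigma>:Gm. vle (Y (\<sigma> y) n - kum_aut al be (Y (\<sigma> y) n)) r"
  using CS_D(2)[OF Y(1)[OF \<sigma>B[OF _ yB]]] by blast+
 from ex obtain \<sigma> where s: "\<sigma> : Gm" "vle (Y (\<sigma> y) n - kum_aut al be (Y (\<sigma> y) n)) r" by blast
 define \<tau> where "\<tau> = compose (carrier E) \<rho>' \<sigma>"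
 have \<tau>: "\<tau> : Gm" using rho_comp(1)[OF s(1)] by (simp add: \<tau>_def)
 have diff: "vle (Y (\<sigma> y) n - Y (\<tau> y) n) r" using vle_add[OF s(2) n2[OF s(1)]] by (simp add: \<tau>_def)
 have gA: "Y (\<gamma> (\<sigma>' y)) n : A" if "\<gamma> : Gm" "\<sigma>' : Gm" for \<gamma> \<sigma>'
  using YA[of "compose (carrier E) \<gamma> \<sigma>'"] G.Gm_comp that y unfolding Gm by (simp add: compose_def)
 let ?h = "%\<gamma>. - (Y (\<gamma> (\<sigma> y)) n - Y (\<gamma> (\<tau> y)) n)"
 let ?id = "\<lambda>x\<in>carrier E. x"
 have id: "?id : Gm" unfolding Gm by (rule G.Gm_id)
 \<comment> \<open>The identity contributes the small difference; the conjugated differences are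
   integral.\<close>
 have "(\<Prod>\<gamma>\<in>Gm. ?h \<gamma>) = ?h ?id * (\<Prod>\<gamma>\<in>Gm - {?id}. ?h \<gamma>)" by (rule prod.remove[OF fin id])
 also have "?h ?id = - (Y (\<sigma> y) n - Y (\<tau> y) n)"
  using G.Gm_in[of \<sigma> y] G.Gm_in[of \<tau> y] s(1) \<tau> y unfolding Gm by simp
 also have "- a * b = b * (- 1) * a" for a b :: "'k alg_closure" by simp
 finally have prod: "(\<Prod>\<gamma>\<in>Gm. ?h \<gamma>) = (\<Prod>\<gamma>\<in>Gm - {?id}. ?h \<gamma>) * (- 1) * (Y (\<sigma> y) n - Y (\<tau> y) n)" .
 have "to_ac (poly (d \<sigma> \<tau>) x0) * ((\<Prod>\<gamma>\<in>Gm - {?id}. ?h \<gamma>) * (- 1)) : A"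
  by (intro in_mult in_prod in_uminus in_diff in_1 d[OF s(1) \<tau>] gA s(1) \<tau>) auto
 from vle_mult_left[OF this diff]
 have "vle (to_ac (poly (d \<sigma> \<tau>) x0) * (\<Prod>\<gamma>\<in>Gm. ?h \<gamma>)) r" unfolding prod by (simp only: mult.assoc)
 from vle_add[OF n3[OF s(1), folded \<tau>_def] this] show False using r(1) by simp
qed

text \<open>The reduced characteristic polynomials of the generators \<open>bs\<close> have all
  their roots in \<open>F\<close>, so the conjugated residues lie in \<open>k_P\<close>. Then all
  values of \<open>\<Phi>\<close> do, \<open>sg 1 0\<close> fixes them, and it would be the identity
  although \<open>N > 1\<close>.\<close>

lemma exceptional_point:
 fixes E :: "'e ring" and \<iota> :: "'k poly fract => 'e"
 assumes gp: "gal_point E \<iota> Lp t \<Phi>" and \<Phi>k: "!!c. \<Phi> (\<iota> (const_fract c)) = nu (to_completion P c)"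
  and gen: "generates (integral_closure E (\<iota> ` local_ring t)) \<Phi>" and N1: "N > 1"
  and Q: "primeideal Q (closure_ring E \<iota> t)" "\<iota> (local_parameter t) : Q"
  and bs: "set bs <= integral_closure E (\<iota> ` local_ring t)"
   "ring.Span (closure_ring E \<iota> t Quot Q) (range (%a. Q +>\<^bsub>closure_ring E \<iota> t\<^esub> \<iota> (const_fract a)))
     (map (%b. Q +>\<^bsub>closure_ring E \<iota> t\<^esub> b) bs) = carrier (closure_ring E \<iota> t Quot Q)"
  and roots: "!!b. b : set bs ==> EX zs. set zs <= F & (ALL j. to_ac (gal_ext.res_coeff E \<iota> t b j) = coeff (\<Prod>z\<leftarrow>zs. [:- z, 1:]) j)"
 shows False
proof -
 interpret G: gal_point E \<iota> Lp t \<Phi> by (rule gp)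
 interpret R: cring "closure_ring E \<iota> t" by (rule G.B_cring)
 interpret Q: primeideal Q "closure_ring E \<iota> t" by (rule Q(1))
 let ?R = "closure_ring E \<iota> t" and ?K = "nu ` carrier (completion P)"
 have \<kappa>: "G.\<kappa> c = q (%_. to_ac c)" for c by (simp add: G.\<kappa>_def \<Phi>k nu_to_completion)
 interpret K: subfield ?K Lp by (rule nu_subfield)
 obtain \<tau> where \<tau>: "\<tau> : G.Gm" "ALL x:Q. \<Phi> (\<tau> x) = \<zero>\<^bsub>Lp\<^esub>" using G.prime_conjugate_kernel[OF Q] by blast
 have gen_in: "\<Phi> (\<tau> b) : ?K" if b: "b : set bs" for b
 proof -
  have bB: "b : G.B t" using bs(1) b by blast
  obtain zs where zs: "set zs <= F" "!!j. to_ac (G.res_coeff t b j) = coeff (\<Prod>z\<leftarrow>zs. [:- z, 1:]) j"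
   using roots[OF b] by blast
  let ?xs = "map (%z (_ :: nat). z) zs" and ?ys = "map \<Phi> (G.orb b)"
  have xs: "set ?xs <= CS" using zs(1) CS_const[OF F_subset_kum_field] by auto
  have qxs: "set (map q ?xs) <= carrier Lp" using xs q_in by auto
  have eq: "root_coeff Lp ?ys = root_coeff Lp (map q ?xs)"
  proof
   fix j show "root_coeff Lp ?ys j = root_coeff Lp (map q ?xs) j"
    using root_coeff_q[OF xs, of j] G.root_coeff_\<Phi>_orb[OF bB, of j] by (simp add: \<kappa> zs(2) comp_def)
  qed
  \<comment> \<open>Root lists with the same coefficient function have equal length: otherwise the
    leading 1 of one meets a 0 of the other.\<close>
  have len: "length zs = length ?ys"
  proof (rule ccontr)
   note ys = G.\<Phi>_orb_in[OF bB]
   assume "length zs ~= length ?ys"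
   hence "length zs < length ?ys | length ?ys < length zs" by linarith
   hence "\<one>\<^bsub>Lp\<^esub> = \<zero>\<^bsub>Lp\<^esub>"
   proof
    assume "length zs < length ?ys"
    thus ?thesis using G.M.root_coeff_lead[OF ys] G.M.root_coeff_outside[OF qxs, of "length ?ys"] by (simp add: eq)
   next
    assume "length ?ys < length zs"
    thus ?thesis using G.M.root_coeff_lead[OF qxs] G.M.root_coeff_outside[OF ys, of "length zs"] by (simp add: eq)
   qed
   thus False by simp
  qed
  have mem: "\<Phi> (\<tau> b) : set ?ys" using \<tau>(1) by (auto simp: G.orb_set)
  have "horner Lp (\<Phi> (\<tau> b)) (length ?ys) (root_coeff Lp ?ys) = \<zero>\<^bsub>Lp\<^esub>" by (rule G.M.horner_at_root[OF G.\<Phi>_orb_in[OF bB] mem])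
  hence "horner Lp (\<Phi> (\<tau> b)) (length (map q ?xs)) (root_coeff Lp (map q ?xs)) = \<zero>\<^bsub>Lp\<^esub>" unfolding eq by (simp add: len)
  from G.M.horner_root_imp[OF qxs G.\<Phi>_in[OF G.B_Gm[OF \<tau>(1) bB]] this]
  have "\<Phi> (\<tau> b) : set (map q ?xs)" .
  thus ?thesis using zs(1) by (auto intro!: F_seq_in_nu cau_const)
 qed
 \<comment> \<open>Every class modulo \<open>Q\<close> has some representative sent to
   \<open>k_P\<close> by \<open>\<Phi>\<close> after \<open>\<tau>\<close>. As this composite kills
   \<open>Q\<close>, the same follows for every representative.\<close>
 have "ALL z:ring.Span (?R Quot Q) (range (%a. Q +>\<^bsub>?R\<^esub> \<iota> (const_fract a))) (map (%b. Q +>\<^bsub>?R\<^esub> b) cs).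
   EX w:G.B t. z = Q +>\<^bsub>?R\<^esub> w & \<Phi> (\<tau> w) : ?K" if "set cs <= set bs" for cs
  using that
 proof (induction cs)
  case Nil
  have "\<Phi> (\<tau> \<zero>\<^bsub>E\<^esub>) : ?K" using G.Gm_0[OF \<tau>(1)] subringE(2)[OF K.subring_axioms] by (simp add: G.\<Phi>_0)
  moreover have "\<zero>\<^bsub>E\<^esub> : G.B t" using R.zero_closed by (simp add: G.B_ops)
  moreover have "\<zero>\<^bsub>?R Quot Q\<^esub> = Q +>\<^bsub>?R\<^esub> \<zero>\<^bsub>E\<^esub>"
   using ring_hom_zero[OF Q.rcos_ring_hom R.ring_axioms Q.quotient_is_ring] by (simp add: G.B_ops)
  ultimately show ?case by (simp add: ring.Span.simps[OF Q.quotient_is_ring]) blast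
 next
  case (Cons b cs)
  show ?case
  proof
   fix z assume "z : ring.Span (?R Quot Q) (range (%a. Q +>\<^bsub>?R\<^esub> \<iota> (const_fract a))) (map (%b. Q +>\<^bsub>?R\<^esub> b) (b # cs))"
   then obtain a v where v: "v : ring.Span (?R Quot Q) (range (%a. Q +>\<^bsub>?R\<^esub> \<iota> (const_fract a))) (map (%b. Q +>\<^bsub>?R\<^esub> b) cs)"
     "z = (Q +>\<^bsub>?R\<^esub> \<iota> (const_fract a)) \<otimes>\<^bsub>?R Quot Q\<^esub> (Q +>\<^bsub>?R\<^esub> b) \<oplus>\<^bsub>?R Quot Q\<^esub> v"
    by (auto simp: ring.Span.simps[OF Q.quotient_is_ring] ring.line_extension_mem_iff[OF Q.quotient_is_ring])
   obtain w where w: "w : G.B t" "v = Q +>\<^bsub>?R\<^esub> w" "\<Phi> (\<tau> w) : ?K" using Cons v(1) by auto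
   have bB: "b : G.B t" using bs(1) Cons.prems by auto
   have aB: "\<iota> (const_fract a) : G.B t" by (simp add: local_ring_const)
   have z: "z = Q +>\<^bsub>?R\<^esub> (\<iota> (const_fract a) \<otimes>\<^bsub>E\<^esub> b \<oplus>\<^bsub>E\<^esub> w)"
    using ring_hom_mult[OF Q.rcos_ring_hom, of "\<iota> (const_fract a)" b]
     ring_hom_add[OF Q.rcos_ring_hom, of "\<iota> (const_fract a) \<otimes>\<^bsub>E\<^esub> b" w] aB bB w(1) G.B_mult[OF aB bB]
    by (simp add: v(2) w(2) G.B_ops)
   have "\<Phi> (\<tau> (\<iota> (const_fract a) \<otimes>\<^bsub>E\<^esub> b \<oplus>\<^bsub>E\<^esub> w)) = nu (to_completion P a) \<otimes>\<^bsub>Lp\<^esub> \<Phi> (\<tau> b) \<oplus>\<^bsub>Lp\<^esub> \<Phi> (\<tau> w)"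
    using aB bB w(1) by (simp add: G.Gm_add[OF \<tau>(1)] G.Gm_mult[OF \<tau>(1)] G.Gm_\<iota>[OF \<tau>(1)] G.B_E G.B_mult G.\<Phi>_add G.\<Phi>_mult
      G.B_Gm[OF \<tau>(1)] \<Phi>k)
   also have "... : ?K"
    using gen_in[of b] Cons.prems w(3) to_completion_in[of a]
    by (intro subringE(7)[OF K.subring_axioms] subringE(6)[OF K.subring_axioms]) auto
   finally show "EX w:G.B t. z = Q +>\<^bsub>?R\<^esub> w & \<Phi> (\<tau> w) : ?K"
    using z G.B_add[OF G.B_mult[OF aB bB] w(1)] by blast
  qed
 qed
 from this[OF subset_refl] bs(2)
 have span: "EX w:G.B t. z = Q +>\<^bsub>?R\<^esub> w & \<Phi> (\<tau> w) : ?K" if "z : carrier (?R Quot Q)" for z using that by simp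
 have \<tau>K: "\<Phi> (\<tau> x) : ?K" if x: "x : G.B t" for x
 proof -
  have "Q +>\<^bsub>?R\<^esub> x : carrier (?R Quot Q)" using ring_hom_closed[OF Q.rcos_ring_hom, of x] x by (simp add: G.B_ops)
  then obtain w where w: "w : G.B t" "Q +>\<^bsub>?R\<^esub> x = Q +>\<^bsub>?R\<^esub> w" "\<Phi> (\<tau> w) : ?K" using span by blast
  have "x : Q +>\<^bsub>?R\<^esub> w" using Q.a_rcos_self[of x] x w(2) by (simp add: G.B_ops)
  then obtain h where h: "h : Q" "x = h \<oplus>\<^bsub>E\<^esub> w" unfolding a_r_coset_def' by (auto simp: G.B_ops)
  have hB: "h : G.B t" using Q.a_subset h(1) by (auto simp: G.B_ops)
  have "\<Phi> (\<tau> x) = \<Phi> (\<tau> h) \<oplus>\<^bsub>Lp\<^esub> \<Phi> (\<tau> w)"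
   using hB w(1) by (simp add: h(2) G.Gm_add[OF \<tau>(1)] G.B_E G.\<Phi>_add G.B_Gm[OF \<tau>(1)])
  hence "\<Phi> (\<tau> x) = \<Phi> (\<tau> w)" using \<tau>(2) h(1) G.\<Phi>_in[OF G.B_Gm[OF \<tau>(1) w(1)]] by simp
  thus ?thesis using w(3) by simp
 qed
 have "N dvd 1 & N dvd 0"
 proof (rule generates_sg[OF gen])
  fix x assume x: "x : G.B t"
  obtain \<sigma> where \<sigma>: "\<sigma> : G.Gm" "ALL x:carrier E. \<tau> (\<sigma> x) = x" using G.Gm_right_inverse[OF \<tau>(1)] by blast
  have "\<Phi> x : ?K" using \<tau>K[OF G.B_Gm[OF \<sigma>(1) x]] \<sigma>(2) G.B_E[OF x] by simp
  thus "sg 1 0 (\<Phi> x) = \<Phi> x" using sg_nu by auto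
 qed
 thus False using N1 by simp
qed

end

section \<open>Two independent elements of prime order in a non-cyclic abelian group\<close>

section \<open>Non-cyclic finite abelian groups\<close>

context comm_group
begin

lemma ord_mult_coprime_dvd:
 assumes x: "x : carrier G" and y: "y : carrier G" and co: "coprime (ord x) (ord y)"
 shows "ord x * ord y dvd ord (x \<otimes> y)"
proof -
 have aux: "ord a dvd ord (a \<otimes> b)" if "a : carrier G" "b : carrier G" "coprime (ord a) (ord b)" for a b
 proof -
  have "(a \<otimes> b) [^] (ord (a \<otimes> b) * ord b) = \<one>" using that by (simp flip: nat_pow_pow)
  moreover have "(a \<otimes> b) [^] (ord (a \<otimes> b) * ord b) = a [^] (ord (a \<otimes> b) * ord b) \<otimes> b [^] (ord (a \<otimes> b) * ord b)"
   using that by (intro pow_mult_distrib m_comm)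
  moreover have "b [^] (ord (a \<otimes> b) * ord b) = \<one>" using that pow_eq_id[of b] by simp
  ultimately have "a [^] (ord (a \<otimes> b) * ord b) = \<one>" using that by simp
  hence "ord a dvd ord (a \<otimes> b) * ord b" using pow_eq_id[OF that(1)] by blast
  thus ?thesis using that(3) coprime_dvd_mult_left_iff by blast
 qed
 have "ord y dvd ord (x \<otimes> y)" using aux[OF y x] co m_comm[OF x y] by (simp add: coprime_commute)
 thus ?thesis using aux[OF x y co] co divides_mult by blast
qed

lemma cyclic_groupI:
 assumes "x : carrier G" "!!y. y : carrier G ==> EX k::nat. y = x [^] k" shows "cyclic_group G"
 unfolding cyclic_group
proof (intro bexI[OF _ assms(1)] equalityI subsetI)
 fix y assume "y : carrier G"
 then obtain k :: nat where "y = x [^] k" using assms(2) by blast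
 hence "y = x [^] int k" by (simp add: int_pow_int)
 thus "y : range (%n::int. x [^] n)" by blast
qed (use assms(1) in auto)

lemma coprime_pow_generates:
 assumes h: "h : carrier G" "h [^] l = \<one>" and "coprime e l" "l > (1::nat)"
 shows "EX u::nat. h = (h [^] e) [^] u"
proof -
 obtain u where "[e * u = Suc 0] (mod l)" using cong_solve_coprime_nat[OF assms(3)] by blast
 hence "(e * u) mod l = 1" using assms(4) by (simp add: cong_def)
 hence eq: "e * u = l * ((e * u) div l) + 1" by (metis mult_div_mod_eq)
 have "h [^] (e * u) = (h [^] l) [^] ((e * u) div l) \<otimes> h"
  by (subst eq) (simp add: h(1) nat_pow_mult[symmetric] nat_pow_pow)
 hence "h [^] (e * u) = h" using h by simp
 thus ?thesis using h(1) by (intro exI[of _ u]) (simp add: nat_pow_pow)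
qed

text \<open>Equality with \<open>b < d\<close> makes a power of \<open>h\<close> with exponent prime
  to \<open>l\<close>, and hence \<open>h\<close> itself, a power of \<open>g\<close>.\<close>

lemma independent_powers:
 assumes l: "Factorial_Ring.prime (l::nat)" and g: "g : carrier G" "ord g = l" and h: "h : carrier G" "h [^] l = \<one>"
  and ind: "!!k::nat. h ~= g [^] k" and abcd: "a < l" "b < l" "c < l" "d < l"
  and eq: "g [^] a \<otimes> h [^] b = g [^] c \<otimes> h [^] (d::nat)"
 shows "a = c & b = d"
proof -
 have l1: "l > 1" using l by (rule prime_gt_1_nat)
 have gl: "g [^] l = \<one>" using g pow_ord_eq_1 by metis
 have less: False if "b < d" "c < l" "d < l" "g [^] a \<otimes> h [^] b = g [^] c \<otimes> h [^] d" for a b c d :: nat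
 proof -
  let ?e = "d - b"
  have "h [^] d = h [^] ?e \<otimes> h [^] b" using that(1) h(1) by (simp add: nat_pow_mult)
  hence "g [^] a \<otimes> h [^] b = g [^] c \<otimes> h [^] ?e \<otimes> h [^] b" using that(4) g(1) h(1) by (simp add: m_assoc)
  hence "g [^] a = g [^] c \<otimes> h [^] ?e" using g(1) h(1) by simp
  hence "g [^] (l - c) \<otimes> g [^] a = g [^] (l - c) \<otimes> g [^] c \<otimes> h [^] ?e" using g(1) h(1) by (simp add: m_assoc)
  hence eq': "g [^] (l - c + a) = h [^] ?e" using that(2) g(1) h(1) gl by (simp add: nat_pow_mult)
  have nd: "~ l dvd ?e" using that(1,3) by (auto dest: dvd_imp_le)
  have co: "coprime ?e l" using prime_imp_coprime[OF l nd] by (simp add: coprime_commute)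
  obtain u :: nat where "h = (h [^] ?e) [^] u" using coprime_pow_generates[OF h co l1] by (elim exE)
  hence "h = (g [^] (l - c + a)) [^] u" by (simp only: eq')
  hence "h = g [^] ((l - c + a) * u)" using g(1) by (simp add: nat_pow_pow)
  thus False using ind by blast
 qed
 have "b = d" using less[OF _ abcd(3,4) eq] less[OF _ abcd(1,2) eq[symmetric]] by (meson linorder_neqE_nat)
 moreover from this have "g [^] a = g [^] c" using eq g(1) h(1) by simp
 hence "a = c" using ord_inj[OF g(1)] abcd l1 by (auto simp: inj_on_def g(2))
 ultimately show ?thesis by blast
qed

text \<open>Let \<open>x\<close> have maximal order and \<open>y\<close> least order among the
  elements that are not powers of \<open>x\<close>. For a prime \<open>l\<close> dividing the order
  of \<open>y\<close>, the power \<open>y [^] l\<close> is a power of \<open>x\<close> with exponent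
  divisible by \<open>l\<close>; dividing \<open>y\<close> by the corresponding power of
  \<open>x\<close> gives \<open>h\<close> with \<open>h [^] l = \<one>\<close>, still not a power of
  \<open>x\<close>. The partner \<open>g\<close> is the power of \<open>x\<close> of order
  \<open>l\<close>.\<close>

lemma non_cyclic_independent:
 assumes fin: "finite (carrier G)" and nc: "~ cyclic_group G"
 shows "EX l g h. Factorial_Ring.prime (l::nat) & g : carrier G & h : carrier G & ord g = l & h [^] l = \<one>
  & (ALL k::nat. h ~= g [^] k)"
proof -
 have ord_pos: "ord x > 0" if "x : carrier G" for x using ord_ge_1[OF fin that] by simp
 have ne: "ord ` carrier G ~= {}" using one_closed by blast
 have "Max (ord ` carrier G) : ord ` carrier G" by (rule Max_in[OF finite_imageI[OF fin] ne])
 then obtain x where x1: "x : carrier G" "Max (ord ` carrier G) = ord x" by blast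
 have "ord y <= Max (ord ` carrier G)" if "y : carrier G" for y
  by (rule Max_ge[OF finite_imageI[OF fin] imageI[OF that]])
 note x = x1(1) this[unfolded x1(2)]
 let ?C = "{x [^] k | k::nat. True}"
 obtain y0 where y0: "y0 : carrier G & y0 ~: ?C" using cyclic_groupI[OF x(1)] nc by blast
 from ex_has_least_nat[of "%y. y : carrier G & y ~: ?C" y0 ord, OF y0]
 obtain y where y: "y : carrier G" "y ~: ?C" "!!z. z : carrier G ==> z ~: ?C ==> ord y <= ord z" by blast
 let ?n = "ord y" and ?m = "ord x"
 have "y ~= \<one>" using y(2) nat_pow_0[of x] by (metis (mono_tags, lifting) mem_Collect_eq)
 hence "?n ~= 1" using ord_eq_1[OF y(1)] by blast
 then obtain l where l: "Factorial_Ring.prime l" "l dvd ?n" using prime_factor_nat by blast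
 have l1: "l > 1" using l(1) by (rule prime_gt_1_nat)
 have ordl: "ord (y [^] l) = ?n div l" using ord_pow[OF y(1) l(2)] l1 by simp
 have "ord (y [^] l) < ?n" using ordl l1 ord_pos[OF y(1)] by simp
 hence "y [^] l : ?C" using y(3)[of "y [^] l"] y(1) by (metis nat_pow_closed linorder_not_less)
 then obtain k :: nat where k: "y [^] l = x [^] k" by blast
 define v where "v = multiplicity l ?m"
 have m0: "?m ~= 0" using ord_pos[OF x(1)] by simp
 have vm: "l ^ v dvd ?m" unfolding v_def by (rule multiplicity_dvd)
 have nvm: "~ l ^ Suc v dvd ?m" unfolding v_def by (subst power_dvd_iff_le_multiplicity) (use m0 l1 in auto)
 \<comment> \<open>Otherwise a power of \<open>y\<close> of order \<open>l ^ Suc v\<close> times a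
   power of \<open>x\<close> of order prime to \<open>l\<close> would have order exceeding that of
   \<open>x\<close>.\<close>
 have key: "~ l ^ Suc v dvd ?n"
 proof
  assume d: "l ^ Suc v dvd ?n"
  let ?a = "y [^] (?n div l ^ Suc v)" and ?b = "x [^] (l ^ v)"
  have n0: "?n div l ^ Suc v ~= 0" using d ord_pos[OF y(1)] by (metis dvd_div_eq_0_iff less_irrefl)
  have a: "ord ?a = l ^ Suc v"
   using ord_pow[OF y(1) div_dvd_iff_mult[THEN iffD2, OF _ d] n0] d ord_pos[OF y(1)] l1
   by (metis dvd_div_mult_self dvd_triv_left n0 nonzero_mult_div_cancel_left ord_pow y(1))
  have b: "ord ?b = ?m div l ^ v" using ord_pow[OF x(1) vm] l1 by simp
  have "~ l dvd ?m div l ^ v" using nvm vm by (metis dvd_div_mult_self mult_dvd_mono dvd_refl power_Suc)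
  hence "coprime l (?m div l ^ v)" by (rule prime_imp_coprime[OF l(1)])
  hence co: "coprime (ord ?a) (ord ?b)" unfolding a b by (rule coprime_power_left_iff[THEN iffD2, OF disjI1])
  have "ord ?a * ord ?b dvd ord (?a \<otimes> ?b)" by (rule ord_mult_coprime_dvd[OF _ _ co]) (use x y in auto)
  hence "ord ?a * ord ?b <= ord (?a \<otimes> ?b)" using ord_pos[of "?a \<otimes> ?b"] x(1) y(1) by (intro dvd_imp_le) auto
  also have "... <= ?m" using x y(1) by simp
  also have "ord ?a * ord ?b = l * (l ^ v * (?m div l ^ v))" unfolding a b by simp
  also have "l ^ v * (?m div l ^ v) = ?m" using vm by simp
  finally show False using l1 m0 by simp
 qed
 have lm: "l dvd ?m" using key l(2) vm by (cases v) (auto dest: dvd_mult_left)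
 \<comment> \<open>If not, the full power \<open>l ^ v\<close> contained in the order of
   \<open>x\<close> would divide \<open>ord y div l\<close>, against \<open>key\<close>.\<close>
 have "l dvd k"
 proof (rule ccontr)
  assume "~ l dvd k"
  hence "coprime l k" by (rule prime_imp_coprime[OF l(1)])
  hence co: "coprime (l ^ v) k" by simp
  have "x [^] (k * (?n div l)) = (y [^] l) [^] (?n div l)" using x(1) by (simp add: k nat_pow_pow)
  also have "... = \<one>" using l(2) y(1) by (simp add: nat_pow_pow)
  finally have "?m dvd k * (?n div l)" using pow_eq_id[OF x(1)] by blast
  hence "l ^ v dvd k * (?n div l)" using vm dvd_trans by blast
  hence "l ^ v dvd ?n div l" using co by (metis coprime_dvd_mult_right_iff)
  hence "l ^ Suc v dvd ?n" using l(2) l1 by (metis dvd_div_mult_self mult_dvd_mono dvd_refl power_Suc mult.commute)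
  thus False using key by blast
 qed
 then obtain k' where k': "k = l * k'" by blast
 define h where "h = y \<otimes> inv (x [^] k')"
 have h: "h : carrier G" using x y by (simp add: h_def)
 have yh: "y = h \<otimes> x [^] k'" using x(1) y(1) by (simp add: h_def m_assoc)
 have "h [^] l \<otimes> x [^] k = y [^] l"
  unfolding yh using h x(1) by (simp add: k' pow_mult_distrib m_comm nat_pow_pow mult.commute)
 hence "h [^] l \<otimes> x [^] k = \<one> \<otimes> x [^] k" using k x(1) by simp
 hence hl: "h [^] l = \<one>" using h x(1) by simp
 have hC: "h ~: ?C"
 proof
  assume "h : ?C"
  then obtain j :: nat where "h = x [^] j" by blast
  hence "y = x [^] (j + k')" using yh x(1) by (simp add: nat_pow_mult)
  thus False using y(2) by blast
 qed
 define g where "g = x [^] (?m div l)"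
 have "?m div l dvd ?m" "?m div l ~= 0" using lm m0 by (metis dvd_div_mult_self dvd_triv_left, metis dvd_div_eq_0_iff)
 hence "ord g = ?m div (?m div l)" unfolding g_def by (rule ord_pow[OF x(1)])
 hence og: "ord g = l" using lm m0 by (metis \<open>?m div l ~= 0\<close> dvd_div_mult_self nonzero_mult_div_cancel_left)
 have "h ~= g [^] i" for i :: nat using hC x(1) by (auto simp: g_def nat_pow_pow)
 thus ?thesis using l(1) h hl og x(1) by (intro exI[of _ l] exI[of _ g] exI[of _ h]) (simp add: g_def)
qed

end

lemma non_cyclic_subgroup_independent:
 fixes G :: "'g monoid"
 assumes G: "group G" "finite (carrier G)" and A: "subgroup A G" "comm_group (G\<lparr>carrier := A\<rparr>)" "~ cyclic_group (G\<lparr>carrier := A\<rparr>)"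
 shows "EX l g h. Factorial_Ring.prime (l::nat) & g : carrier G & h : carrier G & g \<otimes>\<^bsub>G\<^esub> h = h \<otimes>\<^bsub>G\<^esub> g
  & g [^]\<^bsub>G\<^esub> l = \<one>\<^bsub>G\<^esub> & h [^]\<^bsub>G\<^esub> l = \<one>\<^bsub>G\<^esub> & (ALL a<l. ALL b<l. ALL c<l. ALL d<l.
   g [^]\<^bsub>G\<^esub> a \<otimes>\<^bsub>G\<^esub> h [^]\<^bsub>G\<^esub> b = g [^]\<^bsub>G\<^esub> c \<otimes>\<^bsub>G\<^esub> h [^]\<^bsub>G\<^esub> d --> a = c & b = d)"
proof -
 interpret G: group G by (rule G(1))
 interpret H: comm_group "G\<lparr>carrier := A\<rparr>" by (rule A(2))
 have AG: "A <= carrier G" by (rule subgroup.subset[OF A(1)])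
 have pow: "x [^]\<^bsub>G\<lparr>carrier := A\<rparr>\<^esub> n = x [^]\<^bsub>G\<^esub> n" for x and n :: nat by (rule G.nat_pow_consistent[symmetric])
 obtain l g h where *: "Factorial_Ring.prime (l::nat)" "g : A" "h : A" "H.ord g = l" "h [^]\<^bsub>G\<^esub> l = \<one>\<^bsub>G\<^esub>" "ALL k::nat. h ~= g [^]\<^bsub>G\<^esub> k"
  using H.non_cyclic_independent[OF _ A(3)] finite_subset[OF AG G(2)] by (auto simp: pow)
 have gl: "g [^]\<^bsub>G\<^esub> l = \<one>\<^bsub>G\<^esub>" using H.pow_ord_eq_1[of g] *(2,4) by (simp add: pow)
 have comm: "g \<otimes>\<^bsub>G\<^esub> h = h \<otimes>\<^bsub>G\<^esub> g" using H.m_comm[of g h] *(2,3) by simp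
 have gG: "g : carrier G" and hG: "h : carrier G" using *(2,3) AG by auto
 have ind: "a = c & b = d" if "a < l" "b < l" "c < l" "d < l" "g [^]\<^bsub>G\<^esub> a \<otimes>\<^bsub>G\<^esub> h [^]\<^bsub>G\<^esub> b = g [^]\<^bsub>G\<^esub> c \<otimes>\<^bsub>G\<^esub> h [^]\<^bsub>G\<^esub> d" for a b c d :: nat
  using H.independent_powers[OF *(1), of g h a b c d] *(2-6) that by (simp add: pow)
 note prime = *(1) and hl = *(5)
 show ?thesis
  by (rule exI[of _ l], rule exI[of _ g], rule exI[of _ h], (rule conjI, fact)+, intro allI impI, rule ind)
qed

section \<open>Changing the level\<close>

text \<open>The estimates need level \<open>N\<close>, the prescribed extension has level
  \<open>l\<close>; raising the generators to the power \<open>N div l\<close> embeds the small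
  Kummer field into the large one.\<close>

lemma (in kummer) sublevel:
 assumes l: "l dvd N" "l > 0"
 shows "kummer A F p l (\<zeta> ^ (N div l)) (ups ^ (N div l)) (\<rho> ^ (N div l)) u"
proof unfold_locales
 have m: "N div l * l = N" using l by simp
 have m0: "N div l > 0" using m N by (metis gr0I mult_0)
 show "l > 0" by fact
 show "\<zeta> ^ (N div l) : F" by (rule F_power[OF \<zeta>_F])
 show "(\<zeta> ^ (N div l)) ^ l = 1" "(ups ^ (N div l)) ^ l = of_nat u" "(\<rho> ^ (N div l)) ^ l = of_nat p"
  by (simp_all only: power_mult[symmetric] m \<zeta>_N ups \<rho>)
 show "residue_primroot p u" by (rule u)
 show "algebraic x" for x :: 'c by (rule all_algebraic)
 fix d assume d: "0 < d" "d < l"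
 have "N div l * d < N" using d m m0 by (metis mult_less_mono2)
 moreover have "N div l * d > 0" using d m0 by simp
 ultimately show "(\<zeta> ^ (N div l)) ^ d - 1 ~: nonunits A" unfolding power_mult[symmetric] by (rule \<zeta>_unit[rotated])
qed

text \<open>Restriction keeps the exponents \<open>al\<close> and \<open>be\<close>. This is why
  \<open>krasner\<close>, working at level \<open>N\<close>, tests nontriviality modulo
  \<open>l\<close>.\<close>

lemma (in kummer) sublevel_field:
 assumes l: "l dvd N" "l > 0" and x: "x : kummer.kum_field F l (ups ^ (N div l)) (\<rho> ^ (N div l))"
 shows "x : kum_field"
  and "kum_aut al be x = kummer.kum_aut F l (\<zeta> ^ (N div l)) (ups ^ (N div l)) (\<rho> ^ (N div l)) al be x"
proof -
 let ?m = "N div l"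
 interpret L: kummer A F p l "\<zeta> ^ ?m" "ups ^ ?m" "\<rho> ^ ?m" u by (rule sublevel[OF l])
 have monomial: "c * (ups ^ ?m) ^ i * (\<rho> ^ ?m) ^ j = c * ups ^ (?m * i) * \<rho> ^ (?m * j)" for c i j by (simp add: power_mult)
 have in_field: "L.crd x i j * (ups ^ ?m) ^ i * (\<rho> ^ ?m) ^ j : kum_field" for i j
  unfolding monomial by (rule monomial_in_field[OF L.crd_F[OF x]])
 have xs: "x = (\<Sum>i<l. \<Sum>j<l. L.crd x i j * (ups ^ ?m) ^ i * (\<rho> ^ ?m) ^ j)"
  using L.kum_crd[OF x] by (simp add: L.kum_def)
 have "(\<Sum>i<l. \<Sum>j<l. L.crd x i j * (ups ^ ?m) ^ i * (\<rho> ^ ?m) ^ j) : kum_field" by (intro kum_field_sum in_field)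
 thus "x : kum_field" using xs by (simp only: flip: xs)
 have "kum_aut al be x = (\<Sum>i<l. \<Sum>j<l. kum_aut al be (L.crd x i j * (ups ^ ?m) ^ i * (\<rho> ^ ?m) ^ j))"
  by (subst xs) (simp only: kum_aut_sum kum_field_sum in_field)
 also have "... = (\<Sum>i<l. \<Sum>j<l. (L.crd x i j * (\<zeta> ^ ?m) ^ (al * i + be * j)) * (ups ^ ?m) ^ i * (\<rho> ^ ?m) ^ j)"
 proof (intro sum.cong refl)
  fix i j
  have "al * (?m * i) + be * (?m * j) = ?m * (al * i + be * j)" by (simp add: algebra_simps)
  thus "kum_aut al be (L.crd x i j * (ups ^ ?m) ^ i * (\<rho> ^ ?m) ^ j) =
    L.crd x i j * (\<zeta> ^ ?m) ^ (al * i + be * j) * (ups ^ ?m) ^ i * (\<rho> ^ ?m) ^ j"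
   unfolding monomial using kum_aut_monomial[OF L.crd_F[OF x], of al be i j "?m * i" "?m * j"] by (simp add: power_mult)
 qed
 finally show "kum_aut al be x = L.kum_aut al be x" by (simp add: L.kum_aut_def L.kum_def)
qed

section \<open>From a place of the algebraic closure to a prime ideal of the integers of
  \<open>k\<close>\<close>

section \<open>The prime of a place\<close>

lemma integer_ring_cring: "cring (integer_ring :: 'k::field_char_0 ring)"
proof (rule cringI)
 let ?R = "integer_ring :: 'k ring"
 show "abelian_group ?R"
 proof (rule abelian_groupI)
  fix x assume "x : carrier ?R"
  hence "- x : carrier ?R" using algebraic_int_diff[of 0 x] by (simp add: integer_ring_def)
  thus "EX y:carrier ?R. y \<oplus>\<^bsub>?R\<^esub> x = \<zero>\<^bsub>?R\<^esub>" by (rule bexI[rotated]) (simp add: integer_ring_def ring_of_type_algebra_def)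
 qed (auto simp: integer_ring_def ring_of_type_algebra_def algebraic_int_add)
 show "comm_monoid ?R"
  by (rule comm_monoidI) (auto simp: integer_ring_def ring_of_type_algebra_def algebraic_int_mult)
qed (auto simp: integer_ring_def ring_of_type_algebra_def algebra_simps)

text \<open>The Horner remainders \<open>b j\<close> of a primitive integer equation for
  \<open>z\<close> are algebraic integers: a valuation ring contains them by the defining sum if it
  contains \<open>z\<close>, and by the recursion through \<open>inverse z\<close> otherwise. Each
  coefficient is \<open>b j - z * b (Suc j)\<close>, so if all remainders were nonunits of
  \<open>V\<close>, then \<open>p\<close> would divide the whole equation.\<close>

lemma exists_integral_multiplier:
 fixes z :: "'k::field_char_0"
 assumes V: "valuation_ring V" and p: "Factorial_Ring.prime p" "of_nat p : nonunits V"
  and z: "algebraic z" "z : V"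
 shows "EX b. algebraic_int b & b ~: nonunits V & algebraic_int (b * z)"
proof -
 interpret V: valring V by unfold_locales (rule V)
 obtain q0 where q0: "q0 ~= 0" "poly (map_poly of_int q0) z = 0" using z(1) by (erule algebraicE')
 define q where "q = primitive_part q0"
 have "coeff q0 n = content q0 * coeff q n" for n
  unfolding q_def by (metis coeff_smult content_times_primitive_part)
 hence "map_poly of_int q0 = smult (of_int (content q0)) (map_poly of_int q :: 'k poly)"
  by (intro poly_eqI) (simp add: coeff_map_poly)
 hence q: "poly (map_poly of_int q) z = 0" "content q = 1" using q0 by (auto simp: q_def)
 have nv: "EX j. ~ int p dvd coeff q j"
 proof (rule ccontr)
  assume "~ ?thesis"
  hence "[:int p:] dvd q" by (simp add: const_poly_dvd_iff)
  hence "int p dvd content q" by (simp add: const_poly_dvd_iff_dvd_content)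
  hence "p = 1" using q(2) by simp
  thus False using p(1) by simp
 qed
 let ?c = "%i. (of_int (coeff q i) :: 'k)"
 define d where "d = degree q"
 define b where "b j = (\<Sum>i\<in>{j..d}. ?c i * z ^ (i - j))" for j
 have b_rec: "b j = ?c j + z * b (Suc j)" for j
 proof (cases "j <= d")
  case True
  have "b j = ?c j + (\<Sum>i\<in>{Suc j..d}. ?c i * z ^ (i - j))" unfolding b_def using True by (simp add: sum.atLeast_Suc_atMost)
  also have "(\<Sum>i\<in>{Suc j..d}. ?c i * z ^ (i - j)) = z * b (Suc j)"
   unfolding b_def sum_distrib_left
  proof (rule sum.cong)
   fix i assume "i : {Suc j..d}"
   hence "i - j = Suc (i - Suc j)" by auto
   thus "?c i * z ^ (i - j) = z * (?c i * z ^ (i - Suc j))" by simp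
  qed simp
  finally show ?thesis .
 next
  case False
  thus ?thesis by (simp add: b_def coeff_eq_0 d_def)
 qed
 have "poly (map_poly of_int q) z = b 0"
  by (simp add: poly_altdef b_def coeff_map_poly degree_map_poly d_def atLeast0AtMost)
 hence b0: "b 0 = 0" using q by simp
 have bint: "algebraic_int (b j)" for j
  unfolding algebraic_int_iff_valuation_rings
 proof (intro allI impI)
  fix O' :: "'k set" assume O': "valuation_ring O'"
  then interpret O: valring O' by unfold_locales
  show "b j : O'"
  proof (cases "z : O'")
   case True
   thus ?thesis unfolding b_def by (intro O.in_sum O.in_mult O.in_of_int O.in_power)
  next
   case False
   hence zi: "inverse z : O'" "z ~= 0" using O.in_or_inverse_in O.in_0 by blast+
   show ?thesis
   proof (induction j)
    case 0 thus ?case using b0 O.in_0 by simp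
   next
    case (Suc j)
    have "b (Suc j) = inverse z * (b j - ?c j)" using b_rec[of j] zi(2) by (simp add: field_simps)
    thus ?case using O.in_mult[OF zi(1) O.in_diff[OF Suc O.in_of_int]] by simp
   qed
  qed
 qed
 have "EX j. b (Suc j) ~: nonunits V"
 proof (rule ccontr)
  assume all: "~ ?thesis"
  hence nb: "b j : nonunits V" for j by (cases j) (use b0 V.nonunits_0 in auto)
  obtain j where j: "~ int p dvd coeff q j" using nv by blast
  have "?c j = b j - z * b (Suc j)" using b_rec[of j] by simp
  moreover have "b j - z * b (Suc j) : nonunits V"
   by (rule V.nonunits_diff[OF nb V.nonunits_mult[OF z(2) nb]])
  ultimately have cj: "?c j : nonunits V" by simp
  have "coprime (int p) (coeff q j)" using j p(1) by (intro prime_imp_coprime) auto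
  then obtain r s where rs: "r * int p + s * coeff q j = 1" by (metis coprime_iff_gcd_eq_1 bezout_int)
  have "of_int r * of_nat p + of_int s * ?c j : nonunits V"
   by (rule V.nonunits_add[OF V.nonunits_mult[OF V.in_of_int p(2)] V.nonunits_mult[OF V.in_of_int cj]])
  moreover have "of_int r * of_nat p + of_int s * ?c j = of_int (r * int p + s * coeff q j)" by simp
  ultimately show False using V.nonunits_1 by (simp only: rs of_int_1)
 qed
 then obtain j where j: "b (Suc j) ~: nonunits V" by blast
 have "b (Suc j) * z = b j - ?c j" using b_rec[of j] by (simp add: mult.commute)
 moreover have "algebraic_int (b j - ?c j)" by (rule algebraic_int_diff[OF bint]) simp
 ultimately show ?thesis using j bint by metis
qed

text \<open>Elements of \<open>P\<close> are multiples of \<open>p\<close> in \<open>V\<close>,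
  since \<open>p\<close> is a uniformizer; so \<open>prime_power P n\<close> lies in
  \<open>p ^ n\<close> times \<open>V\<close>. Conversely, the integral multiplier, a unit of
  \<open>V\<close>, brings such a multiple back to \<open>p ^ n\<close> times an algebraic
  integer.\<close>

lemma prime_of_valuation:
 fixes V :: "'k::field_char_0 set"
 assumes V: "valuation_ring V" and p: "Factorial_Ring.prime p" "of_nat p : nonunits V"
  and alg: "!!z::'k. algebraic z"
  and decomp: "!!x. x ~= 0 ==> EX n u. x = of_nat p powi n * u & u : V & inverse u : V"
 defines "P \<equiv> {x. algebraic_int x & x : nonunits V}"
 shows "P : nonzero_primes" and "of_nat p : P" and "x : adic_nbhd P n \<longleftrightarrow> (EX z:V. x = of_nat p ^ n * z)"
proof -
 interpret V: valring V by unfold_locales (rule V)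
 let ?R = "integer_ring :: 'k ring"
 interpret R: cring ?R by (rule integer_ring_cring)
 have ops: "carrier ?R = {x. algebraic_int x}" "x \<oplus>\<^bsub>?R\<^esub> y = x + y" "x \<otimes>\<^bsub>?R\<^esub> y = x * y" "\<zero>\<^bsub>?R\<^esub> = 0" "\<one>\<^bsub>?R\<^esub> = 1" for x y
  by (simp_all add: integer_ring_def ring_of_type_algebra_def)
 have p0: "(of_nat p :: 'k) ~= 0" using p(1) by auto
 have int_V: "algebraic_int x ==> x : V" for x using V algebraic_int_iff_valuation_rings by blast
 show pP: "of_nat p : P" using p(2) by (simp add: P_def)
 have minus: "\<ominus>\<^bsub>?R\<^esub> x = - x" if "algebraic_int x" for x
  by (rule R.minus_equality) (use that algebraic_int_diff[of 0 x] in \<open>auto simp: ops\<close>)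
 have "ideal P ?R"
 proof (rule idealI)
  show "ring ?R" by (rule R.ring_axioms)
  show "subgroup P (add_monoid ?R)"
  proof (rule R.add.subgroupI)
   show "P <= carrier ?R" by (auto simp: P_def ops)
   show "P ~= {}" using pP by blast
   fix a assume a: "a : P"
   show "\<ominus>\<^bsub>?R\<^esub> a : P"
    using a algebraic_int_diff[of 0 a] V.nonunits_diff[OF V.nonunits_0, of a] by (simp add: P_def minus)
   fix b assume "b : P"
   thus "a \<oplus>\<^bsub>?R\<^esub> b : P" using a by (auto simp: P_def ops algebraic_int_add V.nonunits_add)
  qed
  fix a x assume "a : P" "x : carrier ?R"
  thus "x \<otimes>\<^bsub>?R\<^esub> a : P" "a \<otimes>\<^bsub>?R\<^esub> x : P"
   using V.nonunits_mult[OF int_V, of x a] by (simp_all add: P_def ops algebraic_int_mult mult.commute)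
 qed
 moreover have "carrier ?R ~= P" using V.nonunits_1 by (auto simp: P_def ops)
 moreover have "a : P | b : P" if "a : carrier ?R" "b : carrier ?R" "a \<otimes>\<^bsub>?R\<^esub> b : P" for a b
  using that int_V V.nonunits_prime[of a b] by (auto simp: P_def ops)
 ultimately have "primeideal P ?R" by (intro primeidealI integer_ring_cring) auto
 thus "P : nonzero_primes" using pP p0 by (auto simp: nonzero_primes_def)
 have P_sub: "EX w:V. i = of_nat p * w" if i: "i : P" for i
 proof (cases "i = 0")
  case True thus ?thesis using V.in_0 by (intro bexI[of _ 0]) simp
 next
  case False
  then obtain m u where mu: "i = of_nat p powi m * u" "u : V" "inverse u : V" using decomp by blast
  have "m >= 1"
  proof (rule ccontr)
   assume "~ m >= 1"
   hence "inverse i = of_nat p ^ nat (- m) * inverse u" unfolding mu(1) by (simp add: power_int_def power_inverse)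
   hence "inverse i : V" using V.in_mult[OF V.in_power[OF V.in_of_nat] mu(3)] by simp
   thus False using i False by (simp add: P_def nonunits_def)
  qed
  hence "i = of_nat p * (of_nat p ^ nat (m - 1) * u)" unfolding mu(1)
   by (simp add: power_int_def nat_diff_distrib flip: power_Suc mult.assoc)
  thus ?thesis using V.in_mult[OF V.in_power[OF V.in_of_nat] mu(2)] by blast
 qed
 have pow_sub: "x : prime_power P n ==> EX w:V. x = of_nat p ^ n * w" for x n
 proof (induction n arbitrary: x)
  case 0 thus ?case using int_V by (auto simp: prime_power_def ops)
 next
  case (Suc n)
  have "x : ideal_prod ?R P (prime_power P n)" using Suc.prems by (simp add: prime_power_def)
  thus ?case
  proof (induction rule: ideal_prod.induct)
   case (prod i j)
   obtain w w' where "w : V" "i = of_nat p * w" "w' : V" "j = of_nat p ^ n * w'"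
    using P_sub[OF prod(1)] Suc.IH[OF prod(2)] by blast
   thus ?case by (intro bexI[of _ "w * w'"]) (simp_all add: ops V.in_mult mult_ac)
  next
   case (sum s t)
   then obtain w w' where "w : V" "s = of_nat p ^ Suc n * w" "w' : V" "t = of_nat p ^ Suc n * w'" by blast
   thus ?case by (intro bexI[of _ "w + w'"]) (simp_all add: ops V.in_add distrib_left)
  qed
 qed
 have pow_sup: "algebraic_int w ==> of_nat p ^ n * w : prime_power P n" for w n
 proof (induction n)
  case 0 thus ?case by (simp add: prime_power_def ops)
 next
  case (Suc n)
  have "of_nat p \<otimes>\<^bsub>?R\<^esub> (of_nat p ^ n * w) : ideal_prod ?R P (prime_power P n)"
   by (rule ideal_prod.prod[OF pP Suc.IH[OF Suc.prems]])
  thus ?case by (simp add: prime_power_def ops mult.assoc)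
 qed
 show "x : adic_nbhd P n \<longleftrightarrow> (EX z:V. x = of_nat p ^ n * z)"
 proof
  assume "x : adic_nbhd P n"
  then obtain b where b: "algebraic_int b" "b ~: P" "b * x : prime_power P n" by (auto simp: adic_nbhd_def ops)
  obtain w where w: "w : V" "b * x = of_nat p ^ n * w" using pow_sub[OF b(3)] by blast
  have bn: "b ~: nonunits V" using b by (simp add: P_def)
  hence bi: "inverse b : V" "b ~= 0" using int_V[OF b(1)] by (auto simp: nonunits_def)
  have "x = of_nat p ^ n * (inverse b * w)" using w(2) bi(2) by (simp add: field_simps)
  thus "EX z:V. x = of_nat p ^ n * z" using V.in_mult[OF bi(1) w(1)] by blast
 next
  assume "EX z:V. x = of_nat p ^ n * z"
  then obtain z where z: "z : V" "x = of_nat p ^ n * z" by blast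
  obtain b where b: "algebraic_int b" "b ~: nonunits V" "algebraic_int (b * z)"
   using exists_integral_multiplier[OF V p alg z(1)] by blast
  have bx: "b * x = of_nat p ^ n * (b * z)" by (simp add: z(2))
  have "b * x : prime_power P n" unfolding bx by (rule pow_sup[OF b(3)])
  moreover have "b : carrier ?R - P" using b by (simp add: P_def ops)
  ultimately show "x : adic_nbhd P n" unfolding adic_nbhd_def by blast
 qed
qed

text \<open>The preceding lemma for the trace of \<open>A\<close> on \<open>k\<close>;
  \<open>decomp\<close> descends because the unit is the quotient of \<open>x\<close> by a power of
  \<open>p\<close>, both in \<open>k\<close>.\<close>

lemma prime_of_place:
 fixes A :: "'k::field_char_0 alg_closure set"
 assumes pl: "place A F p" and F: "range to_ac <= F" and alg: "!!z::'k. algebraic z"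
 defines "P \<equiv> {x. algebraic_int x & to_ac x : nonunits A}"
 shows "P : nonzero_primes" "of_nat p : P" "x : adic_nbhd P n \<longleftrightarrow> valring.vle A (to_ac x) (of_nat p ^ n)"
proof -
 interpret place A F p by (rule pl)
 define V where "V = {x::'k. to_ac x : A}"
 have V: "valuation_ring V"
  unfolding valuation_ring_def subring_set_def V_def
  using in_1 in_diff in_mult in_or_inverse_in by auto
 interpret V: valring V by unfold_locales (rule V)
 have nonunits: "nonunits V = {x. to_ac x : nonunits A}"
  unfolding nonunits_def V_def by auto
 have decomp': "EX n u. x = of_nat p powi n * u & u : V & inverse u : V" if x: "x ~= 0" for x
 proof -
  obtain n w where nw: "to_ac x = of_nat p powi n * w" "w : A" "inverse w : A"
   using decomp[of "to_ac x"] F x to_ac_eq_0_iff[of x] by blast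
  have p0: "(of_nat p :: 'k) ~= 0" using p_neq_0 by (metis of_nat_0 of_nat_eq_iff)
  define u where "u = x / of_nat p powi n"
  have "to_ac (of_nat p powi n :: 'k) = of_nat p powi n" by (simp add: power_int_def power_inverse)
  hence "to_ac u = w" using nw(1) p_neq_0 by (simp add: u_def)
  moreover have "x = of_nat p powi n * u" using p0 by (simp add: u_def)
  ultimately show ?thesis using nw by (intro exI[of _ n] exI[of _ u]) (simp add: V_def)
 qed
 have pV: "of_nat p : nonunits V" using p_nonunit by (simp add: nonunits)
 have P: "P = {x. algebraic_int x & x : nonunits V}" by (simp add: P_def nonunits)
 show "P : nonzero_primes" "of_nat p : P"
  unfolding P by (rule prime_of_valuation(1,2)[OF V p pV alg decomp'], assumption+)+
 have "x : adic_nbhd P n \<longleftrightarrow> (EX z:V. x = of_nat p ^ n * z)"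
  unfolding P by (rule prime_of_valuation(3)[OF V p pV alg decomp'])
 also have "... \<longleftrightarrow> vle (to_ac x) (of_nat p ^ n)"
 proof
  assume "EX z:V. x = of_nat p ^ n * z"
  then obtain z where z: "to_ac z : A" "x = z * of_nat p ^ n" by (auto simp: V_def mult.commute)
  show "vle (to_ac x) (of_nat p ^ n)" using vle_mult_left[OF z(1) vle_refl[of "of_nat p ^ n"]] by (simp add: z(2))
 next
  assume "vle (to_ac x) (of_nat p ^ n)"
  hence "to_ac (x / of_nat p ^ n) : A" using p_pow_neq_0[of n] by (simp add: vle_iff)
  moreover have "x = of_nat p ^ n * (x / of_nat p ^ n)" using p_neq_0 by (metis nonzero_mult_div_cancel_left of_nat_0 of_nat_eq_iff power_not_zero times_divide_eq_right)
  ultimately show "EX z:V. x = of_nat p ^ n * z" by (intro bexI[of _ "x / of_nat p ^ n"]) (simp_all add: V_def)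
 qed
 finally show "x : adic_nbhd P n \<longleftrightarrow> vle (to_ac x) (of_nat p ^ n)" .
qed

text \<open>A truncation \<open>s\<close> of the series root \<open>\<sigma>\<close> agrees with it
  below order \<open>M\<close>, and \<open>s - \<sigma>\<close> divides the difference of the
  polynomial values. One \<open>e\<close> serves all \<open>M\<close>, which matters because the
  order needed later depends on \<open>N\<close>.\<close>

corollary puiseux_truncated:
 fixes f :: "'a::{alg_closed_field, field_char_0} poly poly"
 assumes f: "lead_coeff f = 1" "degree f > 0"
 shows "EX e>0. ALL M. EX s. monom 1 M dvd poly (map_poly (%a. pcompose a ([:t:] + monom 1 e)) f) s"
proof -
 define F where "F = map_poly (%a. fps_of_poly (pcompose a [:t, 1:])) f"
 have dF: "degree F = degree f"
  by (intro antisym degree_le le_degree) (use f in \<open>auto simp: F_def coeff_map_poly coeff_eq_0 pcompose_1\<close>)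
 have "lead_coeff F = 1" using f by (simp add: dF) (simp add: F_def coeff_map_poly pcompose_1)
 then obtain e \<sigma> where e: "e > 0" and \<sigma>: "poly (map_poly (fps_subst_power e) F) \<sigma> = 0"
  using puiseux_root[of F] f dF by auto
 define fe where "fe = map_poly (%a. pcompose a ([:t:] + monom 1 e)) f"
 have sub: "fps_subst_power e (fps_of_poly (pcompose a [:t, 1:])) = fps_of_poly (pcompose a ([:t:] + monom 1 e))" for a
 proof -
  have "fps_subst_power e (fps_of_poly (pcompose a [:t, 1:])) = fps_of_poly (pcompose (pcompose a [:t, 1:]) (monom 1 e))"
   unfolding fps_subst_power_def using e
   by (subst fps_of_poly_pcompose) (auto simp: fps_of_poly_monom)
  also have "pcompose (pcompose a [:t, 1:]) (monom 1 e) = pcompose a (pcompose [:t, 1:] (monom 1 e))"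
   by (rule pcompose_assoc[symmetric])
  also have "pcompose [:t, 1:] (monom 1 e) = [:t:] + monom 1 e" by (simp add: pcompose_pCons)
  finally show ?thesis .
 qed
 have eq: "map_poly (fps_subst_power e) F = map_poly fps_of_poly fe"
  unfolding F_def fe_def by (rule poly_eqI) (use e in \<open>simp add: coeff_map_poly sub\<close>)
 have "EX s. monom 1 M dvd poly fe s" for M
 proof -
  define s where "s = (\<Sum>i<M. monom (\<sigma> $ i) i)"
  have "fps_of_poly (poly fe s) = poly (map_poly fps_of_poly fe) (fps_of_poly s)"
   by (rule hom_poly) (auto simp: fps_of_poly_add fps_of_poly_mult)
  also have "... = poly (map_poly fps_of_poly fe) (fps_of_poly s) - poly (map_poly fps_of_poly fe) \<sigma>"
   using \<sigma> by (simp add: eq)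
  finally have "fps_of_poly s - \<sigma> dvd fps_of_poly (poly fe s)"
   by (simp only: diff_dvd_poly_diff)
  then obtain w where w: "fps_of_poly (poly fe s) = (fps_of_poly s - \<sigma>) * w" by blast
  have "coeff (poly fe s) k = 0" if "k < M" for k
  proof -
   have "(fps_of_poly s - \<sigma>) $ i = 0" if "i < M" for i
    using that by (simp add: s_def coeff_sum)
   hence "((fps_of_poly s - \<sigma>) * w) $ k = 0" using that by (simp add: fps_mult_nth)
   thus ?thesis by (simp flip: w)
  qed
  thus ?thesis by (intro exI[of _ s]) (simp add: monom_1_dvd_iff')
 qed
 thus ?thesis using e by (auto simp: fe_def)
qed

section \<open>Collecting the constants that have to be integral at the place\<close>

section \<open>Data entering the ramification argument\<close>

lemma pcompose_monom_1: "pcompose (monom 1 e) w = (w :: 'a::comm_ring_1 poly) ^ e"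
 by (induction e) (simp_all add: monom_Suc pcompose_pCons pcompose_1 monom_0 pCons_one)

lemma monom_1_power: "monom 1 k ^ e = (monom 1 (k * e) :: 'a::comm_ring_1 poly)"
 by (induction e) (simp_all add: mult_monom)

text \<open>Substituting a power of the parameter passes from \<open>e\<close> to any multiple
  \<open>N\<close> and does not lower the order, so a common \<open>N\<close> can serve all branch
  points.\<close>

lemma puiseux_level:
 fixes f :: "'a::{alg_closed_field, field_char_0} poly poly"
 assumes f: "lead_coeff f = 1" "degree f > 0"
 shows "EX e>0. ALL N>0. e dvd N --> (ALL M. EX s g. puiseux_approx N f M t s g)"
proof -
 obtain e where e: "e > 0" "!!M. EX s. monom 1 M dvd poly (map_poly (%a. pcompose a ([:t:] + monom 1 e)) f) s"
  using puiseux_truncated[OF f] by blast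
 have "EX s g. puiseux_approx N f M t s g" if N: "N > 0" "e dvd N" for N M
 proof -
  obtain k where k: "N = e * k" using N by blast
  hence k0: "k > 0" using N by (cases k) auto
  define h where "h a = pcompose a (monom 1 k :: 'a poly)" for a
  obtain s g where sg: "poly (map_poly (%a. pcompose a ([:t:] + monom 1 e)) f) s = monom 1 M * g"
   using e(2)[of M] by (auto elim!: dvdE)
  have comp: "h (pcompose a ([:t:] + monom 1 e)) = pcompose a ([:t:] + monom 1 N)" for a
   unfolding h_def
   by (simp add: pcompose_add pcompose_monom_1 monom_1_power k mult.commute flip: pcompose_assoc)
  have "h (poly (map_poly (%a. pcompose a ([:t:] + monom 1 e)) f) s)
    = poly (map_poly h (map_poly (%a. pcompose a ([:t:] + monom 1 e)) f)) (h s)"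
   by (rule hom_poly) (simp_all add: h_def pcompose_add pcompose_mult)
  also have "map_poly h (map_poly (%a. pcompose a ([:t:] + monom 1 e)) f) = map_poly (%a. pcompose a ([:t:] + monom 1 N)) f"
   by (rule poly_eqI) (simp add: coeff_map_poly comp h_def[of 0])
  finally have "poly (map_poly (%a. pcompose a ([:t:] + monom 1 N)) f) (h s) = h (monom 1 M * g)" by (simp only: sg)
  also have "... = monom 1 (k * M) * h g" by (simp add: h_def pcompose_mult pcompose_monom_1 monom_1_power)
  also have "monom 1 (k * M) = monom 1 M * (monom 1 (k * M - M) :: 'a poly)" using k0 by (simp add: mult_monom)
  finally show ?thesis unfolding puiseux_approx_def by (metis mult.assoc)
 qed
 thus ?thesis using e(1) by blast
qed

text \<open>Those hypotheses of \<open>krasner\<close> that see the place only through membership of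
  finitely many constants in \<open>A\<close>, \<open>F\<close> and the units.\<close>

definition krasner_data :: "'c::field set => 'c set => nat => 'c poly poly => 'c poly => bool" where
 "krasner_data A F N f D \<longleftrightarrow> (ALL j. coeff f j : poly_over A) & (EX c ts \<mu> D1 s g.
   D = smult c (\<Prod>t\<leftarrow>ts. [:- t, 1:]) & c ~: nonunits A & c : A & set ts <= A & set ts <= F \<and>
   (ALL t:set ts. D = [:- t, 1:] ^ \<mu> t * D1 t & D1 t : poly_over A & poly (D1 t) t ~: nonunits A
    & puiseux_approx N f (degree f * (N * \<mu> t + 1)) t (s t) (g t)
    & s t : poly_over F & s t : poly_over A & g t : poly_over A))"

lemma finite_range_coeff: "finite (range (coeff p))"
proof (rule finite_subset)
 show "range (coeff p) <= insert 0 (coeff p ` {..degree p})"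
 proof
  fix x assume "x : range (coeff p)"
  then obtain i where "x = coeff p i" by blast
  thus "x : insert 0 (coeff p ` {..degree p})" by (cases "i <= degree p") (auto simp: coeff_eq_0)
 qed
qed simp

lemma unit_of_inverse: "x ~= 0 ==> inverse x : A ==> x ~: nonunits A"
 by (simp add: nonunits_def)

lemma krasner_data_exists:
 fixes f :: "'c::{alg_closed_field, field_char_0} poly poly"
 assumes f: "lead_coeff f = 1" "degree f > 0" and D: "D ~= 0"
 shows "EX e>0. ALL N>0. e dvd N --> (EX Y. finite Y & (ALL A F. Y <= A --> Y <= F --> inverse ` Y <= A --> krasner_data A F N f D))"
proof -
 obtain R where R: "D = smult (lead_coeff D) (\<Prod>x\<in>#R. [:- x, 1:])" using alg_closed_imp_factorization[OF D] by blast
 obtain ts where ts: "mset ts = R" by (metis ex_mset)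
 define c where "c = lead_coeff D"
 have c0: "c ~= 0" using D by (simp add: c_def)
 have Dts: "D = smult c (\<Prod>t\<leftarrow>ts. [:- t, 1:])" using R by (simp add: c_def flip: ts prod_mset_prod_list)
 have "ALL t. EX D1. D = [:- t, 1:] ^ order t D * D1 & poly D1 t ~= 0"
  using order_decomp[OF D] by (metis poly_eq_0_iff_dvd)
 then obtain D1 where D1: "!!t. D = [:- t, 1:] ^ order t D * D1 t" "!!t. poly (D1 t) t ~= 0" by metis
 have "ALL t. EX e>0. ALL N>0. e dvd N --> (ALL M. EX s g. puiseux_approx N f M t s g)" using puiseux_level[OF f] by blast
 from choice[OF this] obtain e where e: "ALL t. e t > 0 & (ALL N>0. e t dvd N --> (ALL M. EX s g. puiseux_approx N f M t s g))" by (elim exE)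
 have "EX Y. finite Y & (ALL A F. Y <= A --> Y <= F --> inverse ` Y <= A --> krasner_data A F N f D)"
  if N: "N > 0" "(\<Prod>t\<in>set ts. e t) dvd N" for N
 proof -
  have "ALL t:set ts. EX v. puiseux_approx N f (degree f * (N * order t D + 1)) t (fst v) (snd v)"
  proof
   fix t assume "t : set ts"
   hence "e t dvd N" using N(2) dvd_prodI[of "set ts" t e] dvd_trans by blast
   thus "EX v. puiseux_approx N f (degree f * (N * order t D + 1)) t (fst v) (snd v)" using e N(1) by fastforce
  qed
  from bchoice[OF this] obtain v where v: "ALL t:set ts. puiseux_approx N f (degree f * (N * order t D + 1)) t (fst (v t)) (snd (v t))"
   by (elim exE)
  \<comment> \<open>Besides coefficients, \<open>Y\<close> holds \<open>c\<close> and the values of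
    \<open>D1 t\<close> at \<open>t\<close>; these are nonzero and become units because the inverses
    of \<open>Y\<close> are required to lie in \<open>A\<close>.\<close>
  define Y where "Y = {c} \<union> set ts \<union> (\<Union>t\<in>set ts. range (coeff (D1 t)) \<union> {poly (D1 t) t} \<union> range (coeff (fst (v t))) \<union> range (coeff (snd (v t))))
   \<union> (\<Union>a\<in>range (coeff f). range (coeff a))"
  have "finite Y" unfolding Y_def by (intro finite_UnI finite_UN_I) (auto simp: finite_range_coeff)
  moreover have "krasner_data A F N f D" if Y: "Y <= A" "Y <= F" "inverse ` Y <= A" for A F
   unfolding krasner_data_def
  proof (intro conjI allI)
   have "range (coeff (coeff f j)) <= Y" for j unfolding Y_def by blast
   thus "coeff f j : poly_over A" for j using Y(1) unfolding poly_over_def by blast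
   have cY: "c : Y" and tY: "set ts <= Y" by (auto simp: Y_def)
   have D1Y: "poly (D1 t) t : Y" "range (coeff (D1 t)) <= Y" "range (coeff (fst (v t))) <= Y" "range (coeff (snd (v t))) <= Y"
    if "t : set ts" for t using that by (auto simp: Y_def)
   have po: "range (coeff q) <= Y ==> q : poly_over A & q : poly_over F" for q
    using Y(1,2) by (auto simp: poly_over_def)
   have un: "x : Y ==> x ~= 0 ==> x ~: nonunits A" for x using Y(3) by (intro unit_of_inverse) auto
   show "EX c ts \<mu> D1 s g. D = smult c (\<Prod>t\<leftarrow>ts. [:- t, 1:]) & c ~: nonunits A & c : A & set ts <= A & set ts <= F \<and>
   (ALL t:set ts. D = [:- t, 1:] ^ \<mu> t * D1 t & D1 t : poly_over A & poly (D1 t) t ~: nonunits A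
    & puiseux_approx N f (degree f * (N * \<mu> t + 1)) t (s t) (g t)
    & s t : poly_over F & s t : poly_over A & g t : poly_over A)"
   proof (rule exI[of _ c], rule exI[of _ ts], rule exI[of _ "%t. order t D"], rule exI[of _ D1],
     rule exI[of _ "%t. fst (v t)"], rule exI[of _ "%t. snd (v t)"], intro conjI ballI)
    show "D = smult c (\<Prod>t\<leftarrow>ts. [:- t, 1:])" by (rule Dts)
    show "c ~: nonunits A" by (rule un[OF cY c0])
    show "c : A" "set ts <= A" "set ts <= F" using cY tY Y by auto
    fix t assume t: "t : set ts"
    show "D = [:- t, 1:] ^ order t D * D1 t" by (rule D1(1))
    show "poly (D1 t) t ~: nonunits A" by (rule un[OF D1Y(1)[OF t] D1(2)])
    show "puiseux_approx N f (degree f * (N * order t D + 1)) t (fst (v t)) (snd (v t))" using v t by blast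
    show "D1 t : poly_over A" "fst (v t) : poly_over F" "fst (v t) : poly_over A" "snd (v t) : poly_over A"
     using po D1Y(2-4)[OF t] by blast+
   qed
  qed
  ultimately show ?thesis by blast
 qed
 moreover have "(\<Prod>t\<in>set ts. e t) > 0" using e by (simp add: prod_pos)
 ultimately show ?thesis by blast
qed

lemma to_ac_poly: "to_ac (poly p x) = poly (map_poly to_ac p) (to_ac x)"
 by (rule hom_poly) simp_all

text \<open>Joins the two levels: the estimate is made at level \<open>N'\<close>, while the roots
  come from the extension of level \<open>N\<close>, whose elements and automorphisms are viewed
  inside level \<open>N'\<close>.\<close>

lemma (in local_field) chart_point:
 fixes E :: "'e ring" and \<iota> :: "'k poly fract => 'e"
 defines "Gm \<equiv> carrier (galois_group ring_of_type_algebra E \<iota>)"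
 assumes K: "kummer A F p N' \<zeta>' ups' \<rho>' u" and lev: "N dvd N'" "N > 1"
   "\<zeta> = \<zeta>' ^ (N' div N)" "ups = ups' ^ (N' div N)" "\<rho> = \<rho>' ^ (N' div N)"
  and gp: "gal_point E \<iota> Lp t \<Phi>" and \<Phi>k: "!!c. \<Phi> (\<iota> (const_fract c)) = nu (to_completion P c)"
  and gen: "generates (integral_closure E (\<iota> ` local_ring t)) \<Phi>"
  and W: "W : local_ring t" "\<Phi> (\<iota> W) = \<Phi> (\<iota> (const_fract x0))"
  and y: "y : carrier E" and f: "lead_coeff f = 1" "degree f = card Gm" "card Gm > 0"
  and coeff: "!!j. root_coeff E (gal_ext.orb E \<iota> y) j = \<iota> (ev W (coeff f j))"
  and norm: "!!\<sigma> \<tau>. \<sigma> : Gm ==> \<tau> : Gm ==> \<sigma> ~= \<tau> ==>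
    \<iota> (ev W D) = \<iota> (ev W (d \<sigma> \<tau>)) \<otimes>\<^bsub>E\<^esub> root_coeff E (gal_ext.orb E \<iota> (\<sigma> y \<ominus>\<^bsub>E\<^esub> \<tau> y)) 0"
  and d: "!!\<sigma> \<tau>. \<sigma> : Gm ==> \<tau> : Gm ==> range (coeff (map_poly to_ac (d \<sigma> \<tau>))) <= A"
  and x0: "to_ac x0 : A" "poly D x0 ~= 0"
  and kd: "krasner_data A F N' (map_poly (map_poly to_ac) f) (map_poly to_ac D)"
 shows False
proof -
 interpret K: kummer A F p N' \<zeta>' ups' \<rho>' u by (rule K)
 let ?f = "map_poly (map_poly to_ac) f" and ?D = "map_poly to_ac D"
 have deg: "degree ?f = card Gm" using f by (subst degree_map_poly) (auto simp: map_poly_eq_0_iff)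
 have lead: "lead_coeff ?f = 1" using f by (simp add: deg coeff_map_poly)
 have Dx0: "poly ?D (to_ac x0) = to_ac (poly D x0)" by (simp add: to_ac_poly)
 have fx0: "poly (coeff ?f j) (to_ac x0) = to_ac (poly (coeff f j) x0)" for j by (simp add: coeff_map_poly to_ac_poly)
 from kd obtain c ts \<mu> D1 s g where k1: "!!j. coeff ?f j : poly_over A"
  and k2: "?D = smult c (\<Prod>t\<leftarrow>ts. [:- t, 1:])" "c ~: nonunits A" "c : A" "set ts <= A" "set ts <= F"
  and k3: "ALL t:set ts. ?D = [:- t, 1:] ^ \<mu> t * D1 t & D1 t : poly_over A & poly (D1 t) t ~: nonunits A
    & puiseux_approx N' ?f (degree ?f * (N' * \<mu> t + 1)) t (s t) (g t)
    & s t : poly_over F & s t : poly_over A & g t : poly_over A"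
  unfolding krasner_data_def by (elim conjE exE) (rule that, (erule spec | assumption)+)
 have k4: "?D = [:- t, 1:] ^ \<mu> t * D1 t & D1 t : poly_over A & poly (D1 t) t ~: nonunits A" if "t : set ts" for t
  using k3 that by blast
 have k5: "puiseux_approx N' ?f (card Gm * (N' * \<mu> t + 1)) t (s t) (g t)
   & s t : poly_over F & s t : poly_over A & g t : poly_over A" if "t : set ts" for t
  using k3 that unfolding deg by blast
 have Dnz: "poly ?D (to_ac x0) ~= 0" using x0(2) by (simp add: Dx0)
 have N0: "N > 0" using lev(2) by simp
 have level: "x : kum_field ==> x : K.kum_field" "x : kum_field ==> K.kum_aut al be x = kum_aut al be x" for x al be
  using K.sublevel_field[OF lev(1) N0, of x] by (simp_all only: lev(3-5))
 have fin: "finite Gm" using f(3) by (rule card_ge_0_finite)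
 show False
 proof (rule K.krasner[where 'i = "'e => 'e", OF lev(1,2) lead deg f(3) k1 k2 k4 k5 to_ac_F x0(1) Dnz])
  fix al be r M
  assume r: "~ (N dvd al & N dvd be)" "~ vle (poly ?D (to_ac x0)) r" "r : A" "r ~= 0"
   and kr: "!!I y. finite (I :: ('e => 'e) set) ==> card I = card Gm ==> (!!i. i : I ==> y i : K.kum_field) ==>
    (!!j. vle (poly.coeff (\<Prod>i\<in>I. [:- y i, 1:]) j - poly (poly.coeff ?f j) (to_ac x0)) (of_nat p ^ M)) ==>
    (ALL i:I. y i : A) & (EX i:I. vle (y i - K.kum_aut al be (y i)) r)"
  show False
 proof (rule generic_point[where E = E and \<iota> = \<iota> and t = t and \<Phi> = \<Phi> and W = W and y = y and f = f and D = D and d = d, OF gp \<Phi>k gen W y f(2)[unfolded Gm_def] coeff norm[unfolded Gm_def] _ r(1) _ r(4)])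
  show "to_ac (poly (d \<sigma> \<tau>) x0) : A" if "\<sigma> : carrier (galois_group ring_of_type_algebra E \<iota>)"
    "\<tau> : carrier (galois_group ring_of_type_algebra E \<iota>)" for \<sigma> \<tau>
  proof -
   have "range (poly.coeff (map_poly to_ac (d \<sigma> \<tau>))) <= A" by (rule d) (use that in \<open>simp_all add: Gm_def\<close>)
   hence "map_poly to_ac (d \<sigma> \<tau>) : poly_over A" unfolding poly_over_def by blast
   thus ?thesis unfolding to_ac_poly by (rule poly_over_poly[OF subring _ x0(1)])
  qed
  show "~ vle (to_ac (poly D x0)) r" using r(2) unfolding Dx0 .
  fix Y :: "('e => 'e) => 'k alg_closure"
  assume Y: "!!\<sigma>. \<sigma> : carrier (galois_group ring_of_type_algebra E \<iota>) ==> Y \<sigma> : kum_field"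
   "!!j. vle (poly.coeff (\<Prod>\<sigma>\<in>carrier (galois_group ring_of_type_algebra E \<iota>). [:- Y \<sigma>, 1:]) j - to_ac (poly (poly.coeff f j) x0)) (of_nat p ^ M)"
  have "(ALL i:Gm. Y i : A) & (EX i:Gm. vle (Y i - K.kum_aut al be (Y i)) r)"
   by (rule kr[OF fin refl]) (use Y level(1) in \<open>auto simp: Gm_def fx0\<close>)
  thus "(ALL \<sigma>:carrier (galois_group ring_of_type_algebra E \<iota>). Y \<sigma> : A) \<and>
    (EX \<sigma>:carrier (galois_group ring_of_type_algebra E \<iota>). vle (Y \<sigma> - kum_aut al be (Y \<sigma>)) r)"
   using level(2) Y(1) unfolding Gm_def by fastforce
 qed
 qed
qed

section \<open>Algebraicity over the rationals\<close>

text \<open>Among \<open>card T + 1\<close> powers in a space spanned by \<open>card T\<close>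
  elements, two coincide or a linear relation holds.\<close>

lemma algebraic_of_powers_in_span:
 fixes x :: "'a::field_char_0"
 assumes T: "finite T" and pow: "!!n. EX q. x ^ n = (\<Sum>b\<in>T. of_rat (q b) * b)"
 shows "algebraic x"
proof -
 interpret V: vector_space "%(q::rat) (x::'a). of_rat q * x"
  by unfold_locales (simp_all add: of_rat_add of_rat_mult algebra_simps)
 have sp: "x ^ n : V.span T" for n using pow[of n] by (auto simp: V.span_finite[OF T])
 let ?m = "card T"
 show ?thesis
 proof (cases "inj_on (%n. x ^ n) {..?m}")
  case False
  then obtain i j where ij: "i ~= j" "x ^ i = x ^ j" by (auto simp: inj_on_def)
  show ?thesis
  proof (rule algebraicI[of "monom 1 i - monom 1 j"])
   show "monom (1::'a) i - monom 1 j ~= 0" using ij(1) by (auto simp: poly_eq_iff coeff_diff)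
  qed (auto simp: ij(2) poly_monom)
 next
  case True
  let ?S = "(%n. x ^ n) ` {..?m}"
  have "card ?S = Suc ?m" using True by (simp add: card_image)
  hence "V.dependent ?S" using V.independent_span_bound[OF T, of ?S] sp by auto
  then obtain w where w: "EX v:?S. w v ~= 0" "(\<Sum>v\<in>?S. of_rat (w v) * v) = 0"
   using V.dependent_finite[of ?S] by auto
  define p where "p = (\<Sum>i\<le>?m. monom (of_rat (w (x ^ i)) :: 'a) i)"
  have c: "poly.coeff p i = (if i <= ?m then of_rat (w (x ^ i)) else 0)" for i
   by (auto simp: p_def coeff_sum)
  show ?thesis
  proof (rule algebraicI'[of p])
   show "poly.coeff p i : \<rat>" for i by (simp add: c)
   obtain i where "i <= ?m" "w (x ^ i) ~= 0" using w(1) by auto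
   hence "poly.coeff p i ~= 0" by (simp add: c)
   thus "p ~= 0" by auto
   show "poly p x = 0" using w(2) True by (simp add: p_def poly_sum poly_monom sum.reindex)
  qed
 qed
qed

lemma number_field_basis:
 assumes "number_field TYPE('k::field_char_0)"
 shows "EX T. finite T & (ALL x::'k. EX q. x = (\<Sum>b\<in>T. of_rat (q b) * b))"
proof -
 obtain T where "finite_dimensional_vector_space (%(q::rat) (x::'k). of_rat q * x) T"
  using assms by (auto simp: number_field_def)
 then interpret V: finite_dimensional_vector_space "%(q::rat) (x::'k). of_rat q * x" T .
 have "x : range (%q. \<Sum>b\<in>T. of_rat (q b) * b)" for x :: 'k
  using V.span_Basis V.span_finite[OF V.finite_Basis] by auto
 thus ?thesis using V.finite_Basis by blast
qed

lemma to_ac_of_rat: "to_ac (of_rat r :: 'k::field_char_0) = of_rat r"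
 by (cases r) (simp add: of_rat_rat)

lemma all_algebraic:
 fixes z :: "'k::field_char_0 alg_closure"
 assumes "number_field TYPE('k)" shows "algebraic z"
proof -
 obtain T :: "'k set" where T: "finite T" "!!x. EX q. x = (\<Sum>b\<in>T. of_rat (q b) * b)"
  using number_field_basis[OF assms] by blast
 then obtain q where q: "!!x. x = (\<Sum>b\<in>T. of_rat (q x b) * b)" by metis
 obtain p where p: "p ~= 0" "poly (map_poly to_ac p) z = 0" by (rule alg_closure_algebraic[of z])
 define I where "I = {..<degree p}"
 define W where "W = (%(b, i). to_ac b * z ^ i) ` (T \<times> {..degree p})"
 interpret V: vector_space "%(q::rat) (x::'k alg_closure). of_rat q * x"
  by unfold_locales (simp_all add: of_rat_add of_rat_mult algebra_simps)
 have W: "finite W" using T(1) by (simp add: W_def)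
 have "z ^ n : V.span W" for n
 proof -
  define r where "r = monom 1 n mod p"
  have "degree r <= degree p" using degree_mod_less'[OF p(1), of "monom 1 n"] unfolding r_def
   by (cases "monom 1 n mod p = 0") auto
  have mp: "map_poly to_ac (a * b + c) = map_poly to_ac a * map_poly to_ac b + map_poly to_ac c" for a b c :: "'k poly"
   by (rule poly_eqI) (simp add: coeff_map_poly coeff_mult to_ac_sum)
  have "z ^ n = poly (map_poly to_ac (monom 1 n)) z" by (simp add: map_poly_monom poly_monom)
  also have "monom 1 n = (monom 1 n div p) * p + r" by (simp add: r_def)
  also have "poly (map_poly to_ac ...) z = poly (map_poly to_ac r) z" unfolding mp by (simp add: p(2))
  also have "... = (\<Sum>i\<le>degree r. to_ac (poly.coeff r i) * z ^ i)"
   by (simp add: poly_altdef degree_map_poly coeff_map_poly)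
  also have "... : V.span W"
  proof (intro V.span_sum)
   fix i assume "i : {..degree r}"
   hence i: "i <= degree p" using \<open>degree r <= degree p\<close> by simp
   have "to_ac (poly.coeff r i) * z ^ i = to_ac (\<Sum>b\<in>T. of_rat (q (poly.coeff r i) b) * b) * z ^ i"
    using q[of "poly.coeff r i"] by (simp only:)
   also have "... = (\<Sum>b\<in>T. of_rat (q (poly.coeff r i) b) * (to_ac b * z ^ i))"
    by (simp add: to_ac_sum to_ac_of_rat sum_distrib_right mult.assoc)
   also have "... : V.span W"
    by (intro V.span_sum V.span_scale V.span_base) (use i in \<open>auto simp: W_def\<close>)
   finally show "to_ac (poly.coeff r i) * z ^ i : V.span W" .
  qed
  finally show ?thesis .
 qed
 hence "EX q. z ^ n = (\<Sum>b\<in>W. of_rat (q b) * b)" for n by (auto simp: V.span_finite[OF W])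
 thus ?thesis by (rule algebraic_of_powers_in_span[OF W])
qed

lemma algebraic_to_ac: "algebraic (to_ac x) ==> algebraic (x :: 'k::field_char_0)"
proof -
 assume "algebraic (to_ac x)"
 then obtain p where p: "p ~= 0" "poly (map_poly of_int p) (to_ac x) = 0" by (erule algebraicE')
 have "map_poly of_int p = map_poly to_ac (map_poly of_int p :: 'k poly)"
  by (rule poly_eqI) (simp add: coeff_map_poly)
 hence "to_ac (poly (map_poly of_int p) x) = 0" using p(2) by (simp add: to_ac_poly)
 hence "poly (map_poly of_int p) x = 0" by simp
 moreover have "map_poly of_int p ~= (0 :: 'k poly)" using p(1) by (simp add: map_poly_eq_0_iff)
 ultimately show ?thesis by (intro algebraicI[of "map_poly of_int p"]) (auto simp: coeff_map_poly)
qed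

section \<open>Primitive roots of unity\<close>

text \<open>A prime \<open>q\<close> is split off \<open>n = q * k\<close>. If \<open>q\<close>
  divides \<open>k\<close>, a \<open>q\<close>-th root of a primitive \<open>k\<close>-th root
  works; otherwise the latter is multiplied by a root of
  \<open>1 + X + ... + X ^ (q - 1)\<close>.\<close>

lemma exists_primitive_root_of_unity:
 assumes "n > 0"
 shows "EX z::'c::{alg_closed_field, field_char_0}. ALL m. z ^ m = 1 \<longleftrightarrow> n dvd m"
 using assms
proof (induction n rule: less_induct)
 case (less n)
 show ?case
 proof (cases "n = 1")
  case True
  thus ?thesis by (intro exI[of _ 1]) simp
 next
  case False
  then obtain q where q: "Factorial_Ring.prime q" "q dvd n" using prime_factor_nat by blast
  then obtain k where k: "n = q * k" by blast
  have q1: "q > 1" using q(1) by (rule prime_gt_1_nat)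
  have k0: "k > 0" "k < n" using less.prems k q1 by auto
  then obtain z :: 'c where z: "!!m. z ^ m = 1 \<longleftrightarrow> k dvd m" using less.IH by blast
  show ?thesis
  proof (cases "q dvd k")
   case True
   obtain y where y: "y ^ q = z" using nth_root_exists[of q z] q1 by auto
   have "y ^ m = 1 \<longleftrightarrow> n dvd m" for m
   proof
    assume m: "y ^ m = 1"
    have "z ^ m = (y ^ m) ^ q" by (simp add: power_mult[symmetric] mult.commute flip: y)
    hence "k dvd m" using z m by simp
    then obtain m' where m': "m = q * m'" using True dvd_trans by blast
    have "z ^ m' = 1" using m by (simp add: m' power_mult y)
    thus "n dvd m" using z by (simp add: k m')
   next
    assume "n dvd m"
    then obtain m' where m': "m = n * m'" by blast
    have "y ^ m = (y ^ q) ^ (k * m')" by (simp add: m' k mult.assoc power_mult)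
    thus "y ^ m = 1" using z[of "k * m'"] by (simp add: y)
   qed
   thus ?thesis by blast
  next
   case False
   have co: "coprime q k" by (rule prime_imp_coprime[OF q(1) False])
   define f where "f = (\<Sum>i<q. monom (1::'c) i)"
   have fc: "coeff f i = (if i < q then 1 else 0)" for i by (auto simp: f_def coeff_sum)
   have "degree f > 0"
   proof -
    have "q - 1 <= degree f" by (rule le_degree) (use q1 in \<open>simp add: fc\<close>)
    thus ?thesis using q1 by simp
   qed
   then obtain w where w: "poly f w = 0" using alg_closed_imp_poly_has_root[of f] by blast
   have fw: "poly f x = (\<Sum>i<q. x ^ i)" for x by (simp add: f_def poly_sum poly_monom)
   have w1: "w ~= 1" using w q1 by (auto simp: fw)
   have wq: "w ^ q = 1" using w power_diff_1_eq[of w q] by (simp add: fw)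
   have wm: "q dvd m" if "w ^ m = 1" for m
   proof (rule ccontr)
    assume "~ q dvd m"
    hence "coprime m q" using prime_imp_coprime[OF q(1)] by (simp add: coprime_commute)
    then obtain u where "[m * u = Suc 0] (mod q)" using cong_solve_coprime_nat by blast
    hence "(m * u) mod q = 1" using q1 by (simp add: cong_def)
    hence eq: "m * u = q * ((m * u) div q) + 1" by (metis mult_div_mod_eq)
    have "w ^ (m * u) = w" by (subst eq) (simp add: power_mult wq)
    thus False using that w1 by (simp add: power_mult)
   qed
   have "(z * w) ^ m = 1 \<longleftrightarrow> n dvd m" for m
   proof
    assume m: "(z * w) ^ m = 1"
    have "z ^ (m * q) = ((z * w) ^ m) ^ q" using wq
     by (simp add: power_mult_distrib power_mult[symmetric] mult.commute[of m q]) (simp add: power_mult)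
    hence "k dvd m * q" using z m by simp
    hence km: "k dvd m" using co by (simp add: coprime_dvd_mult_left_iff coprime_commute)
    hence "w ^ m = 1" using m z[of m] by (simp add: power_mult_distrib)
    thus "n dvd m" unfolding k using wm km co by (intro divides_mult) auto
   next
    assume "n dvd m"
    hence "k dvd m" "q dvd m" by (auto simp: k dest: dvd_mult_left dvd_mult_right)
    thus "(z * w) ^ m = 1" using z[of m] wq by (auto simp: power_mult_distrib power_mult elim!: dvdE)
   qed
   thus ?thesis by blast
  qed
 qed
qed

section \<open>The requirements of one extension on a place, and their consequence\<close>

section \<open>The test set of an extension\<close>

context gal_ext
begin

definition chart_data where
 "chart_data W y f D d \<longleftrightarrow> y : carrier E & lead_coeff f = 1 & degree f = card Gm & D ~= (0 :: 'k poly)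
  & (ALL j. root_coeff E (orb y) j = \<iota> (ev W (poly.coeff f j)))
  & (ALL \<sigma>:Gm. ALL \<tau>:Gm. \<sigma> ~= \<tau> -->
    \<iota> (ev W D) = \<iota> (ev W (d \<sigma> \<tau>)) \<otimes>\<^bsub>E\<^esub> root_coeff E (orb (\<sigma> y \<ominus>\<^bsub>E\<^esub> \<tau> y)) 0)"

definition chart_tested where
 "chart_tested N A F f D d \<longleftrightarrow> krasner_data A F N (map_poly (map_poly to_ac) f) (map_poly to_ac D)
  & (ALL \<sigma>:Gm. ALL \<tau>:Gm. range (poly.coeff (map_poly to_ac (d \<sigma> \<tau>))) <= A)"

text \<open>Infinity and the zeros of either discriminant multiple, those of \<open>D'\<close>
  carried over from the chart \<open>1/T\<close>. Every other point may use whichever chart makes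
  its coordinate integral at the place.\<close>

definition exceptional :: "'k poly => 'k poly => 'k proj_line set" where
 "exceptional D D' = insert Infinite_point
   (Finite_point ` ({a. poly D a = 0} \<union> inverse ` {a. poly D' a = 0}))"

text \<open>Some prime above \<open>t\<close> may serve as \<open>Q\<close>, since
  \<open>prime_conjugate_kernel\<close> relates it to the prime of any given specialization.\<close>

definition residue_generators :: "'k proj_line => 'e list => bool" where
 "residue_generators t bs \<longleftrightarrow> (EX Q. primeideal Q (closure_ring E \<iota> t) & \<iota> (local_parameter t) : Q & set bs <= B t \<and>
   ring.Span (closure_ring E \<iota> t Quot Q) (range (%a. Q +>\<^bsub>closure_ring E \<iota> t\<^esub> \<iota> (const_fract a)))
     (map (%b. Q +>\<^bsub>closure_ring E \<iota> t\<^esub> b) bs) = carrier (closure_ring E \<iota> t Quot Q))"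

text \<open>Having these roots in \<open>F\<close> makes the residue extension at \<open>t\<close>
  split completely at the place.\<close>

definition res_roots :: "'k proj_line => 'e => 'k alg_closure list" where
 "res_roots t b = (SOME zs. ALL j. to_ac (res_coeff t b j) = poly.coeff (\<Prod>z\<leftarrow>zs. [:- z, 1:]) j)"

text \<open>All that \<open>E\<close> requires of a place. The guard
  \<open>Ex (residue_generators t)\<close> restricts the last clause to points with a
  finite-dimensional residue extension; a specialization that is a solution supplies such
  generators.\<close>

definition tested :: "nat => 'k alg_closure set => 'k alg_closure set => bool" where
 "tested N A F \<longleftrightarrow> (EX y f D d y' f' D' d'.
   chart_data (Fract [:0, 1:] 1) y f D d & chart_data (Fract 1 [:0, 1:]) y' f' D' d'
   & chart_tested N A F f D d & chart_tested N A F f' D' d'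
   & (ALL t:exceptional D D'. Ex (residue_generators t) -->
     (EX bs. residue_generators t bs & (ALL b:set bs. set (res_roots t b) <= F))))"

lemma card_Gm: "card Gm > 0"
 using Gm_id finite_group by (auto simp: card_gt_0_iff)

lemma chart_test_set:
 assumes "chart_data W y f D d"
 shows "EX e>0. ALL N>0. e dvd N --> (EX Y. finite Y & (ALL A F. Y <= A --> Y <= F --> inverse ` Y <= A --> chart_tested N A F f D d))"
proof -
 let ?f = "map_poly (map_poly to_ac) f" and ?D = "map_poly to_ac D"
 have f: "lead_coeff f = 1" "degree f = card Gm" "D ~= 0" using assms unfolding chart_data_def by blast+
 have deg: "degree ?f = card Gm" using f by (subst degree_map_poly) (auto simp: map_poly_eq_0_iff)
 have lead: "lead_coeff ?f = 1" using f by (simp add: deg coeff_map_poly)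
 have D0: "?D ~= 0" using f by (simp add: map_poly_eq_0_iff)
 obtain e where e: "e > 0" "!!N. N > 0 ==> e dvd N ==> EX Y. finite Y \<and>
   (ALL A F. Y <= A --> Y <= F --> inverse ` Y <= A --> krasner_data A F N ?f ?D)"
  using krasner_data_exists[OF lead _ D0] card_Gm deg by auto
 define Y0 where "Y0 = (\<Union>\<sigma>\<in>Gm. \<Union>\<tau>\<in>Gm. range (poly.coeff (map_poly to_ac (d \<sigma> \<tau>))))"
 have Y0: "finite Y0" unfolding Y0_def by (intro finite_UN_I finite_group finite_range_coeff)
 have "EX Y. finite Y & (ALL A F. Y <= A --> Y <= F --> inverse ` Y <= A --> chart_tested N A F f D d)" if N: "N > 0" "e dvd N" for N
 proof -
  obtain Y where Y: "finite Y" "!!A F. Y <= A ==> Y <= F ==> inverse ` Y <= A ==> krasner_data A F N ?f ?D"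
   using e(2)[OF N] by blast
  have "chart_tested N A F f D d" if "Y \<union> Y0 <= A" "Y \<union> Y0 <= F" "inverse ` (Y \<union> Y0) <= A" for A F
   unfolding chart_tested_def
  proof (intro conjI ballI)
   show "krasner_data A F N ?f ?D" by (rule Y(2)) (use that in auto)
   fix \<sigma> \<tau> assume "\<sigma> : Gm" "\<tau> : Gm"
   hence "range (poly.coeff (map_poly to_ac (d \<sigma> \<tau>))) <= Y0" unfolding Y0_def by blast
   thus "range (poly.coeff (map_poly to_ac (d \<sigma> \<tau>))) <= A" using that(1) by blast
  qed
  thus ?thesis using Y(1) Y0 by (intro exI[of _ "Y \<union> Y0"]) simp
 qed
 thus ?thesis using e(1) by blast
qed

lemma test_set:
 "EX e>0. ALL N>0. e dvd N --> (EX Y. finite Y & (ALL A F. Y <= A --> Y <= F --> inverse ` Y <= A --> tested N A F))"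
proof -
 have ex: "EX y f D d. chart_data W y f D d" if "coordinate W" for W
  unfolding chart_data_def by (rule chart[OF that])
 obtain y f D d where c: "chart_data (Fract [:0, 1:] 1) y f D d" using ex[OF coordinate_T] by (elim exE)
 obtain y' f' D' d' where c': "chart_data (Fract 1 [:0, 1:]) y' f' D' d'" using ex[OF coordinate_inverse_T] by (elim exE)
 from chart_test_set[OF c] obtain e where e: "e > 0" "!!N. N > 0 ==> e dvd N ==> EX Y. finite Y \<and>
   (ALL A F. Y <= A --> Y <= F --> inverse ` Y <= A --> chart_tested N A F f D d)" by blast
 from chart_test_set[OF c'] obtain e' where e': "e' > 0" "!!N. N > 0 ==> e' dvd N ==> EX Y. finite Y \<and>
   (ALL A F. Y <= A --> Y <= F --> inverse ` Y <= A --> chart_tested N A F f' D' d')" by blast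
 have D0: "D ~= 0" "D' ~= 0" using c c' by (simp_all add: chart_data_def)
 have fin: "finite (exceptional D D')" unfolding exceptional_def using poly_roots_finite[OF D0(1)] poly_roots_finite[OF D0(2)] by simp
 \<comment> \<open>Where no generators exist the list is arbitrary, which the guard in
   \<open>tested\<close> makes harmless.\<close>
 define g where "g t = (SOME bs. residue_generators t bs)" for t
 define Y0 where "Y0 = (\<Union>t\<in>exceptional D D'. \<Union>b\<in>set (g t). set (res_roots t b))"
 have Y0: "finite Y0" unfolding Y0_def using fin by blast
 have "EX Y. finite Y & (ALL A F. Y <= A --> Y <= F --> inverse ` Y <= A --> tested N A F)" if N: "N > 0" "e * e' dvd N" for N
 proof -
  have dv: "e dvd N" "e' dvd N" using N(2) by (auto dest: dvd_mult_left dvd_mult_right)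
  obtain Y where Y: "finite Y" "!!A F. Y <= A ==> Y <= F ==> inverse ` Y <= A ==> chart_tested N A F f D d"
   using e(2)[OF N(1) dv(1)] by blast
  obtain Y' where Y': "finite Y'" "!!A F. Y' <= A ==> Y' <= F ==> inverse ` Y' <= A ==> chart_tested N A F f' D' d'"
   using e'(2)[OF N(1) dv(2)] by blast
  have "tested N A F" if YY: "Y \<union> Y' \<union> Y0 <= A" "Y \<union> Y' \<union> Y0 <= F" "inverse ` (Y \<union> Y' \<union> Y0) <= A" for A F
  proof -
   have t: "chart_tested N A F f D d" "chart_tested N A F f' D' d'"
    by (rule Y(2), use YY in auto)[1] (rule Y'(2), use YY in auto)
   have "EX bs. residue_generators t bs & (ALL b:set bs. set (res_roots t b) <= F)"
    if "t : exceptional D D'" "Ex (residue_generators t)" for t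
   proof -
    have "residue_generators t (g t)" unfolding g_def by (rule someI_ex[OF that(2)])
    moreover have "set (res_roots t b) <= F" if "b : set (g t)" for b
    proof -
     have "set (res_roots t b) <= Y0" unfolding Y0_def using that \<open>t : exceptional D D'\<close> by blast
     thus ?thesis using YY(2) by blast
    qed
    ultimately show ?thesis by blast
   qed
   thus ?thesis unfolding tested_def using c c' t by blast
  qed
  thus ?thesis using Y(1) Y'(1) Y0 by (intro exI[of _ "Y \<union> Y' \<union> Y0"]) simp
 qed
 moreover have "e * e' > 0" using e(1) e'(1) by simp
 ultimately show ?thesis by blast
qed

end

text \<open>Injectivity of \<open>\<kappa>\<close> transfers leading coefficient 1 and vanishing of
  higher coefficients from \<open>M\<close> to \<open>k\<close>; the resulting monic polynomial then
  splits in the algebraic closure.\<close>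

lemma (in gal_point) res_roots:
 assumes b: "b : B t"
 shows "ALL j. to_ac (res_coeff t b j) = poly.coeff (\<Prod>z\<leftarrow>res_roots t b. [:- z, 1:]) j"
proof -
 let ?n = "length (map \<Phi> (orb b))" and ?c = "res_coeff t b"
 note xs = \<Phi>_orb_in[OF b]
 have "\<kappa> (?c ?n) = \<kappa> 1" using M.root_coeff_lead[OF xs] by (simp only: root_coeff_\<Phi>_orb[OF b] \<kappa>_1)
 hence lead: "?c ?n = 1" using inj_\<kappa> by (simp add: inj_def)
 have out: "?c j = 0" if "j > ?n" for j
  using M.root_coeff_outside[OF xs that] by (intro \<kappa>_eq_0) (simp only: root_coeff_\<Phi>_orb[OF b])
 define f where "f = (\<Sum>j\<le>?n. monom (to_ac (?c j)) j)"
 have f: "poly.coeff f j = to_ac (?c j)" for j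
  using out[of j] by (auto simp: f_def coeff_sum)
 have deg: "degree f = ?n"
  by (rule antisym[OF degree_le le_degree]) (use lead out in \<open>auto simp: f\<close>)
 have lf: "lead_coeff f = 1" using lead by (simp only: deg f to_ac_1)
 hence "f ~= 0" by auto
 then obtain R where R: "f = smult (lead_coeff f) (\<Prod>z\<in>#R. [:- z, 1:])" using alg_closed_imp_factorization by blast
 obtain zs where "mset zs = R" by (metis ex_mset)
 hence "f = (\<Prod>z\<leftarrow>zs. [:- z, 1:])" using R lf by (simp flip: prod_mset_prod_list)
 hence "ALL j. to_ac (?c j) = poly.coeff (\<Prod>z\<leftarrow>zs. [:- z, 1:]) j" using f by simp
 thus ?thesis unfolding res_roots_def by (rule someI[of "%zs. ALL j. to_ac (?c j) = poly.coeff (\<Prod>z\<leftarrow>zs. [:- z, 1:]) j"])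
qed

context local_field
begin

lemma no_point:
 fixes E :: "'e ring" and \<iota> :: "'k poly fract => 'e"
 assumes K: "kummer A F p N' \<zeta>' ups' \<rho>' u" and lev: "N dvd N'" "N > 1"
   "\<zeta> = \<zeta>' ^ (N' div N)" "ups = ups' ^ (N' div N)" "\<rho> = \<rho>' ^ (N' div N)"
  and gp: "gal_point E \<iota> Lp t \<Phi>" and \<Phi>k: "!!c. \<Phi> (\<iota> (const_fract c)) = nu (to_completion P c)"
  and gen: "generates (integral_closure E (\<iota> ` local_ring t)) \<Phi>"
  and rg: "Ex (gal_ext.residue_generators E \<iota> t)"
  and tst: "gal_ext.tested E \<iota> N' A F"
 shows False
proof -
 interpret G: gal_point E \<iota> Lp t \<Phi> by (rule gp)
 obtain y f D d y' f' D' d' where c: "G.chart_data (Fract [:0, 1:] 1) y f D d" "G.chart_data (Fract 1 [:0, 1:]) y' f' D' d'"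
  and ct: "G.chart_tested N' A F f D d" "G.chart_tested N' A F f' D' d'"
  and ex: "ALL t:G.exceptional D D'. Ex (G.residue_generators t) -->
     (EX bs. G.residue_generators t bs & (ALL b:set bs. set (G.res_roots t b) <= F))"
  using tst unfolding G.tested_def by (elim exE conjE) (rule that)
 have chart_False: False if c: "G.chart_data W y f D d" and ct: "G.chart_tested N' A F f D d"
   and W: "W : local_ring t" "\<Phi> (\<iota> W) = G.\<kappa> x0" and x0: "to_ac x0 : A" "poly D x0 ~= 0" for W y f D d x0
 proof (rule chart_point[where E = E and \<iota> = \<iota> and t = t and \<Phi> = \<Phi> and W = W and y = y and f = f and D = D and d = d,
    OF K lev gp \<Phi>k gen W(1) W(2)[unfolded G.\<kappa>_def]])
  show "y : carrier E" "lead_coeff f = 1" "degree f = card G.Gm" using c unfolding G.chart_data_def by blast+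
  show "card G.Gm > 0" by (rule G.card_Gm)
  show "root_coeff E (G.orb y) j = \<iota> (ev W (poly.coeff f j))" for j using c unfolding G.chart_data_def by blast
  show "\<iota> (ev W D) = \<iota> (ev W (d \<sigma> \<tau>)) \<otimes>\<^bsub>E\<^esub> root_coeff E (G.orb (\<sigma> y \<ominus>\<^bsub>E\<^esub> \<tau> y)) 0"
   if "\<sigma> : G.Gm" "\<tau> : G.Gm" "\<sigma> ~= \<tau>" for \<sigma> \<tau> using c that unfolding G.chart_data_def by blast
  show "range (poly.coeff (map_poly to_ac (d \<sigma> \<tau>))) <= A" if "\<sigma> : G.Gm" "\<tau> : G.Gm" for \<sigma> \<tau>
   using ct that unfolding G.chart_tested_def by blast
  show "krasner_data A F N' (map_poly (map_poly to_ac) f) (map_poly to_ac D)" using ct unfolding G.chart_tested_def by blast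
 qed (rule x0)+
 show False
 proof (cases "t : G.exceptional D D'")
  case True
  then obtain bs where bs: "G.residue_generators t bs" "ALL b:set bs. set (G.res_roots t b) <= F" using ex rg by blast
  then obtain Q where Q: "primeideal Q (closure_ring E \<iota> t)" "\<iota> (local_parameter t) : Q" "set bs <= G.B t"
   "ring.Span (closure_ring E \<iota> t Quot Q) (range (%a. Q +>\<^bsub>closure_ring E \<iota> t\<^esub> \<iota> (const_fract a)))
     (map (%b. Q +>\<^bsub>closure_ring E \<iota> t\<^esub> b) bs) = carrier (closure_ring E \<iota> t Quot Q)"
   unfolding G.residue_generators_def by blast
  have "EX zs. set zs <= F & (ALL j. to_ac (G.res_coeff t b j) = poly.coeff (\<Prod>z\<leftarrow>zs. [:- z, 1:]) j)" if b: "b : set bs" for b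
   by (rule exI[of _ "G.res_roots t b"]) (use bs(2) b G.res_roots[of b] Q(3) in blast)
  thus False by (rule exceptional_point[where E = E and \<iota> = \<iota> and t = t and \<Phi> = \<Phi> and Q = Q and bs = bs, OF gp \<Phi>k gen lev(2) Q])
 next
  case False
  then obtain a where a: "t = Finite_point a" by (cases t) (auto simp: G.exceptional_def)
  have Da: "poly D a ~= 0" using False by (auto simp: a G.exceptional_def)
  show False
  proof (cases "to_ac a : A")
   case True
   show False by (rule chart_False[OF c(1) ct(1) G.chart_T[OF a] True Da])
  next
   \<comment> \<open>The coordinate of \<open>t\<close> is not integral at the place, so its inverse
     is, and the chart \<open>1/T\<close> applies.\<close>
   case nA: False
   hence a0: "a ~= 0" using in_0 by auto
   have iA: "to_ac (inverse a) : A" using in_or_inverse_in[of "to_ac a"] nA by simp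
   have "poly D' (inverse a) ~= 0"
   proof
    assume "poly D' (inverse a) = 0"
    hence "inverse (inverse a) : inverse ` {a. poly D' a = 0}" by blast
    thus False using False by (simp add: a G.exceptional_def)
   qed
   thus False by (rule chart_False[OF c(2) ct(2) G.chart_inverse_T[OF a a0] iA])
  qed
 qed
qed

text \<open>Reduction modulo \<open>Q\<close>, the embedding into the compositum and the isomorphism
  with \<open>Lp\<close> compose to a point of \<open>E\<close>. Generation of the compositum by
  \<open>k_P\<close> and the residue field becomes \<open>generates\<close>, and finite dimension of
  the residue field gives the generators modulo \<open>Q\<close>.\<close>

lemma solution_point:
 fixes E :: "'e ring" and \<iota> :: "'k poly fract => 'e" and M :: "'k local_ext_elem ring"
 assumes ge: "gal_ext E \<iota>" and Q: "Q : primes_above E \<iota> t"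
  and fg: "finite_galois (ring_of_type_algebra :: 'k ring) (closure_ring E \<iota> t Quot Q) (%a. Q +>\<^bsub>closure_ring E \<iota> t\<^esub> \<iota> (const_fract a))"
  and comp: "is_completion_of_ext P (closure_ring E \<iota> t Quot Q) (%a. Q +>\<^bsub>closure_ring E \<iota> t\<^esub> \<iota> (const_fract a)) M \<mu>"
  and iso: "base_isomorphic (completion P) M \<mu> Lp nu"
 shows "EX \<Phi>. gal_point E \<iota> Lp t \<Phi> & (ALL c. \<Phi> (\<iota> (const_fract c)) = nu (to_completion P c))
  & generates (integral_closure E (\<iota> ` local_ring t)) \<Phi>" "Ex (gal_ext.residue_generators E \<iota> t)"
proof -
 interpret G: gal_ext E \<iota> by (rule ge)
 let ?R = "closure_ring E \<iota> t"
 let ?L = "?R Quot Q" and ?h = "%a. Q +>\<^bsub>?R\<^esub> \<iota> (const_fract a)"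
 interpret Q: primeideal Q ?R using Q by (simp add: primes_above_def)
 interpret L: field Lp by (rule Lp_field)
 have par: "\<iota> (local_parameter t) : Q" using Q by (simp add: primes_above_def)
 have Lcar: "EX x:G.B t. z = Q +>\<^bsub>?R\<^esub> x" if "z : carrier ?L" for z
  using that by (auto simp: FactRing_def A_RCOSETS_def' G.closure_ring_carrier)
 have M: "field M" using comp by (simp add: is_completion_of_ext_def field_ext_def)
 interpret M: field M by (rule M)
 obtain l where l: "l : ring_hom ?L M" "!!a. l (?h a) = \<mu> (to_completion P a)"
  and gen: "generate_field M (\<mu> ` carrier (completion P) \<union> l ` carrier ?L) = carrier M"
  using comp unfolding is_completion_of_ext_def by blast
 have \<mu>: "\<mu> : ring_hom (completion P) M" using comp by (simp add: is_completion_of_ext_def field_ext_def)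
 obtain \<phi> where \<phi>: "\<phi> : ring_iso M Lp" "!!a. a : carrier (completion P) ==> \<phi> (\<mu> a) = nu a"
  using iso unfolding base_isomorphic_def by blast
 have \<phi>h: "\<phi> : ring_hom M Lp" and \<phi>s: "\<phi> ` carrier M = carrier Lp" using \<phi>(1) by (auto simp: ring_iso_def bij_betw_def)
 define \<Phi> where "\<Phi> x = \<phi> (l (Q +>\<^bsub>?R\<^esub> x))" for x
 have \<Phi>: "\<Phi> : ring_hom ?R Lp"
  using ring_hom_trans[OF ring_hom_trans[OF Q.rcos_ring_hom l(1)] \<phi>h] by (simp add: \<Phi>_def[abs_def] comp_def)
 have "Q +>\<^bsub>?R\<^esub> \<iota> (local_parameter t) = \<zero>\<^bsub>?L\<^esub>" using Q.a_rcos_const[OF par] by (simp add: FactRing_def)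
 hence "\<Phi> (\<iota> (local_parameter t)) = \<phi> (l \<zero>\<^bsub>?L\<^esub>)" by (simp add: \<Phi>_def)
 also have "... = \<zero>\<^bsub>Lp\<^esub>"
  using ring_hom_zero[OF l(1) Q.quotient_is_ring M.ring_axioms] ring_hom_zero[OF \<phi>h M.ring_axioms L.ring_axioms] by simp
 finally have gp: "gal_point E \<iota> Lp t \<Phi>"
  using ge Lp_field \<Phi> Q.is_cring by (intro gal_point.intro gal_point_axioms.intro)
 have k: "\<Phi> (\<iota> (const_fract c)) = nu (to_completion P c)" for c
  by (simp add: \<Phi>_def l(2) \<phi>(2) to_completion_in)
 have "s a = a" if s: "s : ring_hom Lp Lp" "ALL c:carrier (completion P). s (nu c) = nu c" "ALL x:G.B t. s (\<Phi> x) = \<Phi> x"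
   and a: "a : carrier Lp" for s a
 proof -
  define r where "r x = s (\<phi> x)" for x
  have r: "r : ring_hom M Lp" using ring_hom_trans[OF \<phi>h s(1)] by (simp add: r_def[abs_def] comp_def)
  interpret r: ring_hom_cring M Lp r using M.is_cring L.is_cring r by (simp add: ring_hom_cring_def ring_hom_cring_axioms_def)
  interpret f: ring_hom_cring M Lp \<phi> using M.is_cring L.is_cring \<phi>h by (simp add: ring_hom_cring_def ring_hom_cring_axioms_def)
  have "m : carrier M & r m = \<phi> m" if "m : generate_field M (\<mu> ` carrier (completion P) \<union> l ` carrier ?L)" for m
   using that
  proof (induction rule: generate_field.induct)
   case (incl h)
   thus ?case
   proof
    assume "h : \<mu> ` carrier (completion P)"
    thus ?thesis using \<phi>(2) s(2) ring_hom_closed[OF \<mu>] by (auto simp: r_def)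
   next
    assume "h : l ` carrier ?L"
    then obtain z where z: "z : carrier ?L" "h = l z" by blast
    then obtain x where "x : G.B t" "z = Q +>\<^bsub>?R\<^esub> x" using Lcar by blast
    thus ?thesis using s(3) z ring_hom_closed[OF l(1)] by (auto simp: r_def \<Phi>_def)
   qed
  next
   case (m_inv h)
   have hi: "inv\<^bsub>M\<^esub> h : carrier M" "inv\<^bsub>M\<^esub> h \<otimes>\<^bsub>M\<^esub> h = \<one>\<^bsub>M\<^esub>" using m_inv M.field_Units by auto
   have h0: "\<phi> h ~= \<zero>\<^bsub>Lp\<^esub>"
   proof
    assume "\<phi> h = \<zero>\<^bsub>Lp\<^esub>"
    hence "\<phi> (inv\<^bsub>M\<^esub> h \<otimes>\<^bsub>M\<^esub> h) = \<zero>\<^bsub>Lp\<^esub>" using hi(1) m_inv by simp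
    thus False using hi(2) by simp
   qed
   have "r (inv\<^bsub>M\<^esub> h) \<otimes>\<^bsub>Lp\<^esub> \<phi> h = r (inv\<^bsub>M\<^esub> h \<otimes>\<^bsub>M\<^esub> h)" using hi(1) m_inv by simp
   also have "... = \<phi> (inv\<^bsub>M\<^esub> h \<otimes>\<^bsub>M\<^esub> h)" unfolding hi(2) by simp
   also have "... = \<phi> (inv\<^bsub>M\<^esub> h) \<otimes>\<^bsub>Lp\<^esub> \<phi> h" using hi(1) m_inv by simp
   finally have "r (inv\<^bsub>M\<^esub> h) = \<phi> (inv\<^bsub>M\<^esub> h)" using h0 hi(1) m_inv L.m_rcancel by auto
   thus ?case using hi(1) by blast
  qed auto
  moreover obtain m where m: "m : carrier M" "a = \<phi> m" using a unfolding \<phi>s[symmetric] by blast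
  ultimately have "r m = \<phi> m" unfolding gen by blast
  thus ?thesis by (simp add: r_def m(2))
 qed
 hence "generates (G.B t) \<Phi>" unfolding generates_def by blast
 thus "EX \<Phi>. gal_point E \<iota> Lp t \<Phi> & (ALL c. \<Phi> (\<iota> (const_fract c)) = nu (to_completion P c)) & generates (G.B t) \<Phi>"
  using gp k by blast
 interpret LL: ring ?L by (rule Q.quotient_is_ring)
 have span: "EX us. set us <= carrier ?L & LL.Span KK us = V" if "LL.dimension n KK V" for n KK V
  using that
 proof (induction rule: LL.dimension.induct)
  case (zero_dim K)
  show ?case by (rule exI[of _ "[]"]) simp
 next
  case (Suc_dim v V n K)
  then obtain us where "set us <= carrier ?L" "LL.Span K us = V" by blast
  thus ?case using Suc_dim by (intro exI[of _ "v # us"]) auto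
 qed
 obtain n where "LL.dimension n (?h ` UNIV) (carrier ?L)"
  using fg unfolding finite_galois_def LL.finite_dimension_def by (auto simp: ring_of_type_algebra_def)
 from span[OF this] obtain us where us: "set us <= carrier ?L" "LL.Span (range ?h) us = carrier ?L" by blast
 have "EX bs. set bs <= G.B t & us = map (%b. Q +>\<^bsub>?R\<^esub> b) bs" using us(1)
 proof (induction us)
  case (Cons u us)
  then obtain bs b where "set bs <= G.B t" "us = map (%b. Q +>\<^bsub>?R\<^esub> b) bs" "b : G.B t" "u = Q +>\<^bsub>?R\<^esub> b"
   using Lcar[of u] by auto
  thus ?case by (intro exI[of _ "b # bs"]) simp
 qed simp
 then obtain bs where "set bs <= G.B t" "us = map (%b. Q +>\<^bsub>?R\<^esub> b) bs" by blast
 hence "G.residue_generators t bs" unfolding G.residue_generators_def using us(2) par Q.primeideal_axioms by blast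
 thus "Ex (gal_ext.residue_generators E \<iota> t)" by blast
qed

end

section \<open>Choice of the place and of the unsolvable Grunwald problem\<close>

section \<open>The main theorem\<close>

text \<open>By Bezout a prime ideal contains at most one rational prime. Hence excluding finitely
  many ideals costs only finitely many \<open>p\<close>.\<close>

lemma finite_primes_in_ideals:
 fixes S :: "'k::field_char_0 set set"
 assumes S: "finite S" "S <= nonzero_primes"
 shows "finite {p. Factorial_Ring.prime p & (EX P:S. of_nat p : P)}"
proof -
 have one: "p = p'" if P: "P : S" and p: "Factorial_Ring.prime p" "Factorial_Ring.prime p'" "of_nat p : P" "of_nat p' : P" for P :: "'k set" and p p' :: nat
 proof (rule ccontr)
  assume "p ~= p'"
  interpret primeideal P "integer_ring :: 'k ring" using P S(2) by (auto simp: nonzero_primes_def)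
  have ops: "x \<oplus>\<^bsub>integer_ring\<^esub> y = x + y" "x \<otimes>\<^bsub>integer_ring\<^esub> y = x * y" "\<one>\<^bsub>integer_ring\<^esub> = 1" for x y :: 'k
   by (simp_all add: integer_ring_def ring_of_type_algebra_def)
  have int: "of_int r : carrier (integer_ring :: 'k ring)" for r by (simp add: integer_ring_def)
  have "coprime (int p) (int p')" using primes_coprime[OF p(1,2) \<open>p ~= p'\<close>] by simp
  then obtain r s where rs: "r * int p + s * int p' = 1" by (metis coprime_iff_gcd_eq_1 bezout_int)
  have "of_int r \<otimes>\<^bsub>integer_ring\<^esub> of_nat p \<oplus>\<^bsub>integer_ring\<^esub> of_int s \<otimes>\<^bsub>integer_ring\<^esub> of_nat p' : P"
   by (rule additive_subgroup.a_closed[OF is_additive_subgroup I_l_closed[OF p(3) int] I_l_closed[OF p(4) int]])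
  moreover have "of_int r * of_nat p + of_int s * of_nat p' = (of_int (r * int p + s * int p') :: 'k)" by simp
  ultimately have "\<one>\<^bsub>integer_ring\<^esub> : P" by (simp only: ops rs of_int_1)
  thus False using one_imp_carrier I_notcarr by blast
 qed
 have "finite {p. Factorial_Ring.prime p & of_nat p : P}" if P: "P : S" for P
 proof (cases "{p. Factorial_Ring.prime p & of_nat p : P} = {}")
  case False
  then obtain p where "Factorial_Ring.prime p" "of_nat p : P" by blast
  hence "{p. Factorial_Ring.prime p & of_nat p : P} <= {p}" using one[OF P] by blast
  thus ?thesis by (rule finite_subset) simp
 next
  case True
  show ?thesis unfolding True by simp
 qed
 hence "finite (\<Union>P\<in>S. {p. Factorial_Ring.prime p & of_nat p : P})" using S(1) by blast
 thus ?thesis by (rule rev_finite_subset) blast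
qed

lemma regular_extension_gal_ext:
 assumes "regular_extension G E \<iota>" "finite (carrier G)" shows "gal_ext E \<iota>"
proof -
 have fg: "finite_galois ring_of_type_algebra E \<iota>" "galois_group ring_of_type_algebra E \<iota> \<cong> G"
  using assms(1) by (simp_all add: regular_extension_def galois_ext_with_group_def)
 obtain h where "h : iso (galois_group ring_of_type_algebra E \<iota>) G" using fg(2) by (auto simp: is_iso_def)
 hence "bij_betw h (carrier (galois_group ring_of_type_algebra E \<iota>)) (carrier G)" by (simp add: iso_def)
 hence "finite (carrier (galois_group ring_of_type_algebra E \<iota>))" using assms(2) by (simp add: bij_betw_finite)
 thus ?thesis using fg(1) by (intro gal_ext.intro)
qed

theorem theorem6p2:
  fixes G :: "'g monoid"
    and s :: nat
    and E :: "nat \<Rightarrow> 'e ring"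
    and \<iota> :: "nat \<Rightarrow> 'k::field_char_0 poly fract \<Rightarrow> 'e"
  assumes "number_field TYPE('k)"
    and "group G" and "finite (carrier G)"
    and "\<exists>A. subgroup A G \<and> comm_group (G\<lparr>carrier := A\<rparr>) \<and> \<not> cyclic_group (G\<lparr>carrier := A\<rparr>)"
    and "s \<ge> 1"
    and "\<And>j. j \<in> {1..s} \<Longrightarrow> regular_extension G (E j) (\<iota> j)"
  shows "\<not> (\<exists>S_exc :: 'k set set. finite S_exc \<and> S_exc \<subseteq> nonzero_primes
    \<and> (\<forall>S (Lp :: 'k set \<Rightarrow> 'k local_ext_elem ring) (\<nu> :: 'k set \<Rightarrow> 'k completion \<Rightarrow> 'k local_ext_elem).
         grunwald_problem G S Lp \<nu> \<and> S \<inter> S_exc = {}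
           \<longrightarrow> (\<exists>j\<in>{1..s}. \<exists>(L, h)\<in>specializations (E j) (\<iota> j). grunwald_solution G S Lp \<nu> L h)))"
proof
 assume "EX S_exc :: 'k set set. finite S_exc & S_exc <= nonzero_primes
  & (ALL S (Lp :: 'k set => 'k local_ext_elem ring) (\<nu> :: 'k set => 'k completion => 'k local_ext_elem).
     grunwald_problem G S Lp \<nu> & S \<inter> S_exc = {}
      --> (EX j:{1..s}. EX (L, h):specializations (E j) (\<iota> j). grunwald_solution G S Lp \<nu> L h))"
 then obtain S_exc :: "'k set set" where S_exc: "finite S_exc" "S_exc <= nonzero_primes"
  and all: "ALL S (Lp :: 'k set => 'k local_ext_elem ring) (\<nu> :: 'k set => 'k completion => 'k local_ext_elem).
     grunwald_problem G S Lp \<nu> & S \<inter> S_exc = {}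
      --> (EX j:{1..s}. EX (L, h):specializations (E j) (\<iota> j). grunwald_solution G S Lp \<nu> L h)"
  by (elim exE conjE) (rule that)
 note solve = all[rule_format, OF conjI]
 have alg: "algebraic z" for z :: "'k alg_closure" by (rule all_algebraic[OF assms(1)])
 have algk: "algebraic z" for z :: 'k by (rule algebraic_to_ac[OF alg])
 have ge: "gal_ext (E j) (\<iota> j)" if "j : {1..s}" for j
  by (rule regular_extension_gal_ext[OF assms(6)[OF that] assms(3)])
 obtain H where H: "subgroup H G" "comm_group (G\<lparr>carrier := H\<rparr>)" "~ cyclic_group (G\<lparr>carrier := H\<rparr>)" using assms(4) by blast
 from non_cyclic_subgroup_independent[OF assms(2,3) H]
 obtain l g h where l: "Factorial_Ring.prime (l::nat)" and g: "g : carrier G" and h: "h : carrier G"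
  and gh: "g \<otimes>\<^bsub>G\<^esub> h = h \<otimes>\<^bsub>G\<^esub> g" "g [^]\<^bsub>G\<^esub> l = \<one>\<^bsub>G\<^esub>" "h [^]\<^bsub>G\<^esub> l = \<one>\<^bsub>G\<^esub>"
  and ind: "ALL a<l. ALL b<l. ALL c<l. ALL d<l. g [^]\<^bsub>G\<^esub> a \<otimes>\<^bsub>G\<^esub> h [^]\<^bsub>G\<^esub> b = g [^]\<^bsub>G\<^esub> c \<otimes>\<^bsub>G\<^esub> h [^]\<^bsub>G\<^esub> d --> a = c & b = d"
  by (elim exE conjE) (rule that)
 have l1: "l > 1" using l by (rule prime_gt_1_nat)
 have "ALL j:{1..s}. EX e>0. ALL N>0. e dvd N --> (EX Y. finite Y & (ALL A F. Y <= A --> Y <= F --> inverse ` Y <= A --> gal_ext.tested (E j) (\<iota> j) N A F))"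
 proof
  fix j assume "j : {1..s}"
  from gal_ext.test_set[OF ge[OF this]]
  show "EX e>0. ALL N>0. e dvd N --> (EX Y. finite Y & (ALL A F. Y <= A --> Y <= F --> inverse ` Y <= A --> gal_ext.tested (E j) (\<iota> j) N A F))" .
 qed
 from bchoice[OF this] obtain e where e: "ALL j:{1..s}. e j > 0 & (ALL N>0. e j dvd N -->
   (EX Y. finite Y & (ALL A F. Y <= A --> Y <= F --> inverse ` Y <= A --> gal_ext.tested (E j) (\<iota> j) N A F)))" by (elim exE)
 \<comment> \<open>A common multiple of the Puiseux exponents of all \<open>s\<close> extensions, so
   that one place serves them together, with a factor \<open>l\<close> that makes level
   \<open>l\<close> a sublevel.\<close>
 define N where "N = l * (\<Prod>j\<in>{1..s}. e j)"
 have "(\<Prod>j\<in>{1..s}. e j) > 0" using e by (intro prod_pos) blast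
 hence N0: "N > 0" using l1 by (simp add: N_def)
 have lN: "l dvd N" by (simp add: N_def)
 have "ALL j:{1..s}. EX Y. finite Y & (ALL A F. Y <= A --> Y <= F --> inverse ` Y <= A --> gal_ext.tested (E j) (\<iota> j) N A F)"
 proof
  fix j assume j: "j : {1..s}"
  have "e j dvd (\<Prod>j\<in>{1..s}. e j)" using j by (intro dvd_prodI) auto
  hence eN: "e j dvd N" unfolding N_def by (rule dvd_mult)
  show "EX Y. finite Y & (ALL A F. Y <= A --> Y <= F --> inverse ` Y <= A --> gal_ext.tested (E j) (\<iota> j) N A F)"
   by (rule mp[OF mp[OF spec[OF conjunct2[OF bspec[OF e j]]] N0] eN])
 qed
 from bchoice[OF this] obtain Y where Y: "ALL j:{1..s}. finite (Y j) \<and>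
   (ALL A F. Y j <= A --> Y j <= F --> inverse ` Y j <= A --> gal_ext.tested (E j) (\<iota> j) N A F)" by (elim exE)
 obtain \<zeta> :: "'k alg_closure" where \<zeta>: "!!m. \<zeta> ^ m = 1 \<longleftrightarrow> N dvd m" using exists_primitive_root_of_unity[OF N0] by blast
 obtain T :: "'k set" where T: "finite T" "!!x. EX q. x = (\<Sum>b\<in>T. of_rat (q b) * b)" using number_field_basis[OF assms(1)] by blast
 \<comment> \<open>The test sets of all extensions; \<open>\<zeta>\<close> and the differences
   \<open>\<zeta> ^ d - 1\<close>, whose inverses keep the roots of unity distinct modulo the
   maximal ideal; and a basis of \<open>k\<close> over the rationals, which puts \<open>k\<close>
   into \<open>F\<close>.\<close>
 define Z where "Z = (\<Union>j\<in>{1..s}. Y j) \<union> insert \<zeta> ((%d. \<zeta> ^ d - 1) ` {..<N}) \<union> to_ac ` T"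
 have Yf: "finite (Y j)" if "j : {1..s}" for j by (rule conjunct1[OF bspec[OF Y that]])
 have "finite (\<Union>j\<in>{1..s}. Y j)" by (rule finite_UN_I) (simp_all only: finite_atLeastAtMost Yf)
 hence "finite Z" unfolding Z_def using T(1) by simp
 then obtain F where F: "Z <= F" "infinite {p. EX A. place A F p & Z <= A & inverse ` Z <= A}" by (rule exists_places[OF alg])
 \<comment> \<open>Among the admissible \<open>p\<close>, those lying in an ideal of
   \<open>S_exc\<close> are discarded; since \<open>p : P\<close>, the prime \<open>P\<close> then
   avoids \<open>S_exc\<close>.\<close>
 have "infinite ({p. EX A. place A F p & Z <= A & inverse ` Z <= A} - {p. Factorial_Ring.prime p & (EX P:S_exc. of_nat p : P)})"
  using F(2) finite_primes_in_ideals[OF S_exc] by (rule Diff_infinite_finite[rotated])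
 from infinite_imp_nonempty[OF this] obtain p where
  "p : {p. EX A. place A F p & Z <= A & inverse ` Z <= A} - {p. Factorial_Ring.prime p & (EX P:S_exc. of_nat p : P)}"
  by (meson ex_in_conv)
 hence "EX A. place A F p & Z <= A & inverse ` Z <= A" and
   pS: "~ (Factorial_Ring.prime p & (EX P:S_exc. of_nat p : P))" by simp_all
 then obtain A where pA: "place A F p" "Z <= A" "inverse ` Z <= A" by (elim exE conjE) (rule that)
 interpret place A F p by (rule pA(1))
 have FQ: "to_ac x : F" for x :: 'k
 proof -
  obtain q where q: "x = (\<Sum>b\<in>T. of_rat (q b) * b)" using T(2) by blast
  have rat: "of_rat r : F" for r by (cases r) (simp add: of_rat_rat F_divide F_of_int)
  show ?thesis unfolding q to_ac_sum
   by (intro F_sum) (use F(1) in \<open>auto simp: to_ac_of_rat Z_def intro!: F_mult rat\<close>)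
 qed
 define P where "P = {x::'k. algebraic_int x & to_ac x : nonunits A}"
 have FQ': "range (to_ac :: 'k => _) <= F" using FQ by blast
 note pl = prime_of_place[OF pA(1) FQ' algk, folded P_def]
 have PS: "P ~: S_exc" using pS pl(2) p by blast
 obtain u where u: "residue_primroot p u" using prime_primitive_root_exists[of p] prime_gt_1_nat[OF p] p by blast
 obtain ups :: "'k alg_closure" where ups: "ups ^ N = of_nat u" using nth_root_exists[OF N0] by blast
 obtain \<rho> :: "'k alg_closure" where \<rho>: "\<rho> ^ N = of_nat p" using nth_root_exists[OF N0] by blast
 have K: "kummer A F p N \<zeta> ups \<rho> u"
 proof (intro kummer.intro kummer_axioms.intro)
  show "place A F p" by (rule pA(1))
  show "\<zeta> : F" using F(1) by (simp add: Z_def)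
  show "\<zeta> ^ N = 1" using \<zeta> by simp
  fix d assume d: "0 < d" "d < N"
  have "\<zeta> ^ d ~= 1" using \<zeta> d by (auto dest: dvd_imp_le)
  moreover have "inverse (\<zeta> ^ d - 1) : A" using pA(3) d by (auto simp: Z_def)
  ultimately show "\<zeta> ^ d - 1 ~: nonunits A" by (intro unit_of_inverse) simp_all
 qed (rule alg N0 u ups \<rho>)+
 interpret K: kummer A F p N \<zeta> ups \<rho> u by (rule K)
 let ?m = "N div l"
 \<comment> \<open>The prescribed extension is the sublevel \<open>l\<close>, so that its group
   embeds into \<open>G\<close> through \<open>g\<close> and \<open>h\<close>; level
   \<open>N\<close> serves only for the estimates.\<close>
 interpret L: local_field A F p l "\<zeta> ^ ?m" "ups ^ ?m" "\<rho> ^ ?m" u P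
 proof (intro local_field.intro local_field_axioms.intro)
  show "kummer A F p l (\<zeta> ^ ?m) (ups ^ ?m) (\<rho> ^ ?m) u" by (rule K.sublevel[OF lN]) (use l1 in simp)
 qed (rule pl(3) FQ)+
 have emb: "EX \<phi>:hom L.Gal G. inj_on \<phi> (carrier L.Gal)"
  by (rule L.Gal_embeds[OF assms(2) g h gh]) (use ind in blast)
 have prob: "grunwald_problem G {P} (%_. L.Lp) (%_. L.nu)"
  unfolding grunwald_problem_def using L.finite_galois_Lp emb pl(1) by simp
 have disj: "{P} \<inter> S_exc = {}" using PS by simp
 obtain j where j: "j : {1..s}" and sol: "EX (L, h):specializations (E j) (\<iota> j). grunwald_solution G {P} (%_. L.Lp) (%_. L.nu) L h"
  by (rule bexE[OF solve[OF prob disj]]) (rule that)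
 obtain z where z: "z : specializations (E j) (\<iota> j)" "case z of (L, h) => grunwald_solution G {P} (%_. L.Lp) (%_. L.nu) L h"
  using sol by (elim bexE) (rule that)
 obtain t Q where tQ: "Q : primes_above (E j) (\<iota> j) t"
   "z = (closure_ring (E j) (\<iota> j) t Quot Q, %a. Q +>\<^bsub>closure_ring (E j) (\<iota> j) t\<^esub> \<iota> j (const_fract a))"
  using z(1) unfolding specializations_def by (elim CollectE exE conjE) (rule that)
 let ?L = "closure_ring (E j) (\<iota> j) t Quot Q" and ?h = "%a. Q +>\<^bsub>closure_ring (E j) (\<iota> j) t\<^esub> \<iota> j (const_fract a)"
 have gs: "grunwald_solution G {P} (%_. L.Lp) (%_. L.nu) ?L ?h" using z(2) unfolding tQ(2) by (simp only: prod.case)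
 have fg: "finite_galois ring_of_type_algebra ?L ?h"
  using gs unfolding grunwald_solution_def galois_ext_with_group_def by (elim conjE)
 have "ALL P':{P}. EX (M :: 'k local_ext_elem ring) \<mu>. is_completion_of_ext P' ?L ?h M \<mu> & base_isomorphic (completion P') M \<mu> L.Lp L.nu"
  using gs unfolding grunwald_solution_def by (elim conjE)
 from bspec[OF this singletonI] obtain M :: "'k local_ext_elem ring" and \<mu>
  where M: "is_completion_of_ext P ?L ?h M \<mu>" "base_isomorphic (completion P) M \<mu> L.Lp L.nu" by (elim exE conjE) (rule that)
 note sol = L.solution_point[where E = "E j" and \<iota> = "\<iota> j" and t = t and Q = Q and M = M and \<mu> = \<mu>, OF ge[OF j] tQ(1) fg M]
 obtain \<Phi> where \<Phi>: "gal_point (E j) (\<iota> j) L.Lp t \<Phi>" "ALL c. \<Phi> (\<iota> j (const_fract c)) = L.nu (to_completion P c)"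
  "L.generates (integral_closure (E j) (\<iota> j ` local_ring t)) \<Phi>" using sol(1) by (elim exE conjE) (rule that)
 have YZ: "Y j <= Z" using j by (auto simp: Z_def)
 note Yj = conjunct2[OF bspec[OF Y j], rule_format]
 have "gal_ext.tested (E j) (\<iota> j) N A F"
  by (rule Yj) (use YZ pA(2,3) F(1) in blast)+
 thus False
  by (rule L.no_point[where E = "E j" and \<iota> = "\<iota> j" and t = t and \<Phi> = \<Phi>, OF K lN l1 refl refl refl \<Phi>(1) spec[OF \<Phi>(2)] \<Phi>(3) sol(2)])
qed

end
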